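(* Let $L=(L_1,\dots,L_N)$ be any set of weights with $L_i>0$ and $\sum_{i=1}^NL_i=1$, and assume A1, A2, A3, A4 and A5 (stated in the context). Then the unique solution $\xi_L\in\mathcal U_N$ of the regulator's problem with weights $L$ yields a Pareto-optimal policy for the $N$-player game.
   Context: Let $N,D$ be positive integers, $B=(B^1,\dots,B^D)$ a $D$-dimensional Brownian motion on a filtered probability space $(\Omega,\mathcal F,\{\mathcal F_t\}_{t\ge0},\mathbb P)$, $\mu=(\mu^1,\dots,\mu^N)\in\mathbb R^N$ and $\sigma\in\mathbb R^{N\times D}$ constant, $\sigma^i$ the $i$-th row of $\sigma$, with $\sigma\sigma^T\succeq\lambda I$ for some $\lambda>0$. Let $\rho>0$ and $K_i^+,K_i^->0$ ($1\le i\le N$). Admissible controls: $\mathcal U_N^i$ is the set of pairs $\xi^i=(\xi^{i,+},\xi^{i,-})$ of $\mathcal F_t$-progressively measurable, càdlàg, non-decreasing processes with $\xi^{i,\pm}_{0-}=0$ and $\mathbb E[\int_0^\infty e^{-\rho t}d\xi_t^{i,\pm}]<\infty$ (integrals include a possible jump at $t=0$). $\mathcal U_N=\prod_{i=1}^N\mathcal U_N^i$. A policy may depend on the initial state $x$; $J^i(x;\xi)$ is evaluated with the control that the policy prescribes from $x$. Dynamics: $dX_t^i=\mu^i dt+\sigma^i\cdot dB_t+d\xi_t^{i,+}-d\xi_t^{i,-}$, $X_{0-}^i=x^i$; $\mathbb E_x$ denotes expectation when $X_{0-}=x$. $N$-player game: player $i$ chooses $\xi^i\in\mathcal U_N^i$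 to minimize $J^i(x;\xi)=\mathbb E_x\int_0^\infty e^{-\rho t}[h^i(X_t)dt+K_i^+d\xi_t^{i,+}+K_i^-d\xi_t^{i,-}]$, with $h^i:\mathbb R^N\to[0,\infty)$. Pareto optimality: $\xi^*\in\mathcal U_N$ is a Pareto-optimal policy for the game iff there does not exist $\xi\in\mathcal U_N$ such that, for all $x\in\mathbb R^N$, $J^i(x;\xi)\le J^i(x;\xi^* )$ for every $i\in\{1,\dots,N\}$ and $J^j(x;\xi)<J^j(x;\xi^* )$ for some $j\in\{1,\dots,N\}$. Regulator's problem with weights $L$: $H=\sum_{i=1}^N L_ih^i$, $J(x;\xi)=\sum_{i=1}^N L_iJ^i(x;\xi)$, $v(x)=\inf_{\xi\in\mathcal U_N}J(x;\xi)$; a solution is a policy attaining $v(x)$ from every initial state $x$. Under A1-A3, $v\in\mathcal W^{2,\infty}_{\rm loc}(\mathbb R^N)\subset\mathcal C^1(\mathbb R^N)$. Continuation region and reflection directions: $\mathcal C_N=\{x:\beta(\nabla v(x))<1\}$, with $\beta(q)=\max_{1\le i\le N}\big[(\tfrac{q^i}{L_iK_i^-})^+\vee(\tfrac{q^i}{L_iK_i^+})^-\big]$, $(a)^+=\max\{0,a\}$, $(a)^-=\max\{0,-a\}$. Equivalently $\mathcal C_N=\bigcap_{j=1}^{2N}G_j$ where, for $i=1,\dots,N$, $G_i=\{x:\partial_{x^i}v(x)<L_iK_i^-\}$ and $G_{i+N}=\{x:\partial_{x^i}v(x)>-L_iK_i^+\}$. Let $I(x)=\{j\in\{1,\dots,2N\}:x\notin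 G_j\}$, $\gamma_i=-e_i$, $\gamma_{i+N}=e_i$ ($e_i$ the $i$-th standard basis vector), and $r(x)=\big\{\sum_{j\in I(x)}c_j\gamma_j:\ c_j\ge0,\ \|\sum_{j\in I(x)}c_j\gamma_j\|=1\big\}$. Assumptions: there exist $C>c>0$ such that A1: $0\le H(x)\le C(1+\|x\|^2)$ for all $x\in\mathbb R^N$; A2: $|H(x)-H(x')|\le C(1+\|x\|+\|x'\|)\|x-x'\|$ for all $x,x'\in\mathbb R^N$; A3: $H\in\mathcal C^2(\mathbb R^N)$, $H$ is convex, and $0<c\le\partial_z^2H(x)\le C$ for every unit direction $z\in\mathbb R^N$ and all $x$; and A4: $\partial^2_{x^i}v(x)>\sum_{j\ne i}|\partial^2_{x^ix^j}v(x)|$ for all $i=1,\dots,N$ and all $x\in\overline{\mathcal C}_N$; A5: there is a map $\pi:\mathbb R^N\to\overline{\mathcal C}_N$ with $\pi(x)=x$ for all $x\in\overline{\mathcal C}_N$ and, for every $x\notin\overline{\mathcal C}_N$, $\pi(x)\in\partial\mathcal C_N$ and $\pi(x)-x=\theta d$ for some $\theta>0$ and $d\in r(\pi(x))$. *)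

theory Defs
  imports "HOL-Probability.Probability"
begin

section \<open>Filtrations and Brownian motion\<close>

text \<open>Time is \<^typ>\<open>real\<close>; only \<open>t \<ge> 0\<close> is ever used. Neither completeness nor right-continuity of the
  filtration is assumed, and path properties are required almost surely.\<close>

definition filtered_prob_space :: "'a measure \<Rightarrow> (real \<Rightarrow> 'a measure) \<Rightarrow> bool" where
  "filtered_prob_space M F \<longleftrightarrow> prob_space M \<and> (\<forall>t\<ge>0. subalgebra M (F t)) \<and>
     (\<forall>s t. 0 \<le> s \<and> s \<le> t \<longrightarrow> sets (F s) \<subseteq> sets (F t))"

definition brownian_motion ::
    "'a measure \<Rightarrow> (real \<Rightarrow> 'a measure) \<Rightarrow> (real \<Rightarrow> 'a \<Rightarrow> real ^ 'd) \<Rightarrow> bool" where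
  "brownian_motion M F B \<longleftrightarrow>
     (\<forall>t\<ge>0. B t \<in> borel_measurable (F t)) \<and>
     (AE \<omega> in M. B 0 \<omega> = 0) \<and>
     (AE \<omega> in M. continuous_on {0..} (\<lambda>t. B t \<omega>)) \<and>
     (\<forall>s t. 0 \<le> s \<and> s < t \<longrightarrow>
        prob_space.indep_set M (sets (F s))
          (sets (vimage_algebra (space M) (\<lambda>\<omega>. B t \<omega> - B s \<omega>) borel)) \<and>
        distributed M lborel (\<lambda>\<omega>. B t \<omega> - B s \<omega>)
          (\<lambda>y. ennreal (\<Prod>k\<in>UNIV. normal_density 0 (sqrt (t - s)) (y $ k))))"

definition progressively_measurable :: "(real \<Rightarrow> 'a measure) \<Rightarrow> (real \<Rightarrow> 'a \<Rightarrow> real) \<Rightarrow> bool" where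
  "progressively_measurable F \<zeta> \<longleftrightarrow>
     (\<forall>t\<ge>0. (\<lambda>(s, \<omega>). \<zeta> s \<omega>) \<in> borel_measurable (restrict_space borel {0..t} \<Otimes>\<^sub>M F t))"

section \<open>Admissible controls\<close>

text \<open>The convention \<open>\<zeta>\<^bsub>0-\<^esub> = 0\<close> is encoded by extending a path by \<open>0\<close> to negative times. The
  Stieltjes measure of the extended path then has an atom of mass \<open>\<zeta>\<^sub>0\<close> at time \<open>0\<close>, and
  monotonicity of the extended path includes \<open>\<zeta>\<^sub>0 \<ge> 0\<close>.\<close>

definition ext_path :: "(real \<Rightarrow> 'a \<Rightarrow> real) \<Rightarrow> 'a \<Rightarrow> real \<Rightarrow> real" where
  "ext_path \<zeta> \<omega> = (\<lambda>t. if t < 0 then 0 else \<zeta> t \<omega>)"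

definition cadlag :: "(real \<Rightarrow> real) \<Rightarrow> bool" where
  "cadlag f \<longleftrightarrow> (\<forall>t. continuous (at_right t) f \<and> (\<exists>l. (f \<longlongrightarrow> l) (at_left t)))"

text \<open>The integral of \<open>exp (- \<rho> t)\<close> with respect to \<open>d\<zeta>\<^sub>t\<close> over \<open>[0, \<infinity>)\<close>, jump at \<open>0\<close> included.\<close>

definition discounted_total :: "real \<Rightarrow> (real \<Rightarrow> 'a \<Rightarrow> real) \<Rightarrow> 'a \<Rightarrow> ennreal" where
  "discounted_total \<rho> \<zeta> \<omega> =
     (\<integral>\<^sup>+ t\<in>{0..}. ennreal (exp (- \<rho> * t)) \<partial>interval_measure (ext_path \<zeta> \<omega>))"

definition admissible_part ::
    "'a measure \<Rightarrow> (real \<Rightarrow> 'a measure) \<Rightarrow> real \<Rightarrow> (real \<Rightarrow> 'a \<Rightarrow> real) \<Rightarrow> bool" where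
  "admissible_part M F \<rho> \<zeta> \<longleftrightarrow>
     progressively_measurable F \<zeta> \<and>
     (AE \<omega> in M. cadlag (ext_path \<zeta> \<omega>) \<and> mono (ext_path \<zeta> \<omega>)) \<and>
     (\<integral>\<^sup>+ \<omega>. discounted_total \<rho> \<zeta> \<omega> \<partial>M) < \<infinity>"

text \<open>A control of one player is the pair of its increasing and decreasing parts. A control profile
  assigns one to each player, and a policy prescribes a control profile for each initial state.\<close>

type_synonym 'a control = "(real \<Rightarrow> 'a \<Rightarrow> real) \<times> (real \<Rightarrow> 'a \<Rightarrow> real)"
type_synonym ('a, 'n) profile = "'n \<Rightarrow> 'a control"
type_synonym ('a, 'n) policy = "real ^ 'n \<Rightarrow> ('a, 'n) profile"

definition player_controls ::
    "'a measure \<Rightarrow> (real \<Rightarrow> 'a measure) \<Rightarrow> real \<Rightarrow> 'a control set" where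
  "player_controls M F \<rho> =
     {\<zeta>. admissible_part M F \<rho> (fst \<zeta>) \<and> admissible_part M F \<rho> (snd \<zeta>)}"

definition admissible ::
    "'a measure \<Rightarrow> (real \<Rightarrow> 'a measure) \<Rightarrow> real \<Rightarrow> ('a, 'n) profile set" where
  "admissible M F \<rho> = {\<xi>. \<forall>i. \<xi> i \<in> player_controls M F \<rho>}"

definition admissible_policy ::
    "'a measure \<Rightarrow> (real \<Rightarrow> 'a measure) \<Rightarrow> real \<Rightarrow> ('a, 'n) policy \<Rightarrow> bool" where
  "admissible_policy M F \<rho> \<xi> \<longleftrightarrow> (\<forall>x. \<xi> x \<in> admissible M F \<rho>)"

section \<open>The game\<close>

definition state ::
    "(real \<Rightarrow> 'a \<Rightarrow> real ^ 'd) \<Rightarrow> real ^ 'n \<Rightarrow> real ^ 'd ^ 'n \<Rightarrow> real ^ 'n \<Rightarrow> ('a, 'n) profile \<Rightarrow>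
      real \<Rightarrow> 'a \<Rightarrow> real ^ 'n" where
  "state B \<mu> \<sigma> x \<xi> t \<omega> =
     x + t *\<^sub>R \<mu> + \<sigma> *v B t \<omega> + (\<chi> i. fst (\<xi> i) t \<omega> - snd (\<xi> i) t \<omega>)"

definition player_cost ::
    "'a measure \<Rightarrow> (real \<Rightarrow> 'a \<Rightarrow> real ^ 'd) \<Rightarrow> real ^ 'n \<Rightarrow> real ^ 'd ^ 'n \<Rightarrow> real \<Rightarrow>
      ('n \<Rightarrow> real) \<Rightarrow> ('n \<Rightarrow> real) \<Rightarrow> ('n \<Rightarrow> real ^ 'n \<Rightarrow> real) \<Rightarrow>
      'n \<Rightarrow> real ^ 'n \<Rightarrow> ('a, 'n) profile \<Rightarrow> ennreal" where
  "player_cost M B \<mu> \<sigma> \<rho> Kp Km h i x \<xi> =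
     (\<integral>\<^sup>+ \<omega>. (\<integral>\<^sup>+ t\<in>{0..}. ennreal (exp (- \<rho> * t) * h i (state B \<mu> \<sigma> x \<xi> t \<omega>)) \<partial>lborel)
          + ennreal (Kp i) * discounted_total \<rho> (fst (\<xi> i)) \<omega>
          + ennreal (Km i) * discounted_total \<rho> (snd (\<xi> i)) \<omega> \<partial>M)"

definition pareto_optimal ::
    "'a measure \<Rightarrow> (real \<Rightarrow> 'a measure) \<Rightarrow> (real \<Rightarrow> 'a \<Rightarrow> real ^ 'd) \<Rightarrow>
      real ^ 'n \<Rightarrow> real ^ 'd ^ 'n \<Rightarrow> real \<Rightarrow>
      ('n \<Rightarrow> real) \<Rightarrow> ('n \<Rightarrow> real) \<Rightarrow> ('n \<Rightarrow> real ^ 'n \<Rightarrow> real) \<Rightarrow> ('a, 'n) policy \<Rightarrow> bool" where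
  "pareto_optimal M F B \<mu> \<sigma> \<rho> Kp Km h \<xi>' \<longleftrightarrow>
     admissible_policy M F \<rho> \<xi>' \<and>
     \<not> (\<exists>\<xi>. admissible_policy M F \<rho> \<xi> \<and>
          (\<forall>x. (\<forall>i. player_cost M B \<mu> \<sigma> \<rho> Kp Km h i x (\<xi> x)
                     \<le> player_cost M B \<mu> \<sigma> \<rho> Kp Km h i x (\<xi>' x)) \<and>
               (\<exists>j. player_cost M B \<mu> \<sigma> \<rho> Kp Km h j x (\<xi> x)
                     < player_cost M B \<mu> \<sigma> \<rho> Kp Km h j x (\<xi>' x))))"

section \<open>The regulator's problem\<close>

definition aggregate_running_cost ::
    "('n \<Rightarrow> real) \<Rightarrow> ('n::finite \<Rightarrow> real ^ 'n \<Rightarrow> real) \<Rightarrow> real ^ 'n \<Rightarrow> real" where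
  "aggregate_running_cost L h x = (\<Sum>i\<in>UNIV. L i * h i x)"

definition regulator_cost ::
    "'a measure \<Rightarrow> (real \<Rightarrow> 'a \<Rightarrow> real ^ 'd) \<Rightarrow> real ^ 'n \<Rightarrow> real ^ 'd ^ 'n \<Rightarrow> real \<Rightarrow>
      ('n \<Rightarrow> real) \<Rightarrow> ('n \<Rightarrow> real) \<Rightarrow> ('n \<Rightarrow> real ^ 'n \<Rightarrow> real) \<Rightarrow> ('n \<Rightarrow> real) \<Rightarrow>
      real ^ 'n \<Rightarrow> ('a, 'n) profile \<Rightarrow> ennreal" where
  "regulator_cost M B \<mu> \<sigma> \<rho> Kp Km h L x \<xi> =
     (\<Sum>i\<in>UNIV. ennreal (L i) * player_cost M B \<mu> \<sigma> \<rho> Kp Km h i x \<xi>)"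

definition regulator_inf ::
    "'a measure \<Rightarrow> (real \<Rightarrow> 'a measure) \<Rightarrow> (real \<Rightarrow> 'a \<Rightarrow> real ^ 'd) \<Rightarrow>
      real ^ 'n \<Rightarrow> real ^ 'd ^ 'n \<Rightarrow> real \<Rightarrow>
      ('n \<Rightarrow> real) \<Rightarrow> ('n \<Rightarrow> real) \<Rightarrow> ('n \<Rightarrow> real ^ 'n \<Rightarrow> real) \<Rightarrow> ('n \<Rightarrow> real) \<Rightarrow>
      real ^ 'n \<Rightarrow> ennreal" where
  "regulator_inf M F B \<mu> \<sigma> \<rho> Kp Km h L x =
     (INF \<xi>\<in>admissible M F \<rho>. regulator_cost M B \<mu> \<sigma> \<rho> Kp Km h L x \<xi>)"

text \<open>The real-valued value function, needed for its derivatives. Under the quadratic growth bound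
  on the aggregate running cost the infimum is finite, so the conversion loses nothing.\<close>

definition value_fn ::
    "'a measure \<Rightarrow> (real \<Rightarrow> 'a measure) \<Rightarrow> (real \<Rightarrow> 'a \<Rightarrow> real ^ 'd) \<Rightarrow>
      real ^ 'n \<Rightarrow> real ^ 'd ^ 'n \<Rightarrow> real \<Rightarrow>
      ('n \<Rightarrow> real) \<Rightarrow> ('n \<Rightarrow> real) \<Rightarrow> ('n \<Rightarrow> real ^ 'n \<Rightarrow> real) \<Rightarrow> ('n \<Rightarrow> real) \<Rightarrow>
      real ^ 'n \<Rightarrow> real" where
  "value_fn M F B \<mu> \<sigma> \<rho> Kp Km h L x = enn2real (regulator_inf M F B \<mu> \<sigma> \<rho> Kp Km h L x)"

definition regulator_solution ::
    "'a measure \<Rightarrow> (real \<Rightarrow> 'a measure) \<Rightarrow> (real \<Rightarrow> 'a \<Rightarrow> real ^ 'd) \<Rightarrow>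
      real ^ 'n \<Rightarrow> real ^ 'd ^ 'n \<Rightarrow> real \<Rightarrow>
      ('n \<Rightarrow> real) \<Rightarrow> ('n \<Rightarrow> real) \<Rightarrow> ('n \<Rightarrow> real ^ 'n \<Rightarrow> real) \<Rightarrow> ('n \<Rightarrow> real) \<Rightarrow>
      ('a, 'n) policy \<Rightarrow> bool" where
  "regulator_solution M F B \<mu> \<sigma> \<rho> Kp Km h L \<xi> \<longleftrightarrow>
     admissible_policy M F \<rho> \<xi> \<and>
     (\<forall>x. regulator_cost M B \<mu> \<sigma> \<rho> Kp Km h L x (\<xi> x)
           = regulator_inf M F B \<mu> \<sigma> \<rho> Kp Km h L x)"

text \<open>Processes are identified up to indistinguishability.\<close>

definition same_policy :: "'a measure \<Rightarrow> ('a, 'n) policy \<Rightarrow> ('a, 'n) policy \<Rightarrow> bool" where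
  "same_policy M \<xi> \<eta> \<longleftrightarrow>
     (\<forall>x i. AE \<omega> in M. \<forall>t\<ge>0. fst (\<xi> x i) t \<omega> = fst (\<eta> x i) t \<omega> \<and>
                              snd (\<xi> x i) t \<omega> = snd (\<eta> x i) t \<omega>)"

section \<open>Derivatives\<close>

definition dir_deriv :: "real ^ 'n \<Rightarrow> (real ^ 'n \<Rightarrow> real) \<Rightarrow> real ^ 'n \<Rightarrow> real" where
  "dir_deriv z f x = deriv (\<lambda>s. f (x + s *\<^sub>R z)) 0"

definition grad :: "(real ^ 'n \<Rightarrow> real) \<Rightarrow> real ^ 'n \<Rightarrow> real ^ 'n" where
  "grad f x = (\<chi> i. dir_deriv (axis i 1) f x)"

definition C2 :: "(real ^ 'n \<Rightarrow> real) \<Rightarrow> bool" where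
  "C2 f \<longleftrightarrow> (\<exists>(g :: real ^ 'n \<Rightarrow> real ^ 'n) (Q :: real ^ 'n \<Rightarrow> real ^ 'n ^ 'n).
     (\<forall>x. (f has_derivative (\<lambda>z. g x \<bullet> z)) (at x)) \<and>
     (\<forall>x. (g has_derivative (\<lambda>z. Q x *v z)) (at x)) \<and>
     continuous_on UNIV Q)"

text \<open>Strict diagonal dominance of the Hessian on a set \<open>S\<close>, which will be the closure of an open
  set on whose boundary the function need not be twice differentiable. The Hessian \<open>Q\<close> is therefore
  the derivative of the gradient relative to \<open>S\<close>: at interior points it is the usual Hessian, at
  boundary points the one-sided one.\<close>

definition hessian_diag_dominant_on :: "(real ^ 'n) set \<Rightarrow> (real ^ 'n \<Rightarrow> real) \<Rightarrow> bool" where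
  "hessian_diag_dominant_on S f \<longleftrightarrow>
     (\<forall>x\<in>S. \<exists>Q :: real ^ 'n ^ 'n.
        (grad f has_derivative (\<lambda>z. Q *v z)) (at x within S) \<and>
        (\<forall>i. Q $ i $ i > (\<Sum>j\<in>UNIV - {i}. \<bar>Q $ i $ j\<bar>)))"

section \<open>Continuation region and reflection directions\<close>

definition constraint_gauge ::
    "('n \<Rightarrow> real) \<Rightarrow> ('n \<Rightarrow> real) \<Rightarrow> ('n \<Rightarrow> real) \<Rightarrow> real ^ 'n \<Rightarrow> real" where
  "constraint_gauge L Kp Km q =
     Max (range (\<lambda>i. max (max 0 (q $ i / (L i * Km i))) (max 0 (- (q $ i / (L i * Kp i))))))"

definition continuation_region ::
    "('n \<Rightarrow> real) \<Rightarrow> ('n \<Rightarrow> real) \<Rightarrow> ('n \<Rightarrow> real) \<Rightarrow> (real ^ 'n \<Rightarrow> real) \<Rightarrow> (real ^ 'n) set" where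
  "continuation_region L Kp Km v = {x. constraint_gauge L Kp Km (grad v x) < 1}"

text \<open>The index set \<open>{1, \<dots>, 2N}\<close> is the sum type \<^typ>\<open>'n + 'n\<close>: \<open>Inl i\<close> stands for \<open>i\<close> and \<open>Inr i\<close>
  for \<open>i + N\<close>.\<close>

fun half_region ::
    "('n \<Rightarrow> real) \<Rightarrow> ('n \<Rightarrow> real) \<Rightarrow> ('n \<Rightarrow> real) \<Rightarrow> (real ^ 'n \<Rightarrow> real) \<Rightarrow> 'n + 'n \<Rightarrow>
      (real ^ 'n) set" where
  "half_region L Kp Km v (Inl i) = {x. grad v x $ i < L i * Km i}"
| "half_region L Kp Km v (Inr i) = {x. grad v x $ i > - (L i * Kp i)}"

fun reflection_vec :: "'n + 'n \<Rightarrow> real ^ 'n" where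
  "reflection_vec (Inl i) = - axis i 1"
| "reflection_vec (Inr i) = axis i 1"

definition active_set ::
    "('n \<Rightarrow> real) \<Rightarrow> ('n \<Rightarrow> real) \<Rightarrow> ('n \<Rightarrow> real) \<Rightarrow> (real ^ 'n \<Rightarrow> real) \<Rightarrow> real ^ 'n \<Rightarrow>
      ('n + 'n) set" where
  "active_set L Kp Km v x = {j. x \<notin> half_region L Kp Km v j}"

definition reflection_directions ::
    "('n \<Rightarrow> real) \<Rightarrow> ('n \<Rightarrow> real) \<Rightarrow> ('n \<Rightarrow> real) \<Rightarrow> (real ^ 'n \<Rightarrow> real) \<Rightarrow> real ^ 'n \<Rightarrow>
      (real ^ 'n) set" where
  "reflection_directions L Kp Km v x =
     {d. \<exists>a. (\<forall>j\<in>active_set L Kp Km v x. 0 \<le> a j) \<and>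
             d = (\<Sum>j\<in>active_set L Kp Km v x. a j *\<^sub>R reflection_vec j) \<and> norm d = 1}"

definition has_reflection_projection ::
    "('n \<Rightarrow> real) \<Rightarrow> ('n \<Rightarrow> real) \<Rightarrow> ('n \<Rightarrow> real) \<Rightarrow> (real ^ 'n \<Rightarrow> real) \<Rightarrow> bool" where
  "has_reflection_projection L Kp Km v \<longleftrightarrow>
     (\<exists>\<pi> :: real ^ 'n \<Rightarrow> real ^ 'n.
        (\<forall>x. \<pi> x \<in> closure (continuation_region L Kp Km v)) \<and>
        (\<forall>x \<in> closure (continuation_region L Kp Km v). \<pi> x = x) \<and>
        (\<forall>x. x \<notin> closure (continuation_region L Kp Km v) \<longrightarrow>
           \<pi> x \<in> frontier (continuation_region L Kp Km v) \<and>
           (\<exists>\<theta>>0. \<exists>d\<in>reflection_directions L Kp Km v (\<pi> x). \<pi> x - x = \<theta> *\<^sub>R d)))"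

end

theory Submission
  imports Defs
begin

text \<open>A policy that attains the regulator's infimum from every initial state is Pareto optimal: started
  anywhere, a dominating policy would have a strictly smaller weighted sum of player costs, because
  the weights are positive and the infimum is finite. The substance is therefore the existence and
  uniqueness of a minimising control. It is obtained by the direct method of the calculus of
  variations, within a filtration that may be larger than the one generated by \<open>B\<close> and is assumed
  neither complete nor right-continuous.

  Integration by parts turns the discounted effort \<open>\<integral> exp (- \<rho> t) d\<zeta>\<^sub>t\<close> into
  \<open>\<integral> \<rho> exp (- \<rho> t) \<zeta>\<^sub>t dt\<close> (\<open>discounted_total_eq\<close>). The cost of a control is then the integral, against
  the product of the probability and the discounting measure \<open>exp (- \<rho> t) dt\<close>, of a convex function
  \<open>rate\<close> of the values of the control. No stochastic calculus is left in the problem.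

  Existence. Truncating a control, sampling it on a fine dyadic grid and replacing each sample by
  its conditional expectation given the past of \<open>B\<close> raises the cost by as little as desired
  (\<open>approximation_by_strategies\<close>), so minimising sequences can be taken adapted to \<open>B\<close>. Choose one
  that also nearly minimises the sum of the integrals of \<open>exp (- \<zeta>)\<close> over the parts \<open>\<zeta>\<close>. As midpoints
  of near minimisers are near minimisers, \<open>exp (- \<zeta> / 2)\<close> is Cauchy in mean square, and a subsequence
  converges almost everywhere without any bound on the controls
  (\<open>convergent_minimizing_sequence\<close>). Fatou's lemma makes the limit optimal. The limit is only
  defined for almost every time and must be replaced by its right limits, which a priori depend
  on the information that is available immediately afterwards. In a Brownian filtration no
  information arrives suddenly, and the right limits of an increasing adapted process have a
  progressively measurable version (\<open>predictable_version\<close>).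

  For that theorem, replace on each dyadic grid every increment of the process by its prediction
  given the past at the left end of its cell. The errors, called surprises here, are
  orthogonal and bounded in mean square, and their sum tends weakly to zero because a continuous
  function of finitely many values of \<open>B\<close> hardly depends on the path within one small cell. Averages
  of almost orthogonal surprises tend to zero strongly, the maximal inequality makes this uniform in
  time, and the averaged predictions, which are known at the left end of each cell, converge to the
  right limits of the process.

  Uniqueness. Strong convexity of the running cost determines the net control of every player
  (\<open>optimal_net_unique\<close>). Removing from both parts of a player the increase that they have in common
  does not change the net control and lowers the cost, so in an optimal control nothing can be
  removed (\<open>optimal_overlap_vanishes\<close>), and then the net control determines both parts.\<close>

section \<open>Independence of a Brownian motion's past and future\<close>

text \<open>The \<open>\<sigma>\<close>-algebra that a process generates over a set of times. It is kept uncompleted, so that the past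
  of \<open>B\<close> is contained in an arbitrary, possibly incomplete, filtration.\<close>

definition path_algebra ::
    "'a measure \<Rightarrow> (real \<Rightarrow> 'a \<Rightarrow> 'b::topological_space) \<Rightarrow> real set \<Rightarrow> 'a measure" where
  "path_algebra M X T = sigma (space M) {X s -` U \<inter> space M | s U. s \<in> T \<and> U \<in> sets borel}"

lemma space_path_algebra [simp]: "space (path_algebra M X T) = space M"
  unfolding path_algebra_def by (simp add: space_measure_of_conv)

lemma sets_path_algebra:
  "sets (path_algebra M X T)
     = sigma_sets (space M) {X s -` U \<inter> space M | s U. s \<in> T \<and> U \<in> sets borel}"
  unfolding path_algebra_def by (rule sets_measure_of) auto

lemma measurable_path_algebra:
  assumes "s \<in> T" shows "X s \<in> borel_measurable (path_algebra M X T)"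
  by (rule measurableI) (use assms in \<open>auto simp: sets_path_algebra intro!: sigma_sets.Basic\<close>)

lemma sets_path_algebra_least:
  assumes "space N = space M" and "\<And>s. s \<in> T \<Longrightarrow> X s \<in> borel_measurable N"
  shows "sets (path_algebra M X T) \<subseteq> sets N"
  unfolding sets_path_algebra
  by (subst assms(1)[symmetric], rule sets.sigma_sets_subset)
     (use assms in \<open>auto intro!: measurable_sets simp flip: assms(1)\<close>)

lemma subalgebra_path_algebra:
  assumes "space N = space M" and "\<And>s. s \<in> T \<Longrightarrow> X s \<in> borel_measurable N"
  shows "subalgebra N (path_algebra M X T)"
  unfolding subalgebra_def using sets_path_algebra_least[OF assms] assms(1) by simp

lemma sets_path_algebra_mono:
  assumes "T \<subseteq> T'" shows "sets (path_algebra M X T) \<subseteq> sets (path_algebra M X T')"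
  by (rule sets_path_algebra_least) (use assms in \<open>auto intro: measurable_path_algebra\<close>)

text \<open>Conditions on finitely many times, with closed sets: a generator of the path algebra that is stable
  under intersection, and whose indicators are limits of Lipschitz functions of the path.\<close>

definition cylinders ::
    "'a measure \<Rightarrow> (real \<Rightarrow> 'a \<Rightarrow> 'b::topological_space) \<Rightarrow> real set \<Rightarrow> 'a set set" where
  "cylinders M X T = {{\<omega>\<in>space M. \<forall>s\<in>J. X s \<omega> \<in> U s} | J U. finite J \<and> J \<subseteq> T \<and> (\<forall>s. closed (U s))}"

lemma Int_stable_cylinders: "Int_stable (cylinders M X T)"
  unfolding Int_stable_def
proof safe
  fix a b assume "a \<in> cylinders M X T" "b \<in> cylinders M X T"
  then obtain J U J' U' where
      a: "a = {\<omega>\<in>space M. \<forall>s\<in>J. X s \<omega> \<in> U s}" "finite J" "J \<subseteq> T" "\<And>s. closed (U s)" and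
      b: "b = {\<omega>\<in>space M. \<forall>s\<in>J'. X s \<omega> \<in> U' s}" "finite J'" "J' \<subseteq> T" "\<And>s. closed (U' s)"
    unfolding cylinders_def by auto
  define V where "V s = (if s \<in> J then U s else UNIV) \<inter> (if s \<in> J' then U' s else UNIV)" for s
  have "a \<inter> b = {\<omega>\<in>space M. \<forall>s\<in>J \<union> J'. X s \<omega> \<in> V s}"
    unfolding a b V_def by auto
  moreover have "\<forall>s. closed (V s)" unfolding V_def using a b by auto
  ultimately show "a \<inter> b \<in> cylinders M X T"
    unfolding cylinders_def using a(2,3) b(2,3) by (auto intro!: exI[of _ "J \<union> J'"] exI[of _ V])
qed

lemma cylinders_subset: "cylinders M X T \<subseteq> Pow (space M)"
  unfolding cylinders_def by auto

lemma sets_path_algebra_cylinders: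
  "sets (path_algebra M X T) = sigma_sets (space M) (cylinders M X T)"
proof (rule antisym)
  let ?N = "sigma (space M) (cylinders M X T)"
  have N: "space ?N = space M" "sets ?N = sigma_sets (space M) (cylinders M X T)"
    using cylinders_subset[of M X T] by (auto simp: space_measure_of_conv intro!: sets_measure_of)
  have "X s \<in> borel_measurable ?N" if s: "s \<in> T" for s
  proof (rule borel_measurableI)
    fix U :: "'b set" assume "open U"
    have "{\<omega>\<in>space M. \<forall>u\<in>{s}. X u \<omega> \<in> - U} \<in> cylinders M X T"
      unfolding cylinders_def using s \<open>open U\<close>
      by (auto intro!: exI[of _ "{s}"] exI[of _ "\<lambda>_. - U"])
    then have "{\<omega>\<in>space M. X s \<omega> \<notin> U} \<in> sets ?N" unfolding N by auto
    then have "space ?N - {\<omega>\<in>space M. X s \<omega> \<notin> U} \<in> sets ?N" by blast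
    also have "space ?N - {\<omega>\<in>space M. X s \<omega> \<notin> U} = X s -` U \<inter> space ?N" unfolding N by auto
    finally show "X s -` U \<inter> space ?N \<in> sets ?N" .
  qed
  then show "sets (path_algebra M X T) \<subseteq> sigma_sets (space M) (cylinders M X T)"
    using sets_path_algebra_least[of ?N M T X] N by auto
next
  let ?P = "path_algebra M X T"
  have "cylinders M X T \<subseteq> sets ?P"
  proof
    fix a assume "a \<in> cylinders M X T"
    then obtain J U where
      a: "a = {\<omega>\<in>space M. \<forall>s\<in>J. X s \<omega> \<in> U s}" "finite J" "J \<subseteq> T" "\<And>s. closed (U s)"
      unfolding cylinders_def by auto
    have "{\<omega>\<in>space ?P. \<forall>s\<in>J. X s \<omega> \<in> U s} \<in> sets ?P"
    proof (rule sets.sets_Collect_finite_All)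
      fix s assume "s \<in> J"
      then have "X s \<in> borel_measurable ?P" using a(3) by (auto intro: measurable_path_algebra)
      then have "X s -` U s \<inter> space ?P \<in> sets ?P"
        by (rule measurable_sets) (use a(4)[of s] in auto)
      then show "{\<omega>\<in>space ?P. X s \<omega> \<in> U s} \<in> sets ?P"
        by (simp add: vimage_def Int_def conj_commute)
    qed (use a in auto)
    then show "a \<in> sets ?P" using a by simp
  qed
  then show "sigma_sets (space M) (cylinders M X T) \<subseteq> sets ?P"
    using sets.sigma_sets_subset[of "cylinders M X T" ?P] by simp
qed

text \<open>Independence of two \<open>\<sigma>\<close>-algebras says that the law of \<open>\<omega> \<mapsto> (\<omega>, \<omega>)\<close> is a product measure. Fubini's
  theorem then averages over the second argument, which is how the future is integrated out below.\<close>

lemma (in prob_space) integral_diagonal_indep: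
  fixes f :: "'a \<times> 'a \<Rightarrow> real"
  assumes A: "subalgebra M A" and C: "subalgebra M C"
    and indep: "\<And>a c. a \<in> sets A \<Longrightarrow> c \<in> sets C \<Longrightarrow> prob (a \<inter> c) = prob a * prob c"
    and f: "f \<in> borel_measurable (A \<Otimes>\<^sub>M C)" and bd: "\<And>z. \<bar>f z\<bar> \<le> b"
  shows "(\<integral>\<omega>. f (\<omega>, \<omega>) \<partial>M) = (\<integral>\<omega>. (\<integral>\<eta>. f (\<omega>, \<eta>) \<partial>M) \<partial>M)"
    and "(\<lambda>\<omega>. \<integral>\<eta>. f (\<omega>, \<eta>) \<partial>M) \<in> borel_measurable A"
proof -
  let ?A = "restr_to_subalg M A" and ?C = "restr_to_subalg M C"
  have PA: "prob_space ?A" and PC: "prob_space ?C"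
    using prob_space_restr_to_subalg[OF A prob_space_axioms]
      prob_space_restr_to_subalg[OF C prob_space_axioms] by auto
  interpret PA: prob_space ?A by fact
  interpret PC: prob_space ?C by fact
  interpret P: pair_prob_space ?A ?C ..
  have sA: "sets ?A = sets A" and sC: "sets ?C = sets C"
    using sets_restr_to_subalg A C by auto
  have spA: "space ?A = space M" "space ?C = space M" by (simp_all add: space_restr_to_subalg)
  have sp: "sets (?A \<Otimes>\<^sub>M ?C) = sets (A \<Otimes>\<^sub>M C)" using sA sC by (rule sets_pair_measure_cong)
  have f': "f \<in> borel_measurable (?A \<Otimes>\<^sub>M ?C)" using f sp by (simp cong: measurable_cong_sets)
  have d: "(\<lambda>\<omega>. (\<omega>, \<omega>)) \<in> measurable M (?A \<Otimes>\<^sub>M ?C)"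
  proof (rule measurable_Pair)
    show "(\<lambda>x. x) \<in> measurable M ?A" "(\<lambda>x. x) \<in> measurable M ?C"
      using A C sA sC spA unfolding subalgebra_def
      by (auto intro!: measurableI simp: sets.Int_space_eq2 subset_iff)
  qed
  have eq: "?A \<Otimes>\<^sub>M ?C = distr M (?A \<Otimes>\<^sub>M ?C) (\<lambda>\<omega>. (\<omega>, \<omega>))"
  proof (rule pair_measure_eqI)
    fix a c assume a: "a \<in> sets ?A" and c: "c \<in> sets ?C"
    have aM: "a \<in> sets M" "c \<in> sets M" using a c A C sA sC unfolding subalgebra_def by auto
    have "emeasure (distr M (?A \<Otimes>\<^sub>M ?C) (\<lambda>\<omega>. (\<omega>, \<omega>))) (a \<times> c)
        = emeasure M ((\<lambda>\<omega>. (\<omega>, \<omega>)) -` (a \<times> c) \<inter> space M)"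
      using a c d by (intro emeasure_distr) auto
    also have "(\<lambda>\<omega>. (\<omega>, \<omega>)) -` (a \<times> c) \<inter> space M = a \<inter> c"
      using sets.sets_into_space aM by auto
    also have "emeasure M (a \<inter> c) = emeasure M a * emeasure M c"
      using indep[of a c] a c sA sC by (simp add: emeasure_eq_measure ennreal_mult)
    also have "\<dots> = emeasure ?A a * emeasure ?C c"
      using a c sA sC by (simp add: emeasure_restr_to_subalg A C)
    finally show "emeasure ?A a * emeasure ?C c
        = emeasure (distr M (?A \<Otimes>\<^sub>M ?C) (\<lambda>\<omega>. (\<omega>, \<omega>))) (a \<times> c)" ..
  qed (use PA.sigma_finite_measure_axioms PC.sigma_finite_measure_axioms in auto)
  have int: "integrable (?A \<Otimes>\<^sub>M ?C) f"
    by (rule P.integrable_const_bound[of _ b]) (use f' bd in auto)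
  have inner: "(\<integral>\<eta>. f (\<omega>, \<eta>) \<partial>?C) = (\<integral>\<eta>. f (\<omega>, \<eta>) \<partial>M)" if "\<omega> \<in> space M" for \<omega>
  proof (rule integral_subalgebra2[OF C])
    show "(\<lambda>\<eta>. f (\<omega>, \<eta>)) \<in> borel_measurable C"
      using f that A unfolding subalgebra_def by (auto intro: measurable_Pair2)
  qed
  have "(\<lambda>\<omega>. \<integral>\<eta>. f (\<omega>, \<eta>) \<partial>?C) \<in> borel_measurable ?A"
    using f' by measurable
  then have mA: "(\<lambda>\<omega>. \<integral>\<eta>. f (\<omega>, \<eta>) \<partial>?C) \<in> borel_measurable A"
    using sA by (simp cong: measurable_cong_sets)
  have "(\<integral>\<omega>. f (\<omega>, \<omega>) \<partial>M) = (\<integral>z. f z \<partial>distr M (?A \<Otimes>\<^sub>M ?C) (\<lambda>\<omega>. (\<omega>, \<omega>)))"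
    by (rule integral_distr[symmetric]) (use d f' in auto)
  also have "\<dots> = (\<integral>z. f z \<partial>(?A \<Otimes>\<^sub>M ?C))" using eq by simp
  also have "\<dots> = (\<integral>\<omega>. (\<integral>\<eta>. f (\<omega>, \<eta>) \<partial>?C) \<partial>?A)"
    using P.integral_fst'[OF int] by simp
  also have "\<dots> = (\<integral>\<omega>. (\<integral>\<eta>. f (\<omega>, \<eta>) \<partial>?C) \<partial>M)"
    by (rule integral_subalgebra2[OF A mA])
  also have "\<dots> = (\<integral>\<omega>. (\<integral>\<eta>. f (\<omega>, \<eta>) \<partial>M) \<partial>M)"
    by (rule Bochner_Integration.integral_cong) (auto simp: inner)
  finally show "(\<integral>\<omega>. f (\<omega>, \<omega>) \<partial>M) = (\<integral>\<omega>. (\<integral>\<eta>. f (\<omega>, \<eta>) \<partial>M) \<partial>M)" .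
  show "(\<lambda>\<omega>. \<integral>\<eta>. f (\<omega>, \<eta>) \<partial>M) \<in> borel_measurable A"
    using mA A inner by (subst measurable_cong[of A _ "\<lambda>\<omega>. \<integral>\<eta>. f (\<omega>, \<eta>) \<partial>?C"]) (auto simp: subalgebra_def)
qed

locale brownian_space =
  fixes M :: "'a measure" and F :: "real \<Rightarrow> 'a measure" and B :: "real \<Rightarrow> 'a \<Rightarrow> real ^ 'd"
  assumes filtered: "filtered_prob_space M F" and brownian: "brownian_motion M F B"

sublocale brownian_space \<subseteq> prob_space M
  using filtered unfolding filtered_prob_space_def by simp

context brownian_space
begin

lemma subalg_F: "0 \<le> t \<Longrightarrow> subalgebra M (F t)"
  using filtered unfolding filtered_prob_space_def by simp

lemma sets_F_mono: "0 \<le> s \<Longrightarrow> s \<le> t \<Longrightarrow> sets (F s) \<subseteq> sets (F t)"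
  using filtered unfolding filtered_prob_space_def by simp

lemma space_F: "0 \<le> t \<Longrightarrow> space (F t) = space M"
  using subalg_F unfolding subalgebra_def by simp

lemma B_adapted: "0 \<le> t \<Longrightarrow> B t \<in> borel_measurable (F t)"
  using brownian unfolding brownian_motion_def by simp

lemma measurable_F_mono:
  assumes "0 \<le> s" "s \<le> t" "f \<in> measurable (F s) N" shows "f \<in> measurable (F t) N"
  using assms sets_F_mono[of s t] space_F[of s] space_F[of t] unfolding measurable_def by auto

lemma measurable_F_M:
  assumes "0 \<le> t" "f \<in> measurable (F t) N" shows "f \<in> measurable M N"
  using measurable_from_subalg[OF subalg_F] assms by blast

lemma B_measurable: "0 \<le> t \<Longrightarrow> B t \<in> borel_measurable M"
  using B_adapted measurable_F_M by blast

lemma increment_indep: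
  assumes "0 \<le> s" "s \<le> t" "a \<in> sets (F s)" and U: "U \<in> sets borel"
  shows "prob (a \<inter> ((\<lambda>\<omega>. B t \<omega> - B s \<omega>) -` U \<inter> space M))
    = prob a * prob ((\<lambda>\<omega>. B t \<omega> - B s \<omega>) -` U \<inter> space M)"
proof (cases "s = t")
  case True
  then have "(\<lambda>\<omega>. B t \<omega> - B s \<omega>) -` U \<inter> space M = (if 0 \<in> U then space M else {})" by auto
  moreover have "a \<subseteq> space M" using assms sets.sets_into_space[of a "F s"] space_F by auto
  ultimately show ?thesis by (auto simp: Int_absorb2 prob_space)
next
  case False
  then have "s < t" using assms by simp
  then have "indep_set (sets (F s))
          (sets (vimage_algebra (space M) (\<lambda>\<omega>. B t \<omega> - B s \<omega>) borel))"
    using brownian assms unfolding brownian_motion_def by blast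
  then show ?thesis
    by (rule indep_setD) (use assms U in \<open>auto intro: in_vimage_algebra\<close>)
qed

abbreviation "past t \<equiv> path_algebra M B {0..t}"
abbreviation "whole \<equiv> path_algebra M B {0..}"
abbreviation "future s \<equiv> path_algebra M (\<lambda>u \<omega>. B u \<omega> - B s \<omega>) {s..}"

lemma subalg_past: "0 \<le> t \<Longrightarrow> subalgebra (F t) (past t)"
  by (rule subalgebra_path_algebra) (auto simp: space_F intro: measurable_F_mono B_adapted)

lemma subalg_past_M: "subalgebra M (past t)"
  by (rule subalgebra_path_algebra) (auto intro: B_measurable)

lemma subalg_whole: "subalgebra M whole"
  by (rule subalgebra_path_algebra) (auto intro: B_measurable)

lemma subalg_future: "0 \<le> s \<Longrightarrow> subalgebra M (future s)"
  by (rule subalgebra_path_algebra) (auto intro!: B_measurable borel_measurable_diff)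

lemma subalg_past_mono: "s \<le> t \<Longrightarrow> subalgebra (past t) (past s)"
  unfolding subalgebra_def using sets_path_algebra_mono[of "{0..s}" "{0..t}" M B] by auto

lemma subalg_past_whole: "subalgebra whole (past s)"
  unfolding subalgebra_def using sets_path_algebra_mono[of "{0..s}" "{0..}" M B] by auto

text \<open>Brownian motion is only given through the independence of single increments from the past. Products
  over several later times are reduced to that by removing the latest time \<open>b\<close>: conditionally on the
  information at the last earlier time \<open>m\<close>, the factor at \<open>b\<close> becomes a function of the path at \<open>m\<close>.\<close>

lemma integral_future_indep:
  assumes s: "0 \<le> s" and J: "finite J" "J \<subseteq> {s..}"
    and g: "\<And>u. g u \<in> borel_measurable borel" "\<And>u z. 0 \<le> g u z" "\<And>u z. g u z \<le> (1::real)"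
    and a: "a \<in> sets (F s)"
  shows "(\<integral>\<omega>. indicator a \<omega> * (\<Prod>u\<in>J. g u (B u \<omega> - B s \<omega>)) \<partial>M)
    = prob a * (\<integral>\<omega>. (\<Prod>u\<in>J. g u (B u \<omega> - B s \<omega>)) \<partial>M)"
proof -
  \<comment> \<open>The time \<open>s\<close> itself is added so that a last earlier time always exists.\<close>
  have "(\<integral>\<omega>. indicator a \<omega> * (\<Prod>u\<in>insert s J. g u (B u \<omega> - B s \<omega>)) \<partial>M)
      = prob a * (\<integral>\<omega>. (\<Prod>u\<in>insert s J. g u (B u \<omega> - B s \<omega>)) \<partial>M)"
    if "finite J" "J \<subseteq> {s<..}" and g: "\<And>u. g u \<in> borel_measurable borel" "\<And>u z. 0 \<le> g u z"
      "\<And>u z. g u z \<le> (1::real)" and a: "a \<in> sets (F s)" for J g a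
    using that
  proof (induction J arbitrary: g a rule: finite_linorder_max_induct)
    case empty
    have "a \<in> sets M" using empty(5) subalg_F[OF s] unfolding subalgebra_def by auto
    then show ?case by (simp add: prob_space)
  next
    case (insert b J)
    define m where "m = Max (insert s J)"
    have mJ: "m \<in> insert s J" unfolding m_def using insert.hyps by (intro Max_in) auto
    have sm: "s \<le> m" unfolding m_def using insert.hyps by auto
    have mb: "m < b" using mJ insert by auto
    have le_m: "u \<le> m" if "u \<in> insert s J" for u unfolding m_def using insert.hyps that by (intro Max_ge) auto
    \<comment> \<open>The average of the factor at \<open>b\<close> over the increment from \<open>m\<close> to \<open>b\<close>, absorbed into the factor at \<open>m\<close>.\<close>
    define gh where "gh z = (\<integral>\<omega>. g b (z + (B b \<omega> - B m \<omega>)) \<partial>M)" for z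
    have m0: "0 \<le> m" "0 \<le> b" using s sm mb by auto
    note [measurable] = insert.prems(2) B_measurable[OF m0(1)] B_measurable[OF m0(2)]
    define g' where "g' = (\<lambda>u. if u = m then (\<lambda>z. g m z * gh z) else g u)"
    have ghm: "gh \<in> borel_measurable borel" unfolding gh_def by measurable
    have gh01: "0 \<le> gh z" "gh z \<le> 1" for z
    proof -
      show "0 \<le> gh z" unfolding gh_def using insert.prems(3) by (intro integral_nonneg_AE) auto
      have "gh z \<le> (\<integral>\<omega>. 1 \<partial>M)" unfolding gh_def
        by (rule integral_mono) (use insert.prems(3,4) in \<open>auto intro!: integrable_const_bound[of _ 1]\<close>)
      then show "gh z \<le> 1" by (simp add: prob_space)
    qed
    have g': "g' u \<in> borel_measurable borel" "0 \<le> g' u z" "g' u z \<le> 1" for u z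
      unfolding g'_def using insert.prems(2-4) ghm gh01 by (auto intro!: mult_le_one)
    have step: "(\<integral>\<omega>. indicator a \<omega> * (\<Prod>u\<in>insert s (insert b J). g u (B u \<omega> - B s \<omega>)) \<partial>M)
       = (\<integral>\<omega>. indicator a \<omega> * (\<Prod>u\<in>insert s J. g' u (B u \<omega> - B s \<omega>)) \<partial>M)"
      if a: "a \<in> sets (F s)" for a
    proof -
      let ?C = "path_algebra M (\<lambda>u \<omega>. B b \<omega> - B m \<omega>) {b}"
      let ?X = "\<lambda>\<omega>. indicator a \<omega> * (\<Prod>u\<in>insert s J. g u (B u \<omega> - B s \<omega>))"
      let ?f = "\<lambda>(\<omega>, \<eta>). ?X \<omega> * g b ((B m \<omega> - B s \<omega>) + (B b \<eta> - B m \<eta>))"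
      have C: "subalgebra M ?C"
        by (rule subalgebra_path_algebra) auto
      have setsC: "\<exists>U\<in>sets borel. c = (\<lambda>\<omega>. B b \<omega> - B m \<omega>) -` U \<inter> space M" if "c \<in> sets ?C" for c
      proof -
        have "sets ?C = sets (vimage_algebra (space M) (\<lambda>\<omega>. B b \<omega> - B m \<omega>) borel)"
          unfolding sets_path_algebra sets_vimage_algebra by simp
        then show ?thesis using that by (subst (asm) sets_vimage_algebra2) auto
      qed
      have FM: "B u \<in> borel_measurable (F m)" if "u \<in> insert s J" for u
        using le_m[OF that] insert.prems(1) s that by (auto intro!: measurable_F_mono[OF _ _ B_adapted])
      have FMm: "B m \<in> borel_measurable (F m)" "B s \<in> borel_measurable (F m)"
        using FM mJ by auto
      have aF: "a \<in> sets (F m)" using a sets_F_mono[OF s sm] by auto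
      have Cm: "(\<lambda>\<omega>. B b \<omega> - B m \<omega>) \<in> borel_measurable ?C"
        by (rule measurable_path_algebra) simp
      note [measurable] = aF FMm Cm
      have X[measurable]: "?X \<in> borel_measurable (F m)"
        using FM insert.prems(2) by (intro borel_measurable_times borel_measurable_prod
            measurable_compose[OF _ insert.prems(2)]) (auto intro!: borel_measurable_diff)
      have X01: "0 \<le> ?X \<omega>" "?X \<omega> \<le> 1" for \<omega>
        using insert.prems(3,4) by (auto intro!: mult_nonneg_nonneg mult_le_one prod_nonneg prod_le_1 simp del: prod.insert split: split_indicator)
      have f[measurable]: "?f \<in> borel_measurable (F m \<Otimes>\<^sub>M ?C)" by measurable
      have fb: "\<bar>?f z\<bar> \<le> 1" for z
      proof -
        have "\<bar>?X \<omega> * g b y\<bar> \<le> 1" for \<omega> y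
        proof -
          have "0 \<le> p \<Longrightarrow> p \<le> 1 \<Longrightarrow> 0 \<le> q \<Longrightarrow> q \<le> 1 \<Longrightarrow> \<bar>p * q\<bar> \<le> 1" for p q :: real
            by (simp add: abs_mult mult_le_one)
          from this[OF X01 insert.prems(3,4)] show ?thesis .
        qed
        then show ?thesis by (simp add: case_prod_beta del: prod.insert)
      qed
      have "(\<integral>\<omega>. ?f (\<omega>, \<omega>) \<partial>M) = (\<integral>\<omega>. (\<integral>\<eta>. ?f (\<omega>, \<eta>) \<partial>M) \<partial>M)"
      proof (rule integral_diagonal_indep(1)[OF subalg_F[OF m0(1)] C _ f fb])
        fix a' c assume "a' \<in> sets (F m)" "c \<in> sets ?C"
        then show "prob (a' \<inter> c) = prob a' * prob c"
          using setsC[of c] increment_indep[of m b a'] m0 mb by auto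
      qed
      also have "(\<integral>\<omega>. (\<integral>\<eta>. ?f (\<omega>, \<eta>) \<partial>M) \<partial>M) = (\<integral>\<omega>. ?X \<omega> * gh (B m \<omega> - B s \<omega>) \<partial>M)"
        by (simp add: gh_def del: prod.insert)
      also have "\<dots> = (\<integral>\<omega>. indicator a \<omega> * (\<Prod>u\<in>insert s J. g' u (B u \<omega> - B s \<omega>)) \<partial>M)"
      proof (rule Bochner_Integration.integral_cong[OF refl])
        fix \<omega>
        have fin: "finite (insert s J)" using insert.hyps by auto
        show "?X \<omega> * gh (B m \<omega> - B s \<omega>) = indicator a \<omega> * (\<Prod>u\<in>insert s J. g' u (B u \<omega> - B s \<omega>))"
          unfolding prod.remove[OF fin mJ] g'_def by (simp add: mult_ac)
      qed
      finally have fin: "(\<integral>\<omega>. ?f (\<omega>, \<omega>) \<partial>M)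
          = (\<integral>\<omega>. indicator a \<omega> * (\<Prod>u\<in>insert s J. g' u (B u \<omega> - B s \<omega>)) \<partial>M)" .
      have "?f (\<omega>, \<omega>) = indicator a \<omega> * (\<Prod>u\<in>insert s (insert b J). g u (B u \<omega> - B s \<omega>))" for \<omega>
      proof -
        have "b \<notin> insert s J" "finite (insert s J)" using insert by auto
        moreover have "insert s (insert b J) = insert b (insert s J)" by auto
        ultimately show ?thesis by (simp add: mult_ac del: prod.insert add: prod.insert[of "insert s J" b])
      qed
      then have "(\<lambda>\<omega>. ?f (\<omega>, \<omega>)) = (\<lambda>\<omega>. indicator a \<omega> * (\<Prod>u\<in>insert s (insert b J). g u (B u \<omega> - B s \<omega>)))"
        by (rule ext)
      from fin[unfolded this] show ?thesis .
    qed
    have sp: "space M \<in> sets (F s)" using space_F[OF s] by (metis sets.top)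
    have J: "J \<subseteq> {s<..}" using insert.prems by auto
    have IH: "(\<integral>\<omega>. indicator a \<omega> * (\<Prod>u\<in>insert s J. g' u (B u \<omega> - B s \<omega>)) \<partial>M)
       = prob a * (\<integral>\<omega>. (\<Prod>u\<in>insert s J. g' u (B u \<omega> - B s \<omega>)) \<partial>M)"
      by (rule insert.IH) (use J g' insert.prems in auto)
    have one: "(\<integral>\<omega>. indicator (space M) \<omega> * h \<omega> \<partial>M) = (\<integral>\<omega>. h \<omega> \<partial>M)" for h :: "'a \<Rightarrow> real"
      by (rule Bochner_Integration.integral_cong) auto
    show ?case
      using step[OF insert.prems(5)] step[OF sp] IH unfolding one by simp
  qed
  note key = this
  have "J - {s} \<subseteq> {s<..}" "finite (J - {s})" using J by auto
  define g' where "g' = (\<lambda>u. if u \<in> J then g u else (\<lambda>_. 1))"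
  have eq: "(\<Prod>u\<in>J. g u (B u \<omega> - B s \<omega>)) = (\<Prod>u\<in>insert s (J - {s}). g' u (B u \<omega> - B s \<omega>))" for \<omega>
  proof -
    have "(\<Prod>u\<in>J. g u (B u \<omega> - B s \<omega>)) = (\<Prod>u\<in>J. g' u (B u \<omega> - B s \<omega>))" unfolding g'_def by simp
    also have "\<dots> = (\<Prod>u\<in>insert s J. g' u (B u \<omega> - B s \<omega>))"
      by (rule prod.mono_neutral_left) (use J in \<open>auto simp: g'_def\<close>)
    finally show ?thesis by simp
  qed
  show ?thesis unfolding eq
    by (rule key) (use \<open>J - {s} \<subseteq> {s<..}\<close> \<open>finite (J - {s})\<close> g a in \<open>auto simp: g'_def\<close>)
qed

lemma future_indep:
  assumes s: "0 \<le> s" and a: "a \<in> sets (F s)" and c: "c \<in> sets (future s)"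
  shows "prob (a \<inter> c) = prob a * prob c"
proof -
  let ?C = "cylinders M (\<lambda>u \<omega>. B u \<omega> - B s \<omega>) {s..}"
  have aM: "a \<in> events" using a subalg_F[OF s] unfolding subalgebra_def by auto
  have cM: "c \<in> events" if "c \<in> sets (future s)" for c
    using that subalg_future[OF s] unfolding subalgebra_def by auto
  show ?thesis
    using Int_stable_cylinders cylinders_subset c[unfolded sets_path_algebra_cylinders]
  proof (induction rule: sigma_sets_induct_disjoint)
    case (basic c)
    then obtain J U where J: "c = {\<omega>\<in>space M. \<forall>u\<in>J. B u \<omega> - B s \<omega> \<in> U u}" "finite J"
      "J \<subseteq> {s..}" "\<And>u. closed (U u)" unfolding cylinders_def by auto
    have cs: "c \<in> events" using basic cM sets_path_algebra_cylinders by blast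
    have ind: "(indicator c \<omega> :: real) = (\<Prod>u\<in>J. indicator (U u) (B u \<omega> - B s \<omega>))" if "\<omega> \<in> space M" for \<omega>
      using that J(2) unfolding J(1) by (auto simp: indicator_def prod_zero_iff)
    have "prob (a \<inter> c) = (\<integral>\<omega>. indicator a \<omega> * indicator c \<omega> \<partial>M)"
      using aM cs by (simp flip: indicator_inter_arith)
    also have "\<dots> = (\<integral>\<omega>. indicator a \<omega> * (\<Prod>u\<in>J. indicator (U u) (B u \<omega> - B s \<omega>)) \<partial>M)"
      by (rule Bochner_Integration.integral_cong) (auto simp: ind)
    also have "\<dots> = prob a * (\<integral>\<omega>. (\<Prod>u\<in>J. indicator (U u) (B u \<omega> - B s \<omega>)) \<partial>M)"
      by (rule integral_future_indep[OF s J(2,3)])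
         (use J(4) a in \<open>auto intro!: borel_measurable_indicator split: split_indicator\<close>)
    also have "(\<integral>\<omega>. (\<Prod>u\<in>J. indicator (U u) (B u \<omega> - B s \<omega>)) \<partial>M) = (LINT \<omega>|M. indicat_real c \<omega>)"
      by (rule Bochner_Integration.integral_cong[OF refl]) (rule ind[symmetric])
    also have "\<dots> = prob c" using cs by simp
    finally show ?case .
  next
    case empty show ?case by simp
  next
    case (compl c)
    have c: "c \<in> events" using compl cM sets_path_algebra_cylinders by blast
    have "prob (a \<inter> (space M - c)) = prob (a - (a \<inter> c))"
      using sets.sets_into_space[OF aM] by (intro arg_cong[of _ _ prob]) auto
    also have "\<dots> = prob a - prob (a \<inter> c)" using aM c by (intro finite_measure_Diff) auto
    finally show ?case unfolding compl(2) prob_compl[OF c] by (simp add: algebra_simps)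
  next
    case (union C)
    have C: "range C \<subseteq> events" using union cM sets_path_algebra_cylinders by blast
    have "(\<lambda>i. prob (a \<inter> C i)) sums prob (\<Union>i. a \<inter> C i)"
      by (rule finite_measure_UNION) (use union(1) C aM in \<open>auto simp: disjoint_family_on_def\<close>)
    moreover have "(\<lambda>i. prob a * prob (C i)) sums (prob a * prob (\<Union>i. C i))"
      by (intro sums_mult finite_measure_UNION C union(1))
    ultimately show ?case using union(3) by (simp add: sums_unique2 flip: UN_simps)
  qed
qed

lemma sigma_finite_subalgebraI: "subalgebra M G \<Longrightarrow> sigma_finite_subalgebra M G"
  by (intro finite_measure_subalgebra_is_sigma_finite finite_measure_subalgebra.intro
      finite_measure_subalgebra_axioms.intro finite_measure_axioms)

lemma cond_exp_bounds:
  assumes G: "subalgebra M G" and f: "f \<in> borel_measurable M" and "\<And>\<omega>. c \<le> f \<omega>" "\<And>\<omega>. f \<omega> \<le> (b::real)"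
  shows "AE \<omega> in M. c \<le> real_cond_exp M G f \<omega> \<and> real_cond_exp M G f \<omega> \<le> b"
proof -
  interpret G: sigma_finite_subalgebra M G by (rule sigma_finite_subalgebraI[OF G])
  have i: "integrable M f"
    by (rule integrable_const_bound[of _ "max \<bar>b\<bar> \<bar>c\<bar>"])
       (use assms in \<open>auto simp: abs_le_iff le_max_iff_disj intro!: AE_I2, (smt (verit))+\<close>)
  show ?thesis
    using G.real_cond_exp_ge_c[OF i, of c] G.real_cond_exp_le_c[OF i, of b] assms by auto
qed

text \<open>What happens in the gap between \<open>s\<close> and \<open>t\<close> is not seen by \<open>\<phi>\<close>. Averaging over the future of \<open>t\<close> leaves
  a function of the past of \<open>s\<close>, although the test function \<open>g\<close> may use all of \<open>F t\<close>.\<close>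

lemma integral_future_average:
  assumes s: "0 \<le> s" "s \<le> t"
    and \<phi>: "\<phi> \<in> borel_measurable (past s \<Otimes>\<^sub>M future t)" and \<phi>01: "\<And>z. 0 \<le> \<phi> z" "\<And>z. \<phi> z \<le> (1::real)"
  defines "\<psi> \<equiv> \<lambda>\<omega>. \<integral>\<eta>. \<phi> (\<omega>, \<eta>) \<partial>M"
  shows "\<psi> \<in> borel_measurable (past s)" and "\<And>\<omega>. 0 \<le> \<psi> \<omega>" and "\<And>\<omega>. \<psi> \<omega> \<le> 1"
    and "\<And>g. g \<in> borel_measurable (F t) \<Longrightarrow> (\<And>\<omega>. \<bar>g \<omega>\<bar> \<le> b)
      \<Longrightarrow> (\<integral>\<omega>. g \<omega> * \<phi> (\<omega>, \<omega>) \<partial>M) = (\<integral>\<omega>. g \<omega> * \<psi> \<omega> \<partial>M)"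
proof -
  have t: "0 \<le> t" using s by simp
  have sub: "sets (past s) \<subseteq> sets (F t)"
    using subalg_past[OF s(1)] sets_F_mono[OF s] unfolding subalgebra_def by auto
  show "\<psi> \<in> borel_measurable (past s)"
    unfolding \<psi>_def
  proof (rule integral_diagonal_indep(2)[OF subalg_past_M subalg_future[OF t] _ \<phi>])
    show "prob (a \<inter> c) = prob a * prob c" if "a \<in> sets (past s)" "c \<in> sets (future t)" for a c
      using that sub by (intro future_indep[OF t]) auto
    show "\<bar>\<phi> z\<bar> \<le> 1" for z using \<phi>01[of z] by simp
  qed
  show "0 \<le> \<psi> \<omega>" for \<omega>
    unfolding \<psi>_def using \<phi>01 by (intro integral_nonneg_AE) auto
  have "(\<integral>\<eta>. \<phi> (\<omega>, \<eta>) \<partial>M) \<le> (LINT \<eta>|M. 1)" for \<omega>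
    by (rule integral_mono') (use \<phi>01 in auto)
  then show "\<psi> \<omega> \<le> 1" for \<omega> unfolding \<psi>_def by (simp add: prob_space)
  fix g assume g: "g \<in> borel_measurable (F t)" and gb: "\<And>\<omega>. \<bar>g \<omega>\<bar> \<le> b"
  have b: "0 \<le> b" using gb[of undefined] by linarith
  define k where "k z = g (fst z) * \<phi> z" for z
  have "(\<lambda>z. (fst z, snd z)) \<in> measurable (F t \<Otimes>\<^sub>M future t) (past s \<Otimes>\<^sub>M future t)"
  proof (rule measurable_Pair)
    have "(\<lambda>x. x) \<in> measurable (F t) (past s)"
      using sub space_F[OF t] by (intro measurableI) (auto simp: sets.Int_space_eq2 subset_iff)
    from measurable_compose[OF measurable_fst this]
    show "(\<lambda>z. fst z) \<in> measurable (F t \<Otimes>\<^sub>M future t) (past s)" .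
  qed (rule measurable_snd)
  from measurable_compose[OF this \<phi>]
  have "\<phi> \<in> borel_measurable (F t \<Otimes>\<^sub>M future t)" by simp
  then have m: "k \<in> borel_measurable (F t \<Otimes>\<^sub>M future t)"
    unfolding k_def by (intro borel_measurable_times measurable_compose[OF measurable_fst g])
  have "\<bar>k z\<bar> \<le> b * 1" for z
    unfolding k_def abs_mult using gb[of "fst z"] \<phi>01[of z] b by (intro mult_mono) auto
  then have "(\<integral>\<omega>. k (\<omega>, \<omega>) \<partial>M) = (\<integral>\<omega>. (\<integral>\<eta>. k (\<omega>, \<eta>) \<partial>M) \<partial>M)"
    by (rule integral_diagonal_indep(1)[OF subalg_F[OF t] subalg_future[OF t] future_indep[OF t] m, rotated -1])
  then show "(\<integral>\<omega>. g \<omega> * \<phi> (\<omega>, \<omega>) \<partial>M) = (\<integral>\<omega>. g \<omega> * \<psi> \<omega> \<partial>M)"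
    unfolding k_def \<psi>_def by simp
qed

text \<open>The future of \<open>B\<close> carries no information about an event that is decided by time \<open>t\<close>. Hence one
  conditioning, on the whole path, serves all times at once; in particular projections of an
  increasing process onto the past of \<open>B\<close> are again increasing.\<close>

lemma cond_exp_whole:
  assumes t: "0 \<le> t" and f: "f \<in> borel_measurable (F t)" and bd: "\<And>\<omega>. \<bar>f \<omega>\<bar> \<le> (b::real)"
  shows "AE \<omega> in M. real_cond_exp M whole f \<omega> = real_cond_exp M (past t) f \<omega>"
proof -
  interpret W: sigma_finite_subalgebra M whole by (rule sigma_finite_subalgebraI[OF subalg_whole])
  interpret P: sigma_finite_subalgebra M "past t" by (rule sigma_finite_subalgebraI[OF subalg_past_M])
  have fM[measurable]: "f \<in> borel_measurable M" using measurable_F_M[OF t f] .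
  have fi: "integrable M f" by (rule integrable_const_bound[of _ b]) (use bd in auto)
  let ?e = "real_cond_exp M (past t) f"
  define e where "e \<omega> = max (- b) (min b (?e \<omega>))" for \<omega>
  have e_past: "e \<in> borel_measurable (past t)"
    unfolding e_def by (intro borel_measurable_max borel_measurable_min borel_measurable_cond_exp) auto
  have e_M[measurable]: "e \<in> borel_measurable M"
    using measurable_from_subalg[OF subalg_past_M e_past] .
  have "b \<ge> 0" using bd[of undefined] by linarith
  then have eb: "\<bar>e \<omega>\<bar> \<le> b" for \<omega> unfolding e_def by auto
  have ei: "integrable M e" by (rule integrable_const_bound[of _ b]) (use eb in auto)
  have ee: "AE \<omega> in M. ?e \<omega> = e \<omega>"
    using cond_exp_bounds[OF subalg_past_M fM, of "-b" b t] bd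
    by (auto simp: e_def abs_le_iff minus_le_iff)
  have main: "(\<integral>\<omega>. indicator c \<omega> * f \<omega> \<partial>M) = (\<integral>\<omega>. indicator c \<omega> * e \<omega> \<partial>M)"
    if "c \<in> sets whole" for c
    using Int_stable_cylinders cylinders_subset that[unfolded sets_path_algebra_cylinders]
  proof (induction rule: sigma_sets_induct_disjoint)
    case (basic c)
    then obtain J U where J: "c = {\<omega>\<in>space M. \<forall>u\<in>J. B u \<omega> \<in> U u}" "finite J"
      "J \<subseteq> {0..}" "\<And>u. closed (U u)" unfolding cylinders_def by auto
    \<comment> \<open>The path is read from \<open>\<omega>\<close> up to time \<open>t\<close> and continued with the increments of \<open>\<eta>\<close>.\<close>
    define \<phi> where "\<phi> = (\<lambda>(\<omega>, \<eta>). \<Prod>u\<in>J. indicator (U u) (B (min u t) \<omega> + (B (max u t) \<eta> - B t \<eta>)) :: real)"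
    have \<phi>01: "0 \<le> \<phi> z" "\<phi> z \<le> 1" for z
      unfolding \<phi>_def by (auto simp: case_prod_beta intro!: prod_nonneg prod_le_1 split: split_indicator)
    have diag: "indicator c \<omega> = \<phi> (\<omega>, \<omega>)" if "\<omega> \<in> space M" for \<omega>
    proof -
      have "B (min u t) \<omega> + (B (max u t) \<omega> - B t \<omega>) = B u \<omega>" for u by (auto simp: min_def max_def)
      then show ?thesis using that J(2) unfolding J(1) \<phi>_def by (auto simp: indicator_def prod_zero_iff)
    qed
    have \<phi>_meas: "\<phi> \<in> borel_measurable (past t \<Otimes>\<^sub>M future t)"
      unfolding \<phi>_def case_prod_beta
    proof (rule borel_measurable_prod)
      fix u assume u: "u \<in> J"
      have "(\<lambda>z. B (min u t) (fst z)) \<in> borel_measurable (past t \<Otimes>\<^sub>M future t)"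
        by (rule measurable_compose[OF measurable_fst measurable_path_algebra]) (use u J(3) t in auto)
      moreover have "(\<lambda>z. B (max u t) (snd z) - B t (snd z)) \<in> borel_measurable (past t \<Otimes>\<^sub>M future t)"
        by (rule measurable_compose[OF measurable_snd measurable_path_algebra]) auto
      ultimately show "(\<lambda>z. indicator (U u) (B (min u t) (fst z) + (B (max u t) (snd z) - B t (snd z))) :: real)
          \<in> borel_measurable (past t \<Otimes>\<^sub>M future t)"
        by (intro measurable_compose[OF borel_measurable_add borel_measurable_indicator])
           (use J(4)[of u] in auto)
    qed
    define \<psi> where "\<psi> \<omega> = (\<integral>\<eta>. \<phi> (\<omega>, \<eta>) \<partial>M)" for \<omega>
    note avg = integral_future_average[OF t order_refl \<phi>_meas \<phi>01, folded \<psi>_def]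
    note \<psi>_past = avg(1) and diagonal = avg(4)
    have [measurable]: "\<psi> \<in> borel_measurable M" using measurable_from_subalg[OF subalg_past_M \<psi>_past] .
    have \<psi>b: "\<bar>\<psi> \<omega>\<bar> \<le> 1" for \<omega> using avg(2,3)[of \<omega>] by simp
    have ipf: "integrable M (\<lambda>\<omega>. \<psi> \<omega> * f \<omega>)"
    proof (rule integrable_const_bound[of _ "1 * b"])
      show "AE \<omega> in M. norm (\<psi> \<omega> * f \<omega>) \<le> 1 * b"
        using mult_mono[OF \<psi>b bd] by (intro AE_I2) (simp add: abs_mult)
    qed measurable
    have "(\<integral>\<omega>. indicator c \<omega> * f \<omega> \<partial>M) = (\<integral>\<omega>. f \<omega> * \<phi> (\<omega>, \<omega>) \<partial>M)"
      by (rule Bochner_Integration.integral_cong) (auto simp: diag)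
    also have "\<dots> = (\<integral>\<omega>. \<psi> \<omega> * f \<omega> \<partial>M)" using diagonal[OF f bd] by (simp add: mult.commute)
    also have "\<dots> = (\<integral>\<omega>. \<psi> \<omega> * ?e \<omega> \<partial>M)"
      by (rule P.real_cond_exp_intg(2)[symmetric, OF ipf \<psi>_past]) measurable
    also have "\<dots> = (\<integral>\<omega>. \<psi> \<omega> * e \<omega> \<partial>M)"
      by (rule integral_cong_AE) (use ee in auto)
    also have "\<dots> = (\<integral>\<omega>. e \<omega> * \<phi> (\<omega>, \<omega>) \<partial>M)"
      using diagonal[OF measurable_from_subalg[OF subalg_past[OF t] e_past] eb] by (simp add: mult.commute)
    also have "\<dots> = (\<integral>\<omega>. indicator c \<omega> * e \<omega> \<partial>M)"
      by (rule Bochner_Integration.integral_cong) (auto simp: diag)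
    finally show ?case .
  next
    case empty show ?case by simp
  next
    case (compl c)
    have c: "c \<in> events" using compl(1) subalg_whole sets_path_algebra_cylinders[of M B "{0..}"]
      unfolding subalgebra_def by auto
    have sp: "(\<integral>\<omega>. f \<omega> \<partial>M) = (\<integral>\<omega>. e \<omega> \<partial>M)"
      using P.real_cond_exp_int(2)[OF fi] integral_cong_AE[of ?e M e] ee by auto
    have "(\<integral>\<omega>. indicator (space M - c) \<omega> * g \<omega> \<partial>M) = (\<integral>\<omega>. g \<omega> \<partial>M) - (\<integral>\<omega>. indicator c \<omega> * g \<omega> \<partial>M)"
      if g: "integrable M g" for g :: "'a \<Rightarrow> real"
    proof -
      have "integrable M (\<lambda>\<omega>. indicator c \<omega> * g \<omega>)"
        using integrable_mult_indicator[OF c g] by simp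
      then have "(\<integral>\<omega>. g \<omega> \<partial>M) - (\<integral>\<omega>. indicator c \<omega> * g \<omega> \<partial>M) = (\<integral>\<omega>. g \<omega> - indicator c \<omega> * g \<omega> \<partial>M)"
        using g by simp
      also have "\<dots> = (\<integral>\<omega>. indicator (space M - c) \<omega> * g \<omega> \<partial>M)"
        by (rule Bochner_Integration.integral_cong) (auto split: split_indicator)
      finally show ?thesis by simp
    qed
    from this[OF fi] this[OF ei] show ?case using compl(2) sp by simp
  next
    case (union C)
    have C: "C i \<in> events" for i using union(2) subalg_whole sets_path_algebra_cylinders[of M B "{0..}"]
      unfolding subalgebra_def by blast
    have "(\<integral>\<omega>. indicator (\<Union>i. C i) \<omega> * g \<omega> \<partial>M) = (\<Sum>i. \<integral>\<omega>. indicator (C i) \<omega> * g \<omega> \<partial>M)"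
      if g: "integrable M g" for g :: "'a \<Rightarrow> real"
    proof -
      have "set_integrable M (\<Union>i. C i) g"
        unfolding set_integrable_def using C by (intro integrable_mult_indicator[OF _ g]) auto
      from lebesgue_integral_countable_add[OF C _ this] union(1) show ?thesis
        by (auto simp: disjoint_family_on_def set_lebesgue_integral_def)
    qed
    from this[OF fi] this[OF ei] show ?case using union(3) by simp
  qed
  show ?thesis
  proof (rule AE_mp[OF W.real_cond_exp_charact[where g=e]])
    show "(\<integral>x\<in>A. f x \<partial>M) = (\<integral>x\<in>A. e x \<partial>M)" if "A \<in> sets whole" for A
      using main[OF that] unfolding set_lebesgue_integral_def by simp
    show "e \<in> borel_measurable whole"
      by (rule measurable_from_subalg[OF subalg_past_whole e_past])
    show "AE x in M. real_cond_exp M whole f x = e x \<longrightarrow> real_cond_exp M whole f x = ?e x"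
      using ee by auto
  qed (use fi ei in auto)
qed

end

section \<open>Surprises of increasing processes in a Brownian filtration\<close>

definition dyadic :: "nat \<Rightarrow> nat \<Rightarrow> real" where
  "dyadic n k = real k / 2 ^ n"

lemma dyadic_nonneg [simp]: "0 \<le> dyadic n k" and dyadic_0 [simp]: "dyadic n 0 = 0"
  and dyadic_mono: "j \<le> k \<Longrightarrow> dyadic n j \<le> dyadic n k"
  and dyadic_Suc: "dyadic n (Suc k) = dyadic n k + 1 / 2 ^ n"
  and dyadic_horizon [simp]: "dyadic n (m * 2 ^ n) = real m"
  by (auto simp: dyadic_def divide_right_mono field_simps)

lemma dyadic_refine: "n \<le> m \<Longrightarrow> dyadic n k = dyadic m (k * 2 ^ (m - n))"
  using power_add[of "2::real" "m - n" n] by (simp add: dyadic_def field_simps)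

lemma dyadic_cell:
  assumes "0 \<le> t" obtains k where "dyadic n k \<le> t" "t < dyadic n (Suc k)"
proof
  define k where "k = nat \<lfloor>t * 2 ^ n\<rfloor>"
  have "real k = of_int \<lfloor>t * 2 ^ n\<rfloor>" unfolding k_def using assms by simp
  then have "real k \<le> t * 2 ^ n" "t * 2 ^ n < real k + 1" by linarith+
  then show "dyadic n k \<le> t" "t < dyadic n (Suc k)"
    by (auto simp: dyadic_def field_simps)
qed

lemma dyadic_le_iff [simp]: "dyadic n j \<le> dyadic n k \<longleftrightarrow> j \<le> k"
  and dyadic_less_iff [simp]: "dyadic n j < dyadic n k \<longleftrightarrow> j < k"
  by (auto simp: dyadic_def divide_le_cancel divide_less_cancel)

lemma dyadic_between:
  assumes "0 \<le> s" "s < t" obtains n k where "s < dyadic n k" "dyadic n k < t"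
proof -
  obtain n where n: "1 / 2 ^ n < t - s"
    using real_arch_pow_inv[of "t - s" "1/2"] assms by (auto simp: power_one_over)
  obtain k where k: "dyadic n k \<le> s" "s < dyadic n (Suc k)" by (rule dyadic_cell[OF assms(1)])
  have "dyadic n (Suc k) < t" using k n by (simp add: dyadic_Suc)
  with k that show ?thesis by blast
qed

text \<open>A weighted arithmetic-geometric mean bound, in place of the Cauchy-Schwarz inequality.\<close>

lemma abs_mult_le_weighted:
  fixes p q a :: real assumes "0 < a" shows "\<bar>p * q\<bar> \<le> a * p\<^sup>2 + q\<^sup>2 / a"
proof -
  have "0 \<le> (sqrt a * \<bar>p\<bar> - \<bar>q\<bar> / sqrt a)\<^sup>2" by simp
  also have "\<dots> = a * p\<^sup>2 + q\<^sup>2 / a - 2 * \<bar>p * q\<bar>"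
    using assms by (simp add: power2_diff power_mult_distrib power_divide abs_mult)
  finally show ?thesis by simp
qed

context prob_space
begin

lemma bounded_integrable:
  assumes "f \<in> borel_measurable M" "\<And>\<omega>. \<bar>f \<omega>\<bar> \<le> (b::real)" shows "integrable M f"
  by (rule integrable_const_bound[of _ b]) (use assms in auto)

end

text \<open>The interval \<open>[0, 1]\<close> is no restriction in the application, where an increasing process is first
  mapped into it by a bounded increasing function.\<close>

locale increasing_family = brownian_space M F B
  for M :: "'a measure" and F and B :: "real \<Rightarrow> 'a \<Rightarrow> real ^ 'd" +
  fixes y :: "real \<Rightarrow> 'a \<Rightarrow> real"
  assumes y_past: "0 \<le> t \<Longrightarrow> y t \<in> borel_measurable (past t)"
    and y0: "0 \<le> t \<Longrightarrow> 0 \<le> y t \<omega>" and y1: "0 \<le> t \<Longrightarrow> y t \<omega> \<le> 1"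
    and y_mono: "0 \<le> s \<Longrightarrow> s \<le> t \<Longrightarrow> y s \<omega> \<le> y t \<omega>"
begin

text \<open>The first step contains the initial value, so that the steps sum up to \<open>y\<close>.\<close>

definition step :: "nat \<Rightarrow> nat \<Rightarrow> 'a \<Rightarrow> real" where
  "step n k \<omega> = y (dyadic n (Suc k)) \<omega> - (if k = 0 then 0 else y (dyadic n k) \<omega>)"

text \<open>Clipping changes the conditional expectation only on a null set and makes the bounds hold
  everywhere.\<close>

definition predicted_step :: "nat \<Rightarrow> nat \<Rightarrow> 'a \<Rightarrow> real" where
  "predicted_step n k \<omega>
     = max 0 (min 1 (real_cond_exp M (past (dyadic n k)) (step n k) \<omega>))"

definition surprise :: "nat \<Rightarrow> nat \<Rightarrow> 'a \<Rightarrow> real" where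
  "surprise n k \<omega> = step n k \<omega> - predicted_step n k \<omega>"

text \<open>The martingale part of the discrete decomposition of \<open>y\<close> on the grid of mesh \<open>2\<^sup>-\<^sup>n\<close>, up to time \<open>n\<close>.\<close>

definition total_surprise :: "nat \<Rightarrow> 'a \<Rightarrow> real" where
  "total_surprise n \<omega> = (\<Sum>k<n * 2 ^ n. surprise n k \<omega>)"

lemma measurable_past_mono:
  "s \<le> t \<Longrightarrow> f \<in> measurable (past s) N \<Longrightarrow> f \<in> measurable (past t) N"
  using measurable_from_subalg[OF subalg_past_mono] by blast

lemma past_M: "f \<in> measurable (past t) N \<Longrightarrow> f \<in> measurable M N"
  using measurable_from_subalg[OF subalg_past_M] by blast

lemma step_past: "step n k \<in> borel_measurable (past (dyadic n (Suc k)))"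
proof -
  have "y (dyadic n k) \<in> borel_measurable (past (dyadic n (Suc k)))"
    by (rule measurable_past_mono[OF _ y_past]) (auto intro: dyadic_mono)
  then show ?thesis unfolding step_def[abs_def] using y_past[of "dyadic n (Suc k)"] by simp
qed

lemma step_01: "0 \<le> step n k \<omega>" "step n k \<omega> \<le> 1"
  using y_mono[of "dyadic n k" "dyadic n (Suc k)" \<omega>] y1[of "dyadic n (Suc k)" \<omega>] y0[of "dyadic n k" \<omega>]
    y0[of "dyadic n (Suc k)" \<omega>] by (auto simp: step_def)

lemma predicted_past: "predicted_step n k \<in> borel_measurable (past (dyadic n k))"
  unfolding predicted_step_def[abs_def]
  by (intro borel_measurable_max borel_measurable_min borel_measurable_cond_exp) auto

lemma predicted_01: "0 \<le> predicted_step n k \<omega>" "predicted_step n k \<omega> \<le> 1"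
  by (auto simp: predicted_step_def)

lemma surprise_past: "surprise n k \<in> borel_measurable (past (dyadic n (Suc k)))"
  unfolding surprise_def[abs_def]
  by (intro borel_measurable_diff step_past measurable_past_mono[OF _ predicted_past]) (auto intro: dyadic_mono)

lemma surprise_bound: "\<bar>surprise n k \<omega>\<bar> \<le> 1"
  using step_01[where n=n and k=k and \<omega>=\<omega>] predicted_01[of n k \<omega>] by (auto simp: surprise_def)

lemma M_measurable [measurable]:
  "step n k \<in> borel_measurable M" "predicted_step n k \<in> borel_measurable M"
  "surprise n k \<in> borel_measurable M" "total_surprise n \<in> borel_measurable M"
proof -
  show "step n k \<in> borel_measurable M" "predicted_step n k \<in> borel_measurable M"
    "surprise n k \<in> borel_measurable M" for n k
    by (rule past_M[OF step_past], rule past_M[OF predicted_past], rule past_M[OF surprise_past])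
  then show "total_surprise n \<in> borel_measurable M"
    unfolding total_surprise_def[abs_def] by (intro borel_measurable_sum) auto
qed

lemma sum_step: "(\<Sum>k<m. step n k \<omega>) = (if m = 0 then 0 else y (dyadic n m) \<omega>)"
  by (induction m) (auto simp: step_def)

lemma sum_surprise_bound: "\<bar>\<Sum>k<m. surprise n k \<omega>\<bar> \<le> real m"
proof -
  have "\<bar>\<Sum>k<m. surprise n k \<omega>\<bar> \<le> (\<Sum>k<m. \<bar>surprise n k \<omega>\<bar>)" by (rule sum_abs)
  also have "\<dots> \<le> (\<Sum>k<m. 1)" by (intro sum_mono surprise_bound)
  finally show ?thesis by simp
qed

lemma integral_predicted:
  assumes Z: "Z \<in> borel_measurable (past (dyadic n k))" and bd: "\<And>\<omega>. \<bar>Z \<omega>\<bar> \<le> b"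
  shows "(\<integral>\<omega>. Z \<omega> * predicted_step n k \<omega> \<partial>M) = (\<integral>\<omega>. Z \<omega> * step n k \<omega> \<partial>M)"
proof -
  interpret P: sigma_finite_subalgebra M "past (dyadic n k)"
    by (rule sigma_finite_subalgebraI[OF subalg_past_M])
  have [measurable]: "Z \<in> borel_measurable M" by (rule past_M[OF Z])
  have b: "0 \<le> b" using bd[of undefined] by linarith
  have i: "integrable M (\<lambda>\<omega>. Z \<omega> * step n k \<omega>)"
  proof (rule bounded_integrable[of _ "b * 1"])
    show "\<bar>Z \<omega> * step n k \<omega>\<bar> \<le> b * 1" for \<omega>
      unfolding abs_mult using bd[of \<omega>] step_01[where n=n and k=k and \<omega>=\<omega>] b by (intro mult_mono) auto
  qed measurable
  have ae: "AE \<omega> in M. predicted_step n k \<omega> = real_cond_exp M (past (dyadic n k)) (step n k) \<omega>"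
    using cond_exp_bounds[OF subalg_past_M M_measurable(1) step_01, of "dyadic n k" n k]
    by eventually_elim (auto simp: predicted_step_def)
  have "(\<integral>\<omega>. Z \<omega> * predicted_step n k \<omega> \<partial>M)
      = (\<integral>\<omega>. Z \<omega> * real_cond_exp M (past (dyadic n k)) (step n k) \<omega> \<partial>M)"
    by (rule integral_cong_AE) (use ae in auto)
  also have "\<dots> = (\<integral>\<omega>. Z \<omega> * step n k \<omega> \<partial>M)"
    by (rule P.real_cond_exp_intg(2)[OF i Z]) measurable
  finally show ?thesis .
qed

lemma bounded_mult_integrable:
  assumes "Z \<in> borel_measurable M" "X \<in> borel_measurable M" "\<And>\<omega>. \<bar>Z \<omega>\<bar> \<le> a" "\<And>\<omega>. \<bar>X \<omega>\<bar> \<le> (b::real)"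
  shows "integrable M (\<lambda>\<omega>. Z \<omega> * X \<omega>)"
proof (rule bounded_integrable[of _ "a * b"])
  have "0 \<le> a" using assms(3)[of undefined] by linarith
  then show "\<bar>Z \<omega> * X \<omega>\<bar> \<le> a * b" for \<omega>
    unfolding abs_mult using assms(3,4)[of \<omega>] by (intro mult_mono) auto
qed (use assms in measurable)

lemma integral_surprise_past:
  assumes Z: "Z \<in> borel_measurable (past (dyadic n k))" and bd: "\<And>\<omega>. \<bar>Z \<omega>\<bar> \<le> b"
  shows "(\<integral>\<omega>. Z \<omega> * surprise n k \<omega> \<partial>M) = 0"
proof -
  have [measurable]: "Z \<in> borel_measurable M" by (rule past_M[OF Z])
  have "(\<integral>\<omega>. Z \<omega> * surprise n k \<omega> \<partial>M)
    = (\<integral>\<omega>. Z \<omega> * step n k \<omega> - Z \<omega> * predicted_step n k \<omega> \<partial>M)"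
    by (simp add: surprise_def right_diff_distrib)
  also have "\<dots> = (\<integral>\<omega>. Z \<omega> * step n k \<omega> \<partial>M) - (\<integral>\<omega>. Z \<omega> * predicted_step n k \<omega> \<partial>M)"
    using step_01[where n=n and k=k] predicted_01[of n k]
    by (intro Bochner_Integration.integral_diff bounded_mult_integrable[of _ _ b 1]) (auto intro: bd)
  finally show ?thesis using integral_predicted[OF assms] by simp
qed

text \<open>The surprises are orthogonal, and the mean square of each is at most the mean of its step because
  steps and surprises are bounded by one; the steps sum up to at most one.\<close>

lemma total_surprise_L2: "(\<integral>\<omega>. (total_surprise n \<omega>)\<^sup>2 \<partial>M) \<le> 1"
proof -
  let ?S = "\<lambda>m \<omega>. \<Sum>k<m. surprise n k \<omega>"
  have S_past: "?S m \<in> borel_measurable (past (dyadic n m))" for m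
  proof (rule borel_measurable_sum)
    fix k assume "k \<in> {..<m}"
    then have "dyadic n (Suc k) \<le> dyadic n m" by simp
    then show "surprise n k \<in> borel_measurable (past (dyadic n m))"
      using surprise_past by (rule measurable_past_mono)
  qed
  note [measurable] = past_M[OF S_past]
  have sq: "(\<integral>\<omega>. (surprise n k \<omega>)\<^sup>2 \<partial>M) \<le> (\<integral>\<omega>. step n k \<omega> \<partial>M)" for k
  proof -
    have "(\<integral>\<omega>. predicted_step n k \<omega> * surprise n k \<omega> \<partial>M) = 0"
      using predicted_01 by (intro integral_surprise_past[OF predicted_past, of _ _ 1]) auto
    moreover have "integrable M (\<lambda>\<omega>. step n k \<omega> * surprise n k \<omega>)"
      "integrable M (\<lambda>\<omega>. predicted_step n k \<omega> * surprise n k \<omega>)"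
      using step_01[where n=n and k=k] predicted_01[of n k] surprise_bound
      by (intro bounded_mult_integrable[of _ _ 1 1]; auto)+
    ultimately have "(\<integral>\<omega>. (surprise n k \<omega>)\<^sup>2 \<partial>M) = (\<integral>\<omega>. step n k \<omega> * surprise n k \<omega> \<partial>M)"
      using Bochner_Integration.integral_diff[of M "\<lambda>\<omega>. step n k \<omega> * surprise n k \<omega>" "\<lambda>\<omega>. predicted_step n k \<omega> * surprise n k \<omega>"]
      by (simp add: power2_eq_square surprise_def left_diff_distrib)
    also have "\<dots> \<le> (\<integral>\<omega>. step n k \<omega> \<partial>M)"
    proof (rule integral_mono)
      show "integrable M (\<lambda>\<omega>. step n k \<omega> * surprise n k \<omega>)" by fact
      show "integrable M (step n k)"
        using step_01[where n=n and k=k] by (intro bounded_integrable[of _ 1]) auto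
      show "step n k \<omega> * surprise n k \<omega> \<le> step n k \<omega>" for \<omega>
        using surprise_bound[of n k \<omega>] step_01[where n=n and k=k and \<omega>=\<omega>]
        by (intro mult_left_le) (auto simp: abs_le_iff)
    qed
    finally show ?thesis .
  qed
  have "(\<integral>\<omega>. (?S m \<omega>)\<^sup>2 \<partial>M) \<le> (\<integral>\<omega>. (\<Sum>k<m. step n k \<omega>) \<partial>M)" for m
  proof (induction m)
    case (Suc m)
    have i: "integrable M (\<lambda>\<omega>. (?S m \<omega>)\<^sup>2)" "integrable M (\<lambda>\<omega>. ?S m \<omega> * surprise n m \<omega>)"
      "integrable M (\<lambda>\<omega>. (surprise n m \<omega>)\<^sup>2)"
      unfolding power2_eq_square
      by (intro bounded_mult_integrable[of _ _ "real m" "real m"] bounded_mult_integrable[of _ _ "real m" 1]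
          bounded_mult_integrable[of _ _ 1 1] sum_surprise_bound surprise_bound; measurable)+
    have j: "integrable M (step n k)" for k
      using step_01[where n=n and k=k] by (intro bounded_integrable[of _ 1]) auto
    have "(\<integral>\<omega>. (?S (Suc m) \<omega>)\<^sup>2 \<partial>M)
      = (\<integral>\<omega>. (?S m \<omega>)\<^sup>2 + 2 * (?S m \<omega> * surprise n m \<omega>) + (surprise n m \<omega>)\<^sup>2 \<partial>M)"
      by (simp add: power2_sum algebra_simps)
    also have "\<dots> = (\<integral>\<omega>. (?S m \<omega>)\<^sup>2 \<partial>M) + 2 * (\<integral>\<omega>. ?S m \<omega> * surprise n m \<omega> \<partial>M) + (\<integral>\<omega>. (surprise n m \<omega>)\<^sup>2 \<partial>M)"
      using i by simp
    also have "(\<integral>\<omega>. ?S m \<omega> * surprise n m \<omega> \<partial>M) = 0"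
      by (rule integral_surprise_past[OF S_past sum_surprise_bound])
    finally show ?case using Suc sq[of m] j by simp
  qed simp
  from this[of "n * 2 ^ n"] have "(\<integral>\<omega>. (total_surprise n \<omega>)\<^sup>2 \<partial>M) \<le> (\<integral>\<omega>. (\<Sum>k<n * 2 ^ n. step n k \<omega>) \<partial>M)"
    unfolding total_surprise_def .
  also have "\<dots> \<le> (LINT \<omega>|M. 1)"
    by (rule integral_mono') (use y1 in \<open>auto simp: sum_step\<close>)
  finally show ?thesis by (simp add: prob_space)
qed

lemma total_surprise_bound: "\<bar>total_surprise n \<omega>\<bar> \<le> real (n * 2 ^ n)"
  unfolding total_surprise_def by (rule sum_surprise_bound)

lemma total_surprise_sq_integrable: "integrable M (\<lambda>\<omega>. (total_surprise n \<omega>)\<^sup>2)"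
  unfolding power2_eq_square
  by (rule bounded_mult_integrable[OF _ _ total_surprise_bound total_surprise_bound]) auto

lemma total_surprise_whole: "total_surprise n \<in> borel_measurable whole"
  unfolding total_surprise_def[abs_def]
  by (intro borel_measurable_sum measurable_from_subalg[OF subalg_past_whole surprise_past])

section \<open>Surprises vanish weakly\<close>

definition asymptotically_orthogonal :: "('a \<Rightarrow> real) \<Rightarrow> bool" where
  "asymptotically_orthogonal Z \<longleftrightarrow> (\<lambda>n. \<integral>\<omega>. Z \<omega> * total_surprise n \<omega> \<partial>M) \<longlonglongrightarrow> 0"

text \<open>By the bound in mean square, a small test function has a small integral against all total surprises
  at once.\<close>

lemma integral_mult_surprise_le:
  assumes [measurable]: "Z \<in> borel_measurable M" and bd: "\<And>\<omega>. \<bar>Z \<omega>\<bar> \<le> b" and a: "0 < a"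
  shows "(\<integral>\<omega>. \<bar>Z \<omega> * total_surprise n \<omega>\<bar> \<partial>M) \<le> a * (\<integral>\<omega>. (Z \<omega>)\<^sup>2 \<partial>M) + 1 / a"
proof -
  have i: "integrable M (\<lambda>\<omega>. (Z \<omega>)\<^sup>2)"
    unfolding power2_eq_square by (rule bounded_mult_integrable[OF _ _ bd bd]) auto
  have "(\<integral>\<omega>. \<bar>Z \<omega> * total_surprise n \<omega>\<bar> \<partial>M) \<le> (\<integral>\<omega>. a * (Z \<omega>)\<^sup>2 + (total_surprise n \<omega>)\<^sup>2 / a \<partial>M)"
    by (rule integral_mono[OF integrable_abs[OF bounded_mult_integrable[OF _ _ bd total_surprise_bound]]])
       (use i total_surprise_sq_integrable[of n] abs_mult_le_weighted[OF a] in auto)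
  also have "\<dots> = a * (\<integral>\<omega>. (Z \<omega>)\<^sup>2 \<partial>M) + (\<integral>\<omega>. (total_surprise n \<omega>)\<^sup>2 \<partial>M) / a"
    using i total_surprise_sq_integrable[of n] by simp
  finally show ?thesis using total_surprise_L2[of n] a by (auto simp: divide_right_mono elim!: order_trans)
qed

lemma asymptotically_orthogonal_closed:
  assumes Zn: "\<And>m. asymptotically_orthogonal (Z' m)" and meas: "\<And>m. Z' m \<in> borel_measurable M"
    and bd': "\<And>m \<omega>. \<bar>Z' m \<omega>\<bar> \<le> b"
    and Z: "Z \<in> borel_measurable M" and bd: "\<And>\<omega>. \<bar>Z \<omega>\<bar> \<le> b"
    and lim: "AE \<omega> in M. (\<lambda>m. Z' m \<omega>) \<longlonglongrightarrow> Z \<omega>"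
  shows "asymptotically_orthogonal Z"
  unfolding asymptotically_orthogonal_def
proof (rule LIMSEQ_I)
  fix e :: real assume e: "0 < e"
  note [measurable] = meas Z
  have bb: "\<bar>Z \<omega> - Z' m \<omega>\<bar> \<le> 2 * b" for m \<omega> using bd[of \<omega>] bd'[of m \<omega>] by linarith
  have "(\<lambda>m. \<integral>\<omega>. (Z \<omega> - Z' m \<omega>)\<^sup>2 \<partial>M) \<longlonglongrightarrow> (\<integral>\<omega>. 0 \<partial>M)"
  proof (rule integral_dominated_convergence[where w="\<lambda>_. (2 * b)\<^sup>2"])
    show "AE \<omega> in M. (\<lambda>m. (Z \<omega> - Z' m \<omega>)\<^sup>2) \<longlonglongrightarrow> 0"
      using lim
    proof eventually_elim
      case (elim \<omega>)
      have "(\<lambda>m. (Z \<omega> - Z' m \<omega>)\<^sup>2) \<longlonglongrightarrow> (Z \<omega> - Z \<omega>)\<^sup>2" by (intro tendsto_intros elim)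
      then show ?case by simp
    qed
    show "AE \<omega> in M. norm ((Z \<omega> - Z' m \<omega>)\<^sup>2) \<le> (2 * b)\<^sup>2" for m
      using power_mono[OF bb[of _ m], where n=2] by (intro AE_I2) simp
  qed auto
  then have lim2: "(\<lambda>m. \<integral>\<omega>. (Z \<omega> - Z' m \<omega>)\<^sup>2 \<partial>M) \<longlonglongrightarrow> 0" by simp
  define a where "a = 4 / e"
  have a: "0 < a" using e by (simp add: a_def)
  obtain m where m: "(\<integral>\<omega>. (Z \<omega> - Z' m \<omega>)\<^sup>2 \<partial>M) < e / (4 * a)"
    using LIMSEQ_D[OF lim2, of "e / (4 * a)"] a e by (auto simp: abs_less_iff)
  obtain N where N: "\<And>n. n \<ge> N \<Longrightarrow> \<bar>\<integral>\<omega>. Z' m \<omega> * total_surprise n \<omega> \<partial>M\<bar> < e / 4"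
    using LIMSEQ_D[OF Zn[of m, unfolded asymptotically_orthogonal_def], of "e / 4"] e by auto
  have "\<bar>\<integral>\<omega>. Z \<omega> * total_surprise n \<omega> \<partial>M\<bar> < e" if n: "n \<ge> N" for n
  proof -
    have i: "integrable M (\<lambda>\<omega>. Z' m \<omega> * total_surprise n \<omega>)" "integrable M (\<lambda>\<omega>. (Z \<omega> - Z' m \<omega>) * total_surprise n \<omega>)"
      using bd' bb by (intro bounded_mult_integrable[OF _ _ _ total_surprise_bound]; auto)+
    have "(\<integral>\<omega>. Z \<omega> * total_surprise n \<omega> \<partial>M)
      = (\<integral>\<omega>. Z' m \<omega> * total_surprise n \<omega> + (Z \<omega> - Z' m \<omega>) * total_surprise n \<omega> \<partial>M)"
      by (simp add: algebra_simps)
    also have "\<dots> = (\<integral>\<omega>. Z' m \<omega> * total_surprise n \<omega> \<partial>M) + (\<integral>\<omega>. (Z \<omega> - Z' m \<omega>) * total_surprise n \<omega> \<partial>M)"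
      by (rule Bochner_Integration.integral_add[OF i])
    finally have "\<bar>\<integral>\<omega>. Z \<omega> * total_surprise n \<omega> \<partial>M\<bar>
      \<le> \<bar>\<integral>\<omega>. Z' m \<omega> * total_surprise n \<omega> \<partial>M\<bar> + \<bar>\<integral>\<omega>. (Z \<omega> - Z' m \<omega>) * total_surprise n \<omega> \<partial>M\<bar>" by simp
    also have "\<bar>\<integral>\<omega>. (Z \<omega> - Z' m \<omega>) * total_surprise n \<omega> \<partial>M\<bar>
      \<le> (\<integral>\<omega>. \<bar>(Z \<omega> - Z' m \<omega>) * total_surprise n \<omega>\<bar> \<partial>M)" by (rule integral_abs_bound)
    also have "\<dots> \<le> a * (\<integral>\<omega>. (Z \<omega> - Z' m \<omega>)\<^sup>2 \<partial>M) + 1 / a"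
      by (rule integral_mult_surprise_le[OF _ bb a]) measurable
    also have "a * (\<integral>\<omega>. (Z \<omega> - Z' m \<omega>)\<^sup>2 \<partial>M) < e / 4"
      using m a by (simp add: field_simps)
    also have "1 / a = e / 4" by (simp add: a_def)
    finally show ?thesis using N[OF n] e by linarith
  qed
  then show "\<exists>N. \<forall>n\<ge>N. norm ((\<integral>\<omega>. Z \<omega> * total_surprise n \<omega> \<partial>M) - 0) < e" by auto
qed

lemma asymptotically_orthogonal_sum:
  assumes "\<And>i. i \<in> I \<Longrightarrow> asymptotically_orthogonal (Z i)" "\<And>i. i \<in> I \<Longrightarrow> Z i \<in> borel_measurable M"
    "\<And>i \<omega>. i \<in> I \<Longrightarrow> \<bar>Z i \<omega>\<bar> \<le> b"
  shows "asymptotically_orthogonal (\<lambda>\<omega>. \<Sum>i\<in>I. c i * Z i \<omega>)"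
proof -
  have "(\<integral>\<omega>. (\<Sum>i\<in>I. c i * Z i \<omega>) * total_surprise n \<omega> \<partial>M)
    = (\<Sum>i\<in>I. c i * (\<integral>\<omega>. Z i \<omega> * total_surprise n \<omega> \<partial>M))" for n
  proof -
    have "(\<integral>\<omega>. (\<Sum>i\<in>I. c i * Z i \<omega>) * total_surprise n \<omega> \<partial>M)
      = (\<integral>\<omega>. (\<Sum>i\<in>I. c i * (Z i \<omega> * total_surprise n \<omega>)) \<partial>M)"
      by (simp add: sum_distrib_right mult.assoc)
    also have "\<dots> = (\<Sum>i\<in>I. \<integral>\<omega>. c i * (Z i \<omega> * total_surprise n \<omega>) \<partial>M)"
      using assms
      by (intro Bochner_Integration.integral_sum integrable_mult_right bounded_mult_integrable[OF _ _ _ total_surprise_bound]) auto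
    finally show ?thesis by simp
  qed
  moreover have "(\<lambda>n. \<Sum>i\<in>I. c i * (\<integral>\<omega>. Z i \<omega> * total_surprise n \<omega> \<partial>M)) \<longlonglongrightarrow> (\<Sum>i\<in>I. c i * 0)"
    using assms(1) by (intro tendsto_intros) (auto simp: asymptotically_orthogonal_def)
  ultimately show ?thesis unfolding asymptotically_orthogonal_def by simp
qed

end

context brownian_space
begin

lemma AE_B_continuous: "AE \<omega> in M. continuous_on {0..} (\<lambda>t. B t \<omega>)"
  using brownian unfolding brownian_motion_def by simp

end

context increasing_family
begin

text \<open>Delete from the path of \<open>B\<close> its movement during the \<open>k\<close>-th cell. The functional then depends on the past
  of the cell and on the increments after it, so it is orthogonal to the \<open>k\<close>-th surprise. By uniform
  continuity the deletion changes the functional by at most \<open>w n\<close>, which tends to zero and does not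
  depend on \<open>k\<close>. The total error is at most \<open>w n\<close> times the sum of the absolute surprises, and this sum
  is at most twice the sum of the steps minus the total surprise.\<close>

lemma asymptotically_orthogonal_lipschitz:
  fixes f :: "real \<Rightarrow> real ^ 'd \<Rightarrow> real"
  assumes J: "finite J" "J \<subseteq> {0..}"
    and f01: "\<And>u z. 0 \<le> f u z" "\<And>u z. f u z \<le> 1"
    and lip: "\<And>u z z'. \<bar>f u z - f u z'\<bar> \<le> \<Lambda> * norm (z - z')" and \<Lambda>: "0 \<le> \<Lambda>"
  shows "asymptotically_orthogonal (\<lambda>\<omega>. \<Prod>u\<in>J. f u (B u \<omega>))"
proof -
  define Z where "Z \<omega> = (\<Prod>u\<in>J. f u (B u \<omega>))" for \<omega>
  \<comment> \<open>The functional of the path with the \<open>k\<close>-th cell deleted.\<close>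
  define \<phi> where "\<phi> n k = (\<lambda>(\<omega>, \<eta>). \<Prod>u\<in>J. f u (B (min u (dyadic n k)) \<omega>
      + (B (max u (dyadic n (Suc k))) \<eta> - B (dyadic n (Suc k)) \<eta>)))" for n k
  define w where "w n \<omega> = Max ((\<lambda>k. \<bar>Z \<omega> - \<phi> n k (\<omega>, \<omega>)\<bar>) ` {..n * 2 ^ n})" for n \<omega>
  have f_cont: "continuous_on UNIV (f u)" for u
  proof (rule continuous_onI)
    fix x :: "real ^ 'd" and e :: real assume e: "0 < e"
    have "dist (f u x') (f u x) \<le> e" if "dist x' x < e / (\<Lambda> + 1)" for x'
    proof -
      have "\<bar>f u x' - f u x\<bar> \<le> \<Lambda> * dist x' x" using lip[of u x' x] by (simp add: dist_norm)
      also have "\<dots> \<le> \<Lambda> * (e / (\<Lambda> + 1))" using that \<Lambda> by (intro mult_left_mono) auto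
      also have "\<dots> \<le> e" using \<Lambda> e by (simp add: field_simps)
      finally show ?thesis by (simp add: dist_real_def)
    qed
    then show "\<exists>d>0. \<forall>x'\<in>UNIV. dist x' x < d \<longrightarrow> dist (f u x') (f u x) \<le> e"
      using e \<Lambda> by (intro exI[of _ "e / (\<Lambda> + 1)"]) auto
  qed
  have f_meas: "f u \<in> borel_measurable borel" for u
    by (rule borel_measurable_continuous_onI[OF f_cont])
  have Z_meas[measurable]: "Z \<in> borel_measurable M"
    unfolding Z_def using J(2)
    by (intro borel_measurable_prod measurable_compose[OF B_measurable f_meas]) auto
  have prod01: "0 \<le> (\<Prod>u\<in>J. f u (g u))" "(\<Prod>u\<in>J. f u (g u)) \<le> 1" for g
    using f01 by (auto intro!: prod_nonneg prod_le_1)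
  have Z01: "0 \<le> Z \<omega>" "Z \<omega> \<le> 1" for \<omega> unfolding Z_def by (rule prod01)+
  have \<phi>01: "0 \<le> \<phi> n k z" "\<phi> n k z \<le> 1" for n k z
    unfolding \<phi>_def case_prod_beta by (rule prod01)+
  have \<phi>_meas: "\<phi> n k \<in> borel_measurable (past (dyadic n k) \<Otimes>\<^sub>M future (dyadic n (Suc k)))" for n k
    unfolding \<phi>_def case_prod_beta
  proof (rule borel_measurable_prod)
    let ?s = "dyadic n k" and ?t = "dyadic n (Suc k)"
    fix u assume u: "u \<in> J"
    have "(\<lambda>z. B (min u ?s) (fst z)) \<in> borel_measurable (past ?s \<Otimes>\<^sub>M future ?t)"
      by (rule measurable_compose[OF measurable_fst measurable_path_algebra]) (use u J(2) in auto)
    moreover have "(\<lambda>z. B (max u ?t) (snd z) - B ?t (snd z)) \<in> borel_measurable (past ?s \<Otimes>\<^sub>M future ?t)"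
      by (rule measurable_compose[OF measurable_snd measurable_path_algebra]) auto
    ultimately show "(\<lambda>z. f u (B (min u ?s) (fst z) + (B (max u ?t) (snd z) - B ?t (snd z))))
        \<in> borel_measurable (past ?s \<Otimes>\<^sub>M future ?t)"
      by (intro measurable_compose[OF borel_measurable_add f_meas])
  qed
  have diag_meas[measurable]: "(\<lambda>\<omega>. \<phi> n k (\<omega>, \<omega>)) \<in> borel_measurable M" for n k
    unfolding \<phi>_def split_conv using J(2)
    by (intro borel_measurable_prod measurable_compose[OF _ f_meas] borel_measurable_add
        borel_measurable_diff B_measurable) auto
  have w_meas[measurable]: "w n \<in> borel_measurable M" for n
    unfolding w_def[abs_def] by (rule borel_measurable_Max) auto
  have diff_le_w: "\<bar>Z \<omega> - \<phi> n k (\<omega>, \<omega>)\<bar> \<le> w n \<omega>" if "k \<le> n * 2 ^ n" for n k \<omega>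
    unfolding w_def using that by (intro Max_ge) auto
  have w01: "0 \<le> w n \<omega>" "w n \<omega> \<le> 1" for n \<omega>
  proof -
    show "0 \<le> w n \<omega>" using diff_le_w[of 0 n \<omega>] by simp
    show "w n \<omega> \<le> 1" unfolding w_def
      using Z01[of \<omega>] \<phi>01[of n _ "(\<omega>, \<omega>)"] by (intro Max.boundedI) (auto simp: abs_le_iff, (smt (verit))+)
  qed
  have w_lim: "AE \<omega> in M. (\<lambda>n. w n \<omega>) \<longlonglongrightarrow> 0"
    using AE_B_continuous
  proof eventually_elim
    case (elim \<omega>)
    define T where "T = Max (insert 0 J)"
    have T: "0 \<le> T" "\<And>u. u \<in> J \<Longrightarrow> u \<le> T" unfolding T_def using J by auto
    have "uniformly_continuous_on {0..T} (\<lambda>t. B t \<omega>)"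
      by (intro compact_uniformly_continuous continuous_on_subset[OF elim]) auto
    note unif = this[unfolded uniformly_continuous_on_def, rule_format]
    show ?case
    proof (rule LIMSEQ_I)
      fix e :: real assume e: "0 < e"
      define e' where "e' = e / (2 * (real (card J) * \<Lambda> + 1))"
      have den: "0 < real (card J) * \<Lambda> + 1" using \<Lambda> by (simp add: add_nonneg_pos)
      have e': "0 < e'" using e den by (simp add: e'_def)
      obtain \<delta> where \<delta>: "0 < \<delta>" "\<And>a b. a \<in> {0..T} \<Longrightarrow> b \<in> {0..T} \<Longrightarrow> dist b a < \<delta> \<Longrightarrow> dist (B b \<omega>) (B a \<omega>) < e'"
        using unif[OF e'] by metis
      obtain N where N: "1 / 2 ^ N < \<delta>"
        using real_arch_pow_inv[of \<delta> "1/2"] \<delta>(1) by (auto simp: power_one_over)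
      have "w n \<omega> < e" if n: "n \<ge> N" for n
      proof -
        have "(1::real) / 2 ^ n \<le> 1 / 2 ^ N" using n by (intro divide_left_mono power_increasing) auto
        then have step: "1 / 2 ^ n < \<delta>" using N by linarith
        have "\<bar>Z \<omega> - \<phi> n k (\<omega>, \<omega>)\<bar> \<le> real (card J) * (\<Lambda> * e')" for k
        proof -
          let ?s = "dyadic n k" and ?t = "dyadic n (Suc k)"
          let ?b = "\<lambda>u. B (min u ?s) \<omega> + (B (max u ?t) \<omega> - B ?t \<omega>)"
          have "\<bar>Z \<omega> - \<phi> n k (\<omega>, \<omega>)\<bar> \<le> (\<Sum>u\<in>J. \<bar>f u (B u \<omega>) - f u (?b u)\<bar>)"
            unfolding Z_def \<phi>_def split_conv
            using norm_prod_diff[of J "\<lambda>u. f u (B u \<omega>)" "\<lambda>u. f u (?b u)"] f01 by auto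
          also have "\<dots> \<le> (\<Sum>u\<in>J. \<Lambda> * e')"
          proof (rule sum_mono)
            fix u assume u: "u \<in> J"
            then have u': "0 \<le> u" "u \<le> T" using J(2) T(2) by auto
            have st: "0 \<le> ?s" "?s < ?t" "?t - ?s < \<delta>" using step by (auto simp: dyadic_Suc)
            have "norm (B u \<omega> - ?b u) \<le> e'"
            proof -
              consider "u \<le> ?s" | "?s < u" "u < ?t" | "?t \<le> u" by linarith
              then show ?thesis
              proof cases
                case 1
                then have "min u ?s = u" "max u ?t = ?t" using st(2) by linarith+
                then show ?thesis using e' by simp
              next
                case 2
                have "u \<in> {0..T}" "?s \<in> {0..T}" "dist u ?s < \<delta>"
                  using 2 u' st(3) by (simp_all add: dist_real_def)
                then have "dist (B u \<omega>) (B ?s \<omega>) < e'" by (intro \<delta>(2))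
                then show ?thesis using 2 by (simp add: min_absorb2 max_absorb2 dist_norm)
              next
                case 3
                have "?t \<in> {0..T}" "?s \<in> {0..T}" "dist ?t ?s < \<delta>"
                  using 3 u' st(2,3) order_trans[OF less_imp_le[OF st(2)] order_trans[OF 3 u'(2)]]
                  by (simp_all add: dist_real_def)
                then have "dist (B ?t \<omega>) (B ?s \<omega>) < e'" by (intro \<delta>(2))
                moreover have "min u ?s = ?s" "max u ?t = u" using 3 st(2) by linarith+
                ultimately show ?thesis by (simp add: dist_norm algebra_simps)
              qed
            qed
            then show "\<bar>f u (B u \<omega>) - f u (?b u)\<bar> \<le> \<Lambda> * e'"
              using lip[of u "B u \<omega>" "?b u"] \<Lambda> by (smt (verit) mult_left_mono)
          qed
          finally show ?thesis by simp
        qed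
        then have "w n \<omega> \<le> real (card J) * (\<Lambda> * e')" unfolding w_def by (intro Max.boundedI) auto
        also have "\<dots> < (real (card J) * \<Lambda> + 1) * e'" using e' by (simp add: algebra_simps)
        also have "\<dots> = e / 2"
        proof -
          have "q * (e / (2 * q)) = e / 2" if "0 < q" for q :: real using that by simp
          from this[OF den] show ?thesis unfolding e'_def .
        qed
        finally show ?thesis using e by simp
      qed
      then show "\<exists>no. \<forall>n\<ge>no. norm (w n \<omega> - 0) < e" using w01 by (auto simp: abs_of_nonneg)
    qed
  qed
  have "(\<lambda>n. \<integral>\<omega>. w n \<omega> \<partial>M) \<longlonglongrightarrow> (\<integral>\<omega>. 0 \<partial>M)"
    by (rule integral_dominated_convergence[where w="\<lambda>_. 1"]) (use w_lim w01 in auto)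
  then have Ew: "(\<lambda>n. \<integral>\<omega>. w n \<omega> \<partial>M) \<longlonglongrightarrow> 0" by simp
  have main: "\<bar>\<integral>\<omega>. Z \<omega> * total_surprise n \<omega> \<partial>M\<bar> \<le> (2 + a) * (\<integral>\<omega>. w n \<omega> \<partial>M) + 1 / a" if a: "0 < a" for a n
  proof -
    have zero: "(\<integral>\<omega>. \<phi> n k (\<omega>, \<omega>) * surprise n k \<omega> \<partial>M) = 0" for k
    proof -
      note avg = integral_future_average[OF dyadic_nonneg dyadic_mono[OF le_SucI[OF order_refl]] \<phi>_meas \<phi>01]
      have "(\<integral>\<omega>. surprise n k \<omega> * \<phi> n k (\<omega>, \<omega>) \<partial>M) = (\<integral>\<omega>. surprise n k \<omega> * (\<integral>\<eta>. \<phi> n k (\<omega>, \<eta>) \<partial>M) \<partial>M)"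
        by (rule avg(4)[OF measurable_from_subalg[OF subalg_past surprise_past] surprise_bound]) simp
      also have "\<dots> = (\<integral>\<omega>. (\<integral>\<eta>. \<phi> n k (\<omega>, \<eta>) \<partial>M) * surprise n k \<omega> \<partial>M)" by (simp add: mult.commute)
      also have "\<dots> = 0"
      proof (rule integral_surprise_past[OF avg(1)])
        show "\<bar>\<integral>\<eta>. \<phi> n k (\<omega>, \<eta>) \<partial>M\<bar> \<le> 1" for \<omega>
          using avg(2,3)[of n k \<omega>] by (simp add: abs_le_iff)
      qed
      finally show ?thesis by (simp add: mult.commute)
    qed
    let ?D = "\<lambda>k \<omega>. (Z \<omega> - \<phi> n k (\<omega>, \<omega>)) * surprise n k \<omega>"
    have b1: "\<bar>Z \<omega> - \<phi> n k (\<omega>, \<omega>)\<bar> \<le> 1" for k \<omega>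
      using Z01[of \<omega>] \<phi>01[of n k "(\<omega>, \<omega>)"] by (simp add: abs_le_iff)
    have iD: "integrable M (?D k)" for k
      by (rule bounded_mult_integrable[OF _ _ b1 surprise_bound]) auto
    have iZ: "integrable M (\<lambda>\<omega>. Z \<omega> * surprise n k \<omega>)" "integrable M (\<lambda>\<omega>. \<phi> n k (\<omega>, \<omega>) * surprise n k \<omega>)" for k
      using Z01 \<phi>01 by (intro bounded_mult_integrable[OF _ _ _ surprise_bound, where a=1]; auto)+
    have iw: "integrable M (w n)" "integrable M (\<lambda>\<omega>. \<bar>w n \<omega> * total_surprise n \<omega>\<bar>)"
    proof -
      have "\<bar>w n \<omega>\<bar> \<le> 1" for \<omega> using w01[of n \<omega>] by simp
      from bounded_integrable[OF w_meas this]
        integrable_abs[OF bounded_mult_integrable[OF w_meas M_measurable(4) this total_surprise_bound]]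
      show "integrable M (w n)" "integrable M (\<lambda>\<omega>. \<bar>w n \<omega> * total_surprise n \<omega>\<bar>)" .
    qed
    have "(\<integral>\<omega>. Z \<omega> * total_surprise n \<omega> \<partial>M) = (\<Sum>k<n * 2 ^ n. \<integral>\<omega>. Z \<omega> * surprise n k \<omega> \<partial>M)"
      unfolding total_surprise_def sum_distrib_left
      by (rule Bochner_Integration.integral_sum) (use iZ in auto)
    also have "\<dots> = (\<Sum>k<n * 2 ^ n. \<integral>\<omega>. ?D k \<omega> \<partial>M)"
      by (rule sum.cong) (use zero iZ in \<open>auto simp: left_diff_distrib\<close>)
    also have "\<dots> = (\<integral>\<omega>. (\<Sum>k<n * 2 ^ n. ?D k \<omega>) \<partial>M)"
      by (rule Bochner_Integration.integral_sum[symmetric]) (use iD in auto)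
    finally have "\<bar>\<integral>\<omega>. Z \<omega> * total_surprise n \<omega> \<partial>M\<bar> = \<bar>\<integral>\<omega>. (\<Sum>k<n * 2 ^ n. ?D k \<omega>) \<partial>M\<bar>" by simp
    also have "\<dots> \<le> (\<integral>\<omega>. \<bar>\<Sum>k<n * 2 ^ n. ?D k \<omega>\<bar> \<partial>M)" by (rule integral_abs_bound)
    also have "\<dots> \<le> (\<integral>\<omega>. 2 * w n \<omega> + \<bar>w n \<omega> * total_surprise n \<omega>\<bar> \<partial>M)"
    proof (rule integral_mono)
      show "integrable M (\<lambda>\<omega>. \<bar>\<Sum>k<n * 2 ^ n. ?D k \<omega>\<bar>)" using iD by auto
      show "integrable M (\<lambda>\<omega>. 2 * w n \<omega> + \<bar>w n \<omega> * total_surprise n \<omega>\<bar>)"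
        using iw by simp
      fix \<omega>
      have "\<bar>\<Sum>k<n * 2 ^ n. ?D k \<omega>\<bar> \<le> (\<Sum>k<n * 2 ^ n. \<bar>?D k \<omega>\<bar>)" by (rule sum_abs)
      also have "\<dots> \<le> (\<Sum>k<n * 2 ^ n. w n \<omega> * (2 * step n k \<omega> - surprise n k \<omega>))"
      proof (rule sum_mono)
        fix k assume "k \<in> {..<n * 2 ^ n}"
        then show "\<bar>?D k \<omega>\<bar> \<le> w n \<omega> * (2 * step n k \<omega> - surprise n k \<omega>)"
          unfolding abs_mult using diff_le_w[of k n \<omega>] w01[of n \<omega>] step_01[where n=n and k=k and \<omega>=\<omega>] predicted_01[of n k \<omega>]
          by (intro mult_mono) (auto simp: surprise_def)
      qed
      also have "\<dots> = w n \<omega> * (2 * (\<Sum>k<n * 2 ^ n. step n k \<omega>) - total_surprise n \<omega>)"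
        by (simp add: total_surprise_def sum_distrib_left[symmetric] sum_subtractf)
      also have "\<dots> = 2 * (w n \<omega> * (\<Sum>k<n * 2 ^ n. step n k \<omega>)) - w n \<omega> * total_surprise n \<omega>"
        by (simp add: algebra_simps)
      also have "\<dots> \<le> 2 * w n \<omega> + \<bar>w n \<omega> * total_surprise n \<omega>\<bar>"
      proof -
        have "w n \<omega> * (\<Sum>k<n * 2 ^ n. step n k \<omega>) \<le> w n \<omega> * 1"
          using w01[of n \<omega>] y1 by (intro mult_left_mono) (auto simp: sum_step)
        then show ?thesis by linarith
      qed
      finally show "\<bar>\<Sum>k<n * 2 ^ n. ?D k \<omega>\<bar> \<le> 2 * w n \<omega> + \<bar>w n \<omega> * total_surprise n \<omega>\<bar>" .
    qed
    also have "\<dots> = 2 * (\<integral>\<omega>. w n \<omega> \<partial>M) + (\<integral>\<omega>. \<bar>w n \<omega> * total_surprise n \<omega>\<bar> \<partial>M)"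
      using iw by simp
    also have "(\<integral>\<omega>. \<bar>w n \<omega> * total_surprise n \<omega>\<bar> \<partial>M) \<le> a * (\<integral>\<omega>. (w n \<omega>)\<^sup>2 \<partial>M) + 1 / a"
      using w01 by (intro integral_mult_surprise_le[where b=1] a) auto
    also have "(\<integral>\<omega>. (w n \<omega>)\<^sup>2 \<partial>M) \<le> (\<integral>\<omega>. w n \<omega> \<partial>M)"
      using w01 by (intro integral_mono bounded_integrable[where b=1])
        (auto simp: power2_eq_square abs_mult intro: mult_le_one mult_left_le)
    finally show ?thesis using a by (simp add: algebra_simps mult_left_mono)
  qed
  have "(\<lambda>n. \<integral>\<omega>. Z \<omega> * total_surprise n \<omega> \<partial>M) \<longlonglongrightarrow> 0"
  proof (rule LIMSEQ_I)
    fix e :: real assume e: "0 < e"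
    define a where "a = 2 / e"
    have a: "0 < a" using e by (simp add: a_def)
    obtain N where N: "\<And>n. n \<ge> N \<Longrightarrow> \<bar>\<integral>\<omega>. w n \<omega> \<partial>M\<bar> < e / (2 * (2 + a))"
      using LIMSEQ_D[OF Ew, of "e / (2 * (2 + a))"] a e by auto
    have "\<bar>\<integral>\<omega>. Z \<omega> * total_surprise n \<omega> \<partial>M\<bar> < e" if "n \<ge> N" for n
    proof -
      have "(2 + a) * (\<integral>\<omega>. w n \<omega> \<partial>M) < (2 + a) * (e / (2 * (2 + a)))"
        using N[OF that] a by (intro mult_strict_left_mono) auto
      also have "\<dots> = e / 2" using a by (simp add: field_simps)
      finally show ?thesis using main[OF a, of n] by (simp add: a_def)
    qed
    then show "\<exists>N. \<forall>n\<ge>N. norm ((\<integral>\<omega>. Z \<omega> * total_surprise n \<omega> \<partial>M) - 0) < e" by auto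
  qed
  then show ?thesis unfolding asymptotically_orthogonal_def Z_def .
qed

text \<open>Distances to the closed sets give Lipschitz approximations of a cylinder, and the class of
  asymptotically orthogonal functions is closed under bounded limits.\<close>

lemma asymptotically_orthogonal_indicator:
  assumes c: "c \<in> sets whole"
  shows "asymptotically_orthogonal (indicator c)"
proof -
  have events: "c \<in> events" if "c \<in> sets whole" for c
    using that subalg_whole unfolding subalgebra_def by auto
  show ?thesis
    using Int_stable_cylinders cylinders_subset c[unfolded sets_path_algebra_cylinders]
  proof (induction rule: sigma_sets_induct_disjoint)
    case (basic c)
    then obtain J U where J: "c = {\<omega>\<in>space M. \<forall>u\<in>J. B u \<omega> \<in> U u}" "finite J"
      "J \<subseteq> {0..}" "\<And>u. closed (U u)" unfolding cylinders_def by auto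
    define f where "f m u z = (if U u = {} then 0 else max 0 (1 - real m * infdist z (U u)))"
      for m :: nat and u and z :: "real ^ 'd"
    have f01: "0 \<le> f m u z" "f m u z \<le> 1" for m u z
      unfolding f_def by (auto simp: infdist_nonneg)
    have lip: "\<bar>f m u z - f m u z'\<bar> \<le> real m * norm (z - z')" for m u z z'
    proof -
      have "\<bar>infdist z (U u) - infdist z' (U u)\<bar> \<le> norm (z - z')"
        using infdist_triangle_abs[of z "U u" z'] by (simp add: dist_norm)
      then have "real m * \<bar>infdist z (U u) - infdist z' (U u)\<bar> \<le> real m * norm (z - z')"
        by (intro mult_left_mono) auto
      moreover have "\<bar>f m u z - f m u z'\<bar> \<le> \<bar>real m * infdist z (U u) - real m * infdist z' (U u)\<bar>"
        unfolding f_def by auto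
      moreover have "\<dots> = real m * \<bar>infdist z (U u) - infdist z' (U u)\<bar>"
        by (simp add: abs_mult flip: right_diff_distrib)
      ultimately show ?thesis by linarith
    qed
    have f_lim: "(\<lambda>m. f m u z) \<longlonglongrightarrow> indicator (U u) z" for u z
    proof (cases "z \<in> U u")
      case True
      then have "f m u z = 1" for m unfolding f_def by auto
      then show ?thesis using True by simp
    next
      case False
      show ?thesis
      proof (cases "U u = {}")
        case False2: False
        then have pos: "0 < infdist z (U u)"
          using False J(4) infdist_pos_not_in_closed by blast
        obtain N where "1 / infdist z (U u) < real N" using reals_Archimedean2 by blast
        then have N: "1 < real N * infdist z (U u)" using pos by (simp add: field_simps)
        have "f m u z = 0" if "m \<ge> N" for m
        proof -
          have "real N * infdist z (U u) \<le> real m * infdist z (U u)"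
            using that pos by (intro mult_right_mono) auto
          then show ?thesis unfolding f_def using N by auto
        qed
        then have "eventually (\<lambda>m. f m u z = indicator (U u) z) sequentially"
          using False by (auto simp: eventually_sequentially)
        then show ?thesis by (rule tendsto_eventually)
      qed (use False in \<open>auto simp: f_def\<close>)
    qed
    have c_ev: "c \<in> events" using basic events sets_path_algebra_cylinders by blast
    show ?case
    proof (rule asymptotically_orthogonal_closed[where b=1 and Z'="\<lambda>m \<omega>. \<Prod>u\<in>J. f m u (B u \<omega>)"])
      show "asymptotically_orthogonal (\<lambda>\<omega>. \<Prod>u\<in>J. f m u (B u \<omega>))" for m
        by (rule asymptotically_orthogonal_lipschitz[OF J(2,3) f01 lip]) auto
      show "(\<lambda>\<omega>. \<Prod>u\<in>J. f m u (B u \<omega>)) \<in> borel_measurable M" for m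
      proof (rule borel_measurable_prod)
        fix u assume "u \<in> J"
        then have "0 \<le> u" using J(3) by auto
        have "(\<lambda>z. infdist z (U u)) \<in> borel_measurable borel"
          by (intro borel_measurable_continuous_onI continuous_on_infdist continuous_on_id)
        then have "f m u \<in> borel_measurable borel"
          unfolding f_def[abs_def] by (cases "U u = {}") auto
        then show "(\<lambda>\<omega>. f m u (B u \<omega>)) \<in> borel_measurable M"
          by (rule measurable_compose[OF B_measurable[OF \<open>0 \<le> u\<close>]])
      qed
      show "\<bar>\<Prod>u\<in>J. f m u (B u \<omega>)\<bar> \<le> 1" for m \<omega>
        using f01 by (simp add: abs_prod prod_le_1)
      have "(\<lambda>m. \<Prod>u\<in>J. f m u (B u \<omega>)) \<longlonglongrightarrow> (\<Prod>u\<in>J. indicator (U u) (B u \<omega>))" for \<omega>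
        by (intro tendsto_prod f_lim)
      moreover have "(\<Prod>u\<in>J. indicator (U u) (B u \<omega>)) = (indicator c \<omega> :: real)" if "\<omega> \<in> space M" for \<omega>
        using that J(2) unfolding J(1) by (auto simp: indicator_def prod_zero_iff)
      ultimately show "AE \<omega> in M. (\<lambda>m. \<Prod>u\<in>J. f m u (B u \<omega>)) \<longlonglongrightarrow> indicator c \<omega>"
        by (metis (no_types, lifting) AE_I2)
    qed (use c_ev in \<open>auto split: split_indicator\<close>)
  next
    case empty show ?case by (simp add: asymptotically_orthogonal_def)
  next
    case (compl c)
    have c: "c \<in> events" using compl(1) events sets_path_algebra_cylinders by blast
    have zero: "(\<integral>\<omega>. total_surprise n \<omega> \<partial>M) = 0" for n
    proof -
      have "(\<integral>\<omega>. surprise n k \<omega> \<partial>M) = 0" for k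
        using integral_surprise_past[of "\<lambda>_. 1" n k 1] by simp
      moreover have "integrable M (surprise n k)" for k
        by (rule bounded_integrable[OF _ surprise_bound]) simp
      ultimately show ?thesis
        unfolding total_surprise_def by (simp add: Bochner_Integration.integral_sum)
    qed
    have "(\<integral>\<omega>. indicator (space M - c) \<omega> * total_surprise n \<omega> \<partial>M)
      = - (\<integral>\<omega>. indicator c \<omega> * total_surprise n \<omega> \<partial>M)" for n
    proof -
      have i: "integrable M (total_surprise n)" "integrable M (\<lambda>\<omega>. indicator c \<omega> * total_surprise n \<omega>)"
      proof -
        show i: "integrable M (total_surprise n)"
          by (rule bounded_integrable[OF _ total_surprise_bound]) simp
        show "integrable M (\<lambda>\<omega>. indicator c \<omega> * total_surprise n \<omega>)"
          using integrable_mult_indicator[OF c i] by simp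
      qed
      have "(\<integral>\<omega>. indicator (space M - c) \<omega> * total_surprise n \<omega> \<partial>M)
        = (\<integral>\<omega>. total_surprise n \<omega> - indicator c \<omega> * total_surprise n \<omega> \<partial>M)"
        by (rule Bochner_Integration.integral_cong) (auto split: split_indicator)
      then show ?thesis using i zero[of n] by simp
    qed
    then show ?case using compl(2) unfolding asymptotically_orthogonal_def
      by (auto dest: tendsto_minus)
  next
    case (union C)
    have C: "C i \<in> events" for i using union(2) events sets_path_algebra_cylinders by blast
    have part: "indicator (\<Union>i<m. C i) \<omega> = (\<Sum>i<m. 1 * indicator (C i) \<omega> :: real)" for m \<omega>
    proof -
      have "disjoint_family_on C {..<m}" using union(1) by (auto simp: disjoint_family_on_def)
      then show ?thesis using indicator_UN_disjoint[of "{..<m}" C \<omega>] by simp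
    qed
    show ?case
    proof (rule asymptotically_orthogonal_closed[where b=1 and Z'="\<lambda>m. indicator (\<Union>i<m. C i)"])
      show "asymptotically_orthogonal (indicator (\<Union>i<m. C i))" for m
        using asymptotically_orthogonal_sum[of "{..<m}" "\<lambda>i. indicator (C i)" 1 "\<lambda>_. 1"] union(3) C
        by (auto simp: part[abs_def] split: split_indicator)
      show "AE \<omega> in M. (\<lambda>m. indicator (\<Union>i<m. C i) \<omega> :: real) \<longlonglongrightarrow> indicator (\<Union>i. C i) \<omega>"
        using LIMSEQ_indicator_UN[of C] by auto
    qed (use C in \<open>auto split: split_indicator\<close>)
  qed
qed

text \<open>A bounded function is a uniform limit of step functions; here the level sets at height \<open>k / m\<close> are
  summed with weight \<open>1 / m\<close>.\<close>

lemma asymptotically_orthogonal_bounded: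
  assumes Z: "Z \<in> borel_measurable whole" and bd: "\<And>\<omega>. \<bar>Z \<omega>\<bar> \<le> b"
  shows "asymptotically_orthogonal Z"
proof -
  have b: "0 \<le> b" using bd[of undefined] by linarith
  have ZM: "Z \<in> borel_measurable M" by (rule measurable_from_subalg[OF subalg_whole Z])
  define x where "x m \<omega> = (Z \<omega> + b) * real m" for m :: nat and \<omega>
  define Y where "Y m \<omega> = (\<Sum>k\<in>{..<nat \<lceil>2 * b * real m\<rceil>}.
      (1 / real m) * indicator {\<omega>\<in>space M. real (Suc k) \<le> x m \<omega>} \<omega>) + (- b) * indicator (space M) \<omega>" for m \<omega>
  have sets: "{\<omega>\<in>space M. real (Suc k) \<le> x m \<omega>} \<in> sets whole" for k m
  proof -
    have "{\<omega>\<in>space whole. real (Suc k) \<le> x m \<omega>} \<in> sets whole" unfolding x_def using Z by measurable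
    then show ?thesis by simp
  qed
  have ev: "{\<omega>\<in>space M. real (Suc k) \<le> x m \<omega>} \<in> events" for k m
    using sets subalg_whole unfolding subalgebra_def by auto
  have Yx: "Y m \<omega> = real_of_int \<lfloor>x m \<omega>\<rfloor> / real m - b" if "\<omega> \<in> space M" for m \<omega>
  proof -
    have x: "0 \<le> x m \<omega>" "x m \<omega> \<le> 2 * b * real m"
      using bd[of \<omega>] by (auto simp: x_def abs_le_iff intro!: mult_right_mono)
    have set: "{k\<in>{..<nat \<lceil>2 * b * real m\<rceil>}. real (Suc k) \<le> x m \<omega>} = {..<nat \<lfloor>x m \<omega>\<rfloor>}"
    proof -
      have "k < nat \<lfloor>x m \<omega>\<rfloor> \<longleftrightarrow> real (Suc k) \<le> x m \<omega>" for k
        using x(1) by (simp add: le_nat_floor less_eq_real_def Suc_le_eq[symmetric] le_nat_iff le_floor_iff)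
      moreover have "k < nat \<lceil>2 * b * real m\<rceil>" if "real (Suc k) \<le> x m \<omega>" for k
        using that x(2) by (simp add: zless_nat_eq_int_zless less_ceiling_iff)
      ultimately show ?thesis by auto
    qed
    have "(\<Sum>k\<in>{..<nat \<lceil>2 * b * real m\<rceil>}. (1 / real m) * indicator {\<omega>\<in>space M. real (Suc k) \<le> x m \<omega>} \<omega>)
      = (\<Sum>k\<in>{k\<in>{..<nat \<lceil>2 * b * real m\<rceil>}. real (Suc k) \<le> x m \<omega>}. 1 / real m)"
      using that by (intro sum.mono_neutral_cong_right) (auto split: split_indicator)
    also have "\<dots> = real (nat \<lfloor>x m \<omega>\<rfloor>) / real m" unfolding set by simp
    finally show ?thesis using x(1) that by (simp add: Y_def)
  qed
  have close: "\<bar>Y m \<omega> - Z \<omega>\<bar> \<le> 1 / real m" if "\<omega> \<in> space M" "m > 0" for m \<omega>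
  proof -
    have "Y m \<omega> - Z \<omega> = (real_of_int \<lfloor>x m \<omega>\<rfloor> - x m \<omega>) / real m"
      using Yx[OF that(1), of m] that(2) by (simp add: x_def field_simps)
    moreover have "\<bar>real_of_int \<lfloor>x m \<omega>\<rfloor> - x m \<omega>\<bar> \<le> 1" by linarith
    ultimately show ?thesis using that(2) by (simp add: abs_divide divide_right_mono)
  qed
  define Z' where "Z' m = Y (Suc m)" for m
  have Ym: "Y m \<in> borel_measurable M" for m unfolding Y_def[abs_def]
    using ev by (intro borel_measurable_add borel_measurable_sum borel_measurable_times borel_measurable_indicator) auto
  show ?thesis
  proof (rule asymptotically_orthogonal_closed[where b="b + 1" and Z'="\<lambda>m \<omega>. indicator (space M) \<omega> * Z' m \<omega>"])
    have eq: "indicator (space M) \<omega> * Z' m \<omega> = (\<Sum>k\<in>{..nat \<lceil>2 * b * real (Suc m)\<rceil>}.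
        (if k = nat \<lceil>2 * b * real (Suc m)\<rceil> then - b else 1 / real (Suc m))
        * (if k = nat \<lceil>2 * b * real (Suc m)\<rceil> then indicator (space M) \<omega>
           else indicator {\<omega>\<in>space M. real (Suc k) \<le> x (Suc m) \<omega>} \<omega>))" for m \<omega>
    proof -
      define n where "n = nat \<lceil>2 * b * real (Suc m)\<rceil>"
      have split: "(\<Sum>k\<in>{..n}. g k) = (\<Sum>k<n. g k) + g n" for g :: "nat \<Rightarrow> real"
        by (simp add: lessThan_Suc_atMost[symmetric])
      have "(\<Sum>k<n. (if k = n then - b else 1 / real (Suc m))
            * (if k = n then indicator (space M) \<omega> else indicator {\<omega>\<in>space M. real (Suc k) \<le> x (Suc m) \<omega>} \<omega>))
          = (\<Sum>k<n. (1 / real (Suc m)) * indicator {\<omega>\<in>space M. real (Suc k) \<le> x (Suc m) \<omega>} \<omega>)"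
        by (intro sum.cong) auto
      then show ?thesis
        unfolding Z'_def Y_def n_def[symmetric] split by (cases "\<omega> \<in> space M") simp_all
    qed
    have sp: "space M \<in> sets whole" using sets.top[of whole] by simp
    show "asymptotically_orthogonal (\<lambda>\<omega>. indicator (space M) \<omega> * Z' m \<omega>)" for m
      unfolding eq
    proof (rule asymptotically_orthogonal_sum[where b=1])
      fix k
      show "asymptotically_orthogonal (\<lambda>\<omega>. if k = nat \<lceil>2 * b * real (Suc m)\<rceil> then indicator (space M) \<omega>
           else indicator {\<omega>\<in>space M. real (Suc k) \<le> x (Suc m) \<omega>} \<omega>)"
        using asymptotically_orthogonal_indicator[OF sp] asymptotically_orthogonal_indicator[OF sets, of k "Suc m"]
        by (cases "k = nat \<lceil>2 * b * real (Suc m)\<rceil>") (simp_all only: if_True if_False simp_thms)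
      show "(\<lambda>\<omega>. if k = nat \<lceil>2 * b * real (Suc m)\<rceil> then indicator (space M) \<omega>
           else indicator {\<omega>\<in>space M. real (Suc k) \<le> x (Suc m) \<omega>} \<omega>) \<in> borel_measurable M"
        using ev[of k "Suc m"]
        by (cases "k = nat \<lceil>2 * b * real (Suc m)\<rceil>")
           (simp_all only: if_True if_False simp_thms borel_measurable_indicator sets.top)
    qed (auto split: split_indicator)
    show "(\<lambda>\<omega>. indicator (space M) \<omega> * Z' m \<omega>) \<in> borel_measurable M" for m
      unfolding Z'_def using Ym by auto
    show "\<bar>indicator (space M) \<omega> * Z' m \<omega>\<bar> \<le> b + 1" for m \<omega>
    proof (cases "\<omega> \<in> space M")
      case True
      have "1 / real (Suc m) \<le> 1" by simp
      then have "\<bar>Y (Suc m) \<omega>\<bar> \<le> b + 1" using close[OF True, of "Suc m"] bd[of \<omega>] by linarith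
      then show ?thesis using True unfolding Z'_def by simp
    qed (use b in auto)
    show "\<bar>Z \<omega>\<bar> \<le> b + 1" for \<omega> using bd[of \<omega>] by simp
    have "(\<lambda>m. Z' m \<omega>) \<longlonglongrightarrow> Z \<omega>" if "\<omega> \<in> space M" for \<omega>
    proof (rule LIM_zero_cancel, rule tendsto_rabs_zero_cancel, rule tendsto_sandwich[OF _ _ tendsto_const])
      show "(\<lambda>m. 1 / real (Suc m)) \<longlonglongrightarrow> 0" by (rule LIMSEQ_Suc[OF lim_1_over_n])
      show "\<forall>\<^sub>F m in sequentially. \<bar>Z' m \<omega> - Z \<omega>\<bar> \<le> 1 / real (Suc m)"
        unfolding Z'_def by (intro always_eventually allI close[OF that]) simp
    qed auto
    then show "AE \<omega> in M. (\<lambda>m. indicator (space M) \<omega> * Z' m \<omega>) \<longlonglongrightarrow> Z \<omega>" by auto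
  qed (rule ZM)
qed

end

section \<open>Maximal inequalities\<close>

context brownian_space
begin

text \<open>Doob's maximal inequality for the martingale of conditional expectations of \<open>X\<close>: decompose according to
  the first time \<open>s\<close> at which the level \<open>\<epsilon>\<close> is reached, an event of the past of \<open>s\<close>.\<close>

lemma maximal_inequality_finite:
  assumes S: "finite S" and X: "integrable M X" and \<epsilon>: "0 < (\<epsilon>::real)"
  shows "{\<omega>\<in>space M. \<exists>s\<in>S. \<epsilon> \<le> \<bar>real_cond_exp M (past s) X \<omega>\<bar>} \<in> events"
    and "prob {\<omega>\<in>space M. \<exists>s\<in>S. \<epsilon> \<le> \<bar>real_cond_exp M (past s) X \<omega>\<bar>} \<le> (\<integral>\<omega>. \<bar>X \<omega>\<bar> \<partial>M) / \<epsilon>"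
proof -
  let ?N = "\<lambda>s. real_cond_exp M (past s) X"
  define H where "H s = {\<omega>\<in>space M. \<epsilon> \<le> \<bar>?N s \<omega>\<bar> \<and> (\<forall>s'\<in>{s'\<in>S. s' < s}. \<bar>?N s' \<omega>\<bar> < \<epsilon>)}" for s
  have N_past: "?N s' \<in> borel_measurable (past s)" if "s' \<le> s" for s s'
    by (rule measurable_from_subalg[OF subalg_past_mono[OF that]]) auto
  have H_past: "H s \<in> sets (past s)" for s
  proof -
    have "{\<omega>\<in>space (past s). \<epsilon> \<le> \<bar>?N s \<omega>\<bar> \<and> (\<forall>s'\<in>{s'\<in>S. s' < s}. \<bar>?N s' \<omega>\<bar> < \<epsilon>)} \<in> sets (past s)"
    proof (intro sets.sets_Collect_conj sets.sets_Collect_finite_All)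
      have [measurable]: "?N s \<in> borel_measurable (past s)" by (rule N_past) simp
      show "{\<omega>\<in>space (past s). \<epsilon> \<le> \<bar>?N s \<omega>\<bar>} \<in> sets (past s)" by measurable
      fix s' assume "s' \<in> {s'\<in>S. s' < s}"
      then have [measurable]: "?N s' \<in> borel_measurable (past s)" by (intro N_past) simp
      show "{\<omega>\<in>space (past s). \<bar>?N s' \<omega>\<bar> < \<epsilon>} \<in> sets (past s)" by measurable
    qed (use S in auto)
    then show ?thesis unfolding H_def by simp
  qed
  have H_ev: "H s \<in> events" for s using H_past[of s] subalg_past_M unfolding subalgebra_def by blast
  have U: "{\<omega>\<in>space M. \<exists>s\<in>S. \<epsilon> \<le> \<bar>?N s \<omega>\<bar>} = (\<Union>s\<in>S. H s)"
  proof (intro set_eqI iffI)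
    fix \<omega> assume "\<omega> \<in> {\<omega>\<in>space M. \<exists>s\<in>S. \<epsilon> \<le> \<bar>?N s \<omega>\<bar>}"
    then have \<omega>: "\<omega> \<in> space M" "{s\<in>S. \<epsilon> \<le> \<bar>?N s \<omega>\<bar>} \<noteq> {}" by auto
    define s where "s = Min {s\<in>S. \<epsilon> \<le> \<bar>?N s \<omega>\<bar>}"
    have s: "s \<in> {s\<in>S. \<epsilon> \<le> \<bar>?N s \<omega>\<bar>}" unfolding s_def using S \<omega>(2) by (intro Min_in) auto
    have "\<bar>?N s' \<omega>\<bar> < \<epsilon>" if "s' \<in> S" "s' < s" for s'
      using Min_le[of "{s\<in>S. \<epsilon> \<le> \<bar>?N s \<omega>\<bar>}" s'] S that unfolding s_def by (auto simp: not_less[symmetric])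
    then show "\<omega> \<in> (\<Union>s\<in>S. H s)" using s \<omega>(1) unfolding H_def by auto
  qed (auto simp: H_def)
  show "{\<omega>\<in>space M. \<exists>s\<in>S. \<epsilon> \<le> \<bar>?N s \<omega>\<bar>} \<in> events" unfolding U using S H_ev by auto
  have disj: "disjoint_family_on H S"
    unfolding disjoint_family_on_def
  proof (intro ballI impI)
    fix s s' assume s: "s \<in> S" "s' \<in> S" "s \<noteq> s'"
    have "H s \<inter> H s' = {}" if "s \<in> S" "s < s'" for s s'
    proof -
      have "\<not> (\<omega> \<in> H s \<and> \<omega> \<in> H s')" for \<omega>
        using that unfolding H_def by (force simp: not_le[symmetric])
      then show ?thesis by blast
    qed
    then show "H s \<inter> H s' = {}" using s by (metis inf_commute neqE)
  qed
  have each: "\<epsilon> * prob (H s) \<le> (\<integral>\<omega>. indicator (H s) \<omega> * \<bar>X \<omega>\<bar> \<partial>M)" for s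
  proof -
    interpret P: sigma_finite_subalgebra M "past s" by (rule sigma_finite_subalgebraI[OF subalg_past_M])
    have [measurable]: "X \<in> borel_measurable M" using X by auto
    define Z where "Z \<omega> = indicator (H s) \<omega> * sgn (?N s \<omega>)" for \<omega>
    have Z: "Z \<in> borel_measurable (past s)"
      unfolding Z_def using H_past N_past[of s s] by (intro borel_measurable_times borel_measurable_indicator) auto
    have Zb: "\<bar>Z \<omega>\<bar> \<le> indicator (H s) \<omega>" for \<omega> unfolding Z_def by (auto simp: abs_mult sgn_if split: split_indicator)
    have [measurable]: "Z \<in> borel_measurable M" by (rule measurable_from_subalg[OF subalg_past_M Z])
    have iZX: "integrable M (\<lambda>\<omega>. Z \<omega> * X \<omega>)"
    proof (rule Bochner_Integration.integrable_bound[OF X])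
      have "\<bar>Z \<omega>\<bar> * \<bar>X \<omega>\<bar> \<le> 1 * \<bar>X \<omega>\<bar>" for \<omega>
        using order_trans[OF Zb[of \<omega>] indicator_le_1] by (intro mult_right_mono) auto
      then show "AE \<omega> in M. norm (Z \<omega> * X \<omega>) \<le> norm (X \<omega>)" by (simp add: abs_mult)
    qed measurable
    have iH: "integrable M (\<lambda>\<omega>. indicator (H s) \<omega> * \<bar>X \<omega>\<bar>)"
      using integrable_mult_indicator[OF H_ev integrable_abs[OF X]] by simp
    have "\<epsilon> * prob (H s) = (\<integral>\<omega>. \<epsilon> * indicator (H s) \<omega> \<partial>M)" using H_ev by simp
    also have "\<dots> \<le> (\<integral>\<omega>. Z \<omega> * ?N s \<omega> \<partial>M)"
    proof (rule integral_mono)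
      show "integrable M (\<lambda>\<omega>. Z \<omega> * ?N s \<omega>)" by (rule P.real_cond_exp_intg(1)[OF iZX Z]) measurable
      show "integrable M (\<lambda>\<omega>. \<epsilon> * indicator (H s) \<omega>)" using H_ev by (intro integrable_mult_right) (simp add: less_top[symmetric])
      show "\<epsilon> * indicator (H s) \<omega> \<le> Z \<omega> * ?N s \<omega>" for \<omega>
        unfolding Z_def H_def by (auto simp: abs_sgn mult.commute split: split_indicator)
    qed
    also have "\<dots> = (\<integral>\<omega>. Z \<omega> * X \<omega> \<partial>M)" by (rule P.real_cond_exp_intg(2)[OF iZX Z]) measurable
    also have "\<dots> \<le> (\<integral>\<omega>. indicator (H s) \<omega> * \<bar>X \<omega>\<bar> \<partial>M)"
    proof (rule integral_mono[OF iZX iH])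
      fix \<omega>
      have "Z \<omega> * X \<omega> \<le> \<bar>Z \<omega>\<bar> * \<bar>X \<omega>\<bar>" by (simp flip: abs_mult)
      also have "\<dots> \<le> indicator (H s) \<omega> * \<bar>X \<omega>\<bar>" using Zb[of \<omega>] by (intro mult_right_mono) auto
      finally show "Z \<omega> * X \<omega> \<le> indicator (H s) \<omega> * \<bar>X \<omega>\<bar>" .
    qed
    finally show ?thesis .
  qed
  have "\<epsilon> * prob (\<Union>s\<in>S. H s) = (\<Sum>s\<in>S. \<epsilon> * prob (H s))"
  proof -
    have "H ` S \<subseteq> events" using H_ev by auto
    from finite_measure_finite_Union[OF S this disj] show ?thesis by (simp add: sum_distrib_left)
  qed
  also have "\<dots> \<le> (\<Sum>s\<in>S. \<integral>\<omega>. indicator (H s) \<omega> * \<bar>X \<omega>\<bar> \<partial>M)" by (intro sum_mono each)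
  also have "\<dots> = (\<integral>\<omega>. (\<Sum>s\<in>S. indicator (H s) \<omega> * \<bar>X \<omega>\<bar>) \<partial>M)"
    using integrable_mult_indicator[OF H_ev integrable_abs[OF X]]
    by (intro Bochner_Integration.integral_sum[symmetric]) auto
  also have "\<dots> = (\<integral>\<omega>. indicator (\<Union>s\<in>S. H s) \<omega> * \<bar>X \<omega>\<bar> \<partial>M)"
    by (intro Bochner_Integration.integral_cong refl) (simp add: indicator_UN_disjoint[OF S disj] sum_distrib_right)
  also have "\<dots> \<le> (\<integral>\<omega>. \<bar>X \<omega>\<bar> \<partial>M)"
    by (rule integral_mono') (use X in \<open>auto split: split_indicator\<close>)
  finally show "prob {\<omega>\<in>space M. \<exists>s\<in>S. \<epsilon> \<le> \<bar>?N s \<omega>\<bar>} \<le> (\<integral>\<omega>. \<bar>X \<omega>\<bar> \<partial>M) / \<epsilon>"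
    unfolding U using \<epsilon> by (simp add: field_simps)
qed

lemma maximal_inequality_dyadic:
  assumes X: "integrable M X" and \<epsilon>: "0 < (\<epsilon>::real)"
  defines "A \<equiv> {\<omega>\<in>space M. \<exists>n k. \<epsilon> \<le> \<bar>real_cond_exp M (past (dyadic n k)) X \<omega>\<bar>}"
  shows "A \<in> events" and "prob A \<le> (\<integral>\<omega>. \<bar>X \<omega>\<bar> \<partial>M) / \<epsilon>"
proof -
  define S where "S q = dyadic q ` {..q * 2 ^ q}" for q
  define E where "E q = {\<omega>\<in>space M. \<exists>s\<in>S q. \<epsilon> \<le> \<bar>real_cond_exp M (past s) X \<omega>\<bar>}" for q
  have S_in: "dyadic n k \<in> S q" if "n \<le> q" "k \<le> q * 2 ^ n" for n k q
  proof -
    have "k * 2 ^ (q - n) \<le> q * 2 ^ n * 2 ^ (q - n)" using that(2) by (intro mult_right_mono) auto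
    also have "\<dots> = q * 2 ^ q" using that(1) by (simp flip: power_add)
    finally show ?thesis unfolding S_def dyadic_refine[OF that(1), of k] by auto
  qed
  have S_mono: "S q \<subseteq> S (Suc q)" for q
    by (auto simp: S_def[of q] intro!: S_in elim!: order_trans)
  have fin: "finite (S q)" for q unfolding S_def by simp
  note E = maximal_inequality_finite[OF fin X \<epsilon>, folded E_def]
  have A: "A = (\<Union>q. E q)"
  proof (intro set_eqI iffI)
    fix \<omega> assume "\<omega> \<in> A"
    then obtain n k where nk: "\<omega> \<in> space M" "\<epsilon> \<le> \<bar>real_cond_exp M (past (dyadic n k)) X \<omega>\<bar>"
      unfolding A_def by auto
    have "k * 1 \<le> (n + k) * 2 ^ n" by (intro mult_mono) auto
    then have "dyadic n k \<in> S (n + k)" by (intro S_in) auto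
    then show "\<omega> \<in> (\<Union>q. E q)" using nk unfolding E_def by auto
  qed (auto simp: A_def E_def S_def)
  show "A \<in> events" unfolding A using E(1) by auto
  have "incseq E" unfolding incseq_Suc_iff E_def using S_mono by blast
  then have "(\<lambda>q. prob (E q)) \<longlonglongrightarrow> prob A"
    unfolding A using E(1) by (intro finite_Lim_measure_incseq) auto
  then show "prob A \<le> (\<integral>\<omega>. \<bar>X \<omega>\<bar> \<partial>M) / \<epsilon>"
    by (rule LIMSEQ_le_const2) (use E(2) in auto)
qed

end

section \<open>Convergence of compensators to right limits\<close>

context increasing_family
begin

text \<open>Surprises in cells that begin after \<open>s\<close> have conditional mean zero.\<close>

lemma cond_exp_drop_surprises:
  assumes g: "g \<in> borel_measurable (past s)" and bd: "\<And>\<omega>. \<bar>g \<omega>\<bar> \<le> b"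
    and K: "finite K" "\<And>j. j \<in> K \<Longrightarrow> s \<le> dyadic n j"
  shows "AE \<omega> in M. real_cond_exp M (past s) (\<lambda>\<omega>. g \<omega> + (\<Sum>j\<in>K. surprise n j \<omega>)) \<omega> = g \<omega>"
proof -
  interpret P: sigma_finite_subalgebra M "past s" by (rule sigma_finite_subalgebraI[OF subalg_past_M])
  have [measurable]: "g \<in> borel_measurable M" by (rule past_M[OF g])
  have ig: "integrable M g" by (rule bounded_integrable[OF _ bd]) auto
  have iS: "integrable M (surprise n j)" for j by (rule bounded_integrable[OF _ surprise_bound]) auto
  show ?thesis
  proof (rule P.real_cond_exp_charact)
    fix A assume A: "A \<in> sets (past s)"
    then have AM: "A \<in> events" using subalg_past_M unfolding subalgebra_def by auto
    have zero: "(\<integral>\<omega>. indicator A \<omega> * surprise n j \<omega> \<partial>M) = 0" if "j \<in> K" for j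
    proof (rule integral_surprise_past)
      show "indicator A \<in> borel_measurable (past (dyadic n j))"
        by (rule measurable_past_mono[OF K(2)[OF that]]) (use A in auto)
      show "\<bar>indicator A \<omega>\<bar> \<le> (1::real)" for \<omega> by (auto split: split_indicator)
    qed
    have i: "integrable M (\<lambda>\<omega>. indicator A \<omega> * f \<omega>)" if "integrable M f" for f :: "'a \<Rightarrow> real"
      using integrable_mult_indicator[OF AM that] by simp
    have "(\<integral>\<omega>. indicator A \<omega> * (g \<omega> + (\<Sum>j\<in>K. surprise n j \<omega>)) \<partial>M)
      = (\<integral>\<omega>. indicator A \<omega> * g \<omega> + (\<Sum>j\<in>K. indicator A \<omega> * surprise n j \<omega>) \<partial>M)"
      by (simp add: distrib_left sum_distrib_left)
    also have "\<dots> = (\<integral>\<omega>. indicator A \<omega> * g \<omega> \<partial>M) + (\<Sum>j\<in>K. \<integral>\<omega>. indicator A \<omega> * surprise n j \<omega> \<partial>M)"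
      using i[OF ig] i[OF iS] by simp
    finally show "(\<integral>x\<in>A. g x + (\<Sum>j\<in>K. surprise n j x) \<partial>M) = (\<integral>x\<in>A. g x \<partial>M)"
      using zero by (simp add: set_lebesgue_integral_def)
  qed (use ig iS g in auto)
qed

lemma predicted_sum_at_grid_point:
  assumes k: "1 \<le> k" "k \<le> n * 2 ^ n"
  shows "AE \<omega> in M. (\<Sum>j<k. predicted_step n j \<omega>)
    = y (dyadic n k) \<omega> - real_cond_exp M (past (dyadic n k)) (total_surprise n) \<omega>"
proof -
  let ?g = "\<lambda>\<omega>. \<Sum>j<k. surprise n j \<omega>"
  have g: "?g \<in> borel_measurable (past (dyadic n k))"
  proof (rule borel_measurable_sum)
    fix j assume "j \<in> {..<k}"
    then have "dyadic n (Suc j) \<le> dyadic n k" by simp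
    then show "surprise n j \<in> borel_measurable (past (dyadic n k))"
      using surprise_past by (rule measurable_past_mono)
  qed
  have tot: "total_surprise n = (\<lambda>\<omega>. ?g \<omega> + (\<Sum>j\<in>{k..<n * 2 ^ n}. surprise n j \<omega>))"
    unfolding total_surprise_def[abs_def] lessThan_atLeast0
    using k(2) by (intro ext sum.atLeastLessThan_concat[symmetric]) auto
  have "AE \<omega> in M. real_cond_exp M (past (dyadic n k)) (total_surprise n) \<omega> = ?g \<omega>"
    unfolding tot by (rule cond_exp_drop_surprises[OF g sum_surprise_bound]) auto
  then show ?thesis
  proof eventually_elim
    case (elim \<omega>)
    then show ?case using k(1) sum_step[of n \<omega> k] by (simp add: surprise_def sum_subtractf)
  qed
qed

text \<open>Strictly inside a cell the surprise of that cell is neither past nor future. Monotonicity of \<open>y\<close>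
  gives an inequality in the direction that is needed.\<close>

lemma predicted_sum_in_cell:
  assumes k: "k < n * 2 ^ n" and s: "dyadic n k \<le> s" "s < dyadic n (Suc k)"
  shows "AE \<omega> in M. y s \<omega> - real_cond_exp M (past s) (total_surprise n) \<omega> \<le> (\<Sum>j\<le>k. predicted_step n j \<omega>)"
proof -
  interpret P: sigma_finite_subalgebra M "past s" by (rule sigma_finite_subalgebraI[OF subalg_past_M])
  have s0: "0 \<le> s" using s(1) dyadic_nonneg[of n k] by linarith
  let ?g = "\<lambda>\<omega>. y s \<omega> - (\<Sum>j\<le>k. predicted_step n j \<omega>)"
  let ?K = "{Suc k..<n * 2 ^ n}"
  have g: "?g \<in> borel_measurable (past s)"
  proof (intro borel_measurable_diff borel_measurable_sum y_past s0)
    fix j assume "j \<in> {..k}"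
    then have "dyadic n j \<le> s" using order_trans[OF dyadic_mono s(1), of j] by auto
    then show "predicted_step n j \<in> borel_measurable (past s)"
      using predicted_past by (rule measurable_past_mono)
  qed
  have gb: "\<bar>?g \<omega>\<bar> \<le> 1 + real (Suc k)" for \<omega>
  proof -
    have "(\<Sum>j\<le>k. predicted_step n j \<omega>) \<le> (\<Sum>j\<le>k. 1)" by (intro sum_mono predicted_01)
    moreover have "0 \<le> (\<Sum>j\<le>k. predicted_step n j \<omega>)" by (intro sum_nonneg predicted_01)
    ultimately show ?thesis using y0[OF s0, of \<omega>] y1[OF s0, of \<omega>] by simp
  qed
  have le: "?g \<omega> + (\<Sum>j\<in>?K. surprise n j \<omega>) \<le> total_surprise n \<omega>" for \<omega>
  proof -
    have "total_surprise n \<omega> = (\<Sum>j<Suc k. surprise n j \<omega>) + (\<Sum>j\<in>?K. surprise n j \<omega>)"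
      unfolding total_surprise_def lessThan_atLeast0 using k by (intro sum.atLeastLessThan_concat[symmetric]) auto
    moreover have "(\<Sum>j<Suc k. surprise n j \<omega>) = y (dyadic n (Suc k)) \<omega> - (\<Sum>j\<le>k. predicted_step n j \<omega>)"
      using sum_step[of n \<omega> "Suc k"] by (simp only: surprise_def sum_subtractf lessThan_Suc_atMost) simp
    ultimately show ?thesis using y_mono[OF s0, where t="dyadic n (Suc k)" and \<omega>=\<omega>] s(2) by simp
  qed
  have [measurable]: "?g \<in> borel_measurable M" by (rule past_M[OF g])
  have i: "integrable M (\<lambda>\<omega>. ?g \<omega> + (\<Sum>j\<in>?K. surprise n j \<omega>))"
  proof (rule Bochner_Integration.integrable_add)
    show "integrable M ?g" by (rule bounded_integrable[OF past_M[OF g] gb])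
    show "integrable M (\<lambda>\<omega>. \<Sum>j\<in>?K. surprise n j \<omega>)"
      by (intro Bochner_Integration.integrable_sum bounded_integrable[OF M_measurable(3) surprise_bound])
  qed
  have "s \<le> dyadic n j" if "j \<in> ?K" for j
    using order_trans[OF less_imp_le[OF s(2)] dyadic_mono, of j] that by simp
  then have "AE \<omega> in M. real_cond_exp M (past s) (\<lambda>\<omega>. ?g \<omega> + (\<Sum>j\<in>?K. surprise n j \<omega>)) \<omega> = ?g \<omega>"
    by (intro cond_exp_drop_surprises[OF g gb]) auto
  moreover have "AE \<omega> in M. real_cond_exp M (past s) (\<lambda>\<omega>. ?g \<omega> + (\<Sum>j\<in>?K. surprise n j \<omega>)) \<omega>
      \<le> real_cond_exp M (past s) (total_surprise n) \<omega>"
    by (rule P.real_cond_exp_mono[OF AE_I2[OF le] i bounded_integrable[OF M_measurable(4) total_surprise_bound]])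
  ultimately show ?thesis by eventually_elim auto
qed

lemma almost_orthogonal_subsequence:
  obtains r where "strict_mono r"
    and "\<And>i j. i < j \<Longrightarrow> \<bar>\<integral>\<omega>. total_surprise (r i) \<omega> * total_surprise (r j) \<omega> \<partial>M\<bar> \<le> 1 / real (Suc j)"
proof -
  let ?I = "\<lambda>i j. \<integral>\<omega>. total_surprise i \<omega> * total_surprise j \<omega> \<partial>M"
  have "\<exists>y>x. \<forall>i\<le>x. \<bar>?I i y\<bar> \<le> 1 / real (Suc (Suc n))" for x n
  proof -
    have "eventually (\<lambda>j. \<bar>?I i j\<bar> < 1 / real (Suc (Suc n))) sequentially" for i
    proof -
      have "(\<lambda>j. ?I i j) \<longlonglongrightarrow> 0"
        using asymptotically_orthogonal_bounded[OF total_surprise_whole total_surprise_bound, of i]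
        unfolding asymptotically_orthogonal_def .
      from order_tendstoD(2)[OF tendsto_rabs[OF this], of "1 / real (Suc (Suc n))"] show ?thesis by simp
    qed
    then have "eventually (\<lambda>j. \<forall>i\<in>{..x}. \<bar>?I i j\<bar> < 1 / real (Suc (Suc n))) sequentially"
      by (intro eventually_ball_finite) auto
    then have "eventually (\<lambda>j. (\<forall>i\<in>{..x}. \<bar>?I i j\<bar> < 1 / real (Suc (Suc n))) \<and> x < j) sequentially"
      using eventually_gt_at_top by (rule eventually_conj)
    from eventually_happens[OF this] show ?thesis by (auto intro: less_imp_le)
  qed
  then obtain r where r': "\<forall>n. True \<and> r n < r (Suc n) \<and> (\<forall>i\<le>r n. \<bar>?I i (r (Suc n))\<bar> \<le> 1 / real (Suc (Suc n)))"
    using dependent_nat_choice[of "\<lambda>_ _. True" "\<lambda>n x y. x < y \<and> (\<forall>i\<le>x. \<bar>?I i y\<bar> \<le> 1 / real (Suc (Suc n)))"] by blast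
  have r: "\<And>n. r n < r (Suc n)" "\<And>n i. i \<le> r n \<Longrightarrow> \<bar>?I i (r (Suc n))\<bar> \<le> 1 / real (Suc (Suc n))"
    using r' by blast+
  have mono: "strict_mono r" using r(1) by (simp add: strict_mono_Suc_iff)
  show ?thesis
  proof
    fix i j :: nat assume "i < j"
    then obtain j' where j: "j = Suc j'" "i \<le> j'" by (cases j) auto
    have "r i \<le> r j'" using mono j(2) by (simp add: strict_mono_less_eq)
    from r(2)[OF this] show "\<bar>?I (r i) (r j)\<bar> \<le> 1 / real (Suc j)" unfolding j(1) .
  qed (rule mono)
qed

text \<open>The predictions of all cells that have begun. As the prediction for a cell is already known at its
  left end, this step process includes, at time \<open>t\<close>, what is foreseeable immediately after \<open>t\<close>. That is
  why it can converge to a right limit without looking into the future.\<close>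

definition compensator :: "nat \<Rightarrow> real \<Rightarrow> 'a \<Rightarrow> real" where
  "compensator n t \<omega> = (\<Sum>k<n * 2 ^ n. indicator {dyadic n k..} t * predicted_step n k \<omega>)"

lemma compensator_cell:
  assumes k: "k < n * 2 ^ n" and t: "dyadic n k \<le> t" "t < dyadic n (Suc k)"
  shows "compensator n t \<omega> = (\<Sum>j\<le>k. predicted_step n j \<omega>)"
proof -
  have "dyadic n j \<le> t \<longleftrightarrow> j \<le> k" for j
  proof
    assume "dyadic n j \<le> t"
    then have "dyadic n j < dyadic n (Suc k)" using t by linarith
    then show "j \<le> k" by simp
  qed (use t in \<open>auto intro: order_trans[OF dyadic_mono]\<close>)
  then have "compensator n t \<omega> = (\<Sum>j<n * 2 ^ n. if j \<le> k then predicted_step n j \<omega> else 0)"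
    unfolding compensator_def by (intro sum.cong) (auto simp: indicator_def)
  also have "\<dots> = (\<Sum>j\<in>{j\<in>{..<n * 2 ^ n}. j \<le> k}. predicted_step n j \<omega>)"
    by (rule sum.inter_filter[symmetric]) simp
  also have "{j\<in>{..<n * 2 ^ n}. j \<le> k} = {..k}" using k by auto
  finally show ?thesis .
qed

lemma compensator_before_grid_point:
  assumes k: "k \<le> n * 2 ^ n" and t: "t < dyadic n k"
  shows "compensator n t \<omega> \<le> (\<Sum>j<k. predicted_step n j \<omega>)"
proof -
  have "compensator n t \<omega> = (\<Sum>j<k. indicator {dyadic n j..} t * predicted_step n j \<omega>)"
    unfolding compensator_def
  proof (rule sum.mono_neutral_right)
    show "\<forall>i\<in>{..<n * 2 ^ n} - {..<k}. indicator {dyadic n i..} t * predicted_step n i \<omega> = 0"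
    proof
      fix i assume "i \<in> {..<n * 2 ^ n} - {..<k}"
      then have "t < dyadic n i" using less_le_trans[OF t dyadic_mono, of i] by auto
      then show "indicator {dyadic n i..} t * predicted_step n i \<omega> = 0" by simp
    qed
  qed (use k in auto)
  also have "\<dots> \<le> (\<Sum>j<k. predicted_step n j \<omega>)"
    using predicted_01[of n _ \<omega>] by (intro sum_mono) (auto split: split_indicator)
  finally show ?thesis .
qed

lemma compensator_progressive:
  assumes T: "0 \<le> T"
  shows "(\<lambda>(s, \<omega>). compensator n s \<omega>) \<in> borel_measurable (restrict_space borel {0..T} \<Otimes>\<^sub>M F T)"
  unfolding compensator_def case_prod_beta
proof (rule borel_measurable_sum)
  let ?P = "restrict_space borel {0..T} \<Otimes>\<^sub>M F T"
  fix k
  have fst: "fst \<in> borel_measurable ?P"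
    by (rule measurable_compose[OF measurable_fst measurable_restrict_space1]) simp
  show "(\<lambda>z. indicator {dyadic n k..} (fst z) * predicted_step n k (snd z)) \<in> borel_measurable ?P"
  proof (cases "dyadic n k \<le> T")
    case True
    have "predicted_step n k \<in> borel_measurable (F (dyadic n k))"
      by (rule measurable_from_subalg[OF subalg_past predicted_past]) simp
    then have "predicted_step n k \<in> borel_measurable (F T)"
      using True by (intro measurable_F_mono[of "dyadic n k" T]) auto
    from measurable_compose[OF measurable_snd this]
    have "(\<lambda>z. predicted_step n k (snd z)) \<in> borel_measurable ?P" .
    moreover have "indicator {dyadic n k..} \<in> borel_measurable (borel :: real measure)" by simp
    from measurable_compose[OF fst this]
    have "(\<lambda>z. indicator {dyadic n k..} (fst z)) \<in> borel_measurable ?P" .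
    ultimately show ?thesis by (intro borel_measurable_times)
  next
    case False
    then show ?thesis
      by (subst measurable_cong[where g="\<lambda>_. 0"])
         (auto simp: space_pair_measure space_restrict_space indicator_def)
  qed
qed

text \<open>Only countably many null sets occur, so the convergence holds at all times simultaneously. At a time
  \<open>t\<close> the averaged compensator is compared with \<open>y\<close> at dyadic times slightly later than \<open>t\<close>: it is at most
  the value at any fixed later grid time, and at least the value at a time so close to \<open>t\<close> that it lies
  in the same cell for every grid of the block, up to conditional expectations of averaged surprises
  in both cases. The limit is progressively measurable for the given filtration because it is defined
  as a limit of step processes, with the default value of \<open>lim\<close> where they diverge.\<close>

theorem predictable_version:
  "\<exists>Y. progressively_measurable F Y \<and>
     (AE \<omega> in M. \<forall>t\<ge>0. ((\<lambda>s. y s \<omega>) \<longlongrightarrow> Y t \<omega>) (at_right t))"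
proof -
  obtain r where r: "strict_mono r"
    and orth: "\<And>i j. i < j \<Longrightarrow> \<bar>\<integral>\<omega>. total_surprise (r i) \<omega> * total_surprise (r j) \<omega> \<partial>M\<bar> \<le> 1 / real (Suc j)"
    by (rule almost_orthogonal_subsequence) (rule that)
  \<comment> \<open>Blocks start at \<open>m\<close>, so that the grids in them are fine and their surprises orthogonal up to \<open>1 / m\<close>. With
  \<open>m = 16 ^ p\<close> the averages have mean absolute value at most \<open>3 / 4 ^ p\<close>, which still is summable after
  division by the level \<open>1 / 2 ^ p\<close>.\<close>
  define block where "block m = {m<..2 * m}" for m :: nat
  have block: "finite (block m)" "card (block m) = m" for m by (auto simp: block_def)
  define W where "W m \<omega> = (\<Sum>j\<in>block m. total_surprise (r j) \<omega>) / real m" for m \<omega>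
  define C where "C m t \<omega> = (\<Sum>j\<in>block m. compensator (r j) t \<omega>) / real m" for m t \<omega>
  define Y where "Y t \<omega> = lim (\<lambda>p. C (16 ^ p) t \<omega>)" for t \<omega>
  have W_meas[measurable]: "W m \<in> borel_measurable M" for m unfolding W_def[abs_def] by measurable
  have iR: "integrable M (total_surprise n)" for n by (rule bounded_integrable[OF _ total_surprise_bound]) simp
  have iRR: "integrable M (\<lambda>\<omega>. total_surprise i \<omega> * total_surprise j \<omega>)" for i j
    by (rule bounded_mult_integrable[OF _ _ total_surprise_bound total_surprise_bound]) auto
  have iW: "integrable M (W m)" for m unfolding W_def[abs_def] using iR by simp
  have iW2: "integrable M (\<lambda>\<omega>. (W m \<omega>)\<^sup>2)" for m
    unfolding W_def power2_eq_square using iRR by (simp add: sum_product)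
  have W2: "(\<integral>\<omega>. (W m \<omega>)\<^sup>2 \<partial>M) \<le> 2 / real m" if m: "0 < m" for m
  proof -
    let ?I = "\<lambda>i j. \<integral>\<omega>. total_surprise (r i) \<omega> * total_surprise (r j) \<omega> \<partial>M"
    have I: "?I i j \<le> (if i = j then 1 else 0) + 1 / real m" if "i \<in> block m" "j \<in> block m" for i j
    proof (cases i j rule: linorder_cases)
      case less
      have "1 / real (Suc j) \<le> 1 / real m" using that m by (intro divide_left_mono) (auto simp: block_def)
      then show ?thesis using orth[OF less] less by simp
    next
      case greater
      have "1 / real (Suc i) \<le> 1 / real m" using that m by (intro divide_left_mono) (auto simp: block_def)
      then show ?thesis using orth[OF greater] greater by (simp add: mult.commute)
    next
      case equal
      then show ?thesis using total_surprise_L2[of "r j"] by (simp add: power2_eq_square add_increasing2)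
    qed
    have "(\<integral>\<omega>. (W m \<omega>)\<^sup>2 \<partial>M) = (\<Sum>i\<in>block m. \<Sum>j\<in>block m. ?I i j) / (real m)\<^sup>2"
      unfolding W_def power2_eq_square using iRR by (simp add: sum_product)
    also have "\<dots> \<le> (\<Sum>i\<in>block m. \<Sum>j\<in>block m. (if i = j then 1 else 0) + 1 / real m) / (real m)\<^sup>2"
      by (intro divide_right_mono sum_mono I) auto
    also have "(\<Sum>i\<in>block m. \<Sum>j\<in>block m. (if i = j then 1 else 0) + 1 / real m) = 2 * real m"
      using m block[of m] by (simp add: sum.distrib)
    also have "2 * real m / (real m)\<^sup>2 = 2 / real m" by (simp add: power2_eq_square)
    finally show ?thesis .
  qed
  have W1: "(\<integral>\<omega>. \<bar>W (16 ^ p) \<omega>\<bar> \<partial>M) \<le> 3 / 4 ^ p" for p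
  proof -
    have "\<bar>W (16 ^ p) \<omega>\<bar> \<le> 4 ^ p * (W (16 ^ p) \<omega>)\<^sup>2 + 1 / 4 ^ p" for \<omega>
      using abs_mult_le_weighted[of "4 ^ p" "W (16 ^ p) \<omega>" 1] by simp
    then have "(\<integral>\<omega>. \<bar>W (16 ^ p) \<omega>\<bar> \<partial>M) \<le> (\<integral>\<omega>. 4 ^ p * (W (16 ^ p) \<omega>)\<^sup>2 + 1 / 4 ^ p \<partial>M)"
      using iW iW2 by (intro integral_mono integrable_abs Bochner_Integration.integrable_add integrable_mult_right) auto
    also have "\<dots> = 4 ^ p * (\<integral>\<omega>. (W (16 ^ p) \<omega>)\<^sup>2 \<partial>M) + 1 / 4 ^ p"
      using iW2 by (simp add: prob_space)
    also have "\<dots> \<le> 4 ^ p * (2 / real (16 ^ p)) + 1 / 4 ^ p"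
      by (intro add_mono mult_left_mono W2) auto
    also have "\<dots> = 3 / 4 ^ p"
    proof -
      have "(16::real) ^ p = 4 ^ p * 4 ^ p" by (simp flip: power_mult_distrib)
      then show ?thesis by simp
    qed
    finally show ?thesis .
  qed
  define A where "A p = {\<omega>\<in>space M. \<exists>n k. 1 / 2 ^ p \<le> \<bar>real_cond_exp M (past (dyadic n k)) (W (16 ^ p)) \<omega>\<bar>}" for p :: nat
  have A: "A p \<in> events" "prob (A p) \<le> 3 * (1 / 2) ^ p" for p
  proof -
    note max = maximal_inequality_dyadic[OF iW[of "16 ^ p"], of "1 / 2 ^ p", folded A_def]
    show "A p \<in> events" by (rule max) simp
    have "prob (A p) \<le> (\<integral>\<omega>. \<bar>W (16 ^ p) \<omega>\<bar> \<partial>M) / (1 / 2 ^ p)" by (rule max) simp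
    also have "\<dots> \<le> 3 / 4 ^ p * 2 ^ p" using mult_right_mono[OF W1[of p], of "2 ^ p"] by simp
    also have "\<dots> = 3 * (1 / 2) ^ p"
    proof -
      have "(4::real) ^ p = 2 ^ p * 2 ^ p" by (simp flip: power_mult_distrib)
      then show ?thesis by (simp add: power_one_over)
    qed
    finally show "prob (A p) \<le> 3 * (1 / 2) ^ p" .
  qed
  have "summable (\<lambda>p. prob (A p))"
  proof (rule summable_comparison_test')
    show "summable (\<lambda>p. 3 * (1 / 2 :: real) ^ p)" by (intro summable_mult summable_geometric) auto
    show "norm (prob (A p)) \<le> 3 * (1 / 2) ^ p" for p using A(2)[of p] by simp
  qed
  then have small: "AE \<omega> in M. eventually (\<lambda>p. \<omega> \<in> space M - A p) sequentially"
    using A(1) by (intro borel_cantelli_AE1) (auto simp: emeasure_eq_measure)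
  have linear: "AE \<omega> in M. \<forall>m n k. real_cond_exp M (past (dyadic n k)) (W m) \<omega>
      = (\<Sum>j\<in>block m. real_cond_exp M (past (dyadic n k)) (total_surprise (r j)) \<omega>) / real m"
    unfolding AE_all_countable
  proof (intro allI)
    fix m n k
    interpret P: sigma_finite_subalgebra M "past (dyadic n k)" by (rule sigma_finite_subalgebraI[OF subalg_past_M])
    have "AE \<omega> in M. real_cond_exp M (past (dyadic n k)) (W m) \<omega>
        = real_cond_exp M (past (dyadic n k)) (\<lambda>\<omega>. \<Sum>j\<in>block m. total_surprise (r j) \<omega>) \<omega> / real m"
      unfolding W_def[abs_def] using iR by (intro P.real_cond_exp_cdiv) auto
    moreover have "AE \<omega> in M. real_cond_exp M (past (dyadic n k)) (\<lambda>\<omega>. \<Sum>j\<in>block m. total_surprise (r j) \<omega>) \<omega>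
        = (\<Sum>j\<in>block m. real_cond_exp M (past (dyadic n k)) (total_surprise (r j)) \<omega>)"
      using iR by (intro P.real_cond_exp_sum) auto
    ultimately show "AE \<omega> in M. real_cond_exp M (past (dyadic n k)) (W m) \<omega>
      = (\<Sum>j\<in>block m. real_cond_exp M (past (dyadic n k)) (total_surprise (r j)) \<omega>) / real m"
      by eventually_elim simp
  qed
  have upper: "AE \<omega> in M. \<forall>n k. 1 \<le> k \<longrightarrow> k \<le> n * 2 ^ n \<longrightarrow> (\<Sum>j<k. predicted_step n j \<omega>)
    = y (dyadic n k) \<omega> - real_cond_exp M (past (dyadic n k)) (total_surprise n) \<omega>"
    unfolding AE_all_countable
  proof (intro allI)
    fix n k
    show "AE \<omega> in M. 1 \<le> k \<longrightarrow> k \<le> n * 2 ^ n \<longrightarrow> (\<Sum>j<k. predicted_step n j \<omega>)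
      = y (dyadic n k) \<omega> - real_cond_exp M (past (dyadic n k)) (total_surprise n) \<omega>"
      by (cases "1 \<le> k \<and> k \<le> n * 2 ^ n")
         (auto intro: eventually_mono[OF predicted_sum_at_grid_point])
  qed
  have lower: "AE \<omega> in M. \<forall>n k n' k'. k < n * 2 ^ n \<longrightarrow> dyadic n k \<le> dyadic n' k' \<longrightarrow> dyadic n' k' < dyadic n (Suc k) \<longrightarrow>
     y (dyadic n' k') \<omega> - real_cond_exp M (past (dyadic n' k')) (total_surprise n) \<omega> \<le> (\<Sum>j\<le>k. predicted_step n j \<omega>)"
    unfolding AE_all_countable
  proof (intro allI)
    fix n k n' k'
    show "AE \<omega> in M. k < n * 2 ^ n \<longrightarrow> dyadic n k \<le> dyadic n' k' \<longrightarrow> dyadic n' k' < dyadic n (Suc k) \<longrightarrow>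
       y (dyadic n' k') \<omega> - real_cond_exp M (past (dyadic n' k')) (total_surprise n) \<omega> \<le> (\<Sum>j\<le>k. predicted_step n j \<omega>)"
      by (cases "k < n * 2 ^ n \<and> dyadic n k \<le> dyadic n' k' \<and> dyadic n' k' < dyadic n (Suc k)")
         (auto intro: eventually_mono[OF predicted_sum_in_cell])
  qed
  have "AE \<omega> in M. \<forall>t\<ge>0. ((\<lambda>s. y s \<omega>) \<longlongrightarrow> Y t \<omega>) (at_right t)"
    using small linear upper lower
  proof eventually_elim
    case (elim \<omega>)
    show ?case
    proof (intro allI impI)
      fix t :: real assume t: "0 \<le> t"
      define l where "l = (INF s\<in>{t<..}. y s \<omega>)"
      have bb: "bdd_below ((\<lambda>s. y s \<omega>) ` {t<..})"
        using y0 t by (intro bdd_belowI[of _ 0]) auto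
      have l_le: "l \<le> y s \<omega>" if "t < s" for s
        unfolding l_def using that bb by (intro cINF_lower) auto
      have l_appr: "\<exists>s>t. y s \<omega> < l + e" if "0 < e" for e
        using cINF_less_iff[of "{t<..}" "\<lambda>s. y s \<omega>" "l + e"] bb that unfolding l_def by auto
      have right: "((\<lambda>s. y s \<omega>) \<longlongrightarrow> l) (at_right t)"
      proof (rule order_tendstoI)
        fix a assume "a < l"
        then show "eventually (\<lambda>s. a < y s \<omega>) (at_right t)"
          unfolding eventually_at_right_field using l_le by (intro exI[of _ "t + 1"]) (auto intro: less_le_trans)
      next
        fix a assume "l < a"
        then obtain s where s: "t < s" "y s \<omega> < a" using l_appr[of "a - l"] by auto
        have "y s' \<omega> < a" if "t < s'" "s' < s" for s'
          using y_mono[of s' s \<omega>] that t s(2) by simp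
        then show "eventually (\<lambda>s. y s \<omega> < a) (at_right t)"
          unfolding eventually_at_right_field using s(1) by (intro exI[of _ s]) simp
      qed
      have "(\<lambda>p. C (16 ^ p) t \<omega>) \<longlonglongrightarrow> l"
      proof (rule LIMSEQ_I)
        fix e :: real assume e: "0 < e"
        obtain s0 where s0: "t < s0" "y s0 \<omega> < l + e / 2" using l_appr[of "e / 2"] e by auto
        obtain n0 k0 where s: "t < dyadic n0 k0" "dyadic n0 k0 < s0" using dyadic_between[OF t s0(1)] .
        let ?s = "dyadic n0 k0"
        have ys: "y ?s \<omega> < l + e / 2" using y_mono[of ?s s0 \<omega>] s(2) s0(2) by simp
        obtain p1 where p1: "\<And>p. p \<ge> p1 \<Longrightarrow> \<omega> \<in> space M - A p" using elim(1) by (auto simp: eventually_sequentially)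
        obtain p2 where p2: "1 / 2 ^ p2 < e / 2"
          using real_arch_pow_inv[of "e / 2" "1/2"] e by (auto simp: power_one_over)
        obtain p3 :: nat where p3: "?s + 1 + real n0 + real k0 < real p3" using reals_Archimedean2 by blast
        have "\<bar>C (16 ^ p) t \<omega> - l\<bar> < e" if p: "p \<ge> max p1 (max p2 p3)" for p
        proof -
          define m :: nat where "m = 16 ^ p"
          have m0: "0 < m" "p \<le> m" unfolding m_def using less_exp[of p] power_mono[of 2 "16::nat" p] by auto
          have eps: "1 / 2 ^ p < e / 2"
          proof -
            have "(1::real) / 2 ^ p \<le> 1 / 2 ^ p2" using p by (intro divide_left_mono power_increasing) auto
            then show ?thesis using p2 by simp
          qed
          have wsmall: "\<bar>real_cond_exp M (past (dyadic n k)) (W m) \<omega>\<bar> < 1 / 2 ^ p" for n k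
            using p1[of p] p unfolding A_def m_def by (auto simp: not_le)
          have rj: "p \<le> r j" if "j \<in> block m" for j
            using that m0(2) strict_mono_imp_increasing[OF r, of j] unfolding block_def by auto
          have bigr: "n0 \<le> r j" "?s < real (r j)" if "j \<in> block m" for j
            using rj[OF that] p p3 dyadic_nonneg[of n0 k0] by linarith+
          have up: "compensator (r j) t \<omega> \<le> y ?s \<omega> - real_cond_exp M (past ?s) (total_surprise (r j)) \<omega>"
            if j: "j \<in> block m" for j
          proof -
            define k where "k = k0 * 2 ^ (r j - n0)"
            have sk: "?s = dyadic (r j) k" unfolding k_def by (rule dyadic_refine[OF bigr(1)[OF j]])
            have k1: "1 \<le> k" using s(1) t unfolding sk by (cases k) auto
            have "dyadic (r j) k < dyadic (r j) (r j * 2 ^ r j)" using bigr(2)[OF j] sk by simp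
            then have k2: "k \<le> r j * 2 ^ r j" unfolding dyadic_less_iff by simp
            show ?thesis
              using compensator_before_grid_point[OF k2, of t \<omega>] s(1) elim(3) k1 k2 unfolding sk by auto
          qed
          have "C m t \<omega> \<le> (\<Sum>j\<in>block m. y ?s \<omega> - real_cond_exp M (past ?s) (total_surprise (r j)) \<omega>) / real m"
            unfolding C_def by (intro divide_right_mono sum_mono up) auto
          also have "\<dots> = y ?s \<omega> - real_cond_exp M (past ?s) (W m) \<omega>"
            using elim(2) m0(1) block[of m] by (simp add: sum_subtractf diff_divide_distrib)
          finally have U: "C m t \<omega> < l + e" using wsmall[of n0 k0] eps ys by linarith
          \<comment> \<open>For the lower bound, \<open>u\<close> is a common right bound for the cells that contain \<open>t\<close>.\<close>
          define cell where "cell j = (SOME k. dyadic (r j) k \<le> t \<and> t < dyadic (r j) (Suc k))" for j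
          have cell: "dyadic (r j) (cell j) \<le> t \<and> t < dyadic (r j) (Suc (cell j))" for j
            unfolding cell_def by (rule someI_ex) (rule dyadic_cell[OF t, of "r j"], blast)
          define u where "u = Min (insert (t + 1) ((\<lambda>j. dyadic (r j) (Suc (cell j))) ` block m))"
          have "t < u" unfolding u_def using cell block by (subst Min_gr_iff) auto
          then obtain n1 k1 where s1: "t < dyadic n1 k1" "dyadic n1 k1 < u" using dyadic_between[OF t] by blast
          let ?s1 = "dyadic n1 k1"
          have lo: "y ?s1 \<omega> - real_cond_exp M (past ?s1) (total_surprise (r j)) \<omega> \<le> compensator (r j) t \<omega>"
            if j: "j \<in> block m" for j
          proof -
            have "u \<le> dyadic (r j) (Suc (cell j))" unfolding u_def using j block by (intro Min_le) auto
            then have c1: "dyadic (r j) (cell j) \<le> ?s1" "?s1 < dyadic (r j) (Suc (cell j))"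
              using s1 cell[of j] by auto
            have "dyadic (r j) (cell j) < dyadic (r j) (r j * 2 ^ r j)"
              using cell[of j] s(1) bigr(2)[OF j] by simp
            then have k: "cell j < r j * 2 ^ r j" unfolding dyadic_less_iff .
            show ?thesis
              using elim(4) k c1 compensator_cell[OF k, of t \<omega>] cell[of j] by auto
          qed
          have "l - 1 / 2 ^ p < y ?s1 \<omega> - real_cond_exp M (past ?s1) (W m) \<omega>"
            using l_le[OF s1(1)] wsmall[of n1 k1] by linarith
          also have "\<dots> = (\<Sum>j\<in>block m. y ?s1 \<omega> - real_cond_exp M (past ?s1) (total_surprise (r j)) \<omega>) / real m"
            using elim(2) m0(1) block[of m] by (simp add: sum_subtractf diff_divide_distrib)
          also have "\<dots> \<le> C m t \<omega>"
            unfolding C_def by (intro divide_right_mono sum_mono lo) auto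
          finally have "l - 1 / 2 ^ p < C m t \<omega>" .
          then show ?thesis using U eps unfolding m_def by (simp add: abs_less_iff)
        qed
        then show "\<exists>no. \<forall>p\<ge>no. norm (C (16 ^ p) t \<omega> - l) < e"
          by (intro exI[of _ "max p1 (max p2 p3)"]) simp
      qed
      then have "Y t \<omega> = l" unfolding Y_def by (rule limI)
      with right show "((\<lambda>s. y s \<omega>) \<longlongrightarrow> Y t \<omega>) (at_right t)" by simp
    qed
  qed
  moreover have "progressively_measurable F Y"
    unfolding progressively_measurable_def
  proof (intro allI impI)
    fix T :: real assume T: "0 \<le> T"
    show "(\<lambda>(s, \<omega>). Y s \<omega>) \<in> borel_measurable (restrict_space borel {0..T} \<Otimes>\<^sub>M F T)"
      unfolding Y_def C_def case_prod_beta
      by (intro borel_measurable_lim_metric borel_measurable_divide borel_measurable_sum borel_measurable_const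
          compensator_progressive[OF T, unfolded case_prod_beta])
  qed
  ultimately show ?thesis by blast
qed

end

section \<open>Discounted costs as integrals over time\<close>

lemma nn_integral_exp_tail:
  assumes "0 < \<rho>"
  shows "(\<integral>\<^sup>+ t. ennreal (\<rho> * exp (- \<rho> * t)) * indicator {s..} t \<partial>lborel) = ennreal (exp (- \<rho> * s))"
proof -
  have "(\<integral>\<^sup>+ t. ennreal (\<rho> * exp (- \<rho> * t)) * indicator {s..} t \<partial>lborel) = ennreal (0 - (- exp (- \<rho> * s)))"
  proof (rule nn_integral_FTC_atLeast)
    show "((\<lambda>t. - exp (- \<rho> * t)) has_real_derivative \<rho> * exp (- \<rho> * t)) (at t)" for t
      by (auto intro!: derivative_eq_intros)
    have "((\<lambda>t. exp (- (\<rho> * t))) \<longlongrightarrow> 0) at_top"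
      using assms by (intro filterlim_compose[OF exp_at_bot] filterlim_uminus_at_bot_at_top[THEN filterlim_compose]
          filterlim_tendsto_pos_mult_at_top[OF tendsto_const]) (auto intro: filterlim_ident)
    then show "((\<lambda>t. - exp (- \<rho> * t)) \<longlongrightarrow> 0) at_top"
      using tendsto_minus by fastforce
  qed (use assms in auto)
  then show ?thesis by simp
qed

text \<open>Write \<open>exp (- \<rho> s)\<close> as the integral of \<open>\<rho> exp (- \<rho> t)\<close> over \<open>t \<ge> s\<close> and exchange the integrals. The Stieltjes
  mass of \<open>[0, t]\<close> is \<open>\<zeta>\<^sub>t\<close>, the initial jump included, because the extended path vanishes before \<open>0\<close>.\<close>

lemma discounted_total_eq:
  assumes c: "cadlag (ext_path \<zeta> \<omega>)" and m: "mono (ext_path \<zeta> \<omega>)" and \<rho>: "0 < \<rho>"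
  shows "discounted_total \<rho> \<zeta> \<omega> = (\<integral>\<^sup>+ t\<in>{0..}. ennreal (\<rho> * exp (- \<rho> * t) * \<zeta> t \<omega>) \<partial>lborel)"
proof -
  let ?f = "ext_path \<zeta> \<omega>" and ?\<mu> = "interval_measure (ext_path \<zeta> \<omega>)"
  have rc: "continuous (at_right a) ?f" for a using c unfolding cadlag_def by simp
  have mono: "x \<le> y \<Longrightarrow> ?f x \<le> ?f y" for x y using m by (rule monoD)
  have Ioc: "emeasure ?\<mu> {a<..b} = ennreal (?f b - ?f a)" if "a \<le> b" for a b
    using emeasure_interval_measure_Ioc[OF that mono rc] by simp
  interpret \<mu>: sigma_finite_measure ?\<mu> by (rule sigma_finite_interval_measure[OF mono rc])
  interpret P: pair_sigma_finite ?\<mu> lborel ..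
  \<comment> \<open>The half-open interval from \<open>- 1\<close> is used to reach the atom at \<open>0\<close>; what precedes \<open>0\<close> is a null set.\<close>
  have neg: "emeasure ?\<mu> {- 1<..<0} = 0"
  proof -
    have "{- 1<..<(0::real)} = (\<Union>n. {- 1<..- (1 / real (Suc n))})"
    proof (intro set_eqI iffI)
      fix x :: real assume x: "x \<in> {- 1<..<0}"
      then obtain n where "1 / real (Suc n) < - x" using nat_approx_posE[of "- x"] by auto
      then show "x \<in> (\<Union>n. {- 1<..- (1 / real (Suc n))})" using x by (intro UN_I[of n]) auto
    next
      fix x :: real assume "x \<in> (\<Union>n. {- 1<..- (1 / real (Suc n))})"
      then obtain n where "- 1 < x" "x \<le> - (1 / real (Suc n))" by auto
      moreover have "- (1 / real (Suc n)) < 0" by simp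
      ultimately show "x \<in> {- 1<..<0}" by (auto intro: le_less_trans)
    qed
    also have "emeasure ?\<mu> \<dots> = 0"
    proof (rule emeasure_UN_eq_0)
      fix n
      have "ext_path \<zeta> \<omega> (- (1 / real (Suc n))) = 0" "ext_path \<zeta> \<omega> (- 1) = 0"
        by (auto simp: ext_path_def divide_simps)
      then show "emeasure ?\<mu> {- 1<..- (1 / real (Suc n))} = 0"
        by (subst Ioc) (auto simp: divide_simps)
    qed auto
    finally show ?thesis .
  qed
  have Icc: "emeasure ?\<mu> {0..t} = ennreal (\<zeta> t \<omega>)" if "0 \<le> t" for t
  proof -
    have "{- 1<..t} = {- 1<..<0} \<union> {0..t}" using that by auto
    moreover have "emeasure ?\<mu> ({- 1<..<0} \<union> {0..t}) = emeasure ?\<mu> {- 1<..<0} + emeasure ?\<mu> {0..t}"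
      by (rule plus_emeasure[symmetric]) auto
    ultimately have "emeasure ?\<mu> {- 1<..t} = emeasure ?\<mu> {- 1<..<0} + emeasure ?\<mu> {0..t}" by simp
    moreover have "emeasure ?\<mu> {- 1<..t} = ennreal (\<zeta> t \<omega>)"
      using Ioc[of "- 1" t] that by (simp add: ext_path_def)
    ultimately show ?thesis using neg by simp
  qed
  have "discounted_total \<rho> \<zeta> \<omega>
      = (\<integral>\<^sup>+ s. (\<integral>\<^sup>+ t. ennreal (\<rho> * exp (- \<rho> * t)) * indicator {s..} t \<partial>lborel) * indicator {0..} s \<partial>?\<mu>)"
    unfolding discounted_total_def nn_integral_exp_tail[OF \<rho>] ..
  also have "\<dots> = (\<integral>\<^sup>+ s. (\<integral>\<^sup>+ t. ennreal (\<rho> * exp (- \<rho> * t)) * indicator {0..t} s \<partial>lborel) \<partial>?\<mu>)"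
    by (subst nn_integral_multc[symmetric]) (auto intro!: nn_integral_cong split: split_indicator)
  also have "\<dots> = (\<integral>\<^sup>+ t. (\<integral>\<^sup>+ s. ennreal (\<rho> * exp (- \<rho> * t)) * indicator {0..t} s \<partial>?\<mu>) \<partial>lborel)"
  proof (rule P.Fubini'[symmetric])
    have "{z::real \<times> real. 0 \<le> fst z \<and> fst z \<le> snd z} \<in> sets (borel \<Otimes>\<^sub>M borel)"
      unfolding borel_prod by (intro borel_closed closed_Collect_conj closed_Collect_le continuous_intros)
    then have "(\<lambda>z. indicator {z::real \<times> real. 0 \<le> fst z \<and> fst z \<le> snd z} z :: ennreal) \<in> borel_measurable (?\<mu> \<Otimes>\<^sub>M lborel)"
      by (intro borel_measurable_indicator) (simp cong: sets_pair_measure_cong)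
    moreover have "(\<lambda>z. ennreal (\<rho> * exp (- \<rho> * snd z))) \<in> borel_measurable (?\<mu> \<Otimes>\<^sub>M lborel)"
      by measurable
    ultimately have "(\<lambda>z. ennreal (\<rho> * exp (- \<rho> * snd z)) * indicator {z::real \<times> real. 0 \<le> fst z \<and> fst z \<le> snd z} z)
        \<in> borel_measurable (?\<mu> \<Otimes>\<^sub>M lborel)" by measurable
    also have "(\<lambda>z. ennreal (\<rho> * exp (- \<rho> * snd z)) * indicator {z::real \<times> real. 0 \<le> fst z \<and> fst z \<le> snd z} z)
      = (\<lambda>(s, t). ennreal (\<rho> * exp (- \<rho> * t)) * indicator {0..t} s)" by (auto split: split_indicator)
    finally show "(\<lambda>(s, t). ennreal (\<rho> * exp (- \<rho> * t)) * indicator {0..t} s) \<in> borel_measurable (?\<mu> \<Otimes>\<^sub>M lborel)" .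
  qed
  also have "\<dots> = (\<integral>\<^sup>+ t. ennreal (\<rho> * exp (- \<rho> * t)) * emeasure ?\<mu> {0..t} \<partial>lborel)"
    by (intro nn_integral_cong) (simp add: nn_integral_cmult)
  also have "\<dots> = (\<integral>\<^sup>+ t\<in>{0..}. ennreal (\<rho> * exp (- \<rho> * t) * \<zeta> t \<omega>) \<partial>lborel)"
    using \<rho> Icc by (intro nn_integral_cong) (auto simp: ennreal_mult' split: split_indicator)
  finally show ?thesis .
qed

definition discounting :: "real \<Rightarrow> real measure" where
  "discounting \<rho> = density lborel (\<lambda>t. ennreal (exp (- \<rho> * t)) * indicator {0..} t)"

lemma sets_discounting [measurable_cong, simp]: "sets (discounting \<rho>) = sets borel"
  and space_discounting [simp]: "space (discounting \<rho>) = UNIV"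
  by (simp_all add: discounting_def)

lemma nn_integral_discounting:
  assumes "f \<in> borel_measurable borel"
  shows "(\<integral>\<^sup>+ t. f t \<partial>discounting \<rho>) = (\<integral>\<^sup>+ t\<in>{0..}. ennreal (exp (- \<rho> * t)) * f t \<partial>lborel)"
proof -
  have "(\<integral>\<^sup>+ t. f t \<partial>discounting \<rho>) = (\<integral>\<^sup>+ t. (ennreal (exp (- \<rho> * t)) * indicator {0..} t) * f t \<partial>lborel)"
    unfolding discounting_def using assms by (intro nn_integral_density) auto
  then show ?thesis by (simp add: mult_ac)
qed

lemma AE_discounting: "(AE t in discounting \<rho>. P t) \<longleftrightarrow> (AE t in lborel. 0 \<le> t \<longrightarrow> P t)"
proof -
  have "(AE t in discounting \<rho>. P t) \<longleftrightarrow> (AE t in lborel. 0 < ennreal (exp (- \<rho> * t)) * indicator {0..} t \<longrightarrow> P t)"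
    unfolding discounting_def by (rule AE_density) measurable
  also have "\<dots> \<longleftrightarrow> (AE t in lborel. 0 \<le> t \<longrightarrow> P t)"
    by (intro AE_cong) (auto split: split_indicator)
  finally show ?thesis .
qed

lemma finite_measure_discounting:
  assumes "0 < \<rho>" shows "finite_measure (discounting \<rho>)"
proof
  have "emeasure (discounting \<rho>) (space (discounting \<rho>)) = (\<integral>\<^sup>+ t. 1 \<partial>discounting \<rho>)" by simp
  also have "\<dots> = (\<integral>\<^sup>+ t. ennreal (1 / \<rho>) * (ennreal (\<rho> * exp (- \<rho> * t)) * indicator {0..} t) \<partial>lborel)"
    using assms by (subst nn_integral_discounting)
      (auto intro!: nn_integral_cong simp: ennreal_mult'[symmetric] split: split_indicator)
  also have "\<dots> = ennreal (1 / \<rho>)"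
    using assms nn_integral_exp_tail[OF assms, of 0] by (subst nn_integral_cmult) auto
  finally show "emeasure (discounting \<rho>) (space (discounting \<rho>)) \<noteq> \<infinity>" by simp
qed

lemma countable_AE_discounting:
  assumes "countable X" shows "AE t in discounting \<rho>. t \<notin> X"
proof -
  have "AE t in lborel. t \<notin> X"
    using AE_not_in[OF countable_imp_null_set_lborel[OF assms]] .
  then show ?thesis unfolding AE_discounting by auto
qed

text \<open>A monotone path is continuous off a countable set of times.\<close>

lemma AE_discounting_isCont:
  fixes f :: "real \<Rightarrow> real"
  assumes "\<And>s t. 0 \<le> s \<Longrightarrow> s \<le> t \<Longrightarrow> f s \<le> f t"
  shows "AE t in discounting \<rho>. 0 < t \<and> isCont f t"
proof -
  have "mono_on {0<..} f" using assms by (intro mono_onI) auto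
  then have "countable {a\<in>{0<..}. \<not> continuous (at a within {0<..}) f}" by (rule mono_on_ctble_discont)
  then have "AE t in discounting \<rho>. t \<notin> {0} \<union> {a\<in>{0<..}. \<not> continuous (at a within {0<..}) f}"
    by (intro countable_AE_discounting) auto
  moreover have "AE t in discounting \<rho>. 0 \<le> t" unfolding AE_discounting by simp
  ultimately show ?thesis
  proof eventually_elim
    case (elim t)
    then have "0 < t" by auto
    then show ?case using elim by (auto simp: at_within_open[of t "{0<..}"])
  qed
qed

section \<open>Joint measurability of processes\<close>

text \<open>The index of the last grid point that is not after \<open>t\<close>.\<close>

definition floor_dyadic :: "nat \<Rightarrow> real \<Rightarrow> nat" where
  "floor_dyadic n t = nat \<lfloor>t * 2 ^ n\<rfloor>"

lemma floor_dyadic: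
  assumes "0 \<le> t"
  shows "dyadic n (floor_dyadic n t) \<le> t" "t < dyadic n (floor_dyadic n t) + 1 / 2 ^ n"
proof -
  have "real (floor_dyadic n t) = of_int \<lfloor>t * 2 ^ n\<rfloor>" unfolding floor_dyadic_def using assms by simp
  then have "real (floor_dyadic n t) \<le> t * 2 ^ n" "t * 2 ^ n < real (floor_dyadic n t) + 1" by linarith+
  then show "dyadic n (floor_dyadic n t) \<le> t" "t < dyadic n (floor_dyadic n t) + 1 / 2 ^ n"
    by (auto simp: dyadic_def field_simps)
qed

lemma floor_dyadic_tendsto:
  assumes "0 \<le> t" shows "(\<lambda>n. dyadic n (floor_dyadic n t)) \<longlonglongrightarrow> t"
proof (rule tendsto_sandwich[of "\<lambda>n. t - (1 / 2) ^ n"])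
  have "(\<lambda>n. t - (1 / 2) ^ n) \<longlonglongrightarrow> t - 0" by (intro tendsto_intros LIMSEQ_power_zero) auto
  then show "(\<lambda>n. t - (1 / 2) ^ n) \<longlonglongrightarrow> t" by simp
  show "\<forall>\<^sub>F n in sequentially. t - (1 / 2) ^ n \<le> dyadic n (floor_dyadic n t)"
    using floor_dyadic(2)[OF assms] by (intro always_eventually allI) (simp add: power_one_over less_imp_le algebra_simps)
  show "\<forall>\<^sub>F n in sequentially. dyadic n (floor_dyadic n t) \<le> t"
    using floor_dyadic(1)[OF assms] by simp
qed simp

lemma floor_dyadic_mono: "s \<le> t \<Longrightarrow> floor_dyadic n s \<le> floor_dyadic n t"
  unfolding floor_dyadic_def by (intro nat_mono floor_mono mult_right_mono) auto

lemma step_process_measurable: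
  fixes f :: "nat \<Rightarrow> 'a \<Rightarrow> 'b::topological_space"
  assumes "\<And>k. f k \<in> borel_measurable M"
  shows "(\<lambda>z. f (floor_dyadic n (snd z)) (fst z)) \<in> borel_measurable (M \<Otimes>\<^sub>M borel)"
proof (rule measurable_compose_countable[where f="\<lambda>k z. f k (fst z)"])
  show "(\<lambda>z. f k (fst z)) \<in> borel_measurable (M \<Otimes>\<^sub>M borel)" for k
    by (rule measurable_compose[OF measurable_fst assms])
  show "(\<lambda>z. floor_dyadic n (snd z)) \<in> measurable (M \<Otimes>\<^sub>M borel) (count_space UNIV)"
    unfolding floor_dyadic_def by measurable
qed

lemma continuous_process_measurable:
  fixes X :: "real \<Rightarrow> 'a \<Rightarrow> 'b::{metric_space}"
  assumes X: "\<And>t. 0 \<le> t \<Longrightarrow> X t \<in> borel_measurable M"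
    and cont: "\<And>\<omega>. \<omega> \<in> space M \<Longrightarrow> continuous_on {0..} (\<lambda>t. X t \<omega>)"
  shows "(\<lambda>z. X (max 0 (snd z)) (fst z)) \<in> borel_measurable (M \<Otimes>\<^sub>M borel)"
proof (rule borel_measurable_LIMSEQ_metric)
  fix n
  have "(\<lambda>z. X (dyadic n (floor_dyadic n (snd z))) (fst z)) \<in> borel_measurable (M \<Otimes>\<^sub>M borel)"
    by (rule step_process_measurable[of "\<lambda>k. X (dyadic n k)"]) (auto intro: X)
  from measurable_compose[OF _ this, of "\<lambda>z. (fst z, max 0 (snd z))"]
  show "(\<lambda>z. X (dyadic n (floor_dyadic n (max 0 (snd z)))) (fst z)) \<in> borel_measurable (M \<Otimes>\<^sub>M borel)"
    by simp
next
  fix z assume "z \<in> space (M \<Otimes>\<^sub>M (borel :: real measure))"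
  then have "fst z \<in> space M" by (auto simp: space_pair_measure)
  from cont[OF this] show "(\<lambda>n. X (dyadic n (floor_dyadic n (max 0 (snd z)))) (fst z)) \<longlonglongrightarrow> X (max 0 (snd z)) (fst z)"
    by (rule continuous_on_tendsto_compose[OF _ floor_dyadic_tendsto]) auto
qed

lemma (in brownian_space) progressive_jointly_measurable:
  assumes p: "progressively_measurable F \<zeta>"
  shows "(\<lambda>z. \<zeta> (max 0 (snd z)) (fst z)) \<in> borel_measurable (M \<Otimes>\<^sub>M borel)"
proof (rule borel_measurable_LIMSEQ_metric)
  fix n :: nat
  let ?R = "restrict_space borel {0..real n} :: real measure"
  have "(\<lambda>z. max 0 (min (real n) (snd z))) \<in> measurable (M \<Otimes>\<^sub>M borel) ?R"
    by (rule measurable_restrict_space2) auto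
  moreover have "fst \<in> measurable (M \<Otimes>\<^sub>M (borel :: real measure)) (F (real n))"
  proof -
    have "(\<lambda>x. x) \<in> measurable M (F (real n))"
      using subalg_F[of "real n"] by (intro measurableI) (auto simp: subalgebra_def sets.Int_space_eq2 subset_iff)
    from measurable_compose[OF measurable_fst this] show ?thesis .
  qed
  ultimately have "(\<lambda>z. (max 0 (min (real n) (snd z)), fst z)) \<in> measurable (M \<Otimes>\<^sub>M borel) (?R \<Otimes>\<^sub>M F (real n))"
    by (rule measurable_Pair)
  from measurable_compose[OF this, of "\<lambda>(s, \<omega>). \<zeta> s \<omega>" borel] p
  show "(\<lambda>z. \<zeta> (max 0 (min (real n) (snd z))) (fst z)) \<in> borel_measurable (M \<Otimes>\<^sub>M borel)"
    unfolding progressively_measurable_def by simp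
next
  fix z :: "'a \<times> real"
  obtain N :: nat where N: "snd z \<le> real N" using real_arch_simple by blast
  have "eventually (\<lambda>n. \<zeta> (max 0 (min (real n) (snd z))) (fst z) = \<zeta> (max 0 (snd z)) (fst z)) sequentially"
    using eventually_ge_at_top[of N] by eventually_elim (use N in \<open>auto simp: min_absorb2\<close>)
  then show "(\<lambda>n. \<zeta> (max 0 (min (real n) (snd z))) (fst z)) \<longlonglongrightarrow> \<zeta> (max 0 (snd z)) (fst z)"
    by (rule tendsto_eventually)
qed

lemma (in brownian_space) progressive_adapted:
  assumes p: "progressively_measurable F \<zeta>" and t: "0 \<le> t"
  shows "\<zeta> t \<in> borel_measurable (F t)"
proof -
  have "(\<lambda>\<omega>. (t, \<omega>)) \<in> measurable (F t) (restrict_space borel {0..t} \<Otimes>\<^sub>M F t)"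
    by (rule measurable_Pair1') (use t in \<open>simp add: space_restrict_space\<close>)
  from measurable_compose[OF this, of "\<lambda>(s, \<omega>). \<zeta> s \<omega>" borel] p t
  show ?thesis unfolding progressively_measurable_def by simp
qed

lemma sets_Collect_tendsto:
  fixes f :: "nat \<Rightarrow> 'a \<Rightarrow> real"
  assumes [measurable]: "\<And>n. f n \<in> borel_measurable M" "g \<in> borel_measurable M"
  shows "{x\<in>space M. (\<lambda>n. f n x) \<longlonglongrightarrow> g x} \<in> sets M"
proof -
  have eq: "(\<lambda>n. f n x) \<longlonglongrightarrow> g x \<longleftrightarrow> (\<forall>j. \<exists>N. \<forall>n\<in>{N..}. \<bar>f n x - g x\<bar> < 1 / real (Suc j))" for x
  proof
    assume L: "(\<lambda>n. f n x) \<longlonglongrightarrow> g x"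
    show "\<forall>j. \<exists>N. \<forall>n\<in>{N..}. \<bar>f n x - g x\<bar> < 1 / real (Suc j)"
    proof
      fix j
      have "0 < 1 / real (Suc j)" by simp
      from LIMSEQ_D[OF L this] show "\<exists>N. \<forall>n\<in>{N..}. \<bar>f n x - g x\<bar> < 1 / real (Suc j)" by auto
    qed
  next
    assume *: "\<forall>j. \<exists>N. \<forall>n\<in>{N..}. \<bar>f n x - g x\<bar> < 1 / real (Suc j)"
    show "(\<lambda>n. f n x) \<longlonglongrightarrow> g x"
    proof (rule LIMSEQ_I)
      fix e :: real assume "0 < e"
      then obtain j where "1 / real (Suc j) < e" using nat_approx_posE by blast
      moreover obtain N where "\<And>n. N \<le> n \<Longrightarrow> \<bar>f n x - g x\<bar> < 1 / real (Suc j)" using spec[OF *, of j] by auto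
      ultimately show "\<exists>N. \<forall>n\<ge>N. norm (f n x - g x) < e" by (auto intro: less_trans simp del: of_nat_Suc)
    qed
  qed
  show ?thesis unfolding eq by measurable
qed

section \<open>The regulator's problem as a convex minimisation\<close>

text \<open>The index \<open>Inl i\<close> stands for the increasing and \<open>Inr i\<close> for the decreasing part of player \<open>i\<close>.\<close>

definition net :: "('n::finite + 'n \<Rightarrow> real) \<Rightarrow> real ^ 'n" where
  "net a = (\<chi> i. a (Inl i) - a (Inr i))"

lemma norm_net_le:
  fixes a :: "'n::finite + 'n \<Rightarrow> real"
  assumes "\<And>c. \<bar>a c\<bar> \<le> m" shows "norm (net a) \<le> real CARD('n) * (2 * m)"
proof -
  have "norm (net a) \<le> (\<Sum>i\<in>UNIV. \<bar>net a $ i\<bar>)" by (rule norm_le_l1_cart)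
  also have "\<dots> \<le> (\<Sum>i\<in>(UNIV::'n set). 2 * m)"
  proof (rule sum_mono)
    fix i show "\<bar>net a $ i\<bar> \<le> 2 * m" using assms[of "Inl i"] assms[of "Inr i"] by (simp add: net_def)
  qed
  finally show ?thesis by simp
qed

lemma norm_net_clip_le:
  "norm (net (\<lambda>c. max 0 (min m (a c)))) \<le> norm (net a)" for a :: "'n::finite + 'n \<Rightarrow> real"
  unfolding norm_vec_def by (rule L2_set_mono) (auto simp: net_def)

lemma tendsto_net:
  assumes "\<And>c. ((\<lambda>n. f n c) \<longlongrightarrow> a c) F" shows "((\<lambda>n. net (f n)) \<longlongrightarrow> net a) F"
  unfolding net_def by (rule tendsto_vec_lambda) (intro tendsto_diff assms)

lemma power2_norm_add_le: "(norm (x + y))\<^sup>2 \<le> 2 * (norm x)\<^sup>2 + 2 * (norm y)\<^sup>2"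
proof -
  have "(norm (x + y))\<^sup>2 \<le> (norm x + norm y)\<^sup>2" by (intro power_mono norm_triangle_ineq) auto
  also have "\<dots> \<le> 2 * (norm x)\<^sup>2 + 2 * (norm y)\<^sup>2"
    using zero_le_power2[of "norm x - norm y"] by (simp add: power2_eq_square algebra_simps)
  finally show ?thesis .
qed

text \<open>The regulator's problem from a fixed initial state, in the form used for the minimisation. \<open>S\<close> is the
  state of the uncontrolled system and \<open>g\<close> a slope of supporting hyperplanes of \<open>H\<close>. Processes are
  extended to negative times by their value at \<open>0\<close>, which is harmless as the discounting measure
  charges positive times only.\<close>

locale singular_control = brownian_space M F B
  for M :: "'a measure" and F and B :: "real \<Rightarrow> 'a \<Rightarrow> real ^ 'd" +
  fixes \<rho> c C D :: real and \<kappa> :: "'n::finite + 'n \<Rightarrow> real"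
    and H :: "real ^ 'n \<Rightarrow> real" and g :: "real ^ 'n \<Rightarrow> real ^ 'n" and S :: "real \<Rightarrow> 'a \<Rightarrow> real ^ 'n"
  assumes \<rho>: "0 < \<rho>" and c: "0 < c" and C: "0 \<le> C" and D: "0 \<le> D" and \<kappa>: "\<And>i. 0 < \<kappa> i"
    and H_nonneg: "\<And>x. 0 \<le> H x" and H_growth: "\<And>x. H x \<le> C * (1 + (norm x)\<^sup>2)"
    and H_continuous: "continuous_on UNIV H"
    and H_support: "\<And>x y. H x + g x \<bullet> (y - x) \<le> H y"
    and g_measurable: "g \<in> borel_measurable borel" and g_growth: "\<And>x. norm (g x) \<le> D * (1 + norm x)"
    and H_strongly_convex: "\<And>x y. H ((1 / 2) *\<^sub>R (x + y)) \<le> (H x + H y) / 2 - c * (norm (x - y))\<^sup>2"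
    and S_joint: "(\<lambda>z. S (max 0 (snd z)) (fst z)) \<in> borel_measurable (M \<Otimes>\<^sub>M borel)"
    and S_past: "\<And>t. 0 \<le> t \<Longrightarrow> \<exists>S'\<in>borel_measurable (past t). AE \<omega> in M. S t \<omega> = S' \<omega>"
    and S_sq: "(\<integral>\<^sup>+ z. ennreal ((norm (S (max 0 (snd z)) (fst z)))\<^sup>2) \<partial>(M \<Otimes>\<^sub>M discounting \<rho>)) < \<infinity>"
begin

abbreviation Q where "Q \<equiv> M \<Otimes>\<^sub>M discounting \<rho>"

lemma sets_Q [measurable_cong]: "sets Q = sets (M \<Otimes>\<^sub>M borel)"
  by (intro sets_pair_measure_cong refl) simp

sublocale T: finite_measure "discounting \<rho>" by (rule finite_measure_discounting[OF \<rho>])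
sublocale Q: pair_sigma_finite M "discounting \<rho>" ..
sublocale Qf: finite_measure Q
  by (rule finite_measure_pair_measure) (simp_all add: T.finite_measure_axioms finite_measure_axioms)

lemma measurable_Q: "f \<in> borel_measurable Q \<longleftrightarrow> f \<in> borel_measurable (M \<Otimes>\<^sub>M borel)"
  by (rule arg_cong2[where f="(\<in>)"]) (auto intro: measurable_cong_sets sets_Q)

text \<open>The integrand of the regulator's cost after integration by parts.\<close>

definition rate :: "real ^ 'n \<Rightarrow> ('n + 'n \<Rightarrow> real) \<Rightarrow> real" where
  "rate s a = H (s + net a) + \<rho> * (\<Sum>i\<in>UNIV. \<kappa> i * a i)"

abbreviation vals :: "('n + 'n \<Rightarrow> real \<Rightarrow> 'a \<Rightarrow> real) \<Rightarrow> 'a \<times> real \<Rightarrow> 'n + 'n \<Rightarrow> real" where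
  "vals \<zeta> z \<equiv> (\<lambda>i. \<zeta> i (max 0 (snd z)) (fst z))"

abbreviation noise :: "'a \<times> real \<Rightarrow> real ^ 'n" where
  "noise z \<equiv> S (max 0 (snd z)) (fst z)"

definition cost :: "('n + 'n \<Rightarrow> real \<Rightarrow> 'a \<Rightarrow> real) \<Rightarrow> ennreal" where
  "cost \<zeta> = (\<integral>\<^sup>+ z. ennreal (rate (noise z) (vals \<zeta> z)) \<partial>Q)"

definition jointly_measurable :: "('n + 'n \<Rightarrow> real \<Rightarrow> 'a \<Rightarrow> real) \<Rightarrow> bool" where
  "jointly_measurable \<zeta> \<longleftrightarrow> (\<forall>i. (\<lambda>z. vals \<zeta> z i) \<in> borel_measurable Q)"

lemma noise_measurable [measurable]: "noise \<in> borel_measurable Q"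
  using S_joint by (simp add: measurable_Q)

lemma H_measurable [measurable]: "H \<in> borel_measurable borel"
  by (rule borel_measurable_continuous_onI[OF H_continuous])

lemma net_measurable:
  assumes "\<And>i. (\<lambda>z. f z i) \<in> borel_measurable N" shows "(\<lambda>z. net (f z)) \<in> borel_measurable N"
  using assms
  by (subst borel_measurable_euclidean_space) (auto simp: Basis_vec_def net_def inner_axis)

lemma rate_measurable:
  assumes "s \<in> borel_measurable N" "\<And>i. (\<lambda>z. f z i) \<in> borel_measurable N"
  shows "(\<lambda>z. rate (s z) (f z)) \<in> borel_measurable N"
proof -
  have "(\<lambda>z. s z + net (f z)) \<in> borel_measurable N"
    using assms by (intro borel_measurable_add net_measurable)
  from measurable_compose[OF this H_measurable]
  show ?thesis unfolding rate_def using assms(2) by (intro borel_measurable_add borel_measurable_times borel_measurable_sum) auto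
qed

lemma rate_at_measurable:
  "jointly_measurable \<zeta> \<Longrightarrow> (\<lambda>z. rate (noise z) (vals \<zeta> z)) \<in> borel_measurable Q"
  unfolding jointly_measurable_def by (intro rate_measurable noise_measurable) auto

lemma linear_cost_nonneg: "(\<And>i. 0 \<le> a i) \<Longrightarrow> 0 \<le> (\<Sum>i\<in>UNIV. \<kappa> i * a i)"
  using \<kappa> by (intro sum_nonneg mult_nonneg_nonneg) (auto intro: less_imp_le)

lemma rate_nonneg: "(\<And>i. 0 \<le> a i) \<Longrightarrow> 0 \<le> rate s a"
  unfolding rate_def using H_nonneg linear_cost_nonneg[of a] \<rho> by (intro add_nonneg_nonneg) auto

lemma tendsto_rate:
  assumes "\<And>i. ((\<lambda>n. f n i) \<longlongrightarrow> a i) G" shows "((\<lambda>n. rate s (f n)) \<longlongrightarrow> rate s a) G"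
  unfolding rate_def
  by (intro tendsto_add tendsto_mult tendsto_sum tendsto_const assms
      continuous_on_tendsto_compose[OF H_continuous] tendsto_net) auto

lemma rate_growth:
  "rate s a \<le> C + 2 * C * (norm s)\<^sup>2 + 2 * C * (norm (net a))\<^sup>2 + \<rho> * (\<Sum>i\<in>UNIV. \<kappa> i * a i)"
proof -
  have "H (s + net a) \<le> C * (1 + (norm (s + net a))\<^sup>2)" by (rule H_growth)
  also have "\<dots> \<le> C * (1 + (2 * (norm s)\<^sup>2 + 2 * (norm (net a))\<^sup>2))"
    using power2_norm_add_le[of s "net a"] C by (intro mult_left_mono) auto
  finally show ?thesis unfolding rate_def by (simp add: algebra_simps)
qed

text \<open>Compare \<open>x\<close> with the origin. Quadratic coercivity bounds the net control by the running cost, and so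
  lets the cost of a control dominate that of its truncations.\<close>

lemma H_coercive: "2 * c * (norm x)\<^sup>2 \<le> H x + H 0"
proof -
  have "H ((1 / 2) *\<^sub>R (x + 0)) \<le> (H x + H 0) / 2 - c * (norm (x - 0))\<^sup>2" by (rule H_strongly_convex)
  then show ?thesis using H_nonneg[of "(1 / 2) *\<^sub>R (x + 0)"] by (simp add: field_simps)
qed

lemma noise_sq_integrable:
  "(\<integral>\<^sup>+ z. ennreal (a + b * (norm (noise z))\<^sup>2) \<partial>Q) < \<infinity>" if "0 \<le> a" "0 \<le> b"
proof -
  have "(\<integral>\<^sup>+ z. ennreal (a + b * (norm (noise z))\<^sup>2) \<partial>Q)
      = (\<integral>\<^sup>+ z. ennreal a + ennreal b * ennreal ((norm (noise z))\<^sup>2) \<partial>Q)"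
    using that by (intro nn_integral_cong) (simp add: ennreal_plus ennreal_mult)
  also have "\<dots> = (\<integral>\<^sup>+ z. ennreal a \<partial>Q) + ennreal b * (\<integral>\<^sup>+ z. ennreal ((norm (noise z))\<^sup>2) \<partial>Q)"
    by (subst nn_integral_add) (auto simp: nn_integral_cmult)
  also have "\<dots> < \<infinity>"
  proof -
    have "emeasure Q (space Q) < \<top>" using Qf.emeasure_finite[of "space Q"] by (simp add: less_top[symmetric])
    then show ?thesis using S_sq by (simp add: ennreal_mult_less_top)
  qed
  finally show ?thesis .
qed

section \<open>Truncation and discretisation\<close>

definition clip :: "nat \<Rightarrow> ('n + 'n \<Rightarrow> real \<Rightarrow> 'a \<Rightarrow> real) \<Rightarrow> 'n + 'n \<Rightarrow> real \<Rightarrow> 'a \<Rightarrow> real" where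
  "clip m \<zeta> = (\<lambda>i t \<omega>. max 0 (min (real m) (\<zeta> i t \<omega>)))"

definition increasing_paths :: "('n + 'n \<Rightarrow> real \<Rightarrow> 'a \<Rightarrow> real) \<Rightarrow> 'a \<Rightarrow> bool" where
  "increasing_paths \<zeta> \<omega> \<longleftrightarrow>
     (\<forall>i t. 0 \<le> t \<longrightarrow> 0 \<le> \<zeta> i t \<omega>) \<and> (\<forall>i s t. 0 \<le> s \<longrightarrow> s \<le> t \<longrightarrow> \<zeta> i s \<omega> \<le> \<zeta> i t \<omega>)"

lemma AE_Q_increasing:
  assumes j: "jointly_measurable \<zeta>" and inc: "AE \<omega> in M. increasing_paths \<zeta> \<omega>"
  shows "AE z in Q. \<forall>i. 0 \<le> vals \<zeta> z i"
proof (rule Q.AE_pair_measure)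
  note [measurable] = j[unfolded jointly_measurable_def, rule_format]
  show "{z \<in> space Q. \<forall>i. 0 \<le> vals \<zeta> z i} \<in> sets Q" by measurable
  show "AE \<omega> in M. AE t in discounting \<rho>. \<forall>i. 0 \<le> vals \<zeta> (\<omega>, t) i"
    using inc by eventually_elim (auto simp: increasing_paths_def)
qed

text \<open>Dominated convergence. Truncation does not increase the norm of the net control, which is bounded
  in terms of the noise and the running cost by coercivity.\<close>

lemma clip_cost_tendsto:
  assumes j: "jointly_measurable \<zeta>" and inc: "AE \<omega> in M. increasing_paths \<zeta> \<omega>" and fin: "cost \<zeta> < \<infinity>"
  shows "(\<lambda>m. cost (clip m \<zeta>)) \<longlonglongrightarrow> cost \<zeta>"
  unfolding cost_def
proof (rule nn_integral_dominated_convergence)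
  have jm: "jointly_measurable (clip m \<zeta>)" for m
    using j unfolding jointly_measurable_def clip_def by (intro allI borel_measurable_max borel_measurable_min) auto
  \<comment> \<open>From \<open>net = (noise + net) - noise\<close>: twice \<open>C\<close> times the squared norm of the net control is at most
  \<open>4 C\<close> times that of the noise plus \<open>2 C / c\<close> times \<open>H + H 0\<close>.\<close>
  let ?E = "1 + 2 * C / c"
  let ?w = "\<lambda>z. ennreal (C + 2 * C / c * H 0 + 6 * C * (norm (noise z))\<^sup>2) + ennreal ?E * ennreal (rate (noise z) (vals \<zeta> z))"
  show "(\<lambda>z. ennreal (rate (noise z) (vals (clip m \<zeta>) z))) \<in> borel_measurable Q" for m
    using rate_at_measurable[OF jm] by measurable
  show "(\<lambda>z. ennreal (rate (noise z) (vals \<zeta> z))) \<in> borel_measurable Q"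
    using rate_at_measurable[OF j] by measurable
  show "?w \<in> borel_measurable Q" using rate_at_measurable[OF j] by measurable
  have E: "0 \<le> ?E" using C c by simp
  have "(\<integral>\<^sup>+ z. ?w z \<partial>Q) = (\<integral>\<^sup>+ z. ennreal (C + 2 * C / c * H 0 + 6 * C * (norm (noise z))\<^sup>2) \<partial>Q) + ennreal ?E * cost \<zeta>"
    unfolding cost_def using rate_at_measurable[OF j]
    by (subst nn_integral_add) (auto simp: nn_integral_cmult)
  also have "\<dots> < \<infinity>"
    using noise_sq_integrable[of "C + 2 * C / c * H 0" "6 * C"] C c H_nonneg[of 0] fin
    by (auto simp: ennreal_mult_less_top less_top ennreal_add_eq_top ennreal_mult_eq_top_iff)
  finally show "(\<integral>\<^sup>+ z. ?w z \<partial>Q) < \<infinity>" .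
  show "AE z in Q. ennreal (rate (noise z) (vals (clip m \<zeta>) z)) \<le> ?w z" for m
    using AE_Q_increasing[OF j inc]
  proof eventually_elim
    case (elim z)
    let ?s = "noise z" and ?a = "vals \<zeta> z"
    have nn: "0 \<le> rate ?s ?a" using elim by (intro rate_nonneg) auto
    have lin: "(\<Sum>i\<in>UNIV. \<kappa> i * vals (clip m \<zeta>) z i) \<le> (\<Sum>i\<in>UNIV. \<kappa> i * ?a i)"
      using elim \<kappa> by (intro sum_mono mult_left_mono) (auto simp: clip_def intro: less_imp_le)
    have "(norm (net (vals (clip m \<zeta>) z)))\<^sup>2 \<le> (norm (net ?a))\<^sup>2"
      unfolding clip_def by (intro power_mono norm_net_clip_le) auto
    also have "\<dots> = (norm ((?s + net ?a) + (- ?s)))\<^sup>2" by simp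
    also have "\<dots> \<le> 2 * (norm (?s + net ?a))\<^sup>2 + 2 * (norm ?s)\<^sup>2"
      using power2_norm_add_le[of "?s + net ?a" "- ?s"] by simp
    also have "(norm (?s + net ?a))\<^sup>2 \<le> (H (?s + net ?a) + H 0) / (2 * c)"
      using H_coercive[of "?s + net ?a"] c by (simp add: field_simps)
    finally have "(norm (net (vals (clip m \<zeta>) z)))\<^sup>2 \<le> (H (?s + net ?a) + H 0) / c + 2 * (norm ?s)\<^sup>2"
      using c by (simp add: field_simps)
    then have "2 * C * (norm (net (vals (clip m \<zeta>) z)))\<^sup>2 \<le> 2 * C * ((H (?s + net ?a) + H 0) / c + 2 * (norm ?s)\<^sup>2)"
      using C by (intro mult_left_mono) auto
    also have "\<dots> = 2 * C / c * H (?s + net ?a) + 2 * C / c * H 0 + 4 * C * (norm ?s)\<^sup>2"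
      using c by (simp add: field_simps)
    also have "2 * C / c * H (?s + net ?a) \<le> 2 * C / c * rate ?s ?a"
      using linear_cost_nonneg[of ?a] elim \<rho> C c by (intro mult_left_mono) (auto simp: rate_def)
    finally have n: "2 * C * (norm (net (vals (clip m \<zeta>) z)))\<^sup>2 \<le> 2 * C / c * rate ?s ?a + 2 * C / c * H 0 + 4 * C * (norm ?s)\<^sup>2"
      by simp
    have "rate ?s (vals (clip m \<zeta>) z) \<le> C + 2 * C * (norm ?s)\<^sup>2 + 2 * C * (norm (net (vals (clip m \<zeta>) z)))\<^sup>2
        + \<rho> * (\<Sum>i\<in>UNIV. \<kappa> i * vals (clip m \<zeta>) z i)" by (rule rate_growth)
    also have "\<rho> * (\<Sum>i\<in>UNIV. \<kappa> i * vals (clip m \<zeta>) z i) \<le> rate ?s ?a"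
      using mult_left_mono[OF lin less_imp_le[OF \<rho>]] H_nonneg[of "?s + net ?a"] unfolding rate_def by linarith
    finally have "rate ?s (vals (clip m \<zeta>) z)
      \<le> (C + 2 * C / c * H 0 + 6 * C * (norm ?s)\<^sup>2) + ?E * rate ?s ?a"
      using n by (simp add: algebra_simps)
    then have "ennreal (rate ?s (vals (clip m \<zeta>) z)) \<le> ennreal ((C + 2 * C / c * H 0 + 6 * C * (norm ?s)\<^sup>2) + ?E * rate ?s ?a)"
      by (rule ennreal_leI)
    also have "\<dots> = ?w z" using C c H_nonneg[of 0] E nn by (simp add: ennreal_plus ennreal_mult)
    finally show ?case .
  qed
  show "AE z in Q. (\<lambda>m. ennreal (rate (noise z) (vals (clip m \<zeta>) z))) \<longlonglongrightarrow> ennreal (rate (noise z) (vals \<zeta> z))"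
    using AE_Q_increasing[OF j inc]
  proof eventually_elim
    case (elim z)
    have "(\<lambda>m. vals (clip m \<zeta>) z i) \<longlonglongrightarrow> vals \<zeta> z i" for i
    proof -
      obtain N where "vals \<zeta> z i \<le> real N" using real_arch_simple by blast
      then have "eventually (\<lambda>m. vals (clip m \<zeta>) z i = vals \<zeta> z i) sequentially"
        unfolding clip_def using elim
        by (intro eventually_mono[OF eventually_ge_at_top[of N]]) (auto simp: max_absorb2 min_absorb2)
      then show ?thesis by (rule tendsto_eventually)
    qed
    then show ?case by (intro tendsto_ennrealI tendsto_rate)
  qed
qed

definition sampled :: "nat \<Rightarrow> ('n + 'n \<Rightarrow> real \<Rightarrow> 'a \<Rightarrow> real) \<Rightarrow> 'n + 'n \<Rightarrow> real \<Rightarrow> 'a \<Rightarrow> real" where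
  "sampled n \<zeta> = (\<lambda>i t. \<zeta> i (dyadic n (floor_dyadic n t)))"

lemma step_jointly_measurable:
  assumes "\<And>i k. f i k \<in> borel_measurable M"
  shows "jointly_measurable (\<lambda>i t \<omega>. f i (floor_dyadic n t) \<omega>)"
  unfolding jointly_measurable_def measurable_Q
proof
  fix i
  from measurable_compose[OF _ step_process_measurable[of "f i" M n], of "\<lambda>z. (fst z, max 0 (snd z))" "M \<Otimes>\<^sub>M borel"] assms
  show "(\<lambda>z. vals (\<lambda>i t \<omega>. f i (floor_dyadic n t) \<omega>) z i) \<in> borel_measurable (M \<Otimes>\<^sub>M borel)" by simp
qed

text \<open>A monotone path is continuous at almost every time, so its dyadic samples converge there.\<close>

lemma sampled_cost_tendsto:
  assumes j: "jointly_measurable \<zeta>" and adapted: "\<And>i t. 0 \<le> t \<Longrightarrow> \<zeta> i t \<in> borel_measurable M"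
    and inc: "AE \<omega> in M. increasing_paths \<zeta> \<omega>"
    and bd: "\<And>i t \<omega>. 0 \<le> \<zeta> i t \<omega>" "\<And>i t \<omega>. \<zeta> i t \<omega> \<le> m"
  shows "(\<lambda>n. cost (sampled n \<zeta>)) \<longlonglongrightarrow> cost \<zeta>"
  unfolding cost_def
proof (rule nn_integral_dominated_convergence)
  have jm: "jointly_measurable (sampled n \<zeta>)" for n
    unfolding sampled_def using step_jointly_measurable[of "\<lambda>i k. \<zeta> i (dyadic n k)" n] adapted by simp
  let ?K = "2 * C * (real CARD('n) * (2 * m))\<^sup>2 + \<rho> * (\<Sum>i\<in>UNIV. \<kappa> i * m)"
  let ?w = "\<lambda>z. ennreal ((C + ?K) + 2 * C * (norm (noise z))\<^sup>2)"
  show "(\<lambda>z. ennreal (rate (noise z) (vals (sampled n \<zeta>) z))) \<in> borel_measurable Q" for n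
    using rate_at_measurable[OF jm] by measurable
  show "(\<lambda>z. ennreal (rate (noise z) (vals \<zeta> z))) \<in> borel_measurable Q"
    using rate_at_measurable[OF j] by measurable
  show "?w \<in> borel_measurable Q" by measurable
  have m: "0 \<le> m" using order_trans[OF bd] by blast
  have "0 \<le> ?K" using C \<rho> linear_cost_nonneg[of "\<lambda>_. m"] m by simp
  then show "(\<integral>\<^sup>+ z. ?w z \<partial>Q) < \<infinity>" using C by (intro noise_sq_integrable) auto
  show "AE z in Q. ennreal (rate (noise z) (vals (sampled n \<zeta>) z)) \<le> ?w z" for n
  proof (intro AE_I2 ennreal_leI)
    fix z
    let ?a = "vals (sampled n \<zeta>) z"
    have a: "0 \<le> ?a i" "?a i \<le> m" for i unfolding sampled_def using bd by auto
    have "(norm (net ?a))\<^sup>2 \<le> (real CARD('n) * (2 * m))\<^sup>2"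
    proof (intro power_mono norm_net_le)
      show "\<bar>?a i\<bar> \<le> m" for i using a[of i] by simp
    qed simp
    then have "2 * C * (norm (net ?a))\<^sup>2 \<le> 2 * C * (real CARD('n) * (2 * m))\<^sup>2"
      using C by (intro mult_left_mono) auto
    moreover have "\<rho> * (\<Sum>i\<in>UNIV. \<kappa> i * ?a i) \<le> \<rho> * (\<Sum>i\<in>UNIV. \<kappa> i * m)"
      using a \<rho> \<kappa> by (intro mult_left_mono sum_mono) (auto intro: less_imp_le)
    ultimately show "rate (noise z) ?a \<le> (C + ?K) + 2 * C * (norm (noise z))\<^sup>2"
      using rate_growth[of "noise z" ?a] by linarith
  qed
  have "AE z in Q. \<forall>i. (\<lambda>n. vals (sampled n \<zeta>) z i) \<longlonglongrightarrow> vals \<zeta> z i"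
  proof (rule Q.AE_pair_measure)
    show "{z \<in> space Q. \<forall>i. (\<lambda>n. vals (sampled n \<zeta>) z i) \<longlonglongrightarrow> vals \<zeta> z i} \<in> sets Q"
      using j jm unfolding jointly_measurable_def
      by (intro sets.sets_Collect_countable_All sets_Collect_tendsto) auto
    show "AE \<omega> in M. AE t in discounting \<rho>. \<forall>i. (\<lambda>n. vals (sampled n \<zeta>) (\<omega>, t) i) \<longlonglongrightarrow> vals \<zeta> (\<omega>, t) i"
      using inc
    proof eventually_elim
      case (elim \<omega>)
      have "AE t in discounting \<rho>. \<forall>i. 0 < t \<and> isCont (\<lambda>t. \<zeta> i t \<omega>) t"
        unfolding AE_all_countable using elim unfolding increasing_paths_def
        by (intro allI AE_discounting_isCont) auto
      then show ?case
      proof eventually_elim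
        case (elim t)
        have t: "0 < t" using elim by auto
        show ?case
        proof
          fix i
          have "(\<lambda>n. \<zeta> i (dyadic n (floor_dyadic n t)) \<omega>) \<longlonglongrightarrow> \<zeta> i t \<omega>"
            by (rule isCont_tendsto_compose[OF _ floor_dyadic_tendsto]) (use elim t in auto)
          then show "(\<lambda>n. vals (sampled n \<zeta>) (\<omega>, t) i) \<longlonglongrightarrow> vals \<zeta> (\<omega>, t) i"
            using t by (simp add: sampled_def)
        qed
      qed
    qed
  qed
  then show "AE z in Q. (\<lambda>n. ennreal (rate (noise z) (vals (sampled n \<zeta>) z))) \<longlonglongrightarrow> ennreal (rate (noise z) (vals \<zeta> z))"
    by eventually_elim (intro tendsto_ennrealI tendsto_rate, auto)
qed

end

context singular_control
begin

section \<open>Projection onto the Brownian filtration\<close>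

text \<open>Unlike admissible controls, strategies depend on \<open>B\<close> alone and are monotone for every sample point,
  but they need not be right-continuous.\<close>

definition strategy :: "('n + 'n \<Rightarrow> real \<Rightarrow> 'a \<Rightarrow> real) \<Rightarrow> bool" where
  "strategy \<zeta> \<longleftrightarrow> jointly_measurable \<zeta> \<and> (\<forall>\<omega>. increasing_paths \<zeta> \<omega>)
     \<and> (\<forall>i t. 0 \<le> t \<longrightarrow> \<zeta> i t \<in> borel_measurable (past t))"

lemma integral_mult_cond_exp_past:
  assumes t: "0 \<le> t" and a: "a \<in> borel_measurable (F t)" and bd: "\<And>\<omega>. \<bar>a \<omega>\<bar> \<le> (m::real)"
    and e: "AE \<omega> in M. e \<omega> = real_cond_exp M (past t) a \<omega>" and eM: "e \<in> borel_measurable M"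
    and G: "G \<in> borel_measurable whole" "integrable M G"
  shows "(\<integral>\<omega>. G \<omega> * a \<omega> \<partial>M) = (\<integral>\<omega>. G \<omega> * e \<omega> \<partial>M)"
    and "integrable M (\<lambda>\<omega>. G \<omega> * a \<omega>)" and "integrable M (\<lambda>\<omega>. G \<omega> * e \<omega>)"
proof -
  interpret W: sigma_finite_subalgebra M whole by (rule sigma_finite_subalgebraI[OF subalg_whole])
  have aM[measurable]: "a \<in> borel_measurable M" by (rule measurable_F_M[OF t a])
  note [measurable] = eM
  have GM[measurable]: "G \<in> borel_measurable M" using G(2) by auto
  have m: "0 \<le> m" using bd[of undefined] by linarith
  show i: "integrable M (\<lambda>\<omega>. G \<omega> * a \<omega>)"
  proof (rule Bochner_Integration.integrable_bound[OF integrable_mult_right[OF G(2), of m]])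
    have "\<bar>G \<omega>\<bar> * \<bar>a \<omega>\<bar> \<le> \<bar>G \<omega>\<bar> * m" for \<omega> by (intro mult_left_mono bd) auto
    then show "AE \<omega> in M. norm (G \<omega> * a \<omega>) \<le> norm (m * G \<omega>)" using m by (simp add: abs_mult mult.commute)
  qed measurable
  have ae: "AE \<omega> in M. real_cond_exp M whole a \<omega> = e \<omega>"
    using cond_exp_whole[OF t a bd] e by eventually_elim simp
  have "(\<integral>\<omega>. G \<omega> * a \<omega> \<partial>M) = (\<integral>\<omega>. G \<omega> * real_cond_exp M whole a \<omega> \<partial>M)"
    by (rule W.real_cond_exp_intg(2)[symmetric, OF i G(1) aM])
  also have "\<dots> = (\<integral>\<omega>. G \<omega> * e \<omega> \<partial>M)"
    by (rule integral_cong_AE) (use ae in auto)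
  finally show "(\<integral>\<omega>. G \<omega> * a \<omega> \<partial>M) = (\<integral>\<omega>. G \<omega> * e \<omega> \<partial>M)" .
  have "integrable M (\<lambda>\<omega>. G \<omega> * real_cond_exp M whole a \<omega>)"
    by (rule W.real_cond_exp_intg(1)[OF i G(1) aM])
  then show "integrable M (\<lambda>\<omega>. G \<omega> * e \<omega>)"
    by (rule integrable_cong_AE_imp) (use ae in auto)
qed

lemma rate_integrable:
  assumes "0 \<le> m" and s: "s \<in> borel_measurable M" "integrable M (\<lambda>\<omega>. (norm (s \<omega>))\<^sup>2)"
    and a: "\<And>i. (\<lambda>\<omega>. a \<omega> i) \<in> borel_measurable M" "\<And>i \<omega>. 0 \<le> a \<omega> i" "\<And>i \<omega>. a \<omega> i \<le> m"
  shows "integrable M (\<lambda>\<omega>. rate (s \<omega>) (a \<omega>))"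
proof -
  let ?K = "C + 2 * C * (real CARD('n) * (2 * m))\<^sup>2 + \<rho> * (\<Sum>i\<in>UNIV. \<kappa> i * m)"
  show ?thesis
  proof (rule Bochner_Integration.integrable_bound)
    show "integrable M (\<lambda>\<omega>. ?K + 2 * C * (norm (s \<omega>))\<^sup>2)" using s by simp
    show "(\<lambda>\<omega>. rate (s \<omega>) (a \<omega>)) \<in> borel_measurable M" using s a by (intro rate_measurable) auto
    show "AE \<omega> in M. norm (rate (s \<omega>) (a \<omega>)) \<le> norm (?K + 2 * C * (norm (s \<omega>))\<^sup>2)"
    proof (rule AE_I2)
      fix \<omega>
      have "(norm (net (a \<omega>)))\<^sup>2 \<le> (real CARD('n) * (2 * m))\<^sup>2"
      proof (intro power_mono norm_net_le)
        show "\<bar>a \<omega> i\<bar> \<le> m" for i using a(2,3)[of \<omega> i] by simp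
      qed simp
      then have "2 * C * (norm (net (a \<omega>)))\<^sup>2 \<le> 2 * C * (real CARD('n) * (2 * m))\<^sup>2"
        using C by (intro mult_left_mono) auto
      moreover have "\<rho> * (\<Sum>i\<in>UNIV. \<kappa> i * a \<omega> i) \<le> \<rho> * (\<Sum>i\<in>UNIV. \<kappa> i * m)"
        using a \<rho> \<kappa> by (intro mult_left_mono sum_mono) (auto intro: less_imp_le)
      ultimately have "rate (s \<omega>) (a \<omega>) \<le> ?K + 2 * C * (norm (s \<omega>))\<^sup>2"
        using rate_growth[of "s \<omega>" "a \<omega>"] by linarith
      moreover have "0 \<le> rate (s \<omega>) (a \<omega>)" using a(2) by (rule rate_nonneg)
      ultimately show "norm (rate (s \<omega>) (a \<omega>)) \<le> norm (?K + 2 * C * (norm (s \<omega>))\<^sup>2)" by simp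
    qed
  qed
qed

text \<open>Jensen's inequality for the conditional expectation given the path of \<open>B\<close>, by supporting hyperplanes:
  the linear term \<open>L\<close> has mean zero because its slope is a function of the whole path of \<open>B\<close>, on which
  conditioning is the same as on the past.\<close>

lemma projection_at_time:
  fixes a b :: "'n + 'n \<Rightarrow> 'a \<Rightarrow> real"
  assumes r: "0 \<le> r" "r \<le> t" and sq: "(\<integral>\<^sup>+ \<omega>. ennreal ((norm (S t \<omega>))\<^sup>2) \<partial>M) < \<infinity>"
    and a: "\<And>i. a i \<in> borel_measurable (F r)" "\<And>i \<omega>. 0 \<le> a i \<omega>" "\<And>i \<omega>. a i \<omega> \<le> m"
    and b: "\<And>i. b i \<in> borel_measurable (past r)" "\<And>i \<omega>. 0 \<le> b i \<omega>" "\<And>i \<omega>. b i \<omega> \<le> m"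
    and proj: "\<And>i. AE \<omega> in M. b i \<omega> = real_cond_exp M (past r) (a i) \<omega>"
  shows "(\<integral>\<^sup>+ \<omega>. ennreal (rate (S t \<omega>) (\<lambda>i. b i \<omega>)) \<partial>M) \<le> (\<integral>\<^sup>+ \<omega>. ennreal (rate (S t \<omega>) (\<lambda>i. a i \<omega>)) \<partial>M)"
proof -
  have t: "0 \<le> t" using r by simp
  have m: "0 \<le> m" using order_trans[OF a(2,3)] by blast
  obtain s where s: "s \<in> borel_measurable (past t)" and s_eq: "AE \<omega> in M. S t \<omega> = s \<omega>"
    using S_past[OF t] by blast
  have sM[measurable]: "s \<in> borel_measurable M" by (rule measurable_from_subalg[OF subalg_past_M s])
  have s_whole: "s \<in> borel_measurable whole" by (rule measurable_from_subalg[OF subalg_past_whole s])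
  have aM[measurable]: "a i \<in> borel_measurable M" for i by (rule measurable_F_M[OF r(1) a(1)])
  have bM[measurable]: "b i \<in> borel_measurable M" for i by (rule measurable_from_subalg[OF subalg_past_M b(1)])
  have b_whole: "b i \<in> borel_measurable whole" for i by (rule measurable_from_subalg[OF subalg_past_whole b(1)])
  have s2: "integrable M (\<lambda>\<omega>. (norm (s \<omega>))\<^sup>2)"
  proof (rule integrableI_bounded)
    have "(\<integral>\<^sup>+ \<omega>. ennreal (norm ((norm (s \<omega>))\<^sup>2)) \<partial>M) = (\<integral>\<^sup>+ \<omega>. ennreal ((norm (S t \<omega>))\<^sup>2) \<partial>M)"
      by (rule nn_integral_cong_AE) (use s_eq in auto)
    then show "(\<integral>\<^sup>+ \<omega>. ennreal (norm ((norm (s \<omega>))\<^sup>2)) \<partial>M) < \<infinity>" using sq by simp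
  qed measurable
  have s1: "integrable M (\<lambda>\<omega>. norm (s \<omega>))"
  proof (rule Bochner_Integration.integrable_bound)
    show "integrable M (\<lambda>\<omega>. 1 + (norm (s \<omega>))\<^sup>2)" using s2 by simp
    have "x \<le> 1 + x\<^sup>2" if "0 \<le> x" for x :: real
      using zero_le_power2[of "x - 1"] that by (simp add: power2_eq_square algebra_simps)
    then show "AE \<omega> in M. norm (norm (s \<omega>)) \<le> norm (1 + (norm (s \<omega>))\<^sup>2)" by (auto simp: abs_of_nonneg)
  qed measurable
  let ?b = "\<lambda>\<omega> i. b i \<omega>" and ?a = "\<lambda>\<omega> i. a i \<omega>"
  define G where "G i \<omega> = g (s \<omega> + net (?b \<omega>)) $ i" for i \<omega>
  have G_whole: "G i \<in> borel_measurable whole" for i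
  proof -
    have "(\<lambda>\<omega>. s \<omega> + net (?b \<omega>)) \<in> borel_measurable whole"
      by (intro borel_measurable_add s_whole net_measurable b_whole)
    from measurable_compose[OF this g_measurable]
    have "(\<lambda>\<omega>. g (s \<omega> + net (?b \<omega>))) \<in> borel_measurable whole" .
    from measurable_compose[OF this borel_measurable_nth] show ?thesis unfolding G_def[abs_def] .
  qed
  have G_M[measurable]: "G i \<in> borel_measurable M" for i by (rule measurable_from_subalg[OF subalg_whole G_whole])
  have G_int: "integrable M (G i)" for i
  proof (rule Bochner_Integration.integrable_bound)
    let ?k = "real CARD('n) * (2 * m)"
    show "integrable M (\<lambda>\<omega>. D * (1 + (norm (s \<omega>) + ?k)))" using s1 by simp
    show "AE \<omega> in M. norm (G i \<omega>) \<le> norm (D * (1 + (norm (s \<omega>) + ?k)))"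
    proof (rule AE_I2)
      fix \<omega>
      have "norm (net (?b \<omega>)) \<le> ?k"
      proof (rule norm_net_le)
        show "\<bar>b i \<omega>\<bar> \<le> m" for i using b(2,3)[of i \<omega>] by simp
      qed
      then have "norm (s \<omega> + net (?b \<omega>)) \<le> norm (s \<omega>) + ?k" using norm_triangle_ineq[of "s \<omega>" "net (?b \<omega>)"] by linarith
      then have "D * (1 + norm (s \<omega> + net (?b \<omega>))) \<le> D * (1 + (norm (s \<omega>) + ?k))"
        using D by (intro mult_left_mono) auto
      moreover have "\<bar>G i \<omega>\<bar> \<le> norm (g (s \<omega> + net (?b \<omega>)))" unfolding G_def by (rule component_le_norm_cart)
      ultimately have "\<bar>G i \<omega>\<bar> \<le> D * (1 + (norm (s \<omega>) + ?k))" using g_growth[of "s \<omega> + net (?b \<omega>)"] by linarith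
      then show "norm (G i \<omega>) \<le> norm (D * (1 + (norm (s \<omega>) + ?k)))" by simp
    qed
  qed measurable
  have ab: "\<bar>a i \<omega>\<bar> \<le> m" for i \<omega> using a(2,3)[of i \<omega>] by simp
  note ce = integral_mult_cond_exp_past[OF r(1) a(1) ab proj bM]
  have one: "integrable M (\<lambda>_. 1::real)" "(\<lambda>_. 1::real) \<in> borel_measurable whole" by auto
  note ce1 = ce[OF one(2,1), simplified]
  define L where "L \<omega> = (\<Sum>i\<in>UNIV. (G i \<omega> * a (Inl i) \<omega> - G i \<omega> * b (Inl i) \<omega>) - (G i \<omega> * a (Inr i) \<omega> - G i \<omega> * b (Inr i) \<omega>))
      + \<rho> * (\<Sum>i\<in>UNIV. \<kappa> i * (a i \<omega> - b i \<omega>))" for \<omega>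
  have L_int: "integrable M L"
    unfolding L_def[abs_def] using ce(2,3)[OF G_whole G_int] ce1(2,3)
    by (intro Bochner_Integration.integrable_add Bochner_Integration.integrable_sum Bochner_Integration.integrable_diff integrable_mult_right) auto
  have L0: "(\<integral>\<omega>. L \<omega> \<partial>M) = 0"
    unfolding L_def using ce[OF G_whole G_int] ce1 by simp
  have le: "rate (s \<omega>) (?b \<omega>) + L \<omega> \<le> rate (s \<omega>) (?a \<omega>)" for \<omega>
  proof -
    have "g (s \<omega> + net (?b \<omega>)) \<bullet> (net (?a \<omega>) - net (?b \<omega>))
      = (\<Sum>i\<in>UNIV. (G i \<omega> * a (Inl i) \<omega> - G i \<omega> * b (Inl i) \<omega>) - (G i \<omega> * a (Inr i) \<omega> - G i \<omega> * b (Inr i) \<omega>))"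
      by (simp add: inner_vec_def G_def net_def algebra_simps)
    moreover have "H (s \<omega> + net (?b \<omega>)) + g (s \<omega> + net (?b \<omega>)) \<bullet> (net (?a \<omega>) - net (?b \<omega>)) \<le> H (s \<omega> + net (?a \<omega>))"
      using H_support[of "s \<omega> + net (?b \<omega>)" "s \<omega> + net (?a \<omega>)"] by simp
    ultimately show ?thesis unfolding rate_def L_def by (simp add: algebra_simps sum_subtractf)
  qed
  have ib: "integrable M (\<lambda>\<omega>. rate (s \<omega>) (?b \<omega>))" by (rule rate_integrable[OF m sM s2]) (use b in auto)
  have ia: "integrable M (\<lambda>\<omega>. rate (s \<omega>) (?a \<omega>))" by (rule rate_integrable[OF m sM s2]) (use a in auto)
  have "(\<integral>\<omega>. rate (s \<omega>) (?b \<omega>) \<partial>M) = (\<integral>\<omega>. rate (s \<omega>) (?b \<omega>) + L \<omega> \<partial>M)"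
    using ib L_int L0 by simp
  also have "\<dots> \<le> (\<integral>\<omega>. rate (s \<omega>) (?a \<omega>) \<partial>M)"
    using ib ia L_int le by (intro integral_mono Bochner_Integration.integrable_add) auto
  finally have "ennreal (\<integral>\<omega>. rate (s \<omega>) (?b \<omega>) \<partial>M) \<le> ennreal (\<integral>\<omega>. rate (s \<omega>) (?a \<omega>) \<partial>M)" by (rule ennreal_leI)
  then have "(\<integral>\<^sup>+ \<omega>. ennreal (rate (s \<omega>) (?b \<omega>)) \<partial>M) \<le> (\<integral>\<^sup>+ \<omega>. ennreal (rate (s \<omega>) (?a \<omega>)) \<partial>M)"
    using nn_integral_eq_integral[OF ib] nn_integral_eq_integral[OF ia] rate_nonneg a(2) b(2) by auto
  moreover have "(\<integral>\<^sup>+ \<omega>. ennreal (rate (S t \<omega>) (f \<omega>)) \<partial>M) = (\<integral>\<^sup>+ \<omega>. ennreal (rate (s \<omega>) (f \<omega>)) \<partial>M)" for f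
    by (rule nn_integral_cong_AE) (use s_eq in auto)
  ultimately show ?thesis by simp
qed

lemma AE_noise_sq_finite:
  "AE t in discounting \<rho>. 0 \<le> t \<and> (\<integral>\<^sup>+ \<omega>. ennreal ((norm (S t \<omega>))\<^sup>2) \<partial>M) < \<infinity>"
proof -
  let ?f = "\<lambda>z. ennreal ((norm (noise z))\<^sup>2)"
  have m: "?f \<in> borel_measurable Q" by measurable
  have "(\<integral>\<^sup>+ t. (\<integral>\<^sup>+ \<omega>. ?f (\<omega>, t) \<partial>M) \<partial>discounting \<rho>) < \<infinity>"
    using Q.nn_integral_snd[OF m] S_sq by simp
  then have "(\<integral>\<^sup>+ t. (\<integral>\<^sup>+ \<omega>. ?f (\<omega>, t) \<partial>M) \<partial>discounting \<rho>) \<noteq> \<infinity>" by simp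
  from nn_integral_PInf_AE[OF _ this]
  have "AE t in discounting \<rho>. (\<integral>\<^sup>+ \<omega>. ?f (\<omega>, t) \<partial>M) \<noteq> \<infinity>"
    using borel_measurable_nn_integral[of "\<lambda>t \<omega>. ?f (\<omega>, t)", OF measurable_pair_swap[OF m]] by simp
  moreover have "AE t in discounting \<rho>. 0 \<le> t" by (simp add: AE_discounting)
  ultimately show ?thesis by eventually_elim (auto simp: less_top)
qed

text \<open>Conditional expectations on the grid are increasing only almost surely; running maxima make them
  increasing everywhere and change nothing almost surely.\<close>

lemma projected_strategy:
  assumes adapted: "\<And>i t. 0 \<le> t \<Longrightarrow> \<zeta> i t \<in> borel_measurable (F t)"
    and inc: "AE \<omega> in M. increasing_paths \<zeta> \<omega>"
    and bd: "\<And>i t \<omega>. 0 \<le> \<zeta> i t \<omega>" "\<And>i t \<omega>. \<zeta> i t \<omega> \<le> m"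
  shows "\<exists>\<eta>. strategy \<eta> \<and> cost \<eta> \<le> cost (sampled n \<zeta>)"
proof -
  let ?t = "dyadic n"
  define e where "e i k \<omega> = max 0 (min m (real_cond_exp M (past (?t k)) (\<zeta> i (?t k)) \<omega>))" for i k \<omega>
  define b where "b i k \<omega> = Max ((\<lambda>j. e i j \<omega>) ` {..k})" for i k \<omega>
  have m: "0 \<le> m" using order_trans[OF bd] by blast
  have zM: "\<zeta> i (?t k) \<in> borel_measurable M" for i k by (rule measurable_F_M[OF _ adapted]) auto
  have e_past: "e i j \<in> borel_measurable (past (?t k))" if "j \<le> k" for i j k
  proof -
    have "e i j \<in> borel_measurable (past (?t j))" unfolding e_def[abs_def]
      by (intro borel_measurable_max borel_measurable_min borel_measurable_cond_exp) auto
    then show ?thesis using measurable_from_subalg[OF subalg_past_mono[of "?t j" "?t k"]] that by simp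
  qed
  have b_past: "b i k \<in> borel_measurable (past (?t k))" for i k
    unfolding b_def[abs_def] using e_past by (intro borel_measurable_Max) auto
  have e01: "0 \<le> e i k \<omega>" "e i k \<omega> \<le> m" for i k \<omega> unfolding e_def using m by auto
  have b01: "0 \<le> b i k \<omega>" "b i k \<omega> \<le> m" for i k \<omega>
    unfolding b_def using e01 by (auto simp: Max_ge_iff intro!: Max.boundedI)
  have b_mono: "b i j \<omega> \<le> b i k \<omega>" if "j \<le> k" for i j k \<omega>
    unfolding b_def using that by (intro Max_mono image_mono) auto
  have e_ce: "AE \<omega> in M. e i k \<omega> = real_cond_exp M (past (?t k)) (\<zeta> i (?t k)) \<omega>" for i k
    using cond_exp_bounds[OF subalg_past_M[of "?t k"] zM[of i k] bd] by eventually_elim (auto simp: e_def)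
  have zb: "\<bar>\<zeta> i t \<omega>\<bar> \<le> m" for i t \<omega> using bd[of i t \<omega>] by simp
  have "AE \<omega> in M. e i k \<omega> \<le> e i (Suc k) \<omega>" for i k
  proof -
    interpret W: sigma_finite_subalgebra M whole by (rule sigma_finite_subalgebraI[OF subalg_whole])
    have int: "integrable M (\<zeta> i (?t k))" for k by (rule bounded_integrable[OF zM zb])
    have "AE \<omega> in M. \<zeta> i (?t k) \<omega> \<le> \<zeta> i (?t (Suc k)) \<omega>"
      using inc by eventually_elim (auto simp: increasing_paths_def)
    from W.real_cond_exp_mono[OF this int int]
      e_ce[of i k] e_ce[of i "Suc k"]
      cond_exp_whole[OF dyadic_nonneg[of n k] adapted[OF dyadic_nonneg] zb, of i]
      cond_exp_whole[OF dyadic_nonneg[of n "Suc k"] adapted[OF dyadic_nonneg] zb, of i]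
    show ?thesis by eventually_elim simp
  qed
  then have "AE \<omega> in M. \<forall>i k. e i k \<omega> \<le> e i (Suc k) \<omega>" by (simp add: AE_all_countable)
  then have "AE \<omega> in M. \<forall>i k. b i k \<omega> = e i k \<omega>"
  proof eventually_elim
    case (elim \<omega>)
    have "mono (\<lambda>k. e i k \<omega>)" for i using elim by (simp add: mono_iff_le_Suc)
    then show ?case unfolding b_def by (auto intro!: Max_eqI dest: monoD)
  qed
  then have b_ce: "AE \<omega> in M. b i k \<omega> = real_cond_exp M (past (?t k)) (\<zeta> i (?t k)) \<omega>" for i k
    using e_ce[of i k] by eventually_elim simp
  define \<eta> where "\<eta> i t \<omega> = b i (floor_dyadic n t) \<omega>" for i t \<omega>
  have j\<eta>: "jointly_measurable \<eta>"
    unfolding \<eta>_def[abs_def]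
    by (rule step_jointly_measurable) (rule measurable_from_subalg[OF subalg_past_M b_past])
  have "strategy \<eta>"
    unfolding strategy_def
  proof (intro conjI allI impI)
    show "increasing_paths \<eta> \<omega>" for \<omega>
      unfolding increasing_paths_def \<eta>_def using b01 b_mono floor_dyadic_mono by auto
    show "\<eta> i t \<in> borel_measurable (past t)" if "0 \<le> t" for i t
      unfolding \<eta>_def[abs_def]
      by (rule measurable_from_subalg[OF subalg_past_mono[OF floor_dyadic(1)[OF that]] b_past])
  qed (rule j\<eta>)
  moreover have "cost \<eta> \<le> cost (sampled n \<zeta>)"
  proof -
    have js: "jointly_measurable (sampled n \<zeta>)"
      unfolding sampled_def using step_jointly_measurable[of "\<lambda>i k. \<zeta> i (?t k)" n] zM by simp
    have swap: "cost \<xi> = (\<integral>\<^sup>+ t. (\<integral>\<^sup>+ \<omega>. ennreal (rate (noise (\<omega>, t)) (vals \<xi> (\<omega>, t))) \<partial>M) \<partial>discounting \<rho>)"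
      if "jointly_measurable \<xi>" for \<xi>
    proof -
      have "(\<lambda>z. ennreal (rate (noise z) (vals \<xi> z))) \<in> borel_measurable Q"
        using rate_at_measurable[OF that] by measurable
      from Q.nn_integral_snd[OF this] show ?thesis unfolding cost_def by simp
    qed
    show ?thesis
      unfolding swap[OF j\<eta>] swap[OF js]
    proof (rule nn_integral_mono_AE)
      show "AE t in discounting \<rho>. (\<integral>\<^sup>+ \<omega>. ennreal (rate (noise (\<omega>, t)) (vals \<eta> (\<omega>, t))) \<partial>M)
          \<le> (\<integral>\<^sup>+ \<omega>. ennreal (rate (noise (\<omega>, t)) (vals (sampled n \<zeta>) (\<omega>, t))) \<partial>M)"
        using AE_noise_sq_finite
      proof eventually_elim
        case (elim t)
        let ?k = "floor_dyadic n t"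
        have "(\<integral>\<^sup>+ \<omega>. ennreal (rate (S t \<omega>) (\<lambda>i. b i ?k \<omega>)) \<partial>M)
          \<le> (\<integral>\<^sup>+ \<omega>. ennreal (rate (S t \<omega>) (\<lambda>i. \<zeta> i (?t ?k) \<omega>)) \<partial>M)"
          by (rule projection_at_time[of "?t ?k" t "\<lambda>i. \<zeta> i (?t ?k)" m "\<lambda>i. b i ?k"])
             (use elim floor_dyadic(1)[of t n] adapted bd b01 b_past b_ce in auto)
        then show ?case using elim by (simp add: \<eta>_def sampled_def)
      qed
    qed
  qed
  ultimately show ?thesis by blast
qed

lemma approximation_by_strategies:
  assumes j: "jointly_measurable \<zeta>" and adapted: "\<And>i t. 0 \<le> t \<Longrightarrow> \<zeta> i t \<in> borel_measurable (F t)"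
    and inc: "AE \<omega> in M. increasing_paths \<zeta> \<omega>" and less: "cost \<zeta> < K"
  shows "\<exists>\<eta>. strategy \<eta> \<and> cost \<eta> < K"
proof -
  have "cost \<zeta> < \<infinity>" using less by (simp add: less_top order.strict_trans2)
  from order_tendstoD(2)[OF clip_cost_tendsto[OF j inc this] less]
  obtain m where m: "cost (clip m \<zeta>) < K" by (auto simp: eventually_sequentially)
  have jm: "jointly_measurable (clip m \<zeta>)"
    using j unfolding jointly_measurable_def clip_def by (intro allI borel_measurable_max borel_measurable_min) auto
  have am: "clip m \<zeta> i t \<in> borel_measurable (F t)" if "0 \<le> t" for i t
    unfolding clip_def using adapted[OF that] by (intro borel_measurable_max borel_measurable_min) auto
  have im: "AE \<omega> in M. increasing_paths (clip m \<zeta>) \<omega>"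
    using inc
  proof eventually_elim
    case (elim \<omega>)
    then show ?case unfolding increasing_paths_def clip_def
      by (intro conjI allI impI max.mono min.mono order_refl) auto
  qed
  have bm: "0 \<le> clip m \<zeta> i t \<omega>" "clip m \<zeta> i t \<omega> \<le> real m" for i t \<omega> unfolding clip_def by auto
  have aM: "clip m \<zeta> i t \<in> borel_measurable M" if "0 \<le> t" for i t by (rule measurable_F_M[OF that am[OF that]])
  from order_tendstoD(2)[OF sampled_cost_tendsto[OF jm aM im bm] m]
  obtain n where "cost (sampled n (clip m \<zeta>)) < K" by (auto simp: eventually_sequentially)
  then show ?thesis using projected_strategy[OF am im bm, of n] by (auto intro: le_less_trans)
qed

end

section \<open>Right-continuous paths\<close>

lemma monotone_path_cadlag:
  assumes nonneg: "\<And>t. 0 \<le> t \<Longrightarrow> 0 \<le> \<zeta> t \<omega>" and mono: "\<And>s t. 0 \<le> s \<Longrightarrow> s \<le> t \<Longrightarrow> \<zeta> s \<omega> \<le> \<zeta> t \<omega>"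
    and right: "\<And>t. 0 \<le> t \<Longrightarrow> ((\<lambda>s. \<zeta> s \<omega>) \<longlongrightarrow> \<zeta> t \<omega>) (at_right t)"
  shows "cadlag (ext_path \<zeta> \<omega>)" and "mono (ext_path \<zeta> \<omega>)"
proof -
  let ?f = "ext_path \<zeta> \<omega>"
  show m: "mono ?f"
    by (rule monoI) (use nonneg mono in \<open>auto simp: ext_path_def\<close>)
  show "cadlag ?f"
    unfolding cadlag_def
  proof (intro allI conjI)
    fix t :: real
    have "(?f \<longlongrightarrow> ?f t) (at_right t)"
    proof (cases "0 \<le> t")
      case True
      have "eventually (\<lambda>s. \<zeta> s \<omega> = ?f s) (at_right t)"
        unfolding eventually_at_right_field using True by (intro exI[of _ "t + 1"]) (auto simp: ext_path_def)
      then show ?thesis using right[OF True] True by (auto simp: ext_path_def elim: Lim_transform_eventually)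
    next
      case False
      then have "eventually (\<lambda>s. ?f s = 0) (at_right t)"
        unfolding eventually_at_right_field by (intro exI[of _ 0]) (auto simp: ext_path_def)
      then have "(?f \<longlongrightarrow> 0) (at_right t)" by (rule tendsto_eventually)
      then show ?thesis using False by (simp add: ext_path_def)
    qed
    then show "continuous (at_right t) ?f" by (simp add: continuous_within)
    let ?l = "SUP s\<in>{..<t}. ?f s"
    have mf: "?f a \<le> ?f b" if "a < b" for a b using monoD[OF m, of a b] that by simp
    have bdd: "bdd_above (?f ` {..<t})" by (intro bdd_aboveI[of _ "?f t"]) (auto intro: mf)
    have "(?f \<longlongrightarrow> ?l) (at_left t)"
    proof (rule order_tendstoI)
      fix a assume "a < ?l"
      then obtain s where s: "s < t" "a < ?f s" using less_cSUP_iff[OF _ bdd] by auto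
      then show "eventually (\<lambda>s. a < ?f s) (at_left t)"
        unfolding eventually_at_left_field by (intro exI[of _ s]) (auto intro: less_le_trans mf)
    next
      fix a assume a: "?l < a"
      have "?f s < a" if "s < t" for s using cSUP_upper[OF _ bdd, of s] that a by auto
      then show "eventually (\<lambda>s. ?f s < a) (at_left t)"
        unfolding eventually_at_left_field by (intro exI[of _ "t - 1"]) auto
    qed
    then show "\<exists>l. (?f \<longlongrightarrow> l) (at_left t)" by blast
  qed
qed

lemma AE_discounting_later:
  assumes "AE t in discounting \<rho>. P t" "0 \<le> t0" "t0 < b" obtains t where "t0 < t" "t < b" "P t"
proof -
  have "\<exists>t>t0. t < b \<and> P t"
  proof (rule ccontr)
    assume no: "\<not> (\<exists>t>t0. t < b \<and> P t)"
    have "AE t in lborel. 0 \<le> t \<longrightarrow> P t" using assms(1) unfolding AE_discounting .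
    then have "AE t in lborel. t \<notin> {t0<..<b}"
      by eventually_elim (use no assms(2) in auto)
    then have "emeasure lborel {t0<..<b} = 0"
      by (subst (asm) AE_iff_measurable[of "{t0<..<b}"]) auto
    then show False using assms(3) by simp
  qed
  then show ?thesis using that by blast
qed

lemma right_continuous_AE_eq:
  fixes f g :: "real \<Rightarrow> real"
  assumes eq: "AE t in discounting \<rho>. f t = g t" and t: "0 \<le> t"
    and f: "(f \<longlongrightarrow> f t) (at_right t)" and g: "(g \<longlongrightarrow> g t) (at_right t)"
  shows "f t = g t"
proof (rule ccontr)
  assume "f t \<noteq> g t"
  then have "eventually (\<lambda>s. f s - g s \<noteq> 0) (at_right t)"
    using tendsto_imp_eventually_ne[OF tendsto_diff[OF f g], of 0] by simp
  then obtain b where b: "t < b" "\<And>s. t < s \<Longrightarrow> s < b \<Longrightarrow> f s - g s \<noteq> 0"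
    unfolding eventually_at_right_field by blast
  obtain s where "t < s" "s < b" "f s = g s" by (rule AE_discounting_later[OF eq t b(1)])
  then show False using b(2) by auto
qed

lemma cadlag_ext_path_right:
  assumes "cadlag (ext_path \<zeta> \<omega>)" "0 \<le> t" shows "((\<lambda>s. \<zeta> s \<omega>) \<longlongrightarrow> \<zeta> t \<omega>) (at_right t)"
proof -
  have "ext_path \<zeta> \<omega> t = \<zeta> t \<omega>" using assms(2) by (simp add: ext_path_def)
  moreover have "(ext_path \<zeta> \<omega> \<longlongrightarrow> ext_path \<zeta> \<omega> t) (at_right t)"
    using assms(1) unfolding cadlag_def continuous_within by blast
  ultimately have "(ext_path \<zeta> \<omega> \<longlongrightarrow> \<zeta> t \<omega>) (at_right t)" by simp
  moreover have "eventually (\<lambda>s. ext_path \<zeta> \<omega> s = \<zeta> s \<omega>) (at_right t)"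
    unfolding eventually_at_right_field using assms(2) by (intro exI[of _ "t + 1"]) (auto simp: ext_path_def)
  ultimately show ?thesis by (rule Lim_transform_eventually)
qed

context singular_control
begin

section \<open>Midpoints\<close>

definition midpoint_control ::
    "('n + 'n \<Rightarrow> real \<Rightarrow> 'a \<Rightarrow> real) \<Rightarrow> ('n + 'n \<Rightarrow> real \<Rightarrow> 'a \<Rightarrow> real) \<Rightarrow> 'n + 'n \<Rightarrow> real \<Rightarrow> 'a \<Rightarrow> real" where
  "midpoint_control \<zeta> \<eta> = (\<lambda>i t \<omega>. (\<zeta> i t \<omega> + \<eta> i t \<omega>) / 2)"

lemma rate_midpoint:
  "2 * rate s (\<lambda>i. (a i + b i) / 2) + 2 * c * (norm (net a - net b))\<^sup>2 \<le> rate s a + rate s b"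
proof -
  have n: "s + net (\<lambda>i. (a i + b i) / 2) = (1 / 2) *\<^sub>R ((s + net a) + (s + net b))"
    by (simp add: vec_eq_iff net_def field_simps)
  have l: "2 * (\<Sum>i\<in>UNIV. \<kappa> i * ((a i + b i) / 2)) = (\<Sum>i\<in>UNIV. \<kappa> i * a i) + (\<Sum>i\<in>UNIV. \<kappa> i * b i)"
    unfolding sum_distrib_left sum.distrib[symmetric] by (intro sum.cong refl) (simp add: field_simps)
  have "2 * H ((1 / 2) *\<^sub>R ((s + net a) + (s + net b))) + 2 * c * (norm (net a - net b))\<^sup>2
      \<le> H (s + net a) + H (s + net b)"
  proof -
    have diff: "(s + net a) - (s + net b) = net a - net b" by simp
    have "2 * X + 2 * c * N \<le> Y + Z" if "X \<le> (Y + Z) / 2 - c * N" for X Y Z N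
      using that by (simp add: field_simps)
    from this[OF H_strongly_convex[of "s + net a" "s + net b", unfolded diff]] show ?thesis .
  qed
  moreover have "2 * (\<rho> * (\<Sum>i\<in>UNIV. \<kappa> i * ((a i + b i) / 2)))
      = \<rho> * ((\<Sum>i\<in>UNIV. \<kappa> i * a i) + (\<Sum>i\<in>UNIV. \<kappa> i * b i))"
    using l by (simp add: mult.left_commute)
  ultimately show ?thesis unfolding rate_def n by (simp add: algebra_simps)
qed

lemma midpoint_jointly_measurable:
  "jointly_measurable \<zeta> \<Longrightarrow> jointly_measurable \<eta> \<Longrightarrow> jointly_measurable (midpoint_control \<zeta> \<eta>)"
  unfolding jointly_measurable_def midpoint_control_def by (intro allI borel_measurable_divide borel_measurable_add) auto

lemma midpoint_increasing:
  assumes "increasing_paths \<zeta> \<omega>" "increasing_paths \<eta> \<omega>" shows "increasing_paths (midpoint_control \<zeta> \<eta>) \<omega>"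
  using assms unfolding increasing_paths_def midpoint_control_def
  by (auto intro!: divide_right_mono add_mono add_nonneg_nonneg)

lemma cost_midpoint:
  assumes j: "jointly_measurable \<zeta>" "jointly_measurable \<eta>"
    and inc: "AE \<omega> in M. increasing_paths \<zeta> \<omega>" "AE \<omega> in M. increasing_paths \<eta> \<omega>"
  shows "2 * cost (midpoint_control \<zeta> \<eta>)
      + (\<integral>\<^sup>+ z. ennreal (2 * c * (norm (net (vals \<zeta> z) - net (vals \<eta> z)))\<^sup>2) \<partial>Q) \<le> cost \<zeta> + cost \<eta>"
proof -
  let ?m = "midpoint_control \<zeta> \<eta>"
  let ?d = "\<lambda>z. 2 * c * (norm (net (vals \<zeta> z) - net (vals \<eta> z)))\<^sup>2"
  note [measurable] = rate_at_measurable[OF j(1)] rate_at_measurable[OF j(2)]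
    rate_at_measurable[OF midpoint_jointly_measurable[OF j]]
  have [measurable]: "(\<lambda>z. net (vals \<zeta> z)) \<in> borel_measurable Q" "(\<lambda>z. net (vals \<eta> z)) \<in> borel_measurable Q"
    using j unfolding jointly_measurable_def by (intro net_measurable; simp)+
  have "2 * cost ?m + (\<integral>\<^sup>+ z. ennreal (?d z) \<partial>Q)
      = (\<integral>\<^sup>+ z. 2 * ennreal (rate (noise z) (vals ?m z)) + ennreal (?d z) \<partial>Q)"
    unfolding cost_def by (subst nn_integral_add) (auto simp: nn_integral_cmult)
  also have "\<dots> \<le> (\<integral>\<^sup>+ z. ennreal (rate (noise z) (vals \<zeta> z)) + ennreal (rate (noise z) (vals \<eta> z)) \<partial>Q)"
  proof (rule nn_integral_mono_AE)
    show "AE z in Q. 2 * ennreal (rate (noise z) (vals ?m z)) + ennreal (?d z)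
        \<le> ennreal (rate (noise z) (vals \<zeta> z)) + ennreal (rate (noise z) (vals \<eta> z))"
      using AE_Q_increasing[OF j(1) inc(1)] AE_Q_increasing[OF j(2) inc(2)]
    proof eventually_elim
      case (elim z)
      have n: "0 \<le> rate (noise z) (vals \<zeta> z)" "0 \<le> rate (noise z) (vals \<eta> z)" "0 \<le> rate (noise z) (vals ?m z)"
        using elim by (intro rate_nonneg; simp add: midpoint_control_def)+
      have "2 * rate (noise z) (vals ?m z) + ?d z \<le> rate (noise z) (vals \<zeta> z) + rate (noise z) (vals \<eta> z)"
        unfolding midpoint_control_def by (rule rate_midpoint)
      then have "ennreal (2 * rate (noise z) (vals ?m z) + ?d z) \<le> ennreal (rate (noise z) (vals \<zeta> z) + rate (noise z) (vals \<eta> z))"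
        by (rule ennreal_leI)
      then show ?case using n c by (simp add: ennreal_plus ennreal_mult)
    qed
  qed
  also have "\<dots> = cost \<zeta> + cost \<eta>" unfolding cost_def by (subst nn_integral_add) auto
  finally show ?thesis .
qed

section \<open>A convergent minimising sequence\<close>

text \<open>Strategies are the controls that can be approximated and averaged freely; \<open>infimum_le_cost\<close> extends the
  bound to controls that use the whole filtration.\<close>

definition infimum :: ennreal where
  "infimum = (INF \<zeta>\<in>{\<zeta>. strategy \<zeta>}. cost \<zeta>)"

lemma zero_strategy: "strategy (\<lambda>i t \<omega>. 0)"
  unfolding strategy_def jointly_measurable_def increasing_paths_def by simp

lemma infimum_finite: "infimum < \<infinity>"
proof -
  have "infimum \<le> cost (\<lambda>i t \<omega>. 0)" unfolding infimum_def by (rule INF_lower) (simp add: zero_strategy)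
  also have "\<dots> \<le> (\<integral>\<^sup>+ z. ennreal (C + C * (norm (noise z))\<^sup>2) \<partial>Q)"
    unfolding cost_def
  proof (intro nn_integral_mono ennreal_leI)
    fix z
    have "net (\<lambda>i::'n + 'n. 0) = 0" by (simp add: net_def vec_eq_iff)
    then show "rate (noise z) (\<lambda>i. 0) \<le> C + C * (norm (noise z))\<^sup>2"
      using H_growth[of "noise z"] by (simp add: rate_def algebra_simps)
  qed
  also have "\<dots> < \<infinity>" by (rule noise_sq_integrable[OF C C])
  finally show ?thesis .
qed

text \<open>The cost controls the net control but not the two parts separately, so a second, strictly convex
  functional \<open>G\<close> selects among near minimisers. It is bounded, and \<open>exp\<close> satisfies
  \<open>(exp (- a / 2) - exp (- b / 2))\<^sup>2 = exp (- a) + exp (- b) - 2 exp (- (a + b) / 2)\<close>, so the defect of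
  \<open>G\<close> at the midpoint is exactly the squared mean square distance of the functions \<open>exp (- \<zeta> / 2)\<close>.\<close>

lemma convergent_minimizing_sequence:
  obtains \<zeta> where "\<And>n. strategy (\<zeta> n)" "\<And>n. cost (\<zeta> n) \<le> infimum + ennreal (1 / real (Suc n))"
    "AE z in Q. \<forall>i. Cauchy (\<lambda>n. exp (- vals (\<zeta> n) z i / 2))"
proof -
  define G where "G \<zeta> = (\<integral>z. (\<Sum>i\<in>UNIV. exp (- vals \<zeta> z i)) \<partial>Q)" for \<zeta>
  define K where "K p = {\<zeta>. strategy \<zeta> \<and> cost \<zeta> \<le> infimum + ennreal (1 / real (Suc p))}" for p :: nat
  \<comment> \<open>The infima of \<open>G\<close> over the shrinking sets \<open>K p\<close> increase to a finite limit.\<close>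
  define \<gamma> where "\<gamma> p = (INF \<zeta>\<in>K p. G \<zeta>)" for p
  have nonneg: "0 \<le> vals \<zeta> z i" if "strategy \<zeta>" for \<zeta> z i
    using that unfolding strategy_def increasing_paths_def by simp
  have meas: "(\<lambda>z. vals \<zeta> z i) \<in> borel_measurable Q" if "strategy \<zeta>" for \<zeta> i
    using that unfolding strategy_def jointly_measurable_def by simp
  have Gint: "integrable Q (\<lambda>z. exp (- vals \<zeta> z i))" if "strategy \<zeta>" for \<zeta> i
    by (rule Qf.integrable_const_bound[of _ 1]) (use nonneg[OF that] meas[OF that] in auto)
  have G0: "0 \<le> G \<zeta>" for \<zeta> unfolding G_def by (intro integral_nonneg_AE AE_I2 sum_nonneg) simp
  have G_eq: "G \<zeta> = (\<Sum>i\<in>UNIV. \<integral>z. exp (- vals \<zeta> z i) \<partial>Q)" if "strategy \<zeta>" for \<zeta>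
    unfolding G_def using Gint[OF that] by simp
  have G_le: "G \<zeta> \<le> (\<Sum>i\<in>(UNIV::('n + 'n) set). measure Q (space Q))" if "strategy \<zeta>" for \<zeta>
    unfolding G_eq[OF that]
  proof (rule sum_mono)
    fix i
    have "(\<integral>z. exp (- vals \<zeta> z i) \<partial>Q) \<le> (\<integral>z. 1 \<partial>Q)"
      by (rule integral_mono[OF Gint[OF that]]) (use nonneg[OF that] in auto)
    then show "(\<integral>z. exp (- vals \<zeta> z i) \<partial>Q) \<le> measure Q (space Q)" by simp
  qed
  have bdd: "bdd_below (G ` K p)" for p using G0 by (intro bdd_belowI[of _ 0]) auto
  have K_ne: "K p \<noteq> {}" for p
  proof -
    have "infimum < infimum + ennreal (1 / real (Suc p))"
    proof (cases infimum)
      case (real v)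
      then show ?thesis by (simp add: ennreal_plus[symmetric] del: ennreal_plus) (intro ennreal_lessI, auto simp: add_nonneg_pos)
    qed (use infimum_finite in simp)
    then obtain \<zeta> where "strategy \<zeta>" "cost \<zeta> < infimum + ennreal (1 / real (Suc p))"
      using INF_less_iff[of cost "{\<zeta>. strategy \<zeta>}"] unfolding infimum_def by auto
    then show ?thesis unfolding K_def by (auto intro: less_imp_le)
  qed
  have "\<exists>\<zeta>. \<zeta> \<in> K p \<and> G \<zeta> < \<gamma> p + 1 / real (Suc p)" for p
    using cINF_less_iff[OF K_ne[of p] bdd[of p], of "\<gamma> p + 1 / real (Suc p)"] unfolding \<gamma>_def by auto
  then obtain \<zeta> where \<zeta>: "\<And>p. \<zeta> p \<in> K p" "\<And>p. G (\<zeta> p) < \<gamma> p + 1 / real (Suc p)" by metis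
  have strat: "strategy (\<zeta> p)" for p using \<zeta>(1) unfolding K_def by simp
  have K_mono: "K q \<subseteq> K p" if "p \<le> q" for p q
  proof -
    have "ennreal (1 / real (Suc q)) \<le> ennreal (1 / real (Suc p))"
      using that by (intro ennreal_leI divide_left_mono) auto
    then show ?thesis unfolding K_def by (auto intro: order_trans add_left_mono)
  qed
  have "incseq \<gamma>"
    unfolding incseq_def \<gamma>_def using K_mono K_ne bdd by (auto intro!: cINF_superset_mono)
  moreover have "\<gamma> p \<le> (\<Sum>i\<in>(UNIV::('n + 'n) set). measure Q (space Q))" for p
    unfolding \<gamma>_def using cINF_lower[OF bdd \<zeta>(1)[of p]] G_le[OF strat[of p]] by (rule order_trans)
  ultimately have "Cauchy \<gamma>" by (metis incseq_convergent LIMSEQ_imp_Cauchy)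
  define s where "s p z = (\<chi> i. exp (- vals (\<zeta> p) z i / 2))" for p z
  have s_meas[measurable]: "s p \<in> borel_measurable Q" for p
    unfolding s_def[abs_def] using meas[OF strat[of p]]
    by (subst borel_measurable_euclidean_space) (auto simp: Basis_vec_def inner_axis)
  have s_sq: "(norm (s p z - s q z))\<^sup>2
      = (\<Sum>i\<in>UNIV. exp (- vals (\<zeta> p) z i)) + (\<Sum>i\<in>UNIV. exp (- vals (\<zeta> q) z i))
        - 2 * (\<Sum>i\<in>UNIV. exp (- vals (midpoint_control (\<zeta> p) (\<zeta> q)) z i))" for p q z
  proof -
    have e: "(exp (- x / 2) - exp (- y / 2))\<^sup>2 = exp (- x) + exp (- y) - 2 * exp (- ((x + y) / 2))" for x y :: real
      by (simp add: power2_eq_square algebra_simps flip: exp_add)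
    have "(norm (s p z - s q z))\<^sup>2 = (\<Sum>i\<in>UNIV. (exp (- vals (\<zeta> p) z i / 2) - exp (- vals (\<zeta> q) z i / 2))\<^sup>2)"
      unfolding norm_vec_def L2_set_def s_def by (simp add: sum_nonneg)
    also have "\<dots> = (\<Sum>i\<in>UNIV. exp (- vals (\<zeta> p) z i) + exp (- vals (\<zeta> q) z i)
        - 2 * exp (- vals (midpoint_control (\<zeta> p) (\<zeta> q)) z i))"
      unfolding e midpoint_control_def ..
    finally show ?thesis by (simp add: sum.distrib sum_subtractf sum_distrib_left)
  qed
  \<comment> \<open>For \<open>p \<le> q\<close> the midpoint is still in the larger set \<open>K p\<close>, which bounds \<open>G\<close> there from below by \<open>\<gamma> p\<close>.\<close>
  have mid: "midpoint_control (\<zeta> p) (\<zeta> q) \<in> K p" if "p \<le> q" for p q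
  proof -
    let ?k = "infimum + ennreal (1 / real (Suc p))"
    have st: "strategy (midpoint_control (\<zeta> p) (\<zeta> q))"
      unfolding strategy_def
    proof (intro conjI allI impI)
      show "jointly_measurable (midpoint_control (\<zeta> p) (\<zeta> q))"
        using strat unfolding strategy_def by (intro midpoint_jointly_measurable) auto
      show "increasing_paths (midpoint_control (\<zeta> p) (\<zeta> q)) \<omega>" for \<omega>
        using strat unfolding strategy_def by (intro midpoint_increasing) auto
      show "midpoint_control (\<zeta> p) (\<zeta> q) i t \<in> borel_measurable (past t)" if "0 \<le> t" for i t
        using strat that unfolding strategy_def midpoint_control_def
        by (intro borel_measurable_divide borel_measurable_add) auto
    qed
    have "2 * cost (midpoint_control (\<zeta> p) (\<zeta> q)) \<le> 2 * cost (midpoint_control (\<zeta> p) (\<zeta> q))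
      + (\<integral>\<^sup>+ z. ennreal (2 * c * (norm (net (vals (\<zeta> p) z) - net (vals (\<zeta> q) z)))\<^sup>2) \<partial>Q)" by simp
    also have "\<dots> \<le> cost (\<zeta> p) + cost (\<zeta> q)"
      using strat[of p] strat[of q] unfolding strategy_def by (intro cost_midpoint) auto
    also have "\<dots> \<le> ?k + ?k"
      using \<zeta>(1)[of p] \<zeta>(1)[of q] K_mono[OF that] unfolding K_def by (intro add_mono) auto
    also have "\<dots> = 2 * ?k" by (simp add: mult_2)
    finally have "2 * cost (midpoint_control (\<zeta> p) (\<zeta> q)) \<le> 2 * ?k" .
    then have "cost (midpoint_control (\<zeta> p) (\<zeta> q)) \<le> ?k"
      by (subst (asm) ennreal_mult_le_mult_iff) auto
    then show ?thesis using st unfolding K_def by simp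
  qed
  have L2: "(\<integral>z. (norm (s p z - s q z))\<^sup>2 \<partial>Q) \<le> (\<gamma> q - \<gamma> p) + 2 / real (Suc p)"
    "integrable Q (\<lambda>z. (norm (s p z - s q z))\<^sup>2)" if pq: "p \<le> q" for p q
  proof -
    let ?m = "midpoint_control (\<zeta> p) (\<zeta> q)"
    have stm: "strategy ?m" using mid[OF pq] unfolding K_def by simp
    note gi = Gint[OF strat[of p]] Gint[OF strat[of q]] Gint[OF stm]
    show "integrable Q (\<lambda>z. (norm (s p z - s q z))\<^sup>2)" unfolding s_sq using gi by auto
    have "(\<integral>z. (norm (s p z - s q z))\<^sup>2 \<partial>Q) = G (\<zeta> p) + G (\<zeta> q) - 2 * G ?m"
      unfolding s_sq G_def using gi by simp
    moreover have "\<gamma> p \<le> G ?m" unfolding \<gamma>_def by (rule cINF_lower[OF bdd mid[OF pq]])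
    moreover have "1 / real (Suc q) \<le> 1 / real (Suc p)" using pq by (intro divide_left_mono) auto
    ultimately show "(\<integral>z. (norm (s p z - s q z))\<^sup>2 \<partial>Q) \<le> (\<gamma> q - \<gamma> p) + 2 / real (Suc p)"
      using \<zeta>(2)[of p] \<zeta>(2)[of q] by simp
  qed
  have s_int: "integrable Q (s p)" for p
  proof (rule Qf.integrable_const_bound[of _ "real CARD('n + 'n)"])
    have "norm (s p z) \<le> real CARD('n + 'n)" for z
    proof -
      have "norm (s p z) \<le> (\<Sum>i\<in>UNIV. \<bar>s p z $ i\<bar>)" by (rule norm_le_l1_cart)
      also have "\<dots> \<le> (\<Sum>i\<in>(UNIV::('n + 'n) set). 1)"
        using nonneg[OF strat[of p]] by (intro sum_mono) (simp add: s_def)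
      finally show ?thesis by simp
    qed
    then show "AE z in Q. norm (s p z) \<le> real CARD('n + 'n)" by simp
  qed measurable
  have cauchy: "\<exists>N. \<forall>p\<ge>N. \<forall>q\<ge>N. (\<integral>z. norm (s p z - s q z) \<partial>Q) < e" if e: "0 < e" for e
  proof -
    let ?Q = "measure Q (space Q)"
    define a where "a = 2 * (?Q + 1) / e"
    have a: "0 < a" using e by (simp add: a_def add_nonneg_pos)
    define \<delta> where "\<delta> = e / (4 * a)"
    have \<delta>: "0 < \<delta>" using e a by (simp add: \<delta>_def)
    obtain N1 where N1: "\<And>p q. p \<ge> N1 \<Longrightarrow> q \<ge> N1 \<Longrightarrow> \<bar>\<gamma> p - \<gamma> q\<bar> < \<delta>"
      using \<open>Cauchy \<gamma>\<close> \<delta> unfolding Cauchy_def dist_real_def by metis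
    obtain N2 :: nat where N2: "2 / \<delta> < real N2" using reals_Archimedean2 by blast
    define N where "N = max N1 N2"
    have main: "(\<integral>z. norm (s p z - s q z) \<partial>Q) < e" if "p \<ge> N" "p \<le> q" for p q
    proof -
      have "2 / real (Suc p) < \<delta>"
      proof -
        have "2 / \<delta> < real (Suc p)" using N2 that unfolding N_def by linarith
        then show ?thesis using \<delta> by (simp add: field_simps)
      qed
      then have sq: "(\<integral>z. (norm (s p z - s q z))\<^sup>2 \<partial>Q) < 2 * \<delta>"
        using L2(1)[OF that(2)] N1[of p q] that unfolding N_def by (auto simp: abs_less_iff)
      have "norm (s p z - s q z) \<le> a * (norm (s p z - s q z))\<^sup>2 + 1 / a" for z
        using abs_mult_le_weighted[OF a, of "norm (s p z - s q z)" 1] by simp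
      then have "(\<integral>z. norm (s p z - s q z) \<partial>Q) \<le> (\<integral>z. a * (norm (s p z - s q z))\<^sup>2 + 1 / a \<partial>Q)"
        using L2(2)[OF that(2)] s_int
        by (intro integral_mono integrable_norm Bochner_Integration.integrable_diff Bochner_Integration.integrable_add) auto
      also have "\<dots> = a * (\<integral>z. (norm (s p z - s q z))\<^sup>2 \<partial>Q) + ?Q / a"
        using L2(2)[OF that(2)] by simp
      also have "\<dots> < a * (2 * \<delta>) + e / 2"
      proof (rule add_less_le_mono)
        show "a * (\<integral>z. (norm (s p z - s q z))\<^sup>2 \<partial>Q) < a * (2 * \<delta>)" using sq a by simp
        have "?Q / a \<le> (?Q + 1) / a" using a by (intro divide_right_mono) auto
        also have "(?Q + 1) / a = e / 2"
        proof -
          have "x / (2 * x / e) = e / 2" if "0 < x" for x :: real using that e by simp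
          moreover have "0 < ?Q + 1" by (simp add: add_nonneg_pos)
          ultimately show ?thesis unfolding a_def by blast
        qed
        finally show "?Q / a \<le> e / 2" .
      qed
      also have "a * (2 * \<delta>) = e / 2" using a by (simp add: \<delta>_def)
      finally show ?thesis by simp
    qed
    have "(\<integral>z. norm (s p z - s q z) \<partial>Q) < e" if "p \<ge> N" "q \<ge> N" for p q
      using main[of p q] main[of q p] that by (cases "p \<le> q") (auto simp: norm_minus_commute)
    then show ?thesis by blast
  qed
  obtain r where r: "strict_mono r" "AE z in Q. Cauchy (\<lambda>n. s (r n) z)"
    using cauchy_L1_AE_cauchy_subseq[OF s_int cauchy] by blast
  show ?thesis
  proof
    show "strategy (\<zeta> (r n))" for n by (rule strat)
    have "K (r n) \<subseteq> K n" for n by (rule K_mono) (rule strict_mono_imp_increasing[OF r(1)])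
    then show "cost (\<zeta> (r n)) \<le> infimum + ennreal (1 / real (Suc n))" for n
      using \<zeta>(1)[of "r n"] unfolding K_def by blast
    show "AE z in Q. \<forall>i. Cauchy (\<lambda>n. exp (- vals (\<zeta> (r n)) z i / 2))"
      using r(2)
    proof eventually_elim
      case (elim z)
      then obtain l where "(\<lambda>n. s (r n) z) \<longlonglongrightarrow> l" using Cauchy_convergent convergent_def by blast
      then have "(\<lambda>n. s (r n) z $ i) \<longlonglongrightarrow> l $ i" for i by (rule tendsto_vec_nth)
      then show ?case unfolding s_def by (auto intro: LIMSEQ_imp_Cauchy)
    qed
  qed
qed

end

context singular_control
begin

section \<open>The optimal control\<close>

text \<open>Admissible profiles up to the finiteness of the effort, with the parts indexed by one sum type.\<close>

definition regular :: "('n + 'n \<Rightarrow> real \<Rightarrow> 'a \<Rightarrow> real) \<Rightarrow> bool" where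
  "regular \<xi> \<longleftrightarrow> (\<forall>i. progressively_measurable F (\<xi> i)) \<and>
     (AE \<omega> in M. \<forall>i. cadlag (ext_path (\<xi> i) \<omega>) \<and> mono (ext_path (\<xi> i) \<omega>))"

lemma regular_jointly_measurable:
  assumes "regular \<xi>" shows "jointly_measurable \<xi>"
  using assms progressive_jointly_measurable
  unfolding regular_def jointly_measurable_def measurable_Q by blast

lemma ext_path_increasing:
  assumes "\<And>i. mono (ext_path (\<xi> i) \<omega>)" shows "increasing_paths \<xi> \<omega>"
  unfolding increasing_paths_def
proof (intro conjI allI impI)
  fix i and t :: real assume "0 \<le> t"
  then show "0 \<le> \<xi> i t \<omega>" using monoD[OF assms[of i], of "- 1" t] by (simp add: ext_path_def)
next
  fix i and s t :: real assume "0 \<le> s" "s \<le> t"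
  then show "\<xi> i s \<omega> \<le> \<xi> i t \<omega>" using monoD[OF assms[of i], of s t] by (simp add: ext_path_def)
qed

lemma regular_increasing:
  assumes "regular \<xi>" shows "AE \<omega> in M. increasing_paths \<xi> \<omega>"
  using assms unfolding regular_def by (auto intro: ext_path_increasing elim!: eventually_mono)

text \<open>Strategies do as well as controls that use the additional information in the filtration.\<close>

lemma infimum_le_cost:
  assumes "regular \<xi>" shows "infimum \<le> cost \<xi>"
proof (rule ccontr)
  assume "\<not> infimum \<le> cost \<xi>"
  then have "cost \<xi> < infimum" by simp
  from approximation_by_strategies[OF regular_jointly_measurable[OF assms] _ regular_increasing[OF assms] this]
  obtain \<eta> where "strategy \<eta>" "cost \<eta> < infimum"
    using assms progressive_adapted unfolding regular_def by blast
  moreover from \<open>strategy \<eta>\<close> have "infimum \<le> cost \<eta>" unfolding infimum_def by (intro INF_lower) simp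
  ultimately show False by simp
qed

text \<open>The compactifying map \<open>\<zeta> \<mapsto> 1 - exp (- \<zeta> / 2)\<close> makes the minimising sequence converge in \<open>[0, 1]\<close>. The upper
  limit \<open>y\<close> is defined everywhere, increasing and adapted to \<open>B\<close>, and its right limits \<open>Y\<close> agree with it
  for almost all times. The value \<open>1\<close>, which corresponds to infinite effort, is excluded by the
  finiteness of the cost, first for almost every and then, by monotonicity, for every time.\<close>

theorem optimal_control_exists: "\<exists>\<xi>. regular \<xi> \<and> cost \<xi> = infimum"
proof -
  obtain \<zeta> where strat: "\<And>n. strategy (\<zeta> n)" and cost: "\<And>n. cost (\<zeta> n) \<le> infimum + ennreal (1 / real (Suc n))"
    and cauchy: "AE z in Q. \<forall>i. Cauchy (\<lambda>n. exp (- vals (\<zeta> n) z i / 2))"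
    by (rule convergent_minimizing_sequence) (rule that)
  have nonneg: "0 \<le> \<zeta> n i t \<omega>" if "0 \<le> t" for n i t \<omega>
    using strat[of n] that unfolding strategy_def increasing_paths_def by simp
  have mono: "\<zeta> n i s \<omega> \<le> \<zeta> n i t \<omega>" if "0 \<le> s" "s \<le> t" for n i s t \<omega>
    using strat[of n] that unfolding strategy_def increasing_paths_def by simp
  have past: "\<zeta> n i t \<in> borel_measurable (past t)" if "0 \<le> t" for n i t
    using strat[of n] that unfolding strategy_def by simp
  have joint: "(\<lambda>z. vals (\<zeta> n) z i) \<in> borel_measurable Q" for n i
    using strat[of n] unfolding strategy_def jointly_measurable_def by simp
  define u where "u n i t \<omega> = 1 - exp (- \<zeta> n i t \<omega> / 2)" for n i t \<omega>
  have u01: "0 \<le> u n i t \<omega>" "u n i t \<omega> \<le> 1" if "0 \<le> t" for n i t \<omega>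
    using nonneg[OF that] unfolding u_def by auto
  have u_mono: "u n i s \<omega> \<le> u n i t \<omega>" if "0 \<le> s" "s \<le> t" for n i s t \<omega>
    using mono[OF that, of n i \<omega>] unfolding u_def by simp
  define L where "L i t \<omega> = limsup (\<lambda>n. ereal (u n i t \<omega>))" for i t \<omega>
  define y where "y i t \<omega> = real_of_ereal (L i t \<omega>)" for i t \<omega>
  have L01: "0 \<le> L i t \<omega>" "L i t \<omega> \<le> 1" if "0 \<le> t" for i t \<omega>
    unfolding L_def using u01[OF that]
    by (auto intro!: le_Limsup Limsup_bounded always_eventually)
  have y_L: "ereal (y i t \<omega>) = L i t \<omega>" if "0 \<le> t" for i t \<omega>
    unfolding y_def using L01[OF that, of i \<omega>] by (intro ereal_real') auto
  have y01: "0 \<le> y i t \<omega>" "y i t \<omega> \<le> 1" if "0 \<le> t" for i t \<omega>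
    using L01[OF that, of i \<omega>] unfolding y_L[OF that, symmetric] by simp_all
  have y_mono: "y i s \<omega> \<le> y i t \<omega>" if st: "0 \<le> s" "s \<le> t" for i s t \<omega>
  proof -
    have "L i s \<omega> \<le> L i t \<omega>" unfolding L_def using u_mono[OF st] by (intro Limsup_mono) auto
    then show ?thesis using y_L[of s i \<omega>] y_L[of t i \<omega>] st by (metis ereal_less_eq(3) order_trans)
  qed
  have y_past: "y i t \<in> borel_measurable (past t)" if "0 \<le> t" for i t
  proof -
    note [measurable] = past[OF that]
    show ?thesis unfolding y_def[abs_def] L_def[abs_def] u_def[abs_def] by measurable
  qed
  have y_joint: "(\<lambda>z. vals y z i) \<in> borel_measurable Q" for i
  proof -
    note [measurable] = joint
    show ?thesis unfolding y_def L_def u_def by measurable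
  qed
  have y_lim: "AE z in Q. \<forall>i. (\<lambda>n. exp (- vals (\<zeta> n) z i / 2)) \<longlonglongrightarrow> 1 - vals y z i"
    using cauchy
  proof eventually_elim
    case (elim z)
    show ?case
    proof
      fix i
      obtain l where l: "(\<lambda>n. exp (- vals (\<zeta> n) z i / 2)) \<longlonglongrightarrow> l"
        using elim Cauchy_convergent convergent_def by blast
      then have "(\<lambda>n. vals (u n) z i) \<longlonglongrightarrow> 1 - l" unfolding u_def by (intro tendsto_intros)
      then have "(\<lambda>n. ereal (vals (u n) z i)) \<longlonglongrightarrow> ereal (1 - l)" by simp
      from lim_imp_Limsup[OF _ this] have "L i (max 0 (snd z)) (fst z) = ereal (1 - l)" unfolding L_def by simp
      then have "vals y z i = 1 - l" unfolding y_def by simp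
      then show "(\<lambda>n. exp (- vals (\<zeta> n) z i / 2)) \<longlonglongrightarrow> 1 - vals y z i" using l by simp
    qed
  qed
  have "\<forall>i. \<exists>Y. progressively_measurable F Y \<and> (AE \<omega> in M. \<forall>t\<ge>0. ((\<lambda>s. y i s \<omega>) \<longlongrightarrow> Y t \<omega>) (at_right t))"
  proof
    fix i
    interpret increasing_family M F B "y i"
      by unfold_locales (use y_past y01 y_mono in auto)
    show "\<exists>Y. progressively_measurable F Y \<and> (AE \<omega> in M. \<forall>t\<ge>0. ((\<lambda>s. y i s \<omega>) \<longlongrightarrow> Y t \<omega>) (at_right t))"
      by (rule predictable_version)
  qed
  from choice[OF this] obtain Y where Y: "\<forall>i. progressively_measurable F (Y i)
    \<and> (AE \<omega> in M. \<forall>t\<ge>0. ((\<lambda>s. y i s \<omega>) \<longlongrightarrow> Y i t \<omega>) (at_right t))" ..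
  have Y_prog: "progressively_measurable F (Y i)"
    and Y_lim: "AE \<omega> in M. \<forall>t\<ge>0. ((\<lambda>s. y i s \<omega>) \<longlongrightarrow> Y i t \<omega>) (at_right t)" for i
    using Y by (rule allE[where x=i], blast)+
  have Y_AE: "AE \<omega> in M. \<forall>i. \<forall>t\<ge>0. ((\<lambda>s. y i s \<omega>) \<longlongrightarrow> Y i t \<omega>) (at_right t)"
    using Y_lim by (simp add: AE_all_countable)
  have Y_joint: "(\<lambda>z. vals Y z i) \<in> borel_measurable Q" for i
    using progressive_jointly_measurable[OF Y_prog] unfolding measurable_Q .
  have Y_y: "AE z in Q. \<forall>i. vals Y z i = vals y z i"
  proof (rule Q.AE_pair_measure)
    note [measurable] = Y_joint y_joint
    show "{z \<in> space Q. \<forall>i. vals Y z i = vals y z i} \<in> sets Q" by measurable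
    show "AE \<omega> in M. AE t in discounting \<rho>. \<forall>i. vals Y (\<omega>, t) i = vals y (\<omega>, t) i"
      using Y_AE
    proof eventually_elim
      case (elim \<omega>)
      have "AE t in discounting \<rho>. \<forall>i. 0 < t \<and> isCont (\<lambda>t. y i t \<omega>) t"
        unfolding AE_all_countable using y_mono by (intro allI AE_discounting_isCont) auto
      then show ?case
      proof eventually_elim
        case (elim t)
        then have "0 < t" by auto
        show ?case
        proof
          fix i
          have "((\<lambda>s. y i s \<omega>) \<longlongrightarrow> y i t \<omega>) (at_right t)"
            using elim unfolding isCont_def by (auto intro: tendsto_within_subset)
          moreover have "((\<lambda>s. y i s \<omega>) \<longlongrightarrow> Y i t \<omega>) (at_right t)"
            using \<open>\<forall>i. \<forall>t\<ge>0. ((\<lambda>s. y i s \<omega>) \<longlongrightarrow> Y i t \<omega>) (at_right t)\<close> \<open>0 < t\<close> by simp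
          ultimately have "Y i t \<omega> = y i t \<omega>" by (intro tendsto_unique[of "at_right t"]) auto
          then show "vals Y (\<omega>, t) i = vals y (\<omega>, t) i" using \<open>0 < t\<close> by simp
        qed
      qed
    qed
  qed
  \<comment> \<open>The inverse of the compactifying map, extended by \<open>0\<close> so as to be measurable on the whole line; the
  extension concerns a null set of paths only.\<close>
  define \<phi> where "\<phi> x = (if 0 \<le> x \<and> x < 1 then - 2 * ln (1 - x) else 0)" for x :: real
  have \<phi>_meas[measurable]: "\<phi> \<in> borel_measurable borel" unfolding \<phi>_def[abs_def] by measurable
  define \<xi> where "\<xi> i t \<omega> = \<phi> (Y i t \<omega>)" for i t \<omega>
  let ?f = "\<lambda>n z. ennreal (rate (noise z) (vals (\<zeta> n) z))"
  have f_meas: "?f n \<in> borel_measurable Q" for n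
  proof -
    have "jointly_measurable (\<zeta> n)" using strat[of n] unfolding strategy_def by simp
    note [measurable] = rate_at_measurable[OF this]
    show ?thesis by measurable
  qed
  have fatou: "(\<integral>\<^sup>+ z. liminf (\<lambda>n. ?f n z) \<partial>Q) \<le> infimum"
  proof -
    have "(\<integral>\<^sup>+ z. liminf (\<lambda>n. ?f n z) \<partial>Q) \<le> liminf (\<lambda>n. cost (\<zeta> n))"
      unfolding cost_def by (rule nn_integral_liminf[OF f_meas])
    also have "\<dots> \<le> liminf (\<lambda>n. infimum + ennreal (1 / real (Suc n)))"
      using cost by (intro Liminf_mono always_eventually) simp
    also have "\<dots> = infimum"
    proof (rule lim_imp_Liminf)
      have "(\<lambda>n. infimum + ennreal (1 / real (Suc n))) \<longlonglongrightarrow> infimum + ennreal 0"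
        by (intro tendsto_add tendsto_const tendsto_ennrealI LIMSEQ_Suc[OF lim_1_over_n])
      then show "(\<lambda>n. infimum + ennreal (1 / real (Suc n))) \<longlonglongrightarrow> infimum" by simp
    qed simp
    finally show ?thesis .
  qed
  have "AE z in Q. liminf (\<lambda>n. ?f n z) \<noteq> \<infinity>"
    by (rule nn_integral_PInf_AE) (use f_meas fatou infimum_finite in \<open>auto simp: top_unique\<close>)
  then have point: "AE z in Q. (\<forall>i. vals y z i < 1) \<and> ennreal (rate (noise z) (vals \<xi> z)) = liminf (\<lambda>n. ?f n z)"
    using y_lim Y_y
  proof eventually_elim
    case (elim z)
    let ?t = "max 0 (snd z)"
    obtain K where K: "liminf (\<lambda>n. ?f n z) = ennreal K" "0 \<le> K" using elim(1) by (cases "liminf (\<lambda>n. ?f n z)") auto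
    have nn: "0 \<le> vals (\<zeta> n) z i" for n i by (rule nonneg) simp
    have y1: "vals y z i < 1" for i
    proof (rule ccontr)
      assume "\<not> vals y z i < 1"
      then have "vals y z i = 1" using y01(2)[of ?t i "fst z"] by simp
      then have to0: "(\<lambda>n. exp (- vals (\<zeta> n) z i / 2)) \<longlonglongrightarrow> 0" using spec[OF elim(2), of i] by simp
      \<comment> \<open>Once \<open>exp (- \<zeta> / 2)\<close> is below \<open>\<delta>\<close>, the linear part of the cost alone exceeds \<open>K + 1\<close>.\<close>
      define \<delta> where "\<delta> = exp (- ((K + 1) / (2 * \<rho> * \<kappa> i)))"
      have pos: "0 < \<rho> * \<kappa> i" using \<rho> \<kappa>[of i] by simp
      have "eventually (\<lambda>n. exp (- vals (\<zeta> n) z i / 2) < \<delta>) sequentially"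
        by (rule order_tendstoD(2)[OF to0]) (simp add: \<delta>_def)
      then have "eventually (\<lambda>n. ennreal (K + 1) \<le> ?f n z) sequentially"
      proof eventually_elim
        case (elim n)
        then have "(K + 1) / (2 * \<rho> * \<kappa> i) < vals (\<zeta> n) z i / 2"
            unfolding \<delta>_def exp_less_cancel_iff by linarith
        then have "K + 1 < \<rho> * (\<kappa> i * vals (\<zeta> n) z i)" using pos by (simp add: field_simps)
        also have "\<dots> \<le> \<rho> * (\<Sum>i\<in>UNIV. \<kappa> i * vals (\<zeta> n) z i)"
          using \<rho> \<kappa> nn by (intro mult_left_mono member_le_sum) (auto intro: mult_nonneg_nonneg less_imp_le)
        also have "\<dots> \<le> rate (noise z) (vals (\<zeta> n) z)" unfolding rate_def using H_nonneg by simp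
        finally show ?case by (intro ennreal_leI) simp
      qed
      then have "ennreal (K + 1) \<le> liminf (\<lambda>n. ?f n z)" by (rule Liminf_bounded)
      then show False using K by (simp add: ennreal_le_iff)
    qed
    have "(\<lambda>n. vals (\<zeta> n) z i) \<longlonglongrightarrow> vals \<xi> z i" for i
    proof -
      have "(\<lambda>n. - 2 * ln (exp (- vals (\<zeta> n) z i / 2))) \<longlonglongrightarrow> - 2 * ln (1 - vals y z i)"
        using elim(2) y1[of i] by (intro tendsto_mult tendsto_const tendsto_ln) auto
      moreover have "vals \<xi> z i = - 2 * ln (1 - vals y z i)"
        using elim(3) y1[of i] y01(1)[of ?t i "fst z"] unfolding \<xi>_def \<phi>_def by simp
      ultimately show ?thesis by simp
    qed
    then have "(\<lambda>n. ?f n z) \<longlonglongrightarrow> ennreal (rate (noise z) (vals \<xi> z))"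
      by (intro tendsto_ennrealI tendsto_rate)
    from lim_imp_Liminf[OF _ this] show ?case using y1 by simp
  qed
  have "cost \<xi> = (\<integral>\<^sup>+ z. liminf (\<lambda>n. ?f n z) \<partial>Q)"
    unfolding cost_def by (rule nn_integral_cong_AE) (use point in auto)
  then have cost_\<xi>: "cost \<xi> \<le> infimum" using fatou by simp
  have "AE z in Q. \<forall>i. vals y z i < 1" using point by auto
  from Q.AE_pair[OF this] have y_less: "AE \<omega> in M. AE t in discounting \<rho>. \<forall>i. y i (max 0 t) \<omega> < 1" by simp
  have "regular \<xi>"
    unfolding regular_def
  proof (intro conjI allI)
    show "progressively_measurable F (\<xi> i)" for i
      using Y_prog[of i] unfolding progressively_measurable_def \<xi>_def case_prod_beta
      by (intro allI impI measurable_compose[OF _ \<phi>_meas]) (auto simp: case_prod_beta)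
    show "AE \<omega> in M. \<forall>i. cadlag (ext_path (\<xi> i) \<omega>) \<and> mono (ext_path (\<xi> i) \<omega>)"
      using Y_AE y_less
    proof eventually_elim
      case (elim \<omega>)
      have right: "((\<lambda>s. y i s \<omega>) \<longlongrightarrow> Y i t \<omega>) (at_right t)" if "0 \<le> t" for i t using elim(1) that by simp
      have upper: "Y i t \<omega> \<le> y i s \<omega>" if "0 \<le> t" "t < s" for i s t
      proof (rule tendsto_upperbound[OF right[OF that(1)]])
        show "eventually (\<lambda>r. y i r \<omega> \<le> y i s \<omega>) (at_right t)"
          unfolding eventually_at_right_field using that y_mono by (intro exI[of _ s]) auto
      qed simp
      have lower: "y i t \<omega> \<le> Y i t \<omega>" if "0 \<le> t" for i t
      proof (rule tendsto_lowerbound[OF right[OF that]])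
        show "eventually (\<lambda>r. y i t \<omega> \<le> y i r \<omega>) (at_right t)"
          unfolding eventually_at_right_field using that y_mono by (intro exI[of _ "t + 1"]) auto
      qed simp
      have Y0: "0 \<le> Y i t \<omega>" if "0 \<le> t" for i t using lower[OF that, of i] y01(1)[OF that, of i \<omega>] by simp
      have Y1: "Y i t \<omega> < 1" if "0 \<le> t" for i t
      proof -
        note t = that
        obtain s where s: "t < s" "\<forall>i. y i (max 0 s) \<omega> < 1"
          by (rule AE_discounting_later[OF elim(2) t, of "t + 1"]) simp
        then have "y i s \<omega> < 1" using that by (auto simp: max_absorb2)
        then show ?thesis using upper[OF that s(1), of i] by simp
      qed
      have Y_mono: "Y i s \<omega> \<le> Y i t \<omega>" if "0 \<le> s" "s \<le> t" for i s t
        using upper[of s t i] lower[of t i] that by (cases "s = t") auto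
      have Y_right: "((\<lambda>s. Y i s \<omega>) \<longlongrightarrow> Y i t \<omega>) (at_right t)" if t: "0 \<le> t" for i t
      proof (rule order_tendstoI)
        fix a assume "a < Y i t \<omega>"
        then show "eventually (\<lambda>s. a < Y i s \<omega>) (at_right t)"
          unfolding eventually_at_right_field using t Y_mono by (intro exI[of _ "t + 1"]) (auto intro: less_le_trans)
      next
        fix a assume "Y i t \<omega> < a"
        from order_tendstoD(2)[OF right[OF t] this]
        obtain b where b: "t < b" "\<And>s. t < s \<Longrightarrow> s < b \<Longrightarrow> y i s \<omega> < a"
          unfolding eventually_at_right_field by blast
        have "Y i s \<omega> < a" if "t < s" "s < b" for s
        proof -
          have "Y i s \<omega> \<le> y i ((s + b) / 2) \<omega>" using that t by (intro upper) auto
          also have "\<dots> < a" using that by (intro b(2)) auto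
          finally show ?thesis .
        qed
        then show "eventually (\<lambda>s. Y i s \<omega> < a) (at_right t)"
          unfolding eventually_at_right_field using b(1) by blast
      qed
      have \<xi>_eq: "\<xi> i t \<omega> = - 2 * ln (1 - Y i t \<omega>)" if "0 \<le> t" for i t
        using Y0[OF that] Y1[OF that] unfolding \<xi>_def \<phi>_def by simp
      show ?case
      proof
        fix i
        have n: "0 \<le> \<xi> i t \<omega>" if "0 \<le> t" for t
          using Y0[OF that, of i] Y1[OF that, of i] \<xi>_eq[OF that] by simp
        have m: "\<xi> i s \<omega> \<le> \<xi> i t \<omega>" if "0 \<le> s" "s \<le> t" for s t
          using Y_mono[OF that, of i] Y1[of s i] Y1[of t i] \<xi>_eq[of s i] \<xi>_eq[of t i] that by simp
        have r: "((\<lambda>s. \<xi> i s \<omega>) \<longlongrightarrow> \<xi> i t \<omega>) (at_right t)" if t: "0 \<le> t" for t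
        proof -
          have "((\<lambda>s. - 2 * ln (1 - Y i s \<omega>)) \<longlongrightarrow> - 2 * ln (1 - Y i t \<omega>)) (at_right t)"
            using Y1[OF t, of i] by (intro tendsto_intros Y_right[OF t]) auto
          moreover have "eventually (\<lambda>s. - 2 * ln (1 - Y i s \<omega>) = \<xi> i s \<omega>) (at_right t)"
            unfolding eventually_at_right_field using t \<xi>_eq by (intro exI[of _ "t + 1"]) auto
          ultimately show ?thesis using \<xi>_eq[OF t, of i] by (auto elim: Lim_transform_eventually)
        qed
        show "cadlag (ext_path (\<xi> i) \<omega>) \<and> mono (ext_path (\<xi> i) \<omega>)"
          using monotone_path_cadlag[of "\<xi> i" \<omega>, OF n m r] by simp
      qed
    qed
  qed
  then show ?thesis using cost_\<xi> infimum_le_cost by (auto intro: antisym)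
qed

end

section \<open>Uniqueness\<close>

text \<open>The increment over the \<open>k\<close>-th grid cell of the path stopped at time \<open>t\<close>.\<close>

definition increment :: "(real \<Rightarrow> real) \<Rightarrow> nat \<Rightarrow> nat \<Rightarrow> real \<Rightarrow> real" where
  "increment p n k t = p (min t (dyadic n (Suc k))) - p (min t (dyadic n k))"

text \<open>The increase that two paths have in common on the grid of mesh \<open>2\<^sup>-\<^sup>n\<close>. Its limit is the largest
  increasing path by which both can be reduced, the minimum of the two Stieltjes measures.\<close>

definition overlap :: "(real \<Rightarrow> real) \<Rightarrow> (real \<Rightarrow> real) \<Rightarrow> nat \<Rightarrow> real \<Rightarrow> real" where
  "overlap p q n t = min (p 0) (q 0) + (\<Sum>k<n * 2 ^ n. min (increment p n k t) (increment q n k t))"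

lemma overlap_commute: "overlap p q n t = overlap q p n t"
  unfolding overlap_def by (simp add: min.commute)

lemma sum_increment:
  assumes "0 \<le> t" "t \<le> real n" shows "p 0 + (\<Sum>k<n * 2 ^ n. increment p n k t) = p t"
proof -
  have "(\<Sum>k<m. increment p n k t) = p (min t (dyadic n m)) - p (min t 0)" for m
    by (induction m) (auto simp: increment_def)
  then show ?thesis using assms by simp
qed

text \<open>Up to the first path, the overlap is the positive variation of the difference along the grid,
  so it is determined by the first path and the difference.\<close>

lemma overlap_eq:
  assumes "0 \<le> t" "t \<le> real n"
  shows "overlap p q n t = p t - (max 0 (p 0 - q 0)
    + (\<Sum>k<n * 2 ^ n. max 0 (increment (\<lambda>s. p s - q s) n k t)))"
proof -
  have m: "min x y = x - max 0 (x - y)" for x y :: real by auto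
  have "overlap p q n t = (p 0 - max 0 (p 0 - q 0))
      + (\<Sum>k<n * 2 ^ n. increment p n k t - max 0 (increment p n k t - increment q n k t))"
    unfolding overlap_def m[of "p 0"] m[of "increment p n _ t"] ..
  also have "\<dots> = (p 0 + (\<Sum>k<n * 2 ^ n. increment p n k t))
      - (max 0 (p 0 - q 0) + (\<Sum>k<n * 2 ^ n. max 0 (increment p n k t - increment q n k t)))"
    by (simp add: sum_subtractf)
  also have "(\<lambda>k. increment p n k t - increment q n k t) = (\<lambda>k. increment (\<lambda>s. p s - q s) n k t)"
    by (auto simp: increment_def)
  finally show ?thesis using sum_increment[OF assms, of p] by (simp add: increment_def algebra_simps)
qed

locale increasing_pair =
  fixes p q :: "real \<Rightarrow> real"
  assumes p0: "0 \<le> p 0" and q0: "0 \<le> q 0"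
    and p_mono: "\<And>s t. 0 \<le> s \<Longrightarrow> s \<le> t \<Longrightarrow> p s \<le> p t" and q_mono: "\<And>s t. 0 \<le> s \<Longrightarrow> s \<le> t \<Longrightarrow> q s \<le> q t"
    and p_right: "\<And>t. 0 \<le> t \<Longrightarrow> (p \<longlongrightarrow> p t) (at_right t)" and q_right: "\<And>t. 0 \<le> t \<Longrightarrow> (q \<longlongrightarrow> q t) (at_right t)"
begin

lemma increment_nonneg:
  assumes "0 \<le> t" shows "0 \<le> increment p n k t" "0 \<le> increment q n k t"
proof -
  have "min t (dyadic n k) \<le> min t (dyadic n (Suc k))" by (intro min.mono order_refl dyadic_mono) simp
  moreover have "0 \<le> min t (dyadic n k)" using assms by simp
  ultimately show "0 \<le> increment p n k t" "0 \<le> increment q n k t"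
    unfolding increment_def using p_mono q_mono by auto
qed

lemma increment_mono:
  assumes "0 \<le> s" "s \<le> t" shows "increment p n k s \<le> increment p n k t" "increment q n k s \<le> increment q n k t"
proof -
  let ?a = "dyadic n k" and ?b = "dyadic n (Suc k)"
  have ab: "?a \<le> ?b" by (rule dyadic_mono) simp
  have "f (min s ?b) - f (min s ?a) \<le> f (min t ?b) - f (min t ?a)"
    if f: "\<And>s t. 0 \<le> s \<Longrightarrow> s \<le> t \<Longrightarrow> f s \<le> f t" for f :: "real \<Rightarrow> real"
  proof (cases "s \<le> ?a")
    case True
    then have "min s ?a = s" "min s ?b = s" using ab by linarith+
    moreover have "f (min t ?a) \<le> f (min t ?b)" using assms by (intro f min.mono ab) auto
    ultimately show ?thesis by simp
  next
    case False
    then have "min s ?a = ?a" "min t ?a = ?a" using assms by linarith+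
    moreover have "f (min s ?b) \<le> f (min t ?b)" using assms by (intro f min.mono) auto
    ultimately show ?thesis by simp
  qed
  from this[of p] this[of q] show "increment p n k s \<le> increment p n k t" "increment q n k s \<le> increment q n k t"
    unfolding increment_def using p_mono q_mono by auto
qed

lemma overlap_nonneg: "0 \<le> t \<Longrightarrow> 0 \<le> overlap p q n t"
  unfolding overlap_def using p0 q0 increment_nonneg by (intro add_nonneg_nonneg sum_nonneg) auto

lemma overlap_mono: "0 \<le> s \<Longrightarrow> s \<le> t \<Longrightarrow> overlap p q n s \<le> overlap p q n t"
  unfolding overlap_def using increment_mono by (intro add_left_mono sum_mono min.mono) auto

lemma overlap_increment_le:
  assumes st: "0 \<le> s" "s \<le> t" and n: "t \<le> real n"
  shows "overlap p q n t - overlap p q n s \<le> (p t - p s) + (q t - q s)"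
proof -
  have "overlap p q n t - overlap p q n s
      = (\<Sum>k<n * 2 ^ n. min (increment p n k t) (increment q n k t) - min (increment p n k s) (increment q n k s))"
    unfolding overlap_def by (simp add: sum_subtractf)
  also have "\<dots> \<le> (\<Sum>k<n * 2 ^ n. (increment p n k t - increment p n k s) + (increment q n k t - increment q n k s))"
  proof (rule sum_mono)
    fix k
    show "min (increment p n k t) (increment q n k t) - min (increment p n k s) (increment q n k s)
      \<le> (increment p n k t - increment p n k s) + (increment q n k t - increment q n k s)"
      using increment_mono[OF st, of n k] by linarith
  qed
  also have "\<dots> = (p t - p s) + (q t - q s)"
    using sum_increment[of t n p] sum_increment[of s n p] sum_increment[of t n q] sum_increment[of s n q] st n
    by (simp add: sum.distrib sum_subtractf)
  finally show ?thesis .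
qed

text \<open>At a grid point no cell is interrupted, so each summand increases by at most the increment of \<open>p\<close>.
  This fails for general \<open>s\<close>, which is why the monotonicity of the remainder is first obtained between
  dyadic times.\<close>

lemma overlap_increment_le_dyadic:
  assumes j: "dyadic n j \<le> t" and n: "t \<le> real n"
  shows "overlap p q n t - overlap p q n (dyadic n j) \<le> p t - p (dyadic n j)"
proof -
  let ?s = "dyadic n j"
  have t: "0 \<le> t" using j dyadic_nonneg[of n j] by linarith
  have "overlap p q n t - overlap p q n ?s
      = (\<Sum>k<n * 2 ^ n. min (increment p n k t) (increment q n k t) - min (increment p n k ?s) (increment q n k ?s))"
    unfolding overlap_def by (simp add: sum_subtractf)
  also have "\<dots> \<le> (\<Sum>k<n * 2 ^ n. increment p n k t - increment p n k ?s)"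
  proof (rule sum_mono)
    fix k
    show "min (increment p n k t) (increment q n k t) - min (increment p n k ?s) (increment q n k ?s)
      \<le> increment p n k t - increment p n k ?s"
    proof (cases "Suc k \<le> j")
      case True
      then have le: "dyadic n (Suc k) \<le> ?s" "dyadic n k \<le> ?s" by (auto intro: dyadic_mono)
      have "min t (dyadic n (Suc k)) = min ?s (dyadic n (Suc k))" "min t (dyadic n k) = min ?s (dyadic n k)"
        using le j by linarith+
      then have "increment f n k t = increment f n k ?s" for f
        unfolding increment_def by simp
      then show ?thesis by simp
    next
      case False
      then have le: "?s \<le> dyadic n k" "?s \<le> dyadic n (Suc k)" by (auto intro: dyadic_mono)
      have "min ?s (dyadic n (Suc k)) = ?s" "min ?s (dyadic n k) = ?s"
        using le by linarith+
      then have zero: "increment f n k ?s = 0" for f unfolding increment_def by simp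
      show ?thesis unfolding zero by simp
    qed
  qed
  also have "\<dots> = p t - p ?s"
    using sum_increment[of t n p] sum_increment[of ?s n p] j n t by (simp add: sum_subtractf)
  finally show ?thesis .
qed

text \<open>Refining the grid splits every cell in two, and a minimum of sums is at least the sum of the minima.\<close>

lemma overlap_decreasing:
  assumes t: "0 \<le> t" "t \<le> real n" shows "overlap p q (Suc n) t \<le> overlap p q n t"
proof -
  let ?h = "\<lambda>n k. min (increment p n k t) (increment q n k t)"
  have split: "increment f n k t = increment f (Suc n) (2 * k) t + increment f (Suc n) (Suc (2 * k)) t" for f k
  proof -
    have "dyadic n k = dyadic (Suc n) (2 * k)" "dyadic n (Suc k) = dyadic (Suc n) (Suc (Suc (2 * k)))"
      by (auto simp: dyadic_def field_simps)
    then show ?thesis unfolding increment_def by simp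
  qed
  have pairs: "(\<Sum>k<2 * m. f k) = (\<Sum>k<m. f (2 * k) + f (Suc (2 * k)))" for f :: "nat \<Rightarrow> real" and m
    by (induction m) auto
  have "(\<Sum>k<Suc n * 2 ^ Suc n. ?h (Suc n) k) = (\<Sum>k<2 * (n * 2 ^ n). ?h (Suc n) k)"
  proof (rule sum.mono_neutral_right)
    show "\<forall>k\<in>{..<Suc n * 2 ^ Suc n} - {..<2 * (n * 2 ^ n)}. ?h (Suc n) k = 0"
    proof
      fix k assume "k \<in> {..<Suc n * 2 ^ Suc n} - {..<2 * (n * 2 ^ n)}"
      then have "n * 2 ^ Suc n \<le> k" by auto
      then have "dyadic (Suc n) (n * 2 ^ Suc n) \<le> dyadic (Suc n) k" by (rule dyadic_mono)
      then have "t \<le> dyadic (Suc n) k" "t \<le> dyadic (Suc n) (Suc k)"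
        using t(2) dyadic_mono[of k "Suc k" "Suc n"] unfolding dyadic_horizon by linarith+
      then show "?h (Suc n) k = 0" unfolding increment_def by (simp add: min_absorb1)
    qed
  qed auto
  also have "\<dots> = (\<Sum>k<n * 2 ^ n. ?h (Suc n) (2 * k) + ?h (Suc n) (Suc (2 * k)))" by (rule pairs)
  also have "\<dots> \<le> (\<Sum>k<n * 2 ^ n. ?h n k)"
    by (rule sum_mono) (auto simp: split[of p] split[of q] min_def)
  finally show ?thesis unfolding overlap_def by simp
qed

definition common_part :: "real \<Rightarrow> real" where
  "common_part t = lim (\<lambda>n. overlap p q n t)"

lemma overlap_tendsto:
  assumes t: "0 \<le> t" shows "(\<lambda>n. overlap p q n t) \<longlonglongrightarrow> common_part t"
proof -
  obtain N :: nat where N: "t \<le> real N" using real_arch_simple by blast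
  have "decseq (\<lambda>n. overlap p q (n + N) t)"
    unfolding decseq_Suc_iff using overlap_decreasing[OF t] N by simp
  then have "convergent (\<lambda>n. overlap p q (n + N) t)"
    using overlap_nonneg[OF t] by (metis convergent_def decseq_convergent)
  then obtain L where "(\<lambda>n. overlap p q (n + N) t) \<longlonglongrightarrow> L" unfolding convergent_def by blast
  then have "(\<lambda>n. overlap p q n t) \<longlonglongrightarrow> L" by (rule LIMSEQ_offset)
  then have "convergent (\<lambda>n. overlap p q n t)" unfolding convergent_def by blast
  then show ?thesis unfolding common_part_def by (simp add: convergent_LIMSEQ_iff)
qed

lemma eventually_horizon: "eventually (\<lambda>n. t \<le> real n) sequentially"
proof -
  obtain N :: nat where "t \<le> real N" using real_arch_simple by blast
  then show ?thesis by (intro eventually_mono[OF eventually_ge_at_top[of N]]) simp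
qed

lemma common_nonneg: "0 \<le> t \<Longrightarrow> 0 \<le> common_part t"
  using overlap_nonneg by (intro LIMSEQ_le_const[OF overlap_tendsto]) auto

lemma common_mono: "0 \<le> s \<Longrightarrow> s \<le> t \<Longrightarrow> common_part s \<le> common_part t"
  using overlap_mono by (intro LIMSEQ_le[OF overlap_tendsto overlap_tendsto]) auto

lemma common_le: assumes "0 \<le> t" shows "common_part t \<le> p t"
proof (rule tendsto_upperbound[OF overlap_tendsto[OF assms]])
  show "eventually (\<lambda>n. overlap p q n t \<le> p t) sequentially"
    using eventually_horizon[of t]
  proof eventually_elim
    case (elim n)
    have "0 \<le> max 0 (p 0 - q 0) + (\<Sum>k<n * 2 ^ n. max 0 (increment (\<lambda>s. p s - q s) n k t))"
      by (intro add_nonneg_nonneg sum_nonneg) auto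
    then show ?case using overlap_eq[OF assms elim, of p q] by simp
  qed
qed simp

lemma common_increment_le:
  assumes "0 \<le> s" "s \<le> t" shows "common_part t - common_part s \<le> (p t - p s) + (q t - q s)"
proof (rule tendsto_upperbound)
  show "(\<lambda>n. overlap p q n t - overlap p q n s) \<longlonglongrightarrow> common_part t - common_part s"
    using assms by (intro tendsto_diff overlap_tendsto) auto
  show "eventually (\<lambda>n. overlap p q n t - overlap p q n s \<le> (p t - p s) + (q t - q s)) sequentially"
    using eventually_horizon[of t] by eventually_elim (rule overlap_increment_le[OF assms])
qed simp

lemma common_increment_le_dyadic:
  assumes "dyadic m j \<le> t" shows "common_part t - common_part (dyadic m j) \<le> p t - p (dyadic m j)"
proof (rule tendsto_upperbound)
  have t: "0 \<le> t" using assms dyadic_nonneg[of m j] by linarith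
  show "(\<lambda>n. overlap p q n t - overlap p q n (dyadic m j)) \<longlonglongrightarrow> common_part t - common_part (dyadic m j)"
    using t by (intro tendsto_diff overlap_tendsto) auto
  show "eventually (\<lambda>n. overlap p q n t - overlap p q n (dyadic m j) \<le> p t - p (dyadic m j)) sequentially"
    using eventually_horizon[of t] eventually_ge_at_top[of m]
  proof eventually_elim
    case (elim n)
    then show ?case using overlap_increment_le_dyadic[of n "j * 2 ^ (n - m)" t] assms
      by (simp add: dyadic_refine[OF elim(2), of j])
  qed
qed simp

text \<open>The common part increases at most as fast as \<open>p + q\<close>.\<close>

lemma common_right:
  assumes t: "0 \<le> t" shows "(common_part \<longlongrightarrow> common_part t) (at_right t)"
proof -
  have "((\<lambda>s. common_part t + ((p s - p t) + (q s - q t))) \<longlongrightarrow> common_part t + ((p t - p t) + (q t - q t))) (at_right t)"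
    by (intro tendsto_intros p_right q_right t)
  then have up: "((\<lambda>s. common_part t + ((p s - p t) + (q s - q t))) \<longlongrightarrow> common_part t) (at_right t)" by simp
  have ev: "eventually (\<lambda>s. t < s) (at_right t)" by (rule eventually_at_right_less)
  show ?thesis
  proof (rule tendsto_sandwich[OF _ _ tendsto_const up])
    show "eventually (\<lambda>s. common_part t \<le> common_part s) (at_right t)"
      using ev by eventually_elim (use t common_mono in auto)
    show "eventually (\<lambda>s. common_part s \<le> common_part t + ((p s - p t) + (q s - q t))) (at_right t)"
      using ev
    proof eventually_elim
      case (elim s)
      then show ?case using common_increment_le[OF t, of s] by simp
    qed
  qed
qed

text \<open>Right-continuity reduces the claim to a dyadic left end point.\<close>

lemma remainder_mono:
  assumes st: "0 \<le> s" "s \<le> t" shows "p s - common_part s \<le> p t - common_part t"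
proof (cases "s = t")
  case False
  then have "s < t" using st by simp
  have lim: "((\<lambda>r. p r - common_part r) \<longlongrightarrow> p s - common_part s) (at_right s)"
    by (intro tendsto_diff p_right common_right st)
  show ?thesis
  proof (rule ccontr)
    assume "\<not> ?thesis"
    then have "p t - common_part t < p s - common_part s" by simp
    from order_tendstoD(1)[OF lim this]
    obtain b where b: "s < b" "\<And>r. s < r \<Longrightarrow> r < b \<Longrightarrow> p t - common_part t < p r - common_part r"
      unfolding eventually_at_right_field by blast
    obtain m j where mj: "s < dyadic m j" "dyadic m j < min b t"
      by (rule dyadic_between[of s "min b t"]) (use st b(1) \<open>s < t\<close> in auto)
    then show False using b(2)[of "dyadic m j"] common_increment_le_dyadic[of m j t] by simp
  qed
qed simp

end

context singular_control
begin

lemma midpoint_regular: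
  assumes "regular \<xi>" "regular \<eta>" shows "regular (midpoint_control \<xi> \<eta>)"
  unfolding regular_def
proof (intro conjI allI)
  fix i
  show "progressively_measurable F (midpoint_control \<xi> \<eta> i)"
    using assms unfolding regular_def progressively_measurable_def midpoint_control_def case_prod_beta
    by (intro allI impI borel_measurable_divide borel_measurable_add) auto
next
  show "AE \<omega> in M. \<forall>i. cadlag (ext_path (midpoint_control \<xi> \<eta> i) \<omega>) \<and> mono (ext_path (midpoint_control \<xi> \<eta> i) \<omega>)"
    using assms[unfolded regular_def, THEN conjunct2]
  proof eventually_elim
    case (elim \<omega>)
    then have inc: "increasing_paths \<xi> \<omega>" "increasing_paths \<eta> \<omega>" by (auto intro: ext_path_increasing)
    note mid = midpoint_increasing[OF inc, unfolded increasing_paths_def]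
    show ?case
    proof
      fix i
      have "((\<lambda>s. midpoint_control \<xi> \<eta> i s \<omega>) \<longlongrightarrow> midpoint_control \<xi> \<eta> i t \<omega>) (at_right t)" if "0 \<le> t" for t
        unfolding midpoint_control_def using elim that
        by (intro tendsto_divide tendsto_add tendsto_const cadlag_ext_path_right) auto
      then show "cadlag (ext_path (midpoint_control \<xi> \<eta> i) \<omega>) \<and> mono (ext_path (midpoint_control \<xi> \<eta> i) \<omega>)"
        using monotone_path_cadlag[of "midpoint_control \<xi> \<eta> i" \<omega>] mid by auto
    qed
  qed
qed

text \<open>The midpoint of two optimal controls would be strictly better wherever their net controls differ.\<close>

lemma optimal_net_unique:
  assumes reg: "regular \<xi>" "regular \<eta>" and opt: "cost \<xi> = infimum" "cost \<eta> = infimum"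
  shows "AE \<omega> in M. \<forall>t\<ge>0. \<forall>i. \<xi> (Inl i) t \<omega> - \<xi> (Inr i) t \<omega> = \<eta> (Inl i) t \<omega> - \<eta> (Inr i) t \<omega>"
proof -
  let ?d = "\<lambda>z. 2 * c * (norm (net (vals \<xi> z) - net (vals \<eta> z)))\<^sup>2"
  note j = regular_jointly_measurable[OF reg(1)] regular_jointly_measurable[OF reg(2)]
  have [measurable]: "(\<lambda>z. net (vals \<xi> z)) \<in> borel_measurable Q" "(\<lambda>z. net (vals \<eta> z)) \<in> borel_measurable Q"
    using j unfolding jointly_measurable_def by (intro net_measurable; simp)+
  have "2 * infimum + (\<integral>\<^sup>+ z. ennreal (?d z) \<partial>Q)
      \<le> 2 * cost (midpoint_control \<xi> \<eta>) + (\<integral>\<^sup>+ z. ennreal (?d z) \<partial>Q)"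
    using infimum_le_cost[OF midpoint_regular[OF reg]] by (intro add_right_mono mult_left_mono) auto
  also have "\<dots> \<le> infimum + infimum"
    using cost_midpoint[OF j regular_increasing[OF reg(1)] regular_increasing[OF reg(2)]] opt by simp
  also have "\<dots> = 2 * infimum + 0" by (simp add: mult_2)
  finally have "(\<integral>\<^sup>+ z. ennreal (?d z) \<partial>Q) = 0"
    using infimum_finite by (subst (asm) ennreal_add_left_cancel_le) (auto simp: ennreal_mult_eq_top_iff)
  then have "AE z in Q. ennreal (?d z) = 0" by (subst (asm) nn_integral_0_iff_AE) auto
  then have "AE z in Q. net (vals \<xi> z) = net (vals \<eta> z)"
    by eventually_elim (use c in \<open>auto simp: ennreal_eq_0_iff mult_le_0_iff\<close>)
  from Q.AE_pair[OF this] have "AE \<omega> in M. AE t in discounting \<rho>. net (vals \<xi> (\<omega>, t)) = net (vals \<eta> (\<omega>, t))" .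
  then show ?thesis
    using reg(1)[unfolded regular_def, THEN conjunct2] reg(2)[unfolded regular_def, THEN conjunct2]
  proof eventually_elim
    case (elim \<omega>)
    show ?case
    proof (intro allI impI)
      fix t :: real and i assume t: "0 \<le> t"
      have "AE t in discounting \<rho>. \<xi> (Inl i) t \<omega> - \<xi> (Inr i) t \<omega> = \<eta> (Inl i) t \<omega> - \<eta> (Inr i) t \<omega>"
      proof -
        have "AE t in discounting \<rho>. 0 \<le> t" by (simp add: AE_discounting)
        with elim(1) show ?thesis
        proof eventually_elim
          case (elim t)
          then have "net (vals \<xi> (\<omega>, t)) $ i = net (vals \<eta> (\<omega>, t)) $ i" by simp
          then show ?case using elim(2) by (simp add: net_def)
        qed
      qed
      then show "\<xi> (Inl i) t \<omega> - \<xi> (Inr i) t \<omega> = \<eta> (Inl i) t \<omega> - \<eta> (Inr i) t \<omega>"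
        by (rule right_continuous_AE_eq[OF _ t]) (use elim t in \<open>intro tendsto_diff cadlag_ext_path_right; simp\<close>)+
    qed
  qed
qed

lemma regular_pair:
  fixes \<xi> :: "'n + 'n \<Rightarrow> real \<Rightarrow> 'a \<Rightarrow> real"
  assumes "\<forall>i. cadlag (ext_path (\<xi> i) \<omega>) \<and> mono (ext_path (\<xi> i) \<omega>)"
  shows "increasing_pair (\<lambda>t. \<xi> i t \<omega>) (\<lambda>t. \<xi> i' t \<omega>)"
proof -
  have "increasing_paths \<xi> \<omega>" using assms by (auto intro: ext_path_increasing)
  then show ?thesis
    using assms unfolding increasing_paths_def by unfold_locales (auto intro: cadlag_ext_path_right)
qed

text \<open>An optimal control never pushes in both directions at once: removing the part common to the two
  parts of a player leaves the state unchanged and can only lower the cost.\<close>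

lemma optimal_overlap_vanishes:
  assumes reg: "regular \<xi>" and opt: "cost \<xi> = infimum"
  shows "AE \<omega> in M. \<forall>t\<ge>0. \<forall>i. (\<lambda>n. overlap (\<lambda>s. \<xi> (Inl i) s \<omega>) (\<lambda>s. \<xi> (Inr i) s \<omega>) n t) \<longlonglongrightarrow> 0"
proof -
  define l where "l i t \<omega> = lim (\<lambda>n. overlap (\<lambda>s. \<xi> (Inl i) s \<omega>) (\<lambda>s. \<xi> (Inr i) s \<omega>) n t)" for i t \<omega>
  \<comment> \<open>The player to whom a part belongs.\<close>
  define pl :: "'n + 'n \<Rightarrow> 'n" where "pl = case_sum (\<lambda>i. i) (\<lambda>i. i)"
  define \<eta> where "\<eta> c t \<omega> = \<xi> c t \<omega> - l (pl c) t \<omega>" for c t \<omega>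
  have prog: "progressively_measurable F (\<xi> i)" for i using reg unfolding regular_def by simp
  have stopped: "(\<lambda>z. \<xi> i (min (fst z) r) (snd z)) \<in> borel_measurable (restrict_space borel {0..T} \<Otimes>\<^sub>M F T)"
    if "0 \<le> T" "0 \<le> r" for i r T
  proof -
    let ?R = "restrict_space borel {0..T} :: real measure"
    have "(\<lambda>z. min (fst z) r) \<in> measurable (?R \<Otimes>\<^sub>M F T) ?R"
    proof (rule measurable_restrict_space2)
      show "(\<lambda>z. min (fst z) r) \<in> borel_measurable (?R \<Otimes>\<^sub>M F T)"
        by (intro borel_measurable_min measurable_compose[OF measurable_fst measurable_restrict_space1]) auto
      show "(\<lambda>z. min (fst z) r) \<in> space (?R \<Otimes>\<^sub>M F T) \<rightarrow> {0..T}"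
        using that by (auto simp: space_pair_measure space_restrict_space)
    qed
    from measurable_compose[OF measurable_Pair[OF this measurable_snd], of "\<lambda>(s, \<omega>). \<xi> i s \<omega>" borel]
    show ?thesis using prog[of i] that unfolding progressively_measurable_def by simp
  qed
  have l_prog: "(\<lambda>z. l i (fst z) (snd z)) \<in> borel_measurable (restrict_space borel {0..T} \<Otimes>\<^sub>M F T)" if T: "0 \<le> T" for i T
  proof -
    let ?P = "restrict_space borel {0..T} \<Otimes>\<^sub>M F T"
    have z: "(\<lambda>z. \<xi> c 0 (snd z)) \<in> borel_measurable ?P" for c
    proof -
      have "\<xi> c 0 \<in> borel_measurable (F T)"
        by (rule measurable_F_mono[OF _ T progressive_adapted[OF prog]]) auto
      from measurable_compose[OF measurable_snd this] show ?thesis .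
    qed
    show ?thesis
      unfolding l_def overlap_def increment_def
      by (intro borel_measurable_lim_metric borel_measurable_add borel_measurable_sum borel_measurable_min
          borel_measurable_diff stopped z T dyadic_nonneg)
  qed
  have paths: "AE \<omega> in M. (\<forall>i. cadlag (ext_path (\<xi> i) \<omega>) \<and> mono (ext_path (\<xi> i) \<omega>))"
    using reg unfolding regular_def by simp
  have facts: "AE \<omega> in M. (\<forall>c. cadlag (ext_path (\<eta> c) \<omega>) \<and> mono (ext_path (\<eta> c) \<omega>))
      \<and> (\<forall>i t. 0 \<le> t \<longrightarrow> 0 \<le> l i t \<omega>) \<and> (\<forall>i t. 0 \<le> t \<longrightarrow> ((\<lambda>s. l i s \<omega>) \<longlongrightarrow> l i t \<omega>) (at_right t))
      \<and> (\<forall>i t. 0 \<le> t \<longrightarrow> (\<lambda>n. overlap (\<lambda>s. \<xi> (Inl i) s \<omega>) (\<lambda>s. \<xi> (Inr i) s \<omega>) n t) \<longlonglongrightarrow> l i t \<omega>)"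
    using paths
  proof eventually_elim
    case (elim \<omega>)
    have P: "increasing_pair (\<lambda>t. \<xi> (Inl i) t \<omega>) (\<lambda>t. \<xi> (Inr i) t \<omega>)" "increasing_pair (\<lambda>t. \<xi> (Inr i) t \<omega>) (\<lambda>t. \<xi> (Inl i) t \<omega>)" for i
      using elim by (auto intro: regular_pair)
    have l1: "increasing_pair.common_part (\<lambda>t. \<xi> (Inl i) t \<omega>) (\<lambda>t. \<xi> (Inr i) t \<omega>) t = l i t \<omega>" for i t
      unfolding increasing_pair.common_part_def[OF P(1)] l_def ..
    have l2: "increasing_pair.common_part (\<lambda>t. \<xi> (Inr i) t \<omega>) (\<lambda>t. \<xi> (Inl i) t \<omega>) t = l i t \<omega>" for i t
      unfolding increasing_pair.common_part_def[OF P(2)] l_def by (subst overlap_commute) simp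
    have right: "((\<lambda>s. l i s \<omega>) \<longlongrightarrow> l i t \<omega>) (at_right t)" if "0 \<le> t" for i t
      using increasing_pair.common_right[OF P(1) that, of i] unfolding l1[abs_def] l1 by simp
    have "cadlag (ext_path (\<eta> c) \<omega>) \<and> mono (ext_path (\<eta> c) \<omega>)" for c
    proof -
      have pos: "0 \<le> \<eta> c t \<omega>" if "0 \<le> t" for t
        unfolding \<eta>_def pl_def
        using increasing_pair.common_le[OF P(1) that] increasing_pair.common_le[OF P(2) that]
        unfolding l1 l2 by (cases c) auto
      have mono: "\<eta> c s \<omega> \<le> \<eta> c t \<omega>" if "0 \<le> s" "s \<le> t" for s t
        unfolding \<eta>_def pl_def
        using increasing_pair.remainder_mono[OF P(1) that] increasing_pair.remainder_mono[OF P(2) that]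
        unfolding l1 l2 by (cases c) auto
      have "((\<lambda>s. \<eta> c s \<omega>) \<longlongrightarrow> \<eta> c t \<omega>) (at_right t)" if "0 \<le> t" for t
        unfolding \<eta>_def using elim that by (intro tendsto_diff right cadlag_ext_path_right) auto
      then show ?thesis using monotone_path_cadlag[of "\<eta> c" \<omega>, OF pos mono] by simp
    qed
    moreover have "0 \<le> l i t \<omega>" if "0 \<le> t" for i t
      using increasing_pair.common_nonneg[OF P(1) that] unfolding l1 .
    moreover have "(\<lambda>n. overlap (\<lambda>s. \<xi> (Inl i) s \<omega>) (\<lambda>s. \<xi> (Inr i) s \<omega>) n t) \<longlonglongrightarrow> l i t \<omega>" if "0 \<le> t" for i t
      using increasing_pair.overlap_tendsto[OF P(1) that] unfolding l1 .
    ultimately show ?case using right by blast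
  qed
  have reg\<eta>: "regular \<eta>"
    unfolding regular_def
  proof (intro conjI allI)
    show "progressively_measurable F (\<eta> c)" for c
      unfolding progressively_measurable_def \<eta>_def case_prod_beta
    proof (intro allI impI borel_measurable_diff l_prog)
      fix T :: real assume "0 \<le> T"
      then show "(\<lambda>z. \<xi> c (fst z) (snd z)) \<in> borel_measurable (restrict_space borel {0..T} \<Otimes>\<^sub>M F T)"
        using prog[of c] unfolding progressively_measurable_def case_prod_beta by simp
    qed
    show "AE \<omega> in M. \<forall>c. cadlag (ext_path (\<eta> c) \<omega>) \<and> mono (ext_path (\<eta> c) \<omega>)"
      using facts by auto
  qed
  have l_joint: "(\<lambda>z. l i (max 0 (snd z)) (fst z)) \<in> borel_measurable Q" for i
  proof -
    have "(\<lambda>z. vals \<xi> z (Inl i) - vals \<eta> z (Inl i)) \<in> borel_measurable Q"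
      using regular_jointly_measurable[OF reg] regular_jointly_measurable[OF reg\<eta>]
      unfolding jointly_measurable_def by (intro borel_measurable_diff) auto
    then show ?thesis unfolding \<eta>_def pl_def by simp
  qed
  let ?e = "\<lambda>z. \<rho> * (\<Sum>c\<in>UNIV. \<kappa> c * l (pl c) (max 0 (snd z)) (fst z))"
  have e_meas[measurable]: "?e \<in> borel_measurable Q"
    using l_joint by (intro borel_measurable_times borel_measurable_sum borel_measurable_const)
  have lQ: "AE z in Q. \<forall>i. 0 \<le> l i (max 0 (snd z)) (fst z)"
  proof (rule Q.AE_pair_measure)
    note [measurable] = l_joint
    show "{z \<in> space Q. \<forall>i. 0 \<le> l i (max 0 (snd z)) (fst z)} \<in> sets Q" by measurable
    show "AE \<omega> in M. AE t in discounting \<rho>. \<forall>i. 0 \<le> l i (max 0 (snd (\<omega>, t))) (fst (\<omega>, t))"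
      using facts by eventually_elim simp
  qed
  have "cost \<xi> = (\<integral>\<^sup>+ z. ennreal (rate (noise z) (vals \<eta> z)) + ennreal (?e z) \<partial>Q)"
    unfolding cost_def
  proof (rule nn_integral_cong_AE)
    show "AE z in Q. ennreal (rate (noise z) (vals \<xi> z)) = ennreal (rate (noise z) (vals \<eta> z)) + ennreal (?e z)"
      using lQ AE_Q_increasing[OF regular_jointly_measurable[OF reg\<eta>] regular_increasing[OF reg\<eta>]]
    proof eventually_elim
      case (elim z)
      have "net (vals \<eta> z) = net (vals \<xi> z)" unfolding net_def \<eta>_def pl_def by simp
      moreover have "(\<Sum>c\<in>UNIV. \<kappa> c * vals \<xi> z c) = (\<Sum>c\<in>UNIV. \<kappa> c * vals \<eta> z c) + (\<Sum>c\<in>UNIV. \<kappa> c * l (pl c) (max 0 (snd z)) (fst z))"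
        unfolding \<eta>_def by (simp add: sum.distrib[symmetric] right_diff_distrib)
      ultimately have "rate (noise z) (vals \<xi> z) = rate (noise z) (vals \<eta> z) + ?e z"
        unfolding rate_def by (simp add: distrib_left)
      moreover have "0 \<le> ?e z" using \<rho> \<kappa> elim(1) by (intro mult_nonneg_nonneg sum_nonneg) (auto intro: less_imp_le)
      moreover have "0 \<le> rate (noise z) (vals \<eta> z)" using elim(2) by (intro rate_nonneg) auto
      ultimately show ?case by (simp add: ennreal_plus)
    qed
  qed
  also have "\<dots> = cost \<eta> + (\<integral>\<^sup>+ z. ennreal (?e z) \<partial>Q)"
    unfolding cost_def using rate_at_measurable[OF regular_jointly_measurable[OF reg\<eta>]]
    by (subst nn_integral_add) auto
  finally have eq: "infimum = cost \<eta> + (\<integral>\<^sup>+ z. ennreal (?e z) \<partial>Q)" using opt by simp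
  have "infimum + (\<integral>\<^sup>+ z. ennreal (?e z) \<partial>Q) \<le> infimum + 0"
    using infimum_le_cost[OF reg\<eta>] eq by (simp add: add_right_mono)
  then have "(\<integral>\<^sup>+ z. ennreal (?e z) \<partial>Q) = 0"
    using infimum_finite by (subst (asm) ennreal_add_left_cancel_le) auto
  then have "AE z in Q. ennreal (?e z) = 0" by (subst (asm) nn_integral_0_iff_AE) auto
  then have "AE z in Q. \<forall>i. l i (max 0 (snd z)) (fst z) = 0"
    using lQ
  proof eventually_elim
    case (elim z)
    show ?case
    proof
      fix i
      have terms: "0 \<le> \<kappa> c * l (pl c) (max 0 (snd z)) (fst z)" for c
        using \<kappa>[of c] elim(2) by (intro mult_nonneg_nonneg) (auto intro: less_imp_le)
      have "?e z \<le> 0" using elim(1) by (simp add: ennreal_eq_0_iff)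
      then have "(\<Sum>c\<in>UNIV. \<kappa> c * l (pl c) (max 0 (snd z)) (fst z)) \<le> 0" using \<rho> by (simp add: mult_le_0_iff)
      moreover have "\<kappa> (Inl i) * l (pl (Inl i)) (max 0 (snd z)) (fst z) \<le> (\<Sum>c\<in>UNIV. \<kappa> c * l (pl c) (max 0 (snd z)) (fst z))"
        using terms by (intro member_le_sum) auto
      ultimately have "\<kappa> (Inl i) * l i (max 0 (snd z)) (fst z) \<le> 0" unfolding pl_def by simp
      then show "l i (max 0 (snd z)) (fst z) = 0" using \<kappa>[of "Inl i"] elim(2) by (auto simp: mult_le_0_iff intro: antisym)
    qed
  qed
  from Q.AE_pair[OF this] have "AE \<omega> in M. AE t in discounting \<rho>. \<forall>i. l i (max 0 t) \<omega> = 0" by simp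
  then show ?thesis
    using facts
  proof eventually_elim
    case (elim \<omega>)
    show ?case
    proof (intro allI impI)
      fix t :: real and i assume t: "0 \<le> t"
      have "AE t in discounting \<rho>. l i t \<omega> = 0"
      proof -
        have "AE t in discounting \<rho>. 0 \<le> t" by (simp add: AE_discounting)
        with elim(1) show ?thesis by eventually_elim (simp add: max_absorb2)
      qed
      then have "l i t \<omega> = 0"
        by (rule right_continuous_AE_eq[OF _ t]) (use elim t in auto)
      then show "(\<lambda>n. overlap (\<lambda>s. \<xi> (Inl i) s \<omega>) (\<lambda>s. \<xi> (Inr i) s \<omega>) n t) \<longlonglongrightarrow> 0"
        using elim(2) t by metis
    qed
  qed
qed

text \<open>On every grid the first part minus the overlap is a function of the net control. The net controls
  agree and the overlaps tend to zero, hence the first parts agree, and so do the second ones.\<close>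

theorem optimal_control_unique:
  assumes reg: "regular \<xi>" "regular \<eta>" and opt: "cost \<xi> = infimum" "cost \<eta> = infimum"
  shows "AE \<omega> in M. \<forall>t\<ge>0. \<forall>c. \<xi> c t \<omega> = \<eta> c t \<omega>"
  using optimal_net_unique[OF assms] optimal_overlap_vanishes[OF reg(1) opt(1)]
    optimal_overlap_vanishes[OF reg(2) opt(2)]
proof eventually_elim
  case (elim \<omega>)
  have plus: "\<xi> (Inl i) t \<omega> = \<eta> (Inl i) t \<omega>" if t: "0 \<le> t" for i t
  proof -
    let ?o = "\<lambda>\<zeta> n. overlap (\<lambda>s. \<zeta> (Inl i) s \<omega>) (\<lambda>s. \<zeta> (Inr i) s \<omega>) n t"
    obtain N :: nat where N: "t \<le> real N" using real_arch_simple by blast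
    have "?o \<xi> n - ?o \<eta> n = \<xi> (Inl i) t \<omega> - \<eta> (Inl i) t \<omega>" if "n \<ge> N" for n
    proof -
      have n: "t \<le> real n" using N that by linarith
      have net_eq: "\<xi> (Inl i) s \<omega> - \<xi> (Inr i) s \<omega> = \<eta> (Inl i) s \<omega> - \<eta> (Inr i) s \<omega>" if "0 \<le> s" for s
        using elim(1) that by blast
      have "increment (\<lambda>s. \<xi> (Inl i) s \<omega> - \<xi> (Inr i) s \<omega>) n k t = increment (\<lambda>s. \<eta> (Inl i) s \<omega> - \<eta> (Inr i) s \<omega>) n k t" for k
        unfolding increment_def using t by (simp add: net_eq)
      then show ?thesis
        unfolding overlap_eq[OF t n] using net_eq[of 0] by simp
    qed
    then have "eventually (\<lambda>n. ?o \<xi> n - ?o \<eta> n = \<xi> (Inl i) t \<omega> - \<eta> (Inl i) t \<omega>) sequentially"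
      by (auto simp: eventually_sequentially)
    then have "(\<lambda>n. ?o \<xi> n - ?o \<eta> n) \<longlonglongrightarrow> \<xi> (Inl i) t \<omega> - \<eta> (Inl i) t \<omega>" by (rule tendsto_eventually)
    moreover have "(\<lambda>n. ?o \<xi> n - ?o \<eta> n) \<longlonglongrightarrow> 0 - 0"
      using elim(2,3) t by (intro tendsto_diff) auto
    ultimately have "\<xi> (Inl i) t \<omega> - \<eta> (Inl i) t \<omega> = 0 - 0" by (rule LIMSEQ_unique)
    then show ?thesis by simp
  qed
  show ?case
  proof (intro allI impI)
    fix t :: real and c :: "'n + 'n" assume t: "0 \<le> t"
    show "\<xi> c t \<omega> = \<eta> c t \<omega>"
    proof (cases c)
      case (Inl i) then show ?thesis using plus[OF t] by simp
    next
      case (Inr i)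
      have "\<xi> (Inl i) t \<omega> - \<xi> (Inr i) t \<omega> = \<eta> (Inl i) t \<omega> - \<eta> (Inr i) t \<omega>" using elim(1) t by blast
      then show ?thesis using plus[OF t, of i] Inr by simp
    qed
  qed
qed

end

section \<open>The game\<close>

text \<open>The link between the abstract minimisation and the game: the running cost is the weighted sum
  of those of the players, the prices are theirs multiplied by the weights, and \<open>S\<close> is a version of the uncontrolled state. \<open>S\<close> is not
  taken to be the state itself because paths of \<open>B\<close> are continuous only almost surely, and the state need
  not be jointly measurable on the exceptional set.\<close>

locale regulated_game = singular_control M F B \<rho> c C D \<kappa> H g S
  for M :: "'a measure" and F and B :: "real \<Rightarrow> 'a \<Rightarrow> real ^ 'd"
    and \<rho> c C D :: real and \<kappa> :: "'n::finite + 'n \<Rightarrow> real" and H g S +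
  fixes \<mu> x :: "real ^ 'n" and \<sigma> :: "real ^ 'd ^ 'n" and Kp Km L :: "'n \<Rightarrow> real"
    and h :: "'n \<Rightarrow> real ^ 'n \<Rightarrow> real"
  assumes H_eq: "H = aggregate_running_cost L h"
    and \<kappa>_plus: "\<And>i. \<kappa> (Inl i) = L i * Kp i" and \<kappa>_minus: "\<And>i. \<kappa> (Inr i) = L i * Km i"
    and L_pos: "\<And>i. 0 < L i" and Kp_pos: "\<And>i. 0 < Kp i" and Km_pos: "\<And>i. 0 < Km i"
    and h_measurable: "\<And>i. h i \<in> borel_measurable borel" and h_nonneg: "\<And>i y. 0 \<le> h i y"
    and S_eq: "AE \<omega> in M. \<forall>t\<ge>0. S t \<omega> = x + t *\<^sub>R \<mu> + \<sigma> *v B t \<omega>"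
begin

definition parts :: "('a, 'n) profile \<Rightarrow> 'n + 'n \<Rightarrow> real \<Rightarrow> 'a \<Rightarrow> real" where
  "parts \<xi> = case_sum (\<lambda>i. fst (\<xi> i)) (\<lambda>i. snd (\<xi> i))"

definition profile_of :: "('n + 'n \<Rightarrow> real \<Rightarrow> 'a \<Rightarrow> real) \<Rightarrow> ('a, 'n) profile" where
  "profile_of \<zeta> = (\<lambda>i. (\<zeta> (Inl i), \<zeta> (Inr i)))"

lemma parts_profile_of [simp]: "parts (profile_of \<zeta>) = \<zeta>"
  unfolding parts_def profile_of_def by (auto split: sum.split)

lemma regular_parts:
  assumes "\<xi> \<in> admissible M F \<rho>" shows "regular (parts \<xi>)"
  unfolding regular_def
proof (intro conjI allI)
  have adm: "admissible_part M F \<rho> (parts \<xi> i)" for i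
    using assms unfolding admissible_def player_controls_def parts_def by (auto split: sum.split)
  show "progressively_measurable F (parts \<xi> i)" for i
    using adm unfolding admissible_part_def by simp
  show "AE \<omega> in M. \<forall>i. cadlag (ext_path (parts \<xi> i) \<omega>) \<and> mono (ext_path (parts \<xi> i) \<omega>)"
    unfolding AE_all_countable using adm unfolding admissible_part_def by simp
qed

lemma discounted_total_regular:
  assumes "regular \<zeta>"
  shows "AE \<omega> in M. \<forall>i. discounted_total \<rho> (\<zeta> i) \<omega> = (\<integral>\<^sup>+ t. ennreal (\<rho> * \<zeta> i (max 0 t) \<omega>) \<partial>discounting \<rho>)"
proof -
  note joint = regular_jointly_measurable[OF assms, unfolded jointly_measurable_def, rule_format]
  have "AE \<omega> in M. \<omega> \<in> space M \<and> (\<forall>i. cadlag (ext_path (\<zeta> i) \<omega>) \<and> mono (ext_path (\<zeta> i) \<omega>))"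
    using assms unfolding regular_def by simp
  then show ?thesis
  proof eventually_elim
    case (elim \<omega>)
    show ?case
    proof
      fix i
      have [measurable]: "(\<lambda>t. \<zeta> i (max 0 t) \<omega>) \<in> borel_measurable borel"
        using measurable_compose[OF measurable_Pair1' joint[of i, unfolded measurable_Q]] elim by auto
      have "discounted_total \<rho> (\<zeta> i) \<omega> = (\<integral>\<^sup>+ t\<in>{0..}. ennreal (\<rho> * exp (- \<rho> * t) * \<zeta> i t \<omega>) \<partial>lborel)"
        by (rule discounted_total_eq[OF _ _ \<rho>]) (use elim in auto)
      also have "\<dots> = (\<integral>\<^sup>+ t\<in>{0..}. ennreal (exp (- \<rho> * t)) * ennreal (\<rho> * \<zeta> i (max 0 t) \<omega>) \<partial>lborel)"
        by (intro nn_integral_cong) (auto simp: ennreal_mult'[symmetric] mult_ac max_absorb2 split: split_indicator)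
      also have "\<dots> = (\<integral>\<^sup>+ t. ennreal (\<rho> * \<zeta> i (max 0 t) \<omega>) \<partial>discounting \<rho>)"
        by (rule nn_integral_discounting[symmetric]) measurable
      finally show "discounted_total \<rho> (\<zeta> i) \<omega> = (\<integral>\<^sup>+ t. ennreal (\<rho> * \<zeta> i (max 0 t) \<omega>) \<partial>discounting \<rho>)" .
    qed
  qed
qed

definition player_rate :: "'n \<Rightarrow> real ^ 'n \<Rightarrow> ('n + 'n \<Rightarrow> real) \<Rightarrow> real" where
  "player_rate i s a = h i (s + net a) + \<rho> * (Kp i * a (Inl i) + Km i * a (Inr i))"

lemma sum_player_rates: "(\<Sum>i\<in>UNIV. L i * player_rate i s a) = rate s a"
proof -
  have "(\<Sum>c\<in>UNIV. \<kappa> c * a c) = (\<Sum>i\<in>UNIV. \<kappa> (Inl i) * a (Inl i)) + (\<Sum>i\<in>UNIV. \<kappa> (Inr i) * a (Inr i))"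
    by (subst UNIV_Plus_UNIV[symmetric], subst sum.Plus) auto
  moreover have "H (s + net a) = (\<Sum>i\<in>UNIV. L i * h i (s + net a))"
    using fun_cong[OF H_eq, of "s + net a"] unfolding aggregate_running_cost_def .
  ultimately show ?thesis
    unfolding player_rate_def rate_def \<kappa>_plus \<kappa>_minus
    by (simp add: distrib_left sum.distrib sum_distrib_left mult_ac)
qed

lemma player_rate_measurable:
  assumes "jointly_measurable \<zeta>"
  shows "(\<lambda>z. player_rate i (noise z) (vals \<zeta> z)) \<in> borel_measurable Q"
proof -
  have v: "(\<lambda>z. vals \<zeta> z c) \<in> borel_measurable Q" for c using assms unfolding jointly_measurable_def by simp
  have "(\<lambda>z. noise z + net (vals \<zeta> z)) \<in> borel_measurable Q"
    by (intro borel_measurable_add noise_measurable net_measurable v)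
  from measurable_compose[OF this h_measurable[of i]]
  show ?thesis unfolding player_rate_def
    by (intro borel_measurable_add borel_measurable_times borel_measurable_const v)
qed

lemma player_cost_eq:
  assumes \<xi>: "\<xi> \<in> admissible M F \<rho>"
  shows "player_cost M B \<mu> \<sigma> \<rho> Kp Km h i x \<xi>
    = (\<integral>\<^sup>+ z. ennreal (player_rate i (noise z) (vals (parts \<xi>) z)) \<partial>Q)"
proof -
  let ?\<zeta> = "parts \<xi>"
  have reg: "regular ?\<zeta>" by (rule regular_parts[OF \<xi>])
  note j = regular_jointly_measurable[OF reg]
  have v: "(\<lambda>z. vals ?\<zeta> z c) \<in> borel_measurable Q" for c using j unfolding jointly_measurable_def by simp
  have "player_cost M B \<mu> \<sigma> \<rho> Kp Km h i x \<xi>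
    = (\<integral>\<^sup>+ \<omega>. (\<integral>\<^sup>+ t. ennreal (player_rate i (noise (\<omega>, t)) (vals ?\<zeta> (\<omega>, t))) \<partial>discounting \<rho>) \<partial>M)"
    unfolding player_cost_def
  proof (rule nn_integral_cong_AE)
    have "AE \<omega> in M. \<omega> \<in> space M" by simp
    then show "AE \<omega> in M. (\<integral>\<^sup>+ t\<in>{0..}. ennreal (exp (- \<rho> * t) * h i (state B \<mu> \<sigma> x \<xi> t \<omega>)) \<partial>lborel)
          + ennreal (Kp i) * discounted_total \<rho> (fst (\<xi> i)) \<omega>
          + ennreal (Km i) * discounted_total \<rho> (snd (\<xi> i)) \<omega>
        = (\<integral>\<^sup>+ t. ennreal (player_rate i (noise (\<omega>, t)) (vals ?\<zeta> (\<omega>, t))) \<partial>discounting \<rho>)"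
      using S_eq discounted_total_regular[OF reg] regular_increasing[OF reg]
    proof eventually_elim
      case (elim \<omega>)
      have sect: "(\<lambda>t. f (\<omega>, t)) \<in> borel_measurable borel" if "f \<in> borel_measurable Q" for f :: "_ \<Rightarrow> 'b::topological_space"
        using measurable_compose[OF measurable_Pair1' that[unfolded measurable_Q]] elim(1) by auto
      have hm: "(\<lambda>t. h i (noise (\<omega>, t) + net (vals ?\<zeta> (\<omega>, t)))) \<in> borel_measurable borel"
        using sect[OF measurable_compose[OF borel_measurable_add[OF noise_measurable net_measurable[OF v]] h_measurable[of i]]]
        by simp
      note vm = sect[OF v]
      have nn: "0 \<le> vals ?\<zeta> (\<omega>, t) c" for t c using elim(4) unfolding increasing_paths_def by simp
      have "(\<integral>\<^sup>+ t\<in>{0..}. ennreal (exp (- \<rho> * t) * h i (state B \<mu> \<sigma> x \<xi> t \<omega>)) \<partial>lborel)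
        = (\<integral>\<^sup>+ t\<in>{0..}. ennreal (exp (- \<rho> * t)) * ennreal (h i (noise (\<omega>, t) + net (vals ?\<zeta> (\<omega>, t)))) \<partial>lborel)"
      proof (intro nn_integral_cong)
        fix t
        show "ennreal (exp (- \<rho> * t) * h i (state B \<mu> \<sigma> x \<xi> t \<omega>)) * indicator {0..} t
          = ennreal (exp (- \<rho> * t)) * ennreal (h i (noise (\<omega>, t) + net (vals ?\<zeta> (\<omega>, t)))) * indicator {0..} t"
        proof (cases "0 \<le> t")
          case True
          then have "noise (\<omega>, t) + net (vals ?\<zeta> (\<omega>, t)) = state B \<mu> \<sigma> x \<xi> t \<omega>"
            using elim(2) by (simp add: state_def net_def parts_def max_absorb2)
          then show ?thesis by (simp add: ennreal_mult')
        qed simp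
      qed
      also have "\<dots> = (\<integral>\<^sup>+ t. ennreal (h i (noise (\<omega>, t) + net (vals ?\<zeta> (\<omega>, t)))) \<partial>discounting \<rho>)"
        using hm by (intro nn_integral_discounting[symmetric]) measurable
      finally have 1: "(\<integral>\<^sup>+ t\<in>{0..}. ennreal (exp (- \<rho> * t) * h i (state B \<mu> \<sigma> x \<xi> t \<omega>)) \<partial>lborel)
        = (\<integral>\<^sup>+ t. ennreal (h i (noise (\<omega>, t) + net (vals ?\<zeta> (\<omega>, t)))) \<partial>discounting \<rho>)" .
      have dt: "ennreal k * discounted_total \<rho> (?\<zeta> c) \<omega> = (\<integral>\<^sup>+ t. ennreal (k * (\<rho> * vals ?\<zeta> (\<omega>, t) c)) \<partial>discounting \<rho>)"
        if "0 < k" for k c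
      proof -
        have "ennreal k * discounted_total \<rho> (?\<zeta> c) \<omega> = ennreal k * (\<integral>\<^sup>+ t. ennreal (\<rho> * vals ?\<zeta> (\<omega>, t) c) \<partial>discounting \<rho>)"
          using elim(3) by simp
        also have "\<dots> = (\<integral>\<^sup>+ t. ennreal k * ennreal (\<rho> * vals ?\<zeta> (\<omega>, t) c) \<partial>discounting \<rho>)"
          using vm[of c] by (intro nn_integral_cmult[symmetric]) measurable
        finally show ?thesis using that by (simp add: ennreal_mult')
      qed
      have z: "?\<zeta> (Inl i) = fst (\<xi> i)" "?\<zeta> (Inr i) = snd (\<xi> i)" unfolding parts_def by auto
      note [measurable] = hm vm
      have "(\<integral>\<^sup>+ t. ennreal (player_rate i (noise (\<omega>, t)) (vals ?\<zeta> (\<omega>, t))) \<partial>discounting \<rho>)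
        = (\<integral>\<^sup>+ t. ennreal (h i (noise (\<omega>, t) + net (vals ?\<zeta> (\<omega>, t))))
            + ennreal (Kp i * (\<rho> * vals ?\<zeta> (\<omega>, t) (Inl i))) + ennreal (Km i * (\<rho> * vals ?\<zeta> (\<omega>, t) (Inr i))) \<partial>discounting \<rho>)"
      proof (intro nn_integral_cong)
        fix t
        have "0 \<le> Kp i * (\<rho> * vals ?\<zeta> (\<omega>, t) (Inl i))" "0 \<le> Km i * (\<rho> * vals ?\<zeta> (\<omega>, t) (Inr i))"
          using nn \<rho> Kp_pos[of i] Km_pos[of i] by (auto intro!: mult_nonneg_nonneg less_imp_le)
        then show "ennreal (player_rate i (noise (\<omega>, t)) (vals ?\<zeta> (\<omega>, t)))
          = ennreal (h i (noise (\<omega>, t) + net (vals ?\<zeta> (\<omega>, t))))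
            + ennreal (Kp i * (\<rho> * vals ?\<zeta> (\<omega>, t) (Inl i))) + ennreal (Km i * (\<rho> * vals ?\<zeta> (\<omega>, t) (Inr i)))"
          using h_nonneg unfolding player_rate_def by (simp add: ennreal_plus[symmetric] algebra_simps del: ennreal_plus)
      qed
      also have "\<dots> = (\<integral>\<^sup>+ t. ennreal (h i (noise (\<omega>, t) + net (vals ?\<zeta> (\<omega>, t)))) \<partial>discounting \<rho>)
          + (\<integral>\<^sup>+ t. ennreal (Kp i * (\<rho> * vals ?\<zeta> (\<omega>, t) (Inl i))) \<partial>discounting \<rho>)
          + (\<integral>\<^sup>+ t. ennreal (Km i * (\<rho> * vals ?\<zeta> (\<omega>, t) (Inr i))) \<partial>discounting \<rho>)"
        by (subst nn_integral_add, measurable)+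
      finally show ?case
        using 1 dt[OF Kp_pos[of i], of "Inl i"] dt[OF Km_pos[of i], of "Inr i"] unfolding z by simp
    qed
  qed
  also have "\<dots> = (\<integral>\<^sup>+ z. ennreal (player_rate i (noise z) (vals ?\<zeta> z)) \<partial>Q)"
  proof -
    note [measurable] = player_rate_measurable[OF j, of i]
    have "(\<lambda>z. ennreal (player_rate i (noise z) (vals ?\<zeta> z))) \<in> borel_measurable Q" by measurable
    from T.nn_integral_fst[OF this] show ?thesis by simp
  qed
  finally show ?thesis .
qed

lemma regulator_cost_eq:
  assumes \<xi>: "\<xi> \<in> admissible M F \<rho>"
  shows "regulator_cost M B \<mu> \<sigma> \<rho> Kp Km h L x \<xi> = cost (parts \<xi>)"
proof -
  let ?\<zeta> = "parts \<xi>"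
  have reg: "regular ?\<zeta>" by (rule regular_parts[OF \<xi>])
  note j = regular_jointly_measurable[OF reg]
  note [measurable] = player_rate_measurable[OF j]
  have "regulator_cost M B \<mu> \<sigma> \<rho> Kp Km h L x \<xi>
    = (\<Sum>i\<in>UNIV. \<integral>\<^sup>+ z. ennreal (L i) * ennreal (player_rate i (noise z) (vals ?\<zeta> z)) \<partial>Q)"
    unfolding regulator_cost_def player_cost_eq[OF \<xi>]
    by (intro sum.cong refl nn_integral_cmult[symmetric]) measurable
  also have "\<dots> = (\<integral>\<^sup>+ z. (\<Sum>i\<in>UNIV. ennreal (L i) * ennreal (player_rate i (noise z) (vals ?\<zeta> z))) \<partial>Q)"
    by (rule nn_integral_sum[symmetric]) measurable
  also have "\<dots> = cost ?\<zeta>"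
    unfolding cost_def
  proof (rule nn_integral_cong_AE)
    show "AE z in Q. (\<Sum>i\<in>UNIV. ennreal (L i) * ennreal (player_rate i (noise z) (vals ?\<zeta> z))) = ennreal (rate (noise z) (vals ?\<zeta> z))"
      using AE_Q_increasing[OF j regular_increasing[OF reg]]
    proof eventually_elim
      case (elim z)
      have "0 \<le> player_rate i (noise z) (vals ?\<zeta> z)" for i
        unfolding player_rate_def using h_nonneg elim \<rho> Kp_pos[of i] Km_pos[of i]
        by (intro add_nonneg_nonneg mult_nonneg_nonneg) (auto intro: less_imp_le)
      then have "(\<Sum>i\<in>UNIV. ennreal (L i) * ennreal (player_rate i (noise z) (vals ?\<zeta> z)))
        = ennreal (\<Sum>i\<in>UNIV. L i * player_rate i (noise z) (vals ?\<zeta> z))"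
        using L_pos by (subst sum_ennreal[symmetric]) (auto simp: ennreal_mult less_imp_le)
      then show ?case unfolding sum_player_rates .
    qed
  qed
  finally show ?thesis .
qed

text \<open>The prices are positive, so a finite cost bounds the expected discounted effort of every part.\<close>

lemma profile_of_admissible:
  assumes reg: "regular \<zeta>" and fin: "cost \<zeta> < \<infinity>" shows "profile_of \<zeta> \<in> admissible M F \<rho>"
proof -
  have "admissible_part M F \<rho> (\<zeta> c)" for c
    unfolding admissible_part_def
  proof (intro conjI)
    show "progressively_measurable F (\<zeta> c)" using reg unfolding regular_def by simp
    show "AE \<omega> in M. cadlag (ext_path (\<zeta> c) \<omega>) \<and> mono (ext_path (\<zeta> c) \<omega>)"
      using reg[unfolded regular_def, THEN conjunct2] by eventually_elim simp
    note j = regular_jointly_measurable[OF reg]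
    have v[measurable]: "(\<lambda>z. vals \<zeta> z c) \<in> borel_measurable Q" using j unfolding jointly_measurable_def by simp
    note [measurable] = rate_at_measurable[OF j]
    have "(\<integral>\<^sup>+ \<omega>. discounted_total \<rho> (\<zeta> c) \<omega> \<partial>M)
      = (\<integral>\<^sup>+ \<omega>. (\<integral>\<^sup>+ t. ennreal (\<rho> * vals \<zeta> (\<omega>, t) c) \<partial>discounting \<rho>) \<partial>M)"
      by (rule nn_integral_cong_AE) (use discounted_total_regular[OF reg] in \<open>eventually_elim, simp\<close>)
    also have "\<dots> = (\<integral>\<^sup>+ z. ennreal (\<rho> * vals \<zeta> z c) \<partial>Q)"
    proof -
      have "(\<lambda>z. ennreal (\<rho> * vals \<zeta> z c)) \<in> borel_measurable Q" by measurable
      from T.nn_integral_fst[OF this] show ?thesis by simp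
    qed
    also have "\<dots> \<le> (\<integral>\<^sup>+ z. ennreal (1 / \<kappa> c) * ennreal (rate (noise z) (vals \<zeta> z)) \<partial>Q)"
    proof (rule nn_integral_mono_AE)
      show "AE z in Q. ennreal (\<rho> * vals \<zeta> z c) \<le> ennreal (1 / \<kappa> c) * ennreal (rate (noise z) (vals \<zeta> z))"
        using AE_Q_increasing[OF j regular_increasing[OF reg]]
      proof eventually_elim
        case (elim z)
        have "\<rho> * (\<kappa> c * vals \<zeta> z c) \<le> \<rho> * (\<Sum>i\<in>UNIV. \<kappa> i * vals \<zeta> z i)"
          using \<rho> \<kappa> elim by (intro mult_left_mono member_le_sum) (auto intro: mult_nonneg_nonneg less_imp_le)
        also have "\<dots> \<le> rate (noise z) (vals \<zeta> z)" unfolding rate_def using H_nonneg by simp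
        finally have "\<rho> * vals \<zeta> z c \<le> 1 / \<kappa> c * rate (noise z) (vals \<zeta> z)"
          using \<kappa>[of c] by (simp add: field_simps)
        then have le: "ennreal (\<rho> * vals \<zeta> z c) \<le> ennreal (1 / \<kappa> c * rate (noise z) (vals \<zeta> z))" by (rule ennreal_leI)
        have k0: "0 \<le> 1 / \<kappa> c" using \<kappa>[of c] by simp
        from le show ?case unfolding ennreal_mult'[OF k0] .
      qed
    qed
    also have "\<dots> = ennreal (1 / \<kappa> c) * cost \<zeta>" unfolding cost_def by (rule nn_integral_cmult) measurable
    also have "\<dots> < \<infinity>" using fin by (simp add: ennreal_mult_less_top)
    finally show "(\<integral>\<^sup>+ \<omega>. discounted_total \<rho> (\<zeta> c) \<omega> \<partial>M) < \<infinity>" .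
  qed
  then show ?thesis unfolding admissible_def player_controls_def profile_of_def by simp
qed

lemma regulator_inf_eq: "regulator_inf M F B \<mu> \<sigma> \<rho> Kp Km h L x = infimum"
proof (rule antisym)
  obtain \<zeta> where \<zeta>: "regular \<zeta>" "cost \<zeta> = infimum" using optimal_control_exists by blast
  then have adm: "profile_of \<zeta> \<in> admissible M F \<rho>" using infimum_finite by (intro profile_of_admissible) auto
  show "regulator_inf M F B \<mu> \<sigma> \<rho> Kp Km h L x \<le> infimum"
    unfolding regulator_inf_def using regulator_cost_eq[OF adm] \<zeta>(2) by (intro INF_lower2[OF adm]) simp
  show "infimum \<le> regulator_inf M F B \<mu> \<sigma> \<rho> Kp Km h L x"
    unfolding regulator_inf_def using regulator_cost_eq regular_parts infimum_le_cost by (intro INF_greatest) simp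
qed

theorem regulator_problem_solvable:
  shows "regulator_inf M F B \<mu> \<sigma> \<rho> Kp Km h L x < \<infinity>"
    and "\<exists>\<xi>\<in>admissible M F \<rho>. regulator_cost M B \<mu> \<sigma> \<rho> Kp Km h L x \<xi> = regulator_inf M F B \<mu> \<sigma> \<rho> Kp Km h L x"
    and "\<lbrakk>\<xi> \<in> admissible M F \<rho>; \<eta> \<in> admissible M F \<rho>;
      regulator_cost M B \<mu> \<sigma> \<rho> Kp Km h L x \<xi> = regulator_inf M F B \<mu> \<sigma> \<rho> Kp Km h L x;
      regulator_cost M B \<mu> \<sigma> \<rho> Kp Km h L x \<eta> = regulator_inf M F B \<mu> \<sigma> \<rho> Kp Km h L x\<rbrakk>
      \<Longrightarrow> AE \<omega> in M. \<forall>t\<ge>0. fst (\<xi> i) t \<omega> = fst (\<eta> i) t \<omega> \<and> snd (\<xi> i) t \<omega> = snd (\<eta> i) t \<omega>"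
proof -
  show "regulator_inf M F B \<mu> \<sigma> \<rho> Kp Km h L x < \<infinity>"
    unfolding regulator_inf_eq by (rule infimum_finite)
  obtain \<zeta> where \<zeta>: "regular \<zeta>" "cost \<zeta> = infimum" using optimal_control_exists by blast
  then have adm: "profile_of \<zeta> \<in> admissible M F \<rho>" using infimum_finite by (intro profile_of_admissible) auto
  show "\<exists>\<xi>\<in>admissible M F \<rho>. regulator_cost M B \<mu> \<sigma> \<rho> Kp Km h L x \<xi> = regulator_inf M F B \<mu> \<sigma> \<rho> Kp Km h L x"
    using regulator_cost_eq[OF adm] \<zeta>(2) by (intro bexI[OF _ adm]) (simp add: regulator_inf_eq)
  assume \<xi>: "\<xi> \<in> admissible M F \<rho>" "regulator_cost M B \<mu> \<sigma> \<rho> Kp Km h L x \<xi> = regulator_inf M F B \<mu> \<sigma> \<rho> Kp Km h L x"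
    and \<eta>: "\<eta> \<in> admissible M F \<rho>" "regulator_cost M B \<mu> \<sigma> \<rho> Kp Km h L x \<eta> = regulator_inf M F B \<mu> \<sigma> \<rho> Kp Km h L x"
  have "AE \<omega> in M. \<forall>t\<ge>0. \<forall>c. parts \<xi> c t \<omega> = parts \<eta> c t \<omega>"
    using \<xi> \<eta> by (intro optimal_control_unique regular_parts) (simp_all add: regulator_cost_eq regulator_inf_eq)
  then show "AE \<omega> in M. \<forall>t\<ge>0. fst (\<xi> i) t \<omega> = fst (\<eta> i) t \<omega> \<and> snd (\<xi> i) t \<omega> = snd (\<eta> i) t \<omega>"
  proof eventually_elim
    case (elim \<omega>)
    show ?case
    proof (intro allI impI)
      fix t :: real assume t: "0 \<le> t"
      then have "parts \<xi> (Inl i) t \<omega> = parts \<eta> (Inl i) t \<omega>" "parts \<xi> (Inr i) t \<omega> = parts \<eta> (Inr i) t \<omega>"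
        using elim by blast+
      then show "fst (\<xi> i) t \<omega> = fst (\<eta> i) t \<omega> \<and> snd (\<xi> i) t \<omega> = snd (\<eta> i) t \<omega>" unfolding parts_def by simp
    qed
  qed
qed

end

section \<open>Second moments of Brownian motion\<close>

context brownian_space
begin

lemma B_second_moment:
  assumes t: "0 \<le> t"
  shows "(\<integral>\<^sup>+ \<omega>. ennreal ((norm (B t \<omega>))\<^sup>2) \<partial>M) \<le> ennreal (real CARD('d) * t)"
proof -
  have B0: "AE \<omega> in M. B 0 \<omega> = 0" using brownian unfolding brownian_motion_def by simp
  show ?thesis
  proof (cases "t = 0")
    case True
    then have "(\<integral>\<^sup>+ \<omega>. ennreal ((norm (B t \<omega>))\<^sup>2) \<partial>M) = (\<integral>\<^sup>+ \<omega>. 0 \<partial>M)"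
      using B0 by (intro nn_integral_cong_AE) auto
    then show ?thesis by simp
  next
    case False
    then have tp: "0 < t" using t by simp
    let ?n = "normal_density 0 (sqrt t)"
    have dist: "distributed M lborel (\<lambda>\<omega>. B t \<omega> - B 0 \<omega>) (\<lambda>y. ennreal (\<Prod>k\<in>UNIV. ?n (y $ k)))"
    proof -
      have "\<forall>s t. 0 \<le> s \<and> s < t \<longrightarrow> distributed M lborel (\<lambda>\<omega>. B t \<omega> - B s \<omega>)
          (\<lambda>y. ennreal (\<Prod>k\<in>UNIV. normal_density 0 (sqrt (t - s)) (y $ k)))"
        using brownian unfolding brownian_motion_def by blast
      from this[rule_format, of 0 t] show ?thesis using tp by simp
    qed
    have inj: "inj (\<lambda>k::'d. axis k (1::real))" by (auto simp: inj_def axis_eq_axis)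
    have Basis: "(Basis :: (real ^ 'd) set) = range (\<lambda>k. axis k 1)" by (auto simp: Basis_vec_def)
    have coord: "(\<integral>\<^sup>+ y. ennreal (\<Prod>k\<in>UNIV. ?n (y $ k)) * ennreal ((y $ j)\<^sup>2) \<partial>lborel) = ennreal t" for j :: 'd
    proof -
      define f where "f b u = (if b = axis j (1::real) then ennreal (?n u * u\<^sup>2) else ennreal (?n u))" for b :: "real ^ 'd" and u
      have "(\<Prod>b\<in>Basis. f b (y \<bullet> b)) = ennreal (\<Prod>k\<in>UNIV. ?n (y $ k)) * ennreal ((y $ j)\<^sup>2)" for y
      proof -
        have "(\<Prod>b\<in>Basis. f b (y \<bullet> b)) = (\<Prod>k\<in>UNIV. f (axis k 1) (y $ k))"
          unfolding Basis by (subst prod.reindex[OF inj]) (simp add: inner_axis)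
        also have "\<dots> = (\<Prod>k\<in>UNIV. ennreal (?n (y $ k)) * (if k = j then ennreal ((y $ j)\<^sup>2) else 1))"
          by (intro prod.cong refl) (auto simp: f_def axis_eq_axis ennreal_mult)
        also have "\<dots> = (\<Prod>k\<in>UNIV. ennreal (?n (y $ k))) * ennreal ((y $ j)\<^sup>2)"
          by (simp add: prod.distrib)
        finally show ?thesis by (simp add: prod_ennreal)
      qed
      then have "(\<integral>\<^sup>+ y. ennreal (\<Prod>k\<in>UNIV. ?n (y $ k)) * ennreal ((y $ j)\<^sup>2) \<partial>lborel)
          = (\<integral>\<^sup>+ y. (\<Prod>b\<in>Basis. f b (y \<bullet> b)) \<partial>lborel)" by simp
      also have "\<dots> = (\<Prod>b\<in>Basis. (\<integral>\<^sup>+ u. f b u \<partial>lborel))"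
        by (rule nn_integral_lborel_prod) (auto simp: f_def)
      also have "\<dots> = (\<Prod>b\<in>(Basis :: (real ^ 'd) set). if b = axis j 1 then ennreal t else 1)"
      proof (rule prod.cong[OF refl])
        fix b :: "real ^ 'd"
        have "(\<integral>\<^sup>+ u. ennreal (?n u * u\<^sup>2) \<partial>lborel) = ennreal t"
        proof -
          have "has_bochner_integral lborel (\<lambda>u. ?n u * u\<^sup>2) t"
            using normal_moment_even[of "sqrt t" 0 1] tp by simp
          then show ?thesis by (subst nn_integral_eq_integral) (auto simp: has_bochner_integral_iff)
        qed
        moreover have "(\<integral>\<^sup>+ u. ennreal (?n u) \<partial>lborel) = 1"
          using tp by (subst nn_integral_eq_integral) (auto intro: integral_normal_density)
        ultimately show "(\<integral>\<^sup>+ u. f b u \<partial>lborel) = (if b = axis j 1 then ennreal t else 1)"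
          unfolding f_def by auto
      qed
      also have "\<dots> = ennreal t" using axis_in_Basis_iff[of j "1::real"] by (simp add: prod.delta)
      finally show ?thesis .
    qed
    have "(\<integral>\<^sup>+ \<omega>. ennreal ((norm (B t \<omega>))\<^sup>2) \<partial>M) = (\<integral>\<^sup>+ \<omega>. ennreal ((norm (B t \<omega> - B 0 \<omega>))\<^sup>2) \<partial>M)"
      using B0 by (intro nn_integral_cong_AE) auto
    also have "\<dots> = (\<integral>\<^sup>+ y. ennreal (\<Prod>k\<in>UNIV. ?n (y $ k)) * ennreal ((norm (y :: real ^ 'd))\<^sup>2) \<partial>lborel)"
      by (rule distributed_nn_integral[OF dist, symmetric]) simp
    also have "\<dots> = (\<integral>\<^sup>+ y. (\<Sum>j\<in>UNIV. ennreal (\<Prod>k\<in>UNIV. ?n (y $ k)) * ennreal (((y :: real ^ 'd) $ j)\<^sup>2)) \<partial>lborel)"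
    proof (intro nn_integral_cong)
      fix y :: "real ^ 'd"
      have "(norm y)\<^sup>2 = (\<Sum>j\<in>UNIV. (y $ j)\<^sup>2)"
        unfolding norm_vec_def L2_set_def by (simp add: sum_nonneg)
      then show "ennreal (\<Prod>k\<in>UNIV. ?n (y $ k)) * ennreal ((norm y)\<^sup>2) = (\<Sum>j\<in>UNIV. ennreal (\<Prod>k\<in>UNIV. ?n (y $ k)) * ennreal ((y $ j)\<^sup>2))"
        by (simp add: sum_distrib_left[symmetric] sum_ennreal)
    qed
    also have "\<dots> = (\<Sum>j\<in>UNIV. \<integral>\<^sup>+ y. ennreal (\<Prod>k\<in>UNIV. ?n (y $ k)) * ennreal (((y :: real ^ 'd) $ j)\<^sup>2) \<partial>lborel)"
      by (rule nn_integral_sum) measurable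
    also have "\<dots> = ennreal (real CARD('d) * t)"
      unfolding coord using t by (simp add: ennreal_mult ennreal_of_nat_eq_real_of_nat)
    finally show ?thesis by simp
  qed
qed

end

text \<open>The square of \<open>\<rho> t / 2\<close> is at most twice its exponential, so the quadratic weight costs half of the
  discount rate.\<close>

lemma nn_integral_discounting_quadratic:
  assumes \<rho>: "0 < \<rho>" and K: "0 \<le> K"
  shows "(\<integral>\<^sup>+ t. ennreal (K * (1 + (max 0 t)\<^sup>2)) \<partial>discounting \<rho>) < \<infinity>"
proof -
  let ?k = "K * (1 + 8 / \<rho>\<^sup>2) * (2 / \<rho>)"
  have "(\<integral>\<^sup>+ t. ennreal (K * (1 + (max 0 t)\<^sup>2)) \<partial>discounting \<rho>)
      = (\<integral>\<^sup>+ t\<in>{0..}. ennreal (exp (- \<rho> * t)) * ennreal (K * (1 + (max 0 t)\<^sup>2)) \<partial>lborel)"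
    by (rule nn_integral_discounting) measurable
  also have "\<dots> \<le> (\<integral>\<^sup>+ t. ennreal ?k * (ennreal (\<rho> / 2 * exp (- (\<rho> / 2) * t)) * indicator {0..} t) \<partial>lborel)"
  proof (rule nn_integral_mono)
    fix t :: real
    show "ennreal (exp (- \<rho> * t)) * ennreal (K * (1 + (max 0 t)\<^sup>2)) * indicator {0..} t
      \<le> ennreal ?k * (ennreal (\<rho> / 2 * exp (- (\<rho> / 2) * t)) * indicator {0..} t)"
    proof (cases "0 \<le> t")
      case True
      let ?u = "\<rho> / 2 * t"
      have u: "0 \<le> ?u" using \<rho> True by simp
      have "1 + ?u + ?u\<^sup>2 / 2 \<le> exp ?u" using exp_lower_Taylor_quadratic[OF u] .
      then have "?u\<^sup>2 \<le> 2 * exp ?u" "1 \<le> exp ?u" using u zero_le_power2[of ?u] by linarith+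
      moreover have "t\<^sup>2 = 4 / \<rho>\<^sup>2 * ?u\<^sup>2" using \<rho> by (simp add: power_mult_distrib power_divide)
      ultimately have "t\<^sup>2 \<le> 4 / \<rho>\<^sup>2 * (2 * exp ?u)" using \<rho> by (metis mult_left_mono divide_nonneg_nonneg zero_le_numeral zero_le_power2)
      moreover have "(1 + 8 / \<rho>\<^sup>2) * exp ?u = exp ?u + 4 / \<rho>\<^sup>2 * (2 * exp ?u)" by (simp add: algebra_simps)
      ultimately have "1 + t\<^sup>2 \<le> (1 + 8 / \<rho>\<^sup>2) * exp ?u" using \<open>1 \<le> exp ?u\<close> by linarith
      then have "exp (- \<rho> * t) * (K * (1 + t\<^sup>2)) \<le> exp (- \<rho> * t) * (K * ((1 + 8 / \<rho>\<^sup>2) * exp ?u))"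
        using K by (intro mult_left_mono) auto
      also have "\<dots> = K * (1 + 8 / \<rho>\<^sup>2) * (exp (- \<rho> * t) * exp ?u)" by simp
      also have "exp (- \<rho> * t) * exp ?u = exp (- (\<rho> / 2) * t)" by (simp flip: exp_add add: field_simps)
      also have "K * (1 + 8 / \<rho>\<^sup>2) * exp (- (\<rho> / 2) * t) = ?k * (\<rho> / 2 * exp (- (\<rho> / 2) * t))"
        using \<rho> by simp
      finally have "ennreal (exp (- \<rho> * t) * (K * (1 + t\<^sup>2))) \<le> ennreal (?k * (\<rho> / 2 * exp (- (\<rho> / 2) * t)))"
        by (rule ennreal_leI)
      moreover have "0 \<le> ?k" using K \<rho> by simp
      ultimately have "ennreal (exp (- \<rho> * t)) * ennreal (K * (1 + t\<^sup>2)) \<le> ennreal ?k * ennreal (\<rho> / 2 * exp (- (\<rho> / 2) * t))"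
        by (simp only: ennreal_mult'[symmetric] exp_ge_zero)
      then show ?thesis using True by (simp only: max_absorb2 indicator_simps atLeast_iff mult_1_right)
    qed simp
  qed
  also have "\<dots> = ennreal ?k * (\<integral>\<^sup>+ t. ennreal (\<rho> / 2 * exp (- (\<rho> / 2) * t)) * indicator {0..} t \<partial>lborel)"
    by (rule nn_integral_cmult) measurable
  also have "\<dots> < \<infinity>"
    using nn_integral_exp_tail[of "\<rho> / 2" 0] \<rho> by simp
  finally show ?thesis .
qed

section \<open>Convexity from bounds on second derivatives\<close>

lemma dir_deriv_eq:
  assumes "(f has_derivative f') (at x)" shows "dir_deriv z f x = f' z"
proof -
  have "((\<lambda>s. f (x + s *\<^sub>R z)) has_derivative (\<lambda>s. f' (s *\<^sub>R z))) (at 0)"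
    by (rule has_derivative_compose[of "\<lambda>s. x + s *\<^sub>R z" "\<lambda>s. s *\<^sub>R z"])
       (use assms in \<open>auto intro!: derivative_eq_intros\<close>)
  moreover have "f' (s *\<^sub>R z) = f' z * s" for s
    using has_derivative_linear[OF assms] by (simp add: linear_cmul mult.commute)
  ultimately have "((\<lambda>s. f (x + s *\<^sub>R z)) has_real_derivative f' z) (at 0)"
    unfolding has_field_derivative_def by (simp add: fun_eq_iff)
  then show ?thesis unfolding dir_deriv_def by (rule DERIV_imp_deriv)
qed

text \<open>Restrict \<open>H\<close> to a line and subtract \<open>c / 2\<close> times the squared distance from the base point: the second
  derivative stays nonnegative. Convexity of the difference yields both inequalities.\<close>

lemma strong_convexity:
  assumes H: "C2 H" and bound: "\<And>z x. norm z = 1 \<Longrightarrow> c \<le> dir_deriv z (dir_deriv z H) x" and c: "0 < c"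
  obtains g where "\<And>x. (H has_derivative (\<lambda>z. g x \<bullet> z)) (at x)" "continuous_on UNIV g"
    "\<And>x y. H x + g x \<bullet> (y - x) \<le> H y"
    "\<And>x y. H ((1 / 2) *\<^sub>R (x + y)) \<le> (H x + H y) / 2 - c / 8 * (norm (x - y))\<^sup>2"
proof -
  obtain g Q where g: "\<And>x. (H has_derivative (\<lambda>z. g x \<bullet> z)) (at x)"
    and Q: "\<And>x. (g has_derivative (\<lambda>z. Q x *v z)) (at x)" using H unfolding C2_def by blast
  have dir: "dir_deriv z H = (\<lambda>x. g x \<bullet> z)" for z using dir_deriv_eq[OF g] by auto
  have second: "c * (norm z)\<^sup>2 \<le> (Q x *v z) \<bullet> z" for x z
  proof (cases "z = 0")
    case False
    define e where "e = (1 / norm z) *\<^sub>R z"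
    have e: "norm e = 1" "z = norm z *\<^sub>R e" using False by (auto simp: e_def)
    have "((\<lambda>x. g x \<bullet> e) has_derivative (\<lambda>w. (Q x *v w) \<bullet> e)) (at x)"
      by (rule has_derivative_inner_left[OF Q])
    from dir_deriv_eq[OF this] have "c \<le> (Q x *v e) \<bullet> e" using bound[OF e(1), of x] unfolding dir by simp
    then have "(norm z)\<^sup>2 * c \<le> (norm z)\<^sup>2 * ((Q x *v e) \<bullet> e)" by (intro mult_left_mono) auto
    also have "\<dots> = (Q x *v z) \<bullet> z"
      by (subst (2 3) e(2)) (simp add: matrix_vector_mult_scaleR power2_eq_square)
    finally show ?thesis by (simp add: mult.commute)
  qed simp
  have line: "((\<lambda>s. H (x + s *\<^sub>R z)) has_real_derivative g (x + s *\<^sub>R z) \<bullet> z) (at s)" for x z s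
  proof -
    have "((\<lambda>s. H (x + s *\<^sub>R z)) has_derivative (\<lambda>r. g (x + s *\<^sub>R z) \<bullet> (r *\<^sub>R z))) (at s)"
      by (rule has_derivative_compose[of "\<lambda>s. x + s *\<^sub>R z" "\<lambda>r. r *\<^sub>R z"])
         (auto intro!: derivative_eq_intros g)
    moreover have "(\<lambda>r. g (x + s *\<^sub>R z) \<bullet> (r *\<^sub>R z)) = (*) (g (x + s *\<^sub>R z) \<bullet> z)" by (simp add: fun_eq_iff)
    ultimately show ?thesis unfolding has_field_derivative_def by simp
  qed
  have line2: "((\<lambda>s. g (x + s *\<^sub>R z) \<bullet> z) has_real_derivative (Q (x + s *\<^sub>R z) *v z) \<bullet> z) (at s)" for x z s
  proof -
    have "((\<lambda>s. g (x + s *\<^sub>R z)) has_derivative (\<lambda>r. Q (x + s *\<^sub>R z) *v (r *\<^sub>R z))) (at s)"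
      by (rule has_derivative_compose[of "\<lambda>s. x + s *\<^sub>R z" "\<lambda>r. r *\<^sub>R z"])
         (auto intro!: derivative_eq_intros Q)
    then have "((\<lambda>s. g (x + s *\<^sub>R z) \<bullet> z) has_derivative (\<lambda>r. (Q (x + s *\<^sub>R z) *v (r *\<^sub>R z)) \<bullet> z)) (at s)"
      by (rule has_derivative_inner_left)
    moreover have "(\<lambda>r. (Q (x + s *\<^sub>R z) *v (r *\<^sub>R z)) \<bullet> z) = (*) ((Q (x + s *\<^sub>R z) *v z) \<bullet> z)"
      by (simp add: fun_eq_iff matrix_vector_mult_scaleR)
    ultimately show ?thesis unfolding has_field_derivative_def by simp
  qed
  have conv: "convex_on UNIV (\<lambda>s. H (x + s *\<^sub>R z) - c / 2 * (norm z)\<^sup>2 * s\<^sup>2)" for x z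
  proof (rule f''_ge0_imp_convex)
    show "((\<lambda>s. H (x + s *\<^sub>R z) - c / 2 * (norm z)\<^sup>2 * s\<^sup>2) has_real_derivative
        g (x + s *\<^sub>R z) \<bullet> z - c * (norm z)\<^sup>2 * s) (at s)" for s
      by (rule derivative_eq_intros line refl)+ simp
    show "((\<lambda>s. g (x + s *\<^sub>R z) \<bullet> z - c * (norm z)\<^sup>2 * s) has_real_derivative
        (Q (x + s *\<^sub>R z) *v z) \<bullet> z - c * (norm z)\<^sup>2) (at s)" for s
      by (rule derivative_eq_intros line2 refl)+ simp
    show "0 \<le> (Q (x + s *\<^sub>R z) *v z) \<bullet> z - c * (norm z)\<^sup>2" for s using second by simp
  qed simp
  show ?thesis
  proof
    show "(H has_derivative (\<lambda>z. g x \<bullet> z)) (at x)" for x by (rule g)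
    show "continuous_on UNIV g"
      using Q by (meson continuous_at_imp_continuous_on has_derivative_continuous)
    show "H x + g x \<bullet> (y - x) \<le> H y" for x y
    proof -
      let ?z = "y - x"
      let ?f = "\<lambda>s. H (x + s *\<^sub>R ?z) - c / 2 * (norm ?z)\<^sup>2 * s\<^sup>2"
      have "(?f has_real_derivative g x \<bullet> ?z) (at 0)"
        using line[of x ?z 0] by (auto intro!: derivative_eq_intros)
      then have "?f 1 - ?f 0 \<ge> (g x \<bullet> ?z) * (1 - 0)"
        by (intro convex_on_imp_above_tangent[OF conv]) auto
      then have "H x + g x \<bullet> ?z + c / 2 * (norm ?z)\<^sup>2 \<le> H y" by simp
      moreover have "0 \<le> c / 2 * (norm ?z)\<^sup>2" using c by simp
      ultimately show ?thesis by linarith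
    qed
    show "H ((1 / 2) *\<^sub>R (x + y)) \<le> (H x + H y) / 2 - c / 8 * (norm (x - y))\<^sup>2" for x y
    proof -
      let ?m = "(1 / 2) *\<^sub>R (x + y)" and ?z = "(1 / 2) *\<^sub>R (x - y)"
      let ?f = "\<lambda>s. H (?m + s *\<^sub>R ?z) - c / 2 * (norm ?z)\<^sup>2 * s\<^sup>2"
      have "?f ((1 - 1 / 2) *\<^sub>R 1 + (1 / 2) *\<^sub>R (- 1)) \<le> (1 - 1 / 2) * ?f 1 + (1 / 2) * ?f (- 1)"
        by (rule convex_onD[OF conv]) auto
      moreover have "?m + 1 *\<^sub>R ?z = x" "?m + (- 1) *\<^sub>R ?z = y"
        by (simp_all add: vec_eq_iff field_simps)
      moreover have "(norm ?z)\<^sup>2 = (norm (x - y))\<^sup>2 / 4" by (simp add: power_divide)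
      ultimately show ?thesis by (simp only:) (simp add: add_divide_distrib diff_divide_distrib)
    qed
  qed
qed

section \<open>Existence, uniqueness and Pareto optimality\<close>

text \<open>Move by a unit vector in the direction of the slope.\<close>

lemma supporting_slope_bound:
  fixes H :: "real ^ 'n \<Rightarrow> real"
  assumes C: "0 \<le> C" and A2: "\<And>x y. \<bar>H x - H y\<bar> \<le> C * (1 + norm x + norm y) * norm (x - y)"
    and support: "\<And>x y. H x + g x \<bullet> (y - x) \<le> H y"
  shows "norm (g x) \<le> 2 * C * (1 + norm x)"
proof (cases "g x = 0")
  case False
  define e where "e = (1 / norm (g x)) *\<^sub>R g x"
  have e: "norm e = 1" "g x \<bullet> e = norm (g x)"
    using False by (auto simp: e_def power2_norm_eq_inner[symmetric] power2_eq_square)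
  have "norm (g x) \<le> H (x + e) - H x" using support[of x "x + e"] e by simp
  also have "\<dots> \<le> C * (1 + norm (x + e) + norm x) * norm (x + e - x)" using A2[of "x + e" x] by linarith
  also have "\<dots> \<le> C * (1 + (norm x + 1) + norm x)"
    using C norm_triangle_ineq[of x e] e by (simp add: mult_left_mono)
  finally show ?thesis by (simp add: algebra_simps)
qed (use C in simp)

context brownian_space
begin

text \<open>On a null set that contains all discontinuous paths, the noise is replaced by \<open>0\<close>. This makes the
  process jointly measurable; measurability with respect to the past survives only up to a null set.\<close>

lemma uncontrolled_state:
  fixes \<mu> x :: "real ^ 'n" and \<sigma> :: "real ^ 'd ^ 'n"
  assumes \<rho>: "0 < \<rho>"
  obtains S where "AE \<omega> in M. \<forall>t\<ge>0. S t \<omega> = x + t *\<^sub>R \<mu> + \<sigma> *v B t \<omega>"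
    "(\<lambda>z. S (max 0 (snd z)) (fst z)) \<in> borel_measurable (M \<Otimes>\<^sub>M borel)"
    "\<forall>t\<ge>0. \<exists>S'\<in>borel_measurable (past t). AE \<omega> in M. S t \<omega> = S' \<omega>"
    "(\<integral>\<^sup>+ z. ennreal ((norm (S (max 0 (snd z)) (fst z)))\<^sup>2) \<partial>(M \<Otimes>\<^sub>M discounting \<rho>)) < \<infinity>"
proof -
  obtain N where N: "{\<omega> \<in> space M. \<not> continuous_on {0..} (\<lambda>t. B t \<omega>)} \<subseteq> N" "emeasure M N = 0" "N \<in> sets M"
    using AE_E[OF AE_B_continuous] by blast
  have notN: "AE \<omega> in M. \<omega> \<notin> N" using N by (intro AE_not_in) auto
  define S where "S t \<omega> = x + t *\<^sub>R \<mu> + \<sigma> *v (if \<omega> \<in> N then 0 else B t \<omega>)" for t \<omega>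
  have vm: "(\<lambda>y. \<sigma> *v y) \<in> borel_measurable borel"
    by (intro borel_measurable_continuous_onI linear_continuous_on matrix_vector_mul_bounded_linear)
  have St: "S t \<in> borel_measurable M" if "0 \<le> t" for t
  proof -
    have "(\<lambda>\<omega>. if \<omega> \<in> N then 0 else B t \<omega>) \<in> borel_measurable M"
      using N(3) B_measurable[OF that] by (intro measurable_If_set) auto
    then show ?thesis unfolding S_def by (intro borel_measurable_add borel_measurable_const measurable_compose[OF _ vm])
  qed
  have eq: "AE \<omega> in M. \<forall>t\<ge>0. S t \<omega> = x + t *\<^sub>R \<mu> + \<sigma> *v B t \<omega>"
    using notN by eventually_elim (simp add: S_def)
  have joint: "(\<lambda>z. S (max 0 (snd z)) (fst z)) \<in> borel_measurable (M \<Otimes>\<^sub>M borel)"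
  proof (rule continuous_process_measurable[OF St])
    fix \<omega> assume "\<omega> \<in> space M"
    then have "continuous_on {0..} (\<lambda>t. if \<omega> \<in> N then 0 else B t \<omega>)" using N(1) by (cases "\<omega> \<in> N") auto
    then show "continuous_on {0..} (\<lambda>t. S t \<omega>)" unfolding S_def
      by (intro continuous_on_add continuous_on_const continuous_on_scaleR continuous_on_id
          linear_continuous_on_compose[OF _ matrix_vector_mul_linear])
  qed
  obtain K where K: "0 < K" "\<And>y. norm (\<sigma> *v y) \<le> norm y * K"
    using bounded_linear.pos_bounded[OF matrix_vector_mul_bounded_linear[of \<sigma>]] by blast
  define k where "k = 2 * (norm x + norm \<mu>)\<^sup>2 * 2 + 2 * K\<^sup>2 * real CARD('d)"
  have k: "0 \<le> k" unfolding k_def by simp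
  have sq: "(\<integral>\<^sup>+ \<omega>. ennreal ((norm (S t \<omega>))\<^sup>2) \<partial>M) \<le> ennreal (k * (1 + t\<^sup>2))" if t: "0 \<le> t" for t
  proof -
    let ?b = "(norm x + norm \<mu>)\<^sup>2 * (1 + t)\<^sup>2"
    have [measurable]: "B t \<in> borel_measurable M" by (rule B_measurable[OF t])
    have "(\<integral>\<^sup>+ \<omega>. ennreal ((norm (S t \<omega>))\<^sup>2) \<partial>M)
        \<le> (\<integral>\<^sup>+ \<omega>. ennreal (2 * ?b) + ennreal (2 * K\<^sup>2) * ennreal ((norm (B t \<omega>))\<^sup>2) \<partial>M)"
    proof (rule nn_integral_mono_AE)
      show "AE \<omega> in M. ennreal ((norm (S t \<omega>))\<^sup>2) \<le> ennreal (2 * ?b) + ennreal (2 * K\<^sup>2) * ennreal ((norm (B t \<omega>))\<^sup>2)"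
        using eq
      proof eventually_elim
        case (elim \<omega>)
        have "norm (x + t *\<^sub>R \<mu>) \<le> norm x + t * norm \<mu>" using norm_triangle_ineq[of x "t *\<^sub>R \<mu>"] t by simp
        also have "\<dots> \<le> (norm x + norm \<mu>) * (1 + t)" using t by (simp add: algebra_simps)
        finally have d: "(norm (x + t *\<^sub>R \<mu>))\<^sup>2 \<le> ?b"
          unfolding power_mult_distrib[symmetric] by (intro power_mono) auto
        have "(norm (\<sigma> *v B t \<omega>))\<^sup>2 \<le> (norm (B t \<omega>) * K)\<^sup>2" by (intro power_mono K) auto
        then have "(norm (x + t *\<^sub>R \<mu> + \<sigma> *v B t \<omega>))\<^sup>2 \<le> 2 * ?b + 2 * K\<^sup>2 * (norm (B t \<omega>))\<^sup>2"
          using d power2_norm_add_le[of "x + t *\<^sub>R \<mu>" "\<sigma> *v B t \<omega>"] by (simp add: power_mult_distrib mult_ac)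
        then have "ennreal ((norm (S t \<omega>))\<^sup>2) \<le> ennreal (2 * ?b + 2 * K\<^sup>2 * (norm (B t \<omega>))\<^sup>2)"
          using elim t by (intro ennreal_leI) simp
        also have "\<dots> = ennreal (2 * ?b) + ennreal (2 * K\<^sup>2) * ennreal ((norm (B t \<omega>))\<^sup>2)"
          by (subst ennreal_plus) (simp_all add: ennreal_mult)
        finally show ?case .
      qed
    qed
    also have "\<dots> = ennreal (2 * ?b) + ennreal (2 * K\<^sup>2) * (\<integral>\<^sup>+ \<omega>. ennreal ((norm (B t \<omega>))\<^sup>2) \<partial>M)"
      by (simp add: nn_integral_add nn_integral_cmult emeasure_space_1)
    also have "\<dots> \<le> ennreal (2 * ?b) + ennreal (2 * K\<^sup>2) * ennreal (real CARD('d) * t)"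
      by (intro add_left_mono mult_left_mono B_second_moment[OF t]) simp
    also have "\<dots> = ennreal (2 * ?b + 2 * K\<^sup>2 * (real CARD('d) * t))"
      using t by (subst ennreal_plus) (simp_all add: ennreal_mult)
    also have "\<dots> \<le> ennreal (k * (1 + t\<^sup>2))"
    proof (rule ennreal_leI)
      have t1: "t \<le> 1 + t\<^sup>2" using zero_le_power2[of "t - 1"] t by (simp add: power2_eq_square algebra_simps)
      have t2: "(1 + t)\<^sup>2 \<le> 2 * (1 + t\<^sup>2)"
        using zero_le_power2[of "t - 1"] by (simp add: power2_eq_square algebra_simps)
      have "?b \<le> (norm x + norm \<mu>)\<^sup>2 * (2 * (1 + t\<^sup>2))" by (intro mult_left_mono t2) auto
      moreover have "K\<^sup>2 * (real CARD('d) * t) \<le> K\<^sup>2 * (real CARD('d) * (1 + t\<^sup>2))"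
        by (intro mult_left_mono t1) auto
      ultimately show "2 * ?b + 2 * K\<^sup>2 * (real CARD('d) * t) \<le> k * (1 + t\<^sup>2)"
        unfolding k_def by (simp add: algebra_simps)
    qed
    finally show ?thesis .
  qed
  interpret T: finite_measure "discounting \<rho>" by (rule finite_measure_discounting[OF \<rho>])
  interpret Q: pair_sigma_finite M "discounting \<rho>" ..
  have nm: "(\<lambda>z. ennreal ((norm (S (max 0 (snd z)) (fst z)))\<^sup>2)) \<in> borel_measurable (M \<Otimes>\<^sub>M discounting \<rho>)"
  proof -
    have "(\<lambda>z. S (max 0 (snd z)) (fst z)) \<in> borel_measurable (M \<Otimes>\<^sub>M discounting \<rho>)"
      using joint by (simp cong: measurable_cong_sets sets_pair_measure_cong)
    then show ?thesis by measurable
  qed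
  have "(\<integral>\<^sup>+ z. ennreal ((norm (S (max 0 (snd z)) (fst z)))\<^sup>2) \<partial>(M \<Otimes>\<^sub>M discounting \<rho>))
      = (\<integral>\<^sup>+ t. (\<integral>\<^sup>+ \<omega>. ennreal ((norm (S (max 0 t) \<omega>))\<^sup>2) \<partial>M) \<partial>discounting \<rho>)"
    using Q.nn_integral_snd[OF nm] by simp
  also have "\<dots> \<le> (\<integral>\<^sup>+ t. ennreal (k * (1 + (max 0 t)\<^sup>2)) \<partial>discounting \<rho>)"
    by (intro nn_integral_mono sq) simp
  also have "\<dots> < \<infinity>" by (rule nn_integral_discounting_quadratic[OF \<rho> k])
  finally have int: "(\<integral>\<^sup>+ z. ennreal ((norm (S (max 0 (snd z)) (fst z)))\<^sup>2) \<partial>(M \<Otimes>\<^sub>M discounting \<rho>)) < \<infinity>" .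
  have past: "\<exists>S'\<in>borel_measurable (past t). AE \<omega> in M. S t \<omega> = S' \<omega>" if t: "0 \<le> t" for t
  proof (rule bexI)
    show "AE \<omega> in M. S t \<omega> = x + t *\<^sub>R \<mu> + \<sigma> *v B t \<omega>" using eq by eventually_elim (use t in simp)
    show "(\<lambda>\<omega>. x + t *\<^sub>R \<mu> + \<sigma> *v B t \<omega>) \<in> borel_measurable (past t)"
      using t by (intro borel_measurable_add borel_measurable_const measurable_compose[OF _ vm] measurable_path_algebra) auto
  qed
  show ?thesis using that[OF eq joint _ int] past by blast
qed

end

theorem theorem13:
  fixes M :: "'a measure" and F :: "real \<Rightarrow> 'a measure"
    and B :: "real \<Rightarrow> 'a \<Rightarrow> real ^ 'd"
    and \<mu> :: "real ^ 'n" and \<sigma> :: "real ^ 'd ^ 'n"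
    and lam \<rho> c C :: real
    and Kp Km L :: "'n \<Rightarrow> real"
    and h :: "'n \<Rightarrow> real ^ 'n \<Rightarrow> real"
  defines "H \<equiv> aggregate_running_cost L h"
    and "v \<equiv> value_fn M F B \<mu> \<sigma> \<rho> Kp Km h L"
  assumes space: "filtered_prob_space M F"
    and BM: "brownian_motion M F B"
    and elliptic: "lam > 0"
      "\<And>z. 0 \<le> z \<bullet> ((\<sigma> ** transpose \<sigma> - lam *\<^sub>R mat 1) *v z)"
    and rho: "\<rho> > 0"
    and K: "\<And>i. Kp i > 0" "\<And>i. Km i > 0"
    and h: "\<And>i. h i \<in> borel_measurable borel" "\<And>i x. h i x \<ge> 0"
    and L: "\<And>i. L i > 0" "(\<Sum>i\<in>UNIV. L i) = 1"
    and const: "0 < c" "c < C"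
    and A1: "\<And>x. 0 \<le> H x \<and> H x \<le> C * (1 + (norm x)\<^sup>2)"
    and A2: "\<And>x y. \<bar>H x - H y\<bar> \<le> C * (1 + norm x + norm y) * norm (x - y)"
    and A3: "C2 H" "convex_on UNIV H"
      "\<And>z x. norm z = 1 \<Longrightarrow> c \<le> dir_deriv z (dir_deriv z H) x \<and> dir_deriv z (dir_deriv z H) x \<le> C"
    and A4: "hessian_diag_dominant_on (closure (continuation_region L Kp Km v)) v"
    and A5: "has_reflection_projection L Kp Km v"
  shows "\<exists>\<xi>. regulator_solution M F B \<mu> \<sigma> \<rho> Kp Km h L \<xi> \<and>
             (\<forall>\<eta>. regulator_solution M F B \<mu> \<sigma> \<rho> Kp Km h L \<eta> \<longrightarrow> same_policy M \<xi> \<eta>) \<and>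
             pareto_optimal M F B \<mu> \<sigma> \<rho> Kp Km h \<xi>"
proof -
  let ?cost = "regulator_cost M B \<mu> \<sigma> \<rho> Kp Km h L" and ?inf = "regulator_inf M F B \<mu> \<sigma> \<rho> Kp Km h L"
  interpret brownian_space M F B by unfold_locales (fact space BM)+
  obtain g where g: "\<And>x. (H has_derivative (\<lambda>z. g x \<bullet> z)) (at x)" "continuous_on UNIV g"
    "\<And>x y. H x + g x \<bullet> (y - x) \<le> H y"
    "\<And>x y. H ((1 / 2) *\<^sub>R (x + y)) \<le> (H x + H y) / 2 - c / 8 * (norm (x - y))\<^sup>2"
    using strong_convexity[OF A3(1) conjunct1[OF A3(3)] const(1)] by metis
  have C: "0 \<le> C" using const by simp
  \<comment> \<open>The factor \<open>1 / 8\<close> is the constant of midpoint convexity for second derivatives bounded below by \<open>c\<close>.\<close>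
  have game: "\<exists>\<kappa> S. regulated_game M F B \<rho> (c / 8) C (2 * C) \<kappa> H g S \<mu> x \<sigma> Kp Km L h" for x
  proof -
    obtain S where S: "AE \<omega> in M. \<forall>t\<ge>0. S t \<omega> = x + t *\<^sub>R \<mu> + \<sigma> *v B t \<omega>"
      "(\<lambda>z. S (max 0 (snd z)) (fst z)) \<in> borel_measurable (M \<Otimes>\<^sub>M borel)"
      "\<forall>t\<ge>0. \<exists>S'\<in>borel_measurable (past t). AE \<omega> in M. S t \<omega> = S' \<omega>"
      "(\<integral>\<^sup>+ z. ennreal ((norm (S (max 0 (snd z)) (fst z)))\<^sup>2) \<partial>(M \<Otimes>\<^sub>M discounting \<rho>)) < \<infinity>"
      by (rule uncontrolled_state[OF rho, where x = x and \<mu> = \<mu> and \<sigma> = \<sigma>])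
    let ?\<kappa> = "case_sum (\<lambda>i. L i * Kp i) (\<lambda>i. L i * Km i)"
    have "regulated_game M F B \<rho> (c / 8) C (2 * C) ?\<kappa> H g S \<mu> x \<sigma> Kp Km L h"
    proof unfold_locales
      show "0 < ?\<kappa> i" for i using L(1) K by (cases i) auto
      show "continuous_on UNIV H"
        using g(1) by (meson continuous_at_imp_continuous_on has_derivative_continuous)
      show "g \<in> borel_measurable borel" by (rule borel_measurable_continuous_onI[OF g(2)])
      show "norm (g y) \<le> 2 * C * (1 + norm y)" for y by (rule supporting_slope_bound[OF C A2 g(3)])
    qed (use rho const C A1 g L K h S H_def in auto)
    then show ?thesis by blast
  qed
  have finite: "?inf x < \<infinity>"
    and exists: "\<exists>\<xi>\<in>admissible M F \<rho>. ?cost x \<xi> = ?inf x"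
    and unique: "\<lbrakk>\<xi> \<in> admissible M F \<rho>; \<eta> \<in> admissible M F \<rho>; ?cost x \<xi> = ?inf x; ?cost x \<eta> = ?inf x\<rbrakk>
      \<Longrightarrow> AE \<omega> in M. \<forall>t\<ge>0. fst (\<xi> i) t \<omega> = fst (\<eta> i) t \<omega> \<and> snd (\<xi> i) t \<omega> = snd (\<eta> i) t \<omega>" for x \<xi> \<eta> i
  proof -
    obtain \<kappa> S where "regulated_game M F B \<rho> (c / 8) C (2 * C) \<kappa> H g S \<mu> x \<sigma> Kp Km L h"
      using game[of x] by blast
    note solvable = regulated_game.regulator_problem_solvable[OF this]
    show "?inf x < \<infinity>" by (rule solvable(1))
    show "\<exists>\<xi>\<in>admissible M F \<rho>. ?cost x \<xi> = ?inf x" by (rule solvable(2))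
    show "AE \<omega> in M. \<forall>t\<ge>0. fst (\<xi> i) t \<omega> = fst (\<eta> i) t \<omega> \<and> snd (\<xi> i) t \<omega> = snd (\<eta> i) t \<omega>"
      if "\<xi> \<in> admissible M F \<rho>" "\<eta> \<in> admissible M F \<rho>" "?cost x \<xi> = ?inf x" "?cost x \<eta> = ?inf x" for \<xi> \<eta> i
      by (rule solvable(3)[OF that])
  qed
  obtain \<xi> where \<xi>: "\<And>x. \<xi> x \<in> admissible M F \<rho>" "\<And>x. ?cost x (\<xi> x) = ?inf x"
    using choice[of "\<lambda>x \<xi>. \<xi> \<in> admissible M F \<rho> \<and> ?cost x \<xi> = ?inf x"] exists by blast
  have policy: "admissible_policy M F \<rho> \<xi>" unfolding admissible_policy_def using \<xi>(1) by blast
  show ?thesis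
  proof (intro exI[of _ \<xi>] conjI allI impI)
    show "regulator_solution M F B \<mu> \<sigma> \<rho> Kp Km h L \<xi>"
      unfolding regulator_solution_def using policy \<xi>(2) by blast
    show "same_policy M \<xi> \<eta>" if "regulator_solution M F B \<mu> \<sigma> \<rho> Kp Km h L \<eta>" for \<eta>
      unfolding same_policy_def
    proof (intro allI)
      fix x i
      have "\<eta> x \<in> admissible M F \<rho>" "?cost x (\<eta> x) = ?inf x"
        using that unfolding regulator_solution_def admissible_policy_def by blast+
      then show "AE \<omega> in M. \<forall>t\<ge>0. fst (\<xi> x i) t \<omega> = fst (\<eta> x i) t \<omega> \<and> snd (\<xi> x i) t \<omega> = snd (\<eta> x i) t \<omega>"
        by (intro unique[OF \<xi>(1) _ \<xi>(2)])
    qed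
    show "pareto_optimal M F B \<mu> \<sigma> \<rho> Kp Km h \<xi>"
      unfolding pareto_optimal_def
    proof (intro conjI policy notI)
      let ?J = "player_cost M B \<mu> \<sigma> \<rho> Kp Km h"
      assume "\<exists>\<eta>. admissible_policy M F \<rho> \<eta> \<and>
          (\<forall>x. (\<forall>i. ?J i x (\<eta> x) \<le> ?J i x (\<xi> x)) \<and> (\<exists>j. ?J j x (\<eta> x) < ?J j x (\<xi> x)))"
      then obtain \<eta> where adm: "admissible_policy M F \<rho> \<eta>"
        and dom: "\<forall>x. (\<forall>i. ?J i x (\<eta> x) \<le> ?J i x (\<xi> x)) \<and> (\<exists>j. ?J j x (\<eta> x) < ?J j x (\<xi> x))"
        by (elim exE conjE)
      have \<eta>: "\<eta> 0 \<in> admissible M F \<rho>" using adm unfolding admissible_policy_def ..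
      have le: "?J i 0 (\<eta> 0) \<le> ?J i 0 (\<xi> 0)" for i using dom[rule_format, of 0] by (elim conjE) (rule spec)
      obtain j where j: "?J j 0 (\<eta> 0) < ?J j 0 (\<xi> 0)" using dom[rule_format, of 0] by (elim conjE exE)
      have "?cost 0 (\<eta> 0) = ennreal (L j) * ?J j 0 (\<eta> 0) + (\<Sum>i\<in>UNIV - {j}. ennreal (L i) * ?J i 0 (\<eta> 0))"
        unfolding regulator_cost_def by (rule sum.remove) auto
      also have "\<dots> \<le> ennreal (L j) * ?J j 0 (\<eta> 0) + (\<Sum>i\<in>UNIV - {j}. ennreal (L i) * ?J i 0 (\<xi> 0))"
        by (intro add_left_mono sum_mono mult_left_mono le) simp
      also have "\<dots> < ennreal (L j) * ?J j 0 (\<xi> 0) + (\<Sum>i\<in>UNIV - {j}. ennreal (L i) * ?J i 0 (\<xi> 0))"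
      proof -
        have split: "?cost 0 (\<xi> 0) = ennreal (L j) * ?J j 0 (\<xi> 0) + (\<Sum>i\<in>UNIV - {j}. ennreal (L i) * ?J i 0 (\<xi> 0))"
          unfolding regulator_cost_def by (rule sum.remove) auto
        then have "(\<Sum>i\<in>UNIV - {j}. ennreal (L i) * ?J i 0 (\<xi> 0)) < \<infinity>"
          using finite[of 0] \<xi>(2)[of 0] by simp
        moreover have "ennreal (L j) * ?J j 0 (\<eta> 0) < ennreal (L j) * ?J j 0 (\<xi> 0)"
          using j L(1)[of j] by (intro ennreal_mult_strict_left_mono) auto
        ultimately show ?thesis
          unfolding add.commute[of _ "\<Sum>i\<in>UNIV - {j}. _ i"] ennreal_add_left_cancel_less
          by (intro conjI less_imp_neq)
      qed
      also have "\<dots> = ?cost 0 (\<xi> 0)"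
        unfolding regulator_cost_def by (rule sum.remove[symmetric]) auto
      also have "\<dots> = ?inf 0" by (rule \<xi>(2))
      also have "\<dots> \<le> ?cost 0 (\<eta> 0)" unfolding regulator_inf_def by (rule INF_lower[OF \<eta>])
      finally show False by simp
    qed
  qed
qed

end
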